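(* Fix $s\ge1$. Let $\theta_0$ be of Gevrey-class $s$ with radius of convergence $\tau_0>0$. Then for each $\nu>0$ there exists a unique Gevrey-class $s$ solution $\theta^\nu$ to (IPMB$_\nu$) on $\mathbb{T}^2\times[0,\infty)$ with radius of convergence at least $\tau=\tau(t)$ for all $t\in[0,\infty)$, where $\tau$ is a decreasing function satisfying $$\tau(t)\ge\tau_0\,e^{-Ct\|e^{\tau_0\Lambda^{1/s}}\theta_0\|_{L^2}}.$$ Here $C>0$ is a constant which depends on $\nu$ but is independent of $t$.
   Context: Setting. $\mathbb{T}^2=[0,2\pi]^2$ with periodic boundary conditions. For $\nu\ge0$, (IPMB$_\nu$) denotes the incompressible porous media Brinkman problem on $\mathbb{T}^2\times[0,\infty)$ $$\partial_t\theta^\nu+(u^\nu\cdot\nabla)\theta^\nu=0,\qquad u^\nu=M^\nu[\theta^\nu],\qquad\theta^\nu(x,0)=\theta_0(x),$$ where $M^\nu=(M^\nu_1,M^\nu_2)$ is the Fourier multiplier operator with symbols, for $k=(k_1,k_2)\in\mathbb{Z}^2\setminus\{0\}$, $$\widehat M^\nu_1(k)=\frac{1}{1+\nu(k_1^2+k_2^2)}\cdot\frac{k_1k_2}{k_1^2+k_2^2},\qquad \widehat M^\nu_2(k)=\frac{1}{1+\nu(k_1^2+k_2^2)}\cdot\frac{-k_1^2}{k_1^2+k_2^2}.$$ Standing assumption: $\int_{\mathbb{T}^2}\theta^\nu(x,t)\,dx=0$ for all $t\ge0$. Gevrey classes. $\Lambda=(-\Delta)^{1/2}$ and $\mathbb{Z}^2_*=\mathbb{Z}^2\setminus\{0\}$.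 For $s\ge1$, $r\ge0$, $\tau>0$ put $$\|\Lambda^re^{\tau\Lambda^{1/s}}f\|_{L^2}^2=\sum_{k\in\mathbb{Z}^2_*}|k|^{2r}e^{2\tau|k|^{1/s}}|\hat f(k)|^2.$$ The Gevrey-class $s$ is $\bigcup_{\tau>0}\mathcal{D}(\Lambda^re^{\tau\Lambda^{1/s}})$ (for any $r\ge0$), and $\tau=\tau(t)>0$ is called the radius of convergence. In the claim, "radius of convergence (at least) $\tau$" is measured with $r=0$, i.e. $\|e^{\tau\Lambda^{1/s}}f\|_{L^2}<\infty$. *)

theory Defs
  imports "HOL-Analysis.Analysis"
begin

text \<open>Functions on the torus are represented by functions on the plane that are
  \<open>2 * pi\<close>-periodic in each variable. A square integrable function with finite Gevrey norm has
  exactly one continuous representative, and the continuity required here selects it.\<close>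

definition torus_fun :: "(real \<times> real \<Rightarrow> real) \<Rightarrow> bool" where
  "torus_fun f \<longleftrightarrow> continuous_on UNIV f \<and>
     (\<forall>x y. f (x + 2 * pi, y) = f (x, y) \<and> f (x, y + 2 * pi) = f (x, y))"

definition torus_cell :: "(real \<times> real) set" where
  "torus_cell = {0..2 * pi} \<times> {0..2 * pi}"

definition mean_zero :: "(real \<times> real \<Rightarrow> real) \<Rightarrow> bool" where
  "mean_zero f \<longleftrightarrow> (LINT x:torus_cell|lborel. f x) = 0"

definition lattice_star :: "(int \<times> int) set" where
  "lattice_star = UNIV - {(0, 0)}"

definition mode_norm :: "int \<times> int \<Rightarrow> real" where
  "mode_norm k = sqrt ((of_int (fst k))\<^sup>2 + (of_int (snd k))\<^sup>2)"

definition mode_phase :: "int \<times> int \<Rightarrow> real \<times> real \<Rightarrow> real" where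
  "mode_phase k x = of_int (fst k) * fst x + of_int (snd k) * snd x"

text \<open>Normalised so that \<open>f\<close> is the sum of \<open>fourier_coeff f k * cis (mode_phase k x)\<close> over \<open>k\<close>.\<close>

definition fourier_coeff :: "(real \<times> real \<Rightarrow> real) \<Rightarrow> int \<times> int \<Rightarrow> complex" where
  "fourier_coeff f k =
     (LINT x:torus_cell|lborel. of_real (f x) * cis (- mode_phase k x)) / of_real ((2 * pi)\<^sup>2)"

text \<open>For a real and even symbol, the only kind used below, the series is real-valued, so taking
  the real part only changes the type. The mode \<open>k = 0\<close> is excluded (mean-zero functions).\<close>

definition fourier_multiplier ::
  "(int \<times> int \<Rightarrow> real) \<Rightarrow> (real \<times> real \<Rightarrow> real) \<Rightarrow> real \<times> real \<Rightarrow> real" where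
  "fourier_multiplier m f x =
     Re (\<Sum>\<^sub>\<infinity>k\<in>lattice_star. of_real (m k) * fourier_coeff f k * cis (mode_phase k x))"

definition ipmb_symbol1 :: "real \<Rightarrow> int \<times> int \<Rightarrow> real" where
  "ipmb_symbol1 \<nu> k =
     1 / (1 + \<nu> * ((of_int (fst k))\<^sup>2 + (of_int (snd k))\<^sup>2))
     * ((of_int (fst k) * of_int (snd k)) / ((of_int (fst k))\<^sup>2 + (of_int (snd k))\<^sup>2))"

definition ipmb_symbol2 :: "real \<Rightarrow> int \<times> int \<Rightarrow> real" where
  "ipmb_symbol2 \<nu> k =
     1 / (1 + \<nu> * ((of_int (fst k))\<^sup>2 + (of_int (snd k))\<^sup>2))
     * (- (of_int (fst k))\<^sup>2 / ((of_int (fst k))\<^sup>2 + (of_int (snd k))\<^sup>2))"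

definition ipmb_velocity1 :: "real \<Rightarrow> (real \<times> real \<Rightarrow> real) \<Rightarrow> real \<times> real \<Rightarrow> real" where
  "ipmb_velocity1 \<nu> = fourier_multiplier (ipmb_symbol1 \<nu>)"

definition ipmb_velocity2 :: "real \<Rightarrow> (real \<times> real \<Rightarrow> real) \<Rightarrow> real \<times> real \<Rightarrow> real" where
  "ipmb_velocity2 \<nu> = fourier_multiplier (ipmb_symbol2 \<nu>)"

definition gevrey_term ::
  "real \<Rightarrow> real \<Rightarrow> real \<Rightarrow> (real \<times> real \<Rightarrow> real) \<Rightarrow> int \<times> int \<Rightarrow> real" where
  "gevrey_term r s \<tau> f k =
     mode_norm k powr (2 * r) * exp (2 * \<tau> * mode_norm k powr (1 / s)) * (cmod (fourier_coeff f k))\<^sup>2"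

definition gevrey_domain :: "real \<Rightarrow> real \<Rightarrow> real \<Rightarrow> (real \<times> real \<Rightarrow> real) \<Rightarrow> bool" where
  "gevrey_domain r s \<tau> f \<longleftrightarrow> gevrey_term r s \<tau> f summable_on lattice_star"

text \<open>Meaningful only for \<open>f\<close> with \<open>gevrey_domain r s \<tau> f\<close>.\<close>

definition gevrey_norm :: "real \<Rightarrow> real \<Rightarrow> real \<Rightarrow> (real \<times> real \<Rightarrow> real) \<Rightarrow> real" where
  "gevrey_norm r s \<tau> f = sqrt (\<Sum>\<^sub>\<infinity>k\<in>lattice_star. gevrey_term r s \<tau> f k)"

text \<open>The radius is measured with \<open>r = 0\<close>; the Gevrey class does not depend on \<open>r\<close>.\<close>

definition has_gevrey_radius :: "real \<Rightarrow> real \<Rightarrow> (real \<times> real \<Rightarrow> real) \<Rightarrow> bool" where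
  "has_gevrey_radius s \<tau> f \<longleftrightarrow> 0 < \<tau> \<and> gevrey_domain 0 s \<tau> f"

definition gevrey_class :: "real \<Rightarrow> (real \<times> real \<Rightarrow> real) \<Rightarrow> bool" where
  "gevrey_class s f \<longleftrightarrow> (\<exists>\<tau>. has_gevrey_radius s \<tau> f)"

text \<open>Classical solutions: mean-zero and continuously differentiable in \<open>(t, x)\<close> up to \<open>t = 0\<close>,
  where the time derivative is one-sided. The witnesses \<open>\<theta>t\<close>, \<open>\<theta>x\<close>, \<open>\<theta>y\<close> are the partial
  derivatives. The values \<open>\<theta> t\<close> for \<open>t < 0\<close> are irrelevant.\<close>

definition ipmb_solution ::
  "real \<Rightarrow> (real \<times> real \<Rightarrow> real) \<Rightarrow> (real \<Rightarrow> real \<times> real \<Rightarrow> real) \<Rightarrow> bool" where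
  "ipmb_solution \<nu> \<theta>0 \<theta> \<longleftrightarrow>
     \<theta> 0 = \<theta>0 \<and>
     (\<forall>t\<ge>0. torus_fun (\<theta> t) \<and> mean_zero (\<theta> t)) \<and>
     (\<exists>\<theta>t \<theta>x \<theta>y :: real \<Rightarrow> real \<times> real \<Rightarrow> real.
        continuous_on ({0..} \<times> UNIV) (\<lambda>(t, z). \<theta>t t z) \<and>
        continuous_on ({0..} \<times> UNIV) (\<lambda>(t, z). \<theta>x t z) \<and>
        continuous_on ({0..} \<times> UNIV) (\<lambda>(t, z). \<theta>y t z) \<and>
        (\<forall>t\<ge>0. \<forall>x y.
           ((\<lambda>t'. \<theta> t' (x, y)) has_real_derivative \<theta>t t (x, y)) (at t within {0..}) \<and>
           ((\<lambda>x'. \<theta> t (x', y)) has_real_derivative \<theta>x t (x, y)) (at x) \<and>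
           ((\<lambda>y'. \<theta> t (x, y')) has_real_derivative \<theta>y t (x, y)) (at y) \<and>
           \<theta>t t (x, y) + (ipmb_velocity1 \<nu> (\<theta> t) (x, y) * \<theta>x t (x, y)
                        + ipmb_velocity2 \<nu> (\<theta> t) (x, y) * \<theta>y t (x, y)) = 0))"

definition gevrey_ipmb_solution ::
  "real \<Rightarrow> real \<Rightarrow> (real \<times> real \<Rightarrow> real) \<Rightarrow> (real \<Rightarrow> real \<times> real \<Rightarrow> real) \<Rightarrow> bool" where
  "gevrey_ipmb_solution s \<nu> \<theta>0 \<theta> \<longleftrightarrow>
     ipmb_solution \<nu> \<theta>0 \<theta> \<and> (\<forall>t\<ge>0. gevrey_class s (\<theta> t))"

end

theory Submission
 imports Defs
begin

text \<open>In Fourier variables the problem is an infinite system of ordinary differential equations with a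
 quadratic nonlinearity. Weight the coefficients by \<open>exp (\<tau> * mode_norm k powr (1 / s))\<close> and let \<open>\<tau>\<close>
 shrink at the relative rate \<open>R\<close>: the shrinking produces a dissipation of strength \<open>R * \<tau>\<close> that gains a
 derivative of order \<open>1 / s\<close>. The nonlinearity has to be dominated by it. Since transport by a
 divergence-free field is neutral (\<open>advection_neutral\<close>), only differences of weights enter, and
 expanding the exponential to first order leaves two terms (\<open>gevrey_trilinear_le\<close>): the velocity
 gradient acting on the gained derivatives, and a second-order remainder controlled by the Gevrey
 norm. If the gradient is bounded by a multiple of the initial Gevrey norm for all times, then \<open>R\<close> may
 be taken proportional to that norm, the weighted norm never grows, and \<open>\<tau>\<close> is the asserted
 exponential.

 For positive viscosity the gradient of the velocity is an operator of order \<open>-1\<close> applied to the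
 scalar. It is bounded by the supremum of the scalar (\<open>fseries_strain_le\<close>), although not by its mean
 square: the symbol \<open>1 / mode_norm k\<close> just fails to be square summable, but its differences are, and
 dividing by the symbol of a difference on dyadic strips makes the sum geometric. The supremum is
 conserved by transport (\<open>gevrey_solution_sup_bound\<close>), and initially it is bounded by the Gevrey norm
 (\<open>coefficient_sum_le_gevrey_norm\<close>). This closes the estimate.

 Solutions are obtained by Galerkin approximation, which does not respect the supremum. Therefore the
 estimate is run twice. On a given time interval the mean-square bound on the gradient
 (\<open>strain_form_bound_crude\<close>), which loses an arbitrarily small power of \<open>\<tau>\<close>, yields some uniform
 exponential decay of the coefficients (\<open>galerkin_uniform_decay\<close>). That suffices for convergence to a
 classical solution (\<open>galerkin_limit\<close>, \<open>coefficients_ipmb_solution\<close>), for which the supremum bound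
 holds. The approximations inherit the bound on the gradient up to an error that tends to zero, and
 the second run gives the stated radius (\<open>galerkin_limit_gevrey_bound\<close>).

 Uniqueness is a mean-square estimate for the difference of two solutions
 (\<open>gevrey_solution_unique\<close>): the velocity is smoothing of order two, hence bounded pointwise by the
 mean square.\<close>

section \<open>Sums over the integer lattice\<close>

lemma mode_norm_eq_norm: "mode_norm k = norm (real_of_int (fst k), real_of_int (snd k))"
 by (simp add: mode_norm_def norm_Pair)

lemma mode_norm_nonneg [simp]: "0 \<le> mode_norm k"
 by (simp add: mode_norm_eq_norm)

lemma mode_norm_zero [simp]: "mode_norm 0 = 0"
 by (simp add: mode_norm_def)

lemma mode_norm_minus [simp]: "mode_norm (- k) = mode_norm k"
 by (simp add: mode_norm_def)

lemma mode_norm_triangle: "mode_norm (k + l) \<le> mode_norm k + mode_norm l"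
 using norm_triangle_ineq[of "(real_of_int (fst k), real_of_int (snd k))" "(real_of_int (fst l), real_of_int (snd l))"]
 by (simp add: mode_norm_eq_norm)

lemma mode_norm_minus_commute: "mode_norm (k - l) = mode_norm (l - k)"
 using mode_norm_minus[of "k - l"] by simp

lemma mode_norm_triangle_sub: "mode_norm k \<le> mode_norm (k - l) + mode_norm l"
 using mode_norm_triangle[of "k - l" l] by simp

lemma mode_norm_sq: "(mode_norm k)\<^sup>2 = (of_int (fst k))\<^sup>2 + (of_int (snd k))\<^sup>2"
 by (simp add: mode_norm_def)

definition shell :: "int \<times> int \<Rightarrow> nat" where
 "shell k = max (nat \<bar>fst k\<bar>) (nat \<bar>snd k\<bar>)"

lemma shell_le_mode_norm: "real (shell k) \<le> mode_norm k"
proof -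
 have "\<bar>real_of_int (fst k)\<bar> \<le> mode_norm k" "\<bar>real_of_int (snd k)\<bar> \<le> mode_norm k"
  unfolding mode_norm_def by (simp_all add: real_le_rsqrt)
 then show ?thesis by (simp add: shell_def)
qed

lemma abs_fst_le: "\<bar>real_of_int (fst k)\<bar> \<le> mode_norm k"
 and abs_snd_le: "\<bar>real_of_int (snd k)\<bar> \<le> mode_norm k"
 unfolding mode_norm_def by (simp_all add: real_le_rsqrt)

lemma mode_norm_sq_le_shell: "(mode_norm k)\<^sup>2 \<le> 2 * (real (shell k))\<^sup>2"
proof -
 have "\<bar>real_of_int (fst k)\<bar> \<le> real (shell k)" "\<bar>real_of_int (snd k)\<bar> \<le> real (shell k)"
  by (auto simp: shell_def)
 then have "(real_of_int (fst k))\<^sup>2 \<le> (real (shell k))\<^sup>2" "(real_of_int (snd k))\<^sup>2 \<le> (real (shell k))\<^sup>2"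
  using abs_le_square_iff by (metis abs_of_nat)+
 then show ?thesis by (simp add: mode_norm_sq)
qed

lemma shell_pos: "k \<noteq> 0 \<Longrightarrow> 1 \<le> shell k"
 by (cases k) (auto simp: shell_def zero_prod_def)

lemma mode_norm_ge_1: "k \<noteq> 0 \<Longrightarrow> 1 \<le> mode_norm k"
 using shell_pos[of k] shell_le_mode_norm[of k] by linarith

lemma mode_norm_pos: "k \<noteq> 0 \<Longrightarrow> 0 < mode_norm k"
 using mode_norm_ge_1[of k] by linarith

lemma mode_norm_eq_0 [simp]: "mode_norm k = 0 \<longleftrightarrow> k = 0"
 using mode_norm_pos[of k] by (cases "k = 0") auto

lemma card_shell_le:
 assumes "1 \<le> n"
 shows "finite {k. shell k = n}" "card {k. shell k = n} \<le> 12 * n"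
proof -
 let ?I = "{- int n..int n}" and ?E = "{- int n, int n}"
 have sub: "{k. shell k = n} \<subseteq> ?E \<times> ?I \<union> ?I \<times> ?E"
  by (auto simp: shell_def max_def split: if_splits)
 show "finite {k. shell k = n}" by (rule finite_subset[OF sub]) auto
 have "card {k. shell k = n} \<le> card (?E \<times> ?I \<union> ?I \<times> ?E)"
  by (rule card_mono[OF _ sub]) auto
 also have "\<dots> \<le> card (?E \<times> ?I) + card (?I \<times> ?E)" by (rule card_Un_le)
 also have "\<dots> = 4 * (2 * n + 1)" using assms by (simp add: card_cartesian_product)
 also have "\<dots> \<le> 12 * n" using assms by simp
 finally show "card {k. shell k = n} \<le> 12 * n" .
qed

text \<open>Square shells of radius \<open>n\<close> have at most \<open>12 * n\<close> points, which turns lattice sums into one-dimensional ones.\<close>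

lemma sum_lattice_le_sum_shells:
 fixes f :: "nat \<Rightarrow> real"
 assumes F: "finite F" "0 \<notin> F" and pos: "\<And>n. 0 \<le> f n"
  and le: "\<And>k. k \<in> F \<Longrightarrow> g k \<le> f (shell k)"
  and bound: "\<And>N. (\<Sum>n=1..N. real n * f n) \<le> C"
 shows "sum g F \<le> 12 * C"
proof -
 define N where "N = Max (insert 1 (shell ` F))"
 have N: "shell ` F \<subseteq> {1..N}"
 proof
  fix n assume "n \<in> shell ` F"
  then show "n \<in> {1..N}" using F shell_pos by (force simp: N_def)
 qed
 have "sum g F \<le> (\<Sum>k\<in>F. f (shell k))" by (rule sum_mono) (rule le)
 also have "\<dots> = (\<Sum>n\<in>{1..N}. \<Sum>k\<in>{k\<in>F. shell k = n}. f (shell k))"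
  by (rule sum.group[symmetric]) (use F N in auto)
 also have "\<dots> = (\<Sum>n\<in>{1..N}. real (card {k\<in>F. shell k = n}) * f n)"
  by (rule sum.cong) auto
 also have "\<dots> \<le> (\<Sum>n\<in>{1..N}. 12 * (real n * f n))"
 proof (rule sum_mono)
  fix n assume n: "n \<in> {1..N}"
  have "card {k\<in>F. shell k = n} \<le> card {k. shell k = n}"
   by (rule card_mono) (use n card_shell_le in auto)
  also have "\<dots> \<le> 12 * n" using n card_shell_le by auto
  finally have "real (card {k\<in>F. shell k = n}) \<le> 12 * real n" by linarith
  from mult_right_mono[OF this pos[of n]]
  show "real (card {k\<in>F. shell k = n}) * f n \<le> 12 * (real n * f n)" by simp
 qed
 also have "\<dots> = 12 * (\<Sum>n=1..N. real n * f n)" by (simp add: sum_distrib_left)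
 also have "\<dots> \<le> 12 * C" using bound by simp
 finally show ?thesis .
qed

lemma sum_le_telescope:
 fixes f F :: "nat \<Rightarrow> real"
 assumes "\<And>n. 1 \<le> n \<Longrightarrow> f n \<le> F n - F (n - 1)" and "\<And>n. F n \<le> B"
 shows "(\<Sum>n=1..N. f n) \<le> B - F 0"
proof -
 have "(\<Sum>n=1..N. f n) \<le> (\<Sum>n=1..N. F n - F (n - 1))" by (rule sum_mono) (use assms in auto)
 also have "\<dots> = F N - F 0" by (induction N) auto
 also have "\<dots> \<le> B - F 0" using assms(2) by simp
 finally show ?thesis .
qed

lemma one_minus_inverse_powr_ge:
 fixes n :: nat and p :: real
 assumes "1 \<le> n" "0 < p"
 shows "p * real (Suc n) powr (- 1 - p) \<le> real n powr (- p) - real (Suc n) powr (- p)"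
proof -
 have "\<exists>z. real n < z \<and> z < real (Suc n) \<and> real (Suc n) powr (- p) - real n powr (- p) =
   (real (Suc n) - real n) * (- p * z powr (- p - 1))"
  by (rule MVT2) (use assms in \<open>auto intro!: derivative_eq_intros simp: field_simps powr_diff\<close>)
 then obtain z where z: "real n < z" "z < real (Suc n)"
  "real (Suc n) powr (- p) - real n powr (- p) = - p * z powr (- p - 1)" by auto
 have "real (Suc n) powr (- p - 1) \<le> z powr (- p - 1)"
  by (rule powr_mono2') (use z assms in auto)
 then have "p * real (Suc n) powr (- p - 1) \<le> p * z powr (- p - 1)"
  using assms by (intro mult_left_mono) auto
 moreover have "- p - 1 = - 1 - p" by simp
 ultimately show ?thesis using z by (simp only:)
qed

text \<open>The constant is explicit because its growth as the exponent tends to the critical value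
 2 decides which crude lifespan is available.\<close>

lemma sum_mode_norm_powr_le:
 assumes "finite F" "0 \<notin> F" "0 < p"
 shows "(\<Sum>k\<in>F. mode_norm k powr (- 2 - p)) \<le> 12 * (1 + 1 / p)"
proof (rule sum_lattice_le_sum_shells[where f = "\<lambda>n. real n powr (- 2 - p)"])
 fix k assume "k \<in> F"
 then have "k \<noteq> 0" using assms by auto
 then show "mode_norm k powr (- 2 - p) \<le> real (shell k) powr (- 2 - p)"
  using shell_pos[of k] shell_le_mode_norm[of k] assms by (intro powr_mono2') auto
next
 fix N
 have eq: "real n * real n powr (- 2 - p) = real n powr (- 1 - p)" if "1 \<le> n" for n :: nat
  using that powr_mult_base[of "real n" "- 2 - p"] by simp
 have "(\<Sum>n=1..N. real n * real n powr (- 2 - p)) = (\<Sum>n=1..N. real n powr (- 1 - p))"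
  by (rule sum.cong) (use eq in auto)
 also have "\<dots> \<le> (1 + 1/p) - 0"
 proof (rule order_trans[OF sum_le_telescope[where F = "\<lambda>n. if n = 0 then 0 else 1 + (1 - real n powr (- p)) / p" and B = "1 + 1/p"]])
  fix n :: nat assume n: "1 \<le> n"
  show "real n powr (- 1 - p) \<le> (if n = 0 then 0 else 1 + (1 - real n powr (- p)) / p)
    - (if n - 1 = 0 then 0 else 1 + (1 - real (n - 1) powr (- p)) / p)"
  proof (cases "n = 1")
   case False
   then obtain m where m: "n = Suc m" "1 \<le> m" using n by (cases n) auto
   have "p * real n powr (- 1 - p) \<le> real m powr (- p) - real n powr (- p)"
    using one_minus_inverse_powr_ge[OF m(2) assms(3)] m by simp
   then have "real n powr (- 1 - p) \<le> (real m powr (- p) - real n powr (- p)) / p"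
    using assms(3) by (simp add: pos_le_divide_eq mult.commute)
   also have "\<dots> = (1 + (1 - real n powr (- p)) / p) - (1 + (1 - real m powr (- p)) / p)"
    by (simp add: diff_divide_distrib)
   finally show ?thesis using m by simp
  qed (use assms in auto)
 qed (use assms in \<open>auto simp: divide_right_mono\<close>)
 finally show "(\<Sum>n=1..N. real n * real n powr (- 2 - p)) \<le> 1 + 1 / p" by simp
qed (use assms in auto)

lemma card_mode_norm_le:
 assumes "0 \<le> R"
 shows "finite {l. mode_norm l \<le> R}" "real (card {l. mode_norm l \<le> R}) \<le> (2 * R + 1)\<^sup>2"
proof -
 let ?I = "{- \<lfloor>R\<rfloor>..\<lfloor>R\<rfloor>}"
 have sub: "{l. mode_norm l \<le> R} \<subseteq> ?I \<times> ?I"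
 proof
  fix l assume "l \<in> {l. mode_norm l \<le> R}"
  then have "\<bar>real_of_int (fst l)\<bar> \<le> R" "\<bar>real_of_int (snd l)\<bar> \<le> R"
   using abs_fst_le[of l] abs_snd_le[of l] by auto
  then have "\<bar>fst l\<bar> \<le> \<lfloor>R\<rfloor>" "\<bar>snd l\<bar> \<le> \<lfloor>R\<rfloor>" by (auto simp: le_floor_iff)
  then show "l \<in> ?I \<times> ?I" by (cases l) auto
 qed
 show "finite {l. mode_norm l \<le> R}" by (rule finite_subset[OF sub]) auto
 have "card {l. mode_norm l \<le> R} \<le> card (?I \<times> ?I)" by (rule card_mono[OF _ sub]) auto
 then have "real (card {l. mode_norm l \<le> R}) \<le> real (card (?I \<times> ?I))" by (rule of_nat_mono)
 also have "\<dots> = (2 * of_int \<lfloor>R\<rfloor> + 1)\<^sup>2"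
  using assms by (simp add: card_cartesian_product power2_eq_square)
 also have "\<dots> \<le> (2 * R + 1)\<^sup>2" using assms by (intro power_mono) auto
 finally show "real (card {l. mode_norm l \<le> R}) \<le> (2 * R + 1)\<^sup>2" .
qed

text \<open>The profile of \<open>min y (1/y)\<close>, squared, in the variable \<open>v = y^2\<close>: its sum over a
 logarithmic scale is finite and does not change when \<open>\<tau>\<close> rescales the argument.\<close>

lemma sum_scale_invariant_profile:
 fixes p :: real
 assumes "0 < p" "p \<le> 2" "0 \<le> a"
 shows "(\<Sum>n=1..N. a * real n powr p / (real n * (1 + a * real n powr p)\<^sup>2)) \<le> 1 / min p 1"
proof -
 let ?v = "\<lambda>n. a * real n powr p" and ?c = "min p 1"
 have c: "0 < ?c" using assms by simp
 have "(\<Sum>n=1..N. ?v n / (real n * (1 + ?v n)\<^sup>2)) \<le> 1 / ?c - (1 - 1 / (1 + ?v 0)) / ?c"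
 proof (rule sum_le_telescope)
  fix n :: nat assume n: "1 \<le> n"
  have v: "0 \<le> ?v m" for m using assms by simp
  have incr: "?c * real n powr p \<le> real n * (real n powr p - real (n - 1) powr p)"
  proof (cases "p \<le> 1")
   case True
   have "\<exists>z. real (n - 1) < z \<and> z < real n \<and> real n powr p - real (n - 1) powr p =
     (real n - real (n - 1)) * (p * z powr (p - 1))" if "2 \<le> n"
    by (rule MVT2) (use that assms in \<open>auto intro!: derivative_eq_intros simp: field_simps powr_diff\<close>)
   moreover have ?thesis if "n = 1" using that True assms by simp
   moreover have ?thesis if n2: "2 \<le> n" and z: "real (n - 1) < z" "z < real n"
     "real n powr p - real (n - 1) powr p = (real n - real (n - 1)) * (p * z powr (p - 1))" for z
   proof -
    have "real n powr (p - 1) \<le> z powr (p - 1)"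
     by (rule powr_mono2') (use z n2 True in auto)
    then have "p * real n powr (p - 1) \<le> p * z powr (p - 1)" using assms by (intro mult_left_mono) auto
    then have "real n * (p * real n powr (p - 1)) \<le> real n * (p * z powr (p - 1))"
     by (rule mult_left_mono) simp
    moreover have "real n * (p * real n powr (p - 1)) = p * real n powr p"
     using n powr_mult_base[of "real n" "p - 1"] by simp
    moreover have "real n - real (n - 1) = 1" using n by (simp add: of_nat_diff)
    ultimately show ?thesis using z True by simp
   qed
   ultimately show ?thesis using n by (cases "n = 1") auto
  next
   case False
   have "real n * real (n - 1) powr p = real n * (real (n - 1) * real (n - 1) powr (p - 1))"
    using powr_mult_base[of "real (n - 1)" "p - 1"] by simp
   also have "\<dots> \<le> real n * (real (n - 1) * real n powr (p - 1))"
    using False by (intro mult_left_mono powr_mono2) auto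
   also have "\<dots> = real (n - 1) * real n powr p"
    using n powr_mult_base[of "real n" "p - 1"] by simp
   also have "\<dots> = real n * real n powr p - real n powr p"
    using n by (simp add: of_nat_diff algebra_simps)
   finally show ?thesis using False by (simp add: algebra_simps)
  qed
  have "?c * ?v n \<le> real n * (?v n - ?v (n - 1))"
   using mult_left_mono[OF incr assms(3)] by (simp add: algebra_simps)
  then have "?v n / real n \<le> (?v n - ?v (n - 1)) / ?c"
   using c n by (simp add: field_simps)
  then have "?v n / real n / (1 + ?v n)\<^sup>2 \<le> (?v n - ?v (n - 1)) / ?c / (1 + ?v n)\<^sup>2"
   by (rule divide_right_mono) simp
  also have "\<dots> \<le> (?v n - ?v (n - 1)) / ?c / ((1 + ?v n) * (1 + ?v (n - 1)))"
  proof (rule divide_left_mono)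
   have le: "?v (n - 1) \<le> ?v n" using assms by (intro mult_left_mono powr_mono2) auto
   show "(1 + ?v n) * (1 + ?v (n - 1)) \<le> (1 + ?v n)\<^sup>2"
    unfolding power2_eq_square using le v[of n] by (intro mult_left_mono) auto
   show "0 \<le> (?v n - ?v (n - 1)) / ?c" using le c by simp
   have "0 < 1 + ?v n" "0 < 1 + ?v (n - 1)" using v[of n] v[of "n - 1"] by linarith+
   then show "0 < (1 + ?v n)\<^sup>2 * ((1 + ?v n) * (1 + ?v (n - 1)))" by simp
  qed
  also have "\<dots> = (1 - 1 / (1 + ?v n)) / ?c - (1 - 1 / (1 + ?v (n - 1))) / ?c"
  proof -
   have "0 < 1 + ?v n" "0 < 1 + ?v (n - 1)" using v[of n] v[of "n - 1"] by linarith+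
   then have "1 / (1 + ?v (n - 1)) - 1 / (1 + ?v n) = (?v n - ?v (n - 1)) / ((1 + ?v n) * (1 + ?v (n - 1)))"
    by (simp add: divide_simps)
   then show ?thesis by (simp add: diff_divide_distrib[symmetric] mult.commute)
  qed
  finally show "?v n / (real n * (1 + ?v n)\<^sup>2) \<le>
    (1 - 1 / (1 + ?v n)) / ?c - (1 - 1 / (1 + ?v (n - 1))) / ?c" by simp
 next
  fix n show "(1 - 1 / (1 + ?v n)) / ?c \<le> 1 / ?c"
   using c assms by (intro divide_right_mono) (auto simp: field_simps)
 qed
 then show ?thesis using assms by simp
qed

definition bump :: "real \<Rightarrow> real" where
 "bump y = min y (1 / y)"

text \<open>Uniformity in \<open>\<tau>\<close> is the point: the constant of the trilinear estimate must not deteriorate as the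
 radius shrinks.\<close>

lemma sum_bump_le:
 assumes "finite F" "0 \<notin> F" "0 < \<sigma>" "\<sigma> \<le> 1" "0 < \<tau>"
 shows "(\<Sum>k\<in>F. (bump (\<tau> * mode_norm k powr \<sigma>) / mode_norm k)\<^sup>2) \<le> 96 / min (2 * \<sigma>) 1"
proof -
 let ?w = "\<lambda>n::nat. \<tau>\<^sup>2 * real n powr (2 * \<sigma>)"
 have "(\<Sum>k\<in>F. (bump (\<tau> * mode_norm k powr \<sigma>) / mode_norm k)\<^sup>2) \<le> 12 * (8 / min (2 * \<sigma>) 1)"
 proof (rule sum_lattice_le_sum_shells[where f = "\<lambda>n. 8 * (?w n / ((real n)\<^sup>2 * (1 + ?w n)\<^sup>2))"])
  fix k assume "k \<in> F"
  then have k0: "k \<noteq> 0" using assms by auto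
  define y where "y = \<tau> * mode_norm k powr \<sigma>"
  define n where "n = shell k"
  have mp: "0 < mode_norm k" "1 \<le> n" "real n \<le> mode_norm k"
   using k0 mode_norm_pos shell_pos shell_le_mode_norm by (auto simp: n_def)
  have y: "0 < y" unfolding y_def using mp(1) assms by (intro mult_pos_pos) auto
  have y2: "y\<^sup>2 = \<tau>\<^sup>2 * mode_norm k powr (2 * \<sigma>)"
   using powr_add[of "mode_norm k" \<sigma> \<sigma>] by (simp add: y_def power_mult_distrib power2_eq_square)
  have up: "y\<^sup>2 \<le> 2 * ?w n"
  proof -
   have "mode_norm k powr (2 * \<sigma>) = ((mode_norm k)\<^sup>2) powr \<sigma>"
    using mp by (simp add: powr_powr flip: powr_numeral)
   also have "\<dots> \<le> (2 * (real n)\<^sup>2) powr \<sigma>"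
    using mode_norm_sq_le_shell[of k] assms by (intro powr_mono2) (auto simp: n_def)
   also have "\<dots> = 2 powr \<sigma> * real n powr (2 * \<sigma>)"
    using mp by (simp add: powr_mult powr_powr flip: powr_numeral)
   also have "\<dots> \<le> 2 powr 1 * real n powr (2 * \<sigma>)"
    using assms by (intro mult_right_mono powr_mono) auto
   finally show ?thesis using assms by (simp add: y2 algebra_simps)
  qed
  have lo: "?w n \<le> y\<^sup>2" unfolding y2 using mp assms by (intro mult_left_mono powr_mono2) auto
  have w: "0 \<le> ?w n" using assms by simp
  have "(bump y)\<^sup>2 \<le> 4 * (y\<^sup>2 / (1 + y\<^sup>2)\<^sup>2)"
  proof -
   have "bump y \<le> 2 * y / (1 + y\<^sup>2)"
   proof (cases "y \<le> 1")
    case True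
    have "y * (1 + y\<^sup>2) \<le> y * 2" using True y by (intro mult_left_mono) (auto simp: power_le_one)
    moreover have "bump y \<le> y" by (simp add: bump_def)
    ultimately show ?thesis using y
     by (smt (verit) pos_le_divide_eq zero_le_power2 mult.commute)
   next
    case False
    have "1 + y\<^sup>2 \<le> 2 * y * y" using False by (simp add: power2_eq_square) (smt (verit) mult_less_cancel_left2)
    then have "1 / y \<le> 2 * y / (1 + y\<^sup>2)" using y by (simp add: divide_simps add_pos_nonneg)
    moreover have "bump y \<le> 1 / y" by (simp add: bump_def)
    ultimately show ?thesis by linarith
   qed
   moreover have "0 \<le> bump y" using y by (simp add: bump_def)
   ultimately have "(bump y)\<^sup>2 \<le> (2 * y / (1 + y\<^sup>2))\<^sup>2" by (intro power_mono) auto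
   then show ?thesis by (simp add: power_divide power_mult_distrib)
  qed
  also have "\<dots> \<le> 4 * (2 * ?w n / (1 + ?w n)\<^sup>2)"
   using up lo w y by (intro mult_left_mono frac_le power_mono) (auto simp: add_pos_nonneg)
  finally have b: "(bump y)\<^sup>2 \<le> 8 * ?w n / (1 + ?w n)\<^sup>2" by simp
  have "(bump y)\<^sup>2 / (mode_norm k)\<^sup>2 \<le> (8 * ?w n / (1 + ?w n)\<^sup>2) / (real n)\<^sup>2"
   using b mp w by (intro frac_le power_mono) auto
  then show "(bump (\<tau> * mode_norm k powr \<sigma>) / mode_norm k)\<^sup>2 \<le>
    8 * (?w (shell k) / ((real (shell k))\<^sup>2 * (1 + ?w (shell k))\<^sup>2))"
   by (simp add: y_def n_def power_divide mult.commute)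
 next
  fix N
  have "(\<Sum>n=1..N. real n * (8 * (?w n / ((real n)\<^sup>2 * (1 + ?w n)\<^sup>2)))) =
   8 * (\<Sum>n=1..N. ?w n / (real n * (1 + ?w n)\<^sup>2))"
   unfolding sum_distrib_left by (rule sum.cong) (auto simp: power2_eq_square)
  also have "\<dots> \<le> 8 * (1 / min (2 * \<sigma>) 1)"
   by (rule mult_left_mono[OF sum_scale_invariant_profile]) (use assms in auto)
  finally show "(\<Sum>n=1..N. real n * (8 * (?w n / ((real n)\<^sup>2 * (1 + ?w n)\<^sup>2)))) \<le> 8 / min (2 * \<sigma>) 1"
   by simp
 qed (use assms in auto)
 then show ?thesis by simp
qed

section \<open>The nonlinearity in Fourier variables\<close>

text \<open>The velocity symbol at the mode \<open>j\<close>, paired with the wave vector \<open>l\<close> of the transported function.\<close>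

definition drift :: "real \<Rightarrow> int \<times> int \<Rightarrow> int \<times> int \<Rightarrow> real" where
 "drift \<nu> j l = ipmb_symbol1 \<nu> j * of_int (fst l) + ipmb_symbol2 \<nu> j * of_int (snd l)"

definition hermitian :: "(int \<times> int \<Rightarrow> complex) \<Rightarrow> bool" where
 "hermitian a \<longleftrightarrow> (\<forall>k. a (- k) = cnj (a k))"

text \<open>The Fourier coefficient at \<open>k\<close> of the derivative of \<open>b\<close> along the velocity generated by \<open>a\<close>, with the
 modes of \<open>b\<close> restricted to \<open>S\<close>.\<close>

definition advection ::
 "real \<Rightarrow> (int \<times> int) set \<Rightarrow> (int \<times> int \<Rightarrow> complex) \<Rightarrow> (int \<times> int \<Rightarrow> complex) \<Rightarrow> int \<times> int \<Rightarrow> complex" where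
 "advection \<nu> S a b k = (\<Sum>l\<in>S. \<i> * of_real (drift \<nu> (k - l) l) * a (k - l) * b l)"

lemma symbol1_minus [simp]: "ipmb_symbol1 \<nu> (- k) = ipmb_symbol1 \<nu> k"
 and symbol2_minus [simp]: "ipmb_symbol2 \<nu> (- k) = ipmb_symbol2 \<nu> k"
 by (simp_all add: ipmb_symbol1_def ipmb_symbol2_def)

lemma symbol_zero [simp]: "ipmb_symbol1 \<nu> 0 = 0" "ipmb_symbol2 \<nu> 0 = 0"
 by (simp_all add: ipmb_symbol1_def ipmb_symbol2_def)

text \<open>The velocity is divergence free.\<close>

lemma drift_self: "drift \<nu> j j = 0"
 by (simp add: drift_def ipmb_symbol1_def ipmb_symbol2_def power2_eq_square)

lemma drift_minus [simp]: "drift \<nu> (- j) l = drift \<nu> j l"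
 by (simp add: drift_def)

lemma drift_diff: "drift \<nu> j (k - l) = drift \<nu> j k - drift \<nu> j l"
 by (simp add: drift_def algebra_simps)

lemma drift_shift: "drift \<nu> (k - l) k = drift \<nu> (k - l) l"
 using drift_self[of \<nu> "k - l"] by (simp add: drift_diff)

lemma drift_commute: "drift \<nu> (l - k) k = drift \<nu> (k - l) l"
 using drift_minus[of \<nu> "k - l" k] drift_shift[of \<nu> k l] by simp

lemma symbol_sq_sum_le:
 assumes "0 \<le> \<nu>"
 shows "(ipmb_symbol1 \<nu> j)\<^sup>2 + (ipmb_symbol2 \<nu> j)\<^sup>2 \<le> (1 / (1 + \<nu> * (mode_norm j)\<^sup>2))\<^sup>2"
proof (cases "j = 0")
 case False
 define p q where "p = (real_of_int (fst j))" "q = (real_of_int (snd j))"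
 have n: "(mode_norm j)\<^sup>2 = p\<^sup>2 + q\<^sup>2" by (simp add: mode_norm_sq p_q_def)
 have pos: "0 < p\<^sup>2 + q\<^sup>2" unfolding n[symmetric] using False by simp
 have "(p * q / (p\<^sup>2 + q\<^sup>2))\<^sup>2 + (- p\<^sup>2 / (p\<^sup>2 + q\<^sup>2))\<^sup>2 = ((p * q)\<^sup>2 + (p\<^sup>2)\<^sup>2) / (p\<^sup>2 + q\<^sup>2)\<^sup>2"
  by (simp add: power_divide add_divide_distrib)
 also have "\<dots> = p\<^sup>2 * (p\<^sup>2 + q\<^sup>2) / (p\<^sup>2 + q\<^sup>2)\<^sup>2" by (simp add: power2_eq_square algebra_simps)
 also have "\<dots> \<le> 1" using pos by (simp add: power2_eq_square divide_simps)
 finally have r: "(p * q / (p\<^sup>2 + q\<^sup>2))\<^sup>2 + (- p\<^sup>2 / (p\<^sup>2 + q\<^sup>2))\<^sup>2 \<le> 1" .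
 have "(ipmb_symbol1 \<nu> j)\<^sup>2 + (ipmb_symbol2 \<nu> j)\<^sup>2 =
  (1 / (1 + \<nu> * (p\<^sup>2 + q\<^sup>2)))\<^sup>2 * ((p * q / (p\<^sup>2 + q\<^sup>2))\<^sup>2 + (- p\<^sup>2 / (p\<^sup>2 + q\<^sup>2))\<^sup>2)"
  unfolding ipmb_symbol1_def ipmb_symbol2_def p_q_def[symmetric] by (simp only: power_mult_distrib distrib_left)
 also have "\<dots> \<le> (1 / (1 + \<nu> * (p\<^sup>2 + q\<^sup>2)))\<^sup>2 * 1"
  using r by (rule mult_left_mono) simp
 finally show ?thesis by (simp add: n)
qed auto

lemma abs_symbol_le:
 assumes "0 \<le> \<nu>"
 shows "\<bar>ipmb_symbol1 \<nu> j\<bar> \<le> 1 / (1 + \<nu> * (mode_norm j)\<^sup>2)"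
  and "\<bar>ipmb_symbol2 \<nu> j\<bar> \<le> 1 / (1 + \<nu> * (mode_norm j)\<^sup>2)"
proof -
 have p: "0 \<le> 1 / (1 + \<nu> * (mode_norm j)\<^sup>2)" using assms by simp
 have "(ipmb_symbol1 \<nu> j)\<^sup>2 \<le> (1 / (1 + \<nu> * (mode_norm j)\<^sup>2))\<^sup>2"
    "(ipmb_symbol2 \<nu> j)\<^sup>2 \<le> (1 / (1 + \<nu> * (mode_norm j)\<^sup>2))\<^sup>2"
  using symbol_sq_sum_le[OF assms, of j] zero_le_power2[of "ipmb_symbol1 \<nu> j"]
   zero_le_power2[of "ipmb_symbol2 \<nu> j"] by linarith+
 then show "\<bar>ipmb_symbol1 \<nu> j\<bar> \<le> 1 / (1 + \<nu> * (mode_norm j)\<^sup>2)"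
  "\<bar>ipmb_symbol2 \<nu> j\<bar> \<le> 1 / (1 + \<nu> * (mode_norm j)\<^sup>2)"
  using p by (metis abs_le_square_iff abs_of_nonneg)+
qed

lemma abs_pair_dot_le: "\<bar>a * c + b * d\<bar> \<le> sqrt (a\<^sup>2 + b\<^sup>2) * sqrt (c\<^sup>2 + d\<^sup>2)" for a b c d :: real
 using Cauchy_Schwarz_ineq2[of "(a, b)" "(c, d)"] by (simp add: norm_Pair)

lemma abs_drift_le:
 assumes "0 \<le> \<nu>"
 shows "\<bar>drift \<nu> j l\<bar> \<le> mode_norm l / (1 + \<nu> * (mode_norm j)\<^sup>2)"
proof -
 have "\<bar>drift \<nu> j l\<bar> \<le> sqrt ((ipmb_symbol1 \<nu> j)\<^sup>2 + (ipmb_symbol2 \<nu> j)\<^sup>2) * mode_norm l"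
  unfolding drift_def mode_norm_def by (rule abs_pair_dot_le)
 also have "\<dots> \<le> (1 / (1 + \<nu> * (mode_norm j)\<^sup>2)) * mode_norm l"
  using symbol_sq_sum_le[OF assms, of j] assms
  by (intro mult_right_mono) (auto intro: real_le_lsqrt)
 finally show ?thesis by simp
qed

lemma abs_drift_le':
 assumes "0 < \<nu>" "j \<noteq> 0"
 shows "\<bar>drift \<nu> j l\<bar> \<le> mode_norm l / (\<nu> * (mode_norm j)\<^sup>2)"
proof -
 have "mode_norm l / (1 + \<nu> * (mode_norm j)\<^sup>2) \<le> mode_norm l / (\<nu> * (mode_norm j)\<^sup>2)"
  using assms mode_norm_pos[of j] by (intro divide_left_mono mult_pos_pos) (auto simp: add_pos_pos)
 with abs_drift_le[of \<nu> j l] assms show ?thesis by simp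
qed

lemma abs_drift_le_mode_norm:
 assumes "0 \<le> \<nu>"
 shows "\<bar>drift \<nu> j l\<bar> \<le> mode_norm l"
proof -
 have "mode_norm l / (1 + \<nu> * (mode_norm j)\<^sup>2) \<le> mode_norm l / 1"
  using assms by (intro divide_left_mono) (auto simp: add_pos_nonneg)
 with abs_drift_le[OF assms, of j l] show ?thesis by simp
qed

text \<open>Because the velocity field is real and divergence free, the matrix
 \<open>(drift \<nu> (k - l) l * a (k - l))\<close> is Hermitian, so transport is orthogonal to the transported
 function, also after restriction to finitely many modes.\<close>

lemma advection_neutral:
 assumes "finite S" "hermitian a"
 shows "Re (\<Sum>k\<in>S. cnj (b k) * advection \<nu> S a b k) = 0"
proof -
 define X where "X = (\<Sum>k\<in>S. cnj (b k) * advection \<nu> S a b k)"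
 have H: "of_real (drift \<nu> (l - k) k) * a (l - k) = cnj (of_real (drift \<nu> (k - l) l) * a (k - l))" for k l
  using assms(2)[unfolded hermitian_def, rule_format, of "k - l"] by (simp add: drift_commute)
 have "cnj X = (\<Sum>k\<in>S. \<Sum>l\<in>S. b k * (- \<i> * cnj (of_real (drift \<nu> (k - l) l) * a (k - l)) * cnj (b l)))"
  by (simp add: X_def advection_def sum_distrib_left mult.assoc)
 also have "\<dots> = (\<Sum>k\<in>S. \<Sum>l\<in>S. b k * (- \<i> * (of_real (drift \<nu> (l - k) k) * a (l - k)) * cnj (b l)))"
  by (simp only: H[symmetric])
 also have "\<dots> = (\<Sum>l\<in>S. \<Sum>k\<in>S. b k * (- \<i> * (of_real (drift \<nu> (l - k) k) * a (l - k)) * cnj (b l)))"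
  by (rule sum.swap)
 also have "\<dots> = - X"
  by (simp add: X_def advection_def sum_distrib_left sum_negf[symmetric] algebra_simps)
 finally have "Re (cnj X) = Re (- X)" by simp
 then show ?thesis by (simp add: X_def)
qed

subsection \<open>Three kernels\<close>

lemma sum_pairs_diff_le:
 fixes u :: "int \<times> int \<Rightarrow> int \<times> int \<Rightarrow> real"
 assumes "finite S" and P: "P \<subseteq> S \<times> S" and supp: "\<And>j l. j \<notin> S \<Longrightarrow> u j l = 0"
  and pos: "\<And>j l. 0 \<le> u j l"
  and L: "\<And>k l. (k, l) \<in> P \<Longrightarrow> k - l \<in> S \<Longrightarrow> l \<in> L (k - l)" and finL: "\<And>j. finite (L j)"
 shows "(\<Sum>(k, l)\<in>P. u (k - l) l) \<le> (\<Sum>j\<in>S. \<Sum>l\<in>L j. u j l)"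
proof -
 have finP: "finite P" using assms finite_subset by blast
 let ?P = "{p\<in>P. fst p - snd p \<in> S}" and ?h = "\<lambda>(k :: int \<times> int, l). (k - l, l)"
 have "(\<Sum>(k, l)\<in>P. u (k - l) l) = (\<Sum>(k, l)\<in>?P. u (k - l) l)"
  using finP supp by (intro sum.mono_neutral_right) (simp_all add: case_prod_unfold)
 also have "\<dots> = (\<Sum>(j, l)\<in>?h ` ?P. u j l)"
  by (subst sum.reindex) (auto simp: inj_on_def intro!: sum.cong)
 also have "\<dots> \<le> (\<Sum>(j, l)\<in>Sigma S L. u j l)"
  by (rule sum_mono2) (use assms in \<open>auto\<close>)
 also have "\<dots> = (\<Sum>j\<in>S. \<Sum>l\<in>L j. u j l)"
  by (rule sum.Sigma[symmetric]) (use assms in auto)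
 finally show ?thesis .
qed

lemma sum_pairs_Cauchy_Schwarz:
 fixes u v :: "'a \<Rightarrow> real"
 assumes "(\<Sum>p\<in>P. (u p)\<^sup>2) \<le> c\<^sup>2" "(\<Sum>p\<in>P. (v p)\<^sup>2) \<le> d\<^sup>2" "0 \<le> c" "0 \<le> d"
 shows "(\<Sum>p\<in>P. u p * v p) \<le> c * d"
proof (rule power2_le_imp_le)
 have "(\<Sum>p\<in>P. u p * v p)\<^sup>2 \<le> (\<Sum>p\<in>P. (u p)\<^sup>2) * (\<Sum>p\<in>P. (v p)\<^sup>2)"
  by (rule Cauchy_Schwarz_ineq_sum)
 also have "\<dots> \<le> c\<^sup>2 * d\<^sup>2" using assms by (intro mult_mono sum_nonneg) auto
 finally show "(\<Sum>p\<in>P. u p * v p)\<^sup>2 \<le> (c * d)\<^sup>2" by (simp add: power_mult_distrib)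
qed (use assms in auto)

lemma L2_set_sq: "(L2_set f A)\<^sup>2 = (\<Sum>i\<in>A. (f i)\<^sup>2)"
 by (simp add: L2_set_def sum_nonneg)

lemma sum_pairs_prod_sq_le:
 fixes f g :: "'a \<Rightarrow> real"
 assumes "finite S" "P \<subseteq> S \<times> S"
 shows "(\<Sum>(k, l)\<in>P. (f l * g k)\<^sup>2) \<le> (L2_set f S * L2_set g S)\<^sup>2"
proof -
 have "(\<Sum>(k, l)\<in>P. (f l * g k)\<^sup>2) \<le> (\<Sum>(k, l)\<in>S \<times> S. (f l * g k)\<^sup>2)"
  by (rule sum_mono2) (use assms in auto)
 also have "\<dots> = (\<Sum>k\<in>S. \<Sum>l\<in>S. (f l * g k)\<^sup>2)" by (simp add: sum.cartesian_product)
 also have "\<dots> = (L2_set f S * L2_set g S)\<^sup>2"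
  by (simp add: power_mult_distrib L2_set_sq sum_product mult.commute sum_distrib_left sum_distrib_right)
 finally show ?thesis .
qed

text \<open>Two modes interact either with the velocity at comparable or higher frequency (far), where its two
 orders of smoothing dominate, or at lower frequency (near), where the transported mode has to be
 treated by cancellation.\<close>

definition far_pairs :: "(int \<times> int) set \<Rightarrow> ((int \<times> int) \<times> (int \<times> int)) set" where
 "far_pairs S = {(k, l) \<in> S \<times> S. k \<noteq> l \<and> mode_norm l < 2 * mode_norm (k - l)}"

definition near_pairs :: "(int \<times> int) set \<Rightarrow> ((int \<times> int) \<times> (int \<times> int)) set" where
 "near_pairs S = {(k, l) \<in> S \<times> S. k \<noteq> l \<and> 2 * mode_norm (k - l) \<le> mode_norm l}"

lemma far_pairs_subset: "far_pairs S \<subseteq> S \<times> S" and near_pairs_subset: "near_pairs S \<subseteq> S \<times> S"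
 by (auto simp: far_pairs_def near_pairs_def)

lemma inj_on_shift: "inj_on (\<lambda>k :: int \<times> int. k - j) A" "inj_on (\<lambda>l :: int \<times> int. k - l) A"
 by (auto simp: inj_on_def prod_eq_iff)

lemma far_form_le:
 assumes S: "finite S" and supp: "\<And>j. j \<notin> S \<Longrightarrow> \<alpha> j = 0"
 shows "(\<Sum>(k, l)\<in>far_pairs S. \<alpha> (k - l) / mode_norm (k - l) * (\<beta> l * \<gamma> k)) \<le>
   5 * L2_set \<alpha> S * (L2_set \<beta> S * L2_set \<gamma> S)"
proof -
 have "(\<Sum>(k, l)\<in>far_pairs S. (\<alpha> (k - l) / mode_norm (k - l))\<^sup>2) \<le>
   (\<Sum>j\<in>S. \<Sum>l\<in>{l. mode_norm l \<le> 2 * mode_norm j}. (\<alpha> j / mode_norm j)\<^sup>2)"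
  by (rule sum_pairs_diff_le)
   (use S supp card_mode_norm_le in \<open>auto simp: far_pairs_def\<close>)
 also have "\<dots> \<le> (\<Sum>j\<in>S. 25 * (\<alpha> j)\<^sup>2)"
 proof (rule sum_mono)
  fix j
  show "(\<Sum>l\<in>{l. mode_norm l \<le> 2 * mode_norm j}. (\<alpha> j / mode_norm j)\<^sup>2) \<le> 25 * (\<alpha> j)\<^sup>2"
  proof (cases "j = 0")
   case False
   have "real (card {l. mode_norm l \<le> 2 * mode_norm j}) \<le> (2 * (2 * mode_norm j) + 1)\<^sup>2"
    by (rule card_mode_norm_le) simp
   also have "\<dots> \<le> (5 * mode_norm j)\<^sup>2" using mode_norm_ge_1[OF False] by (intro power_mono) auto
   finally have "real (card {l. mode_norm l \<le> 2 * mode_norm j}) * (\<alpha> j / mode_norm j)\<^sup>2 \<le>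
     (5 * mode_norm j)\<^sup>2 * (\<alpha> j / mode_norm j)\<^sup>2" by (rule mult_right_mono) simp
   also have "\<dots> = 25 * (\<alpha> j)\<^sup>2" using False by (simp add: power_mult_distrib power_divide)
   finally show ?thesis by simp
  qed auto
 qed
 also have "\<dots> = (5 * L2_set \<alpha> S)\<^sup>2" by (simp add: power_mult_distrib L2_set_sq sum_distrib_left)
 finally have u: "(\<Sum>p\<in>far_pairs S. (\<lambda>(k, l). \<alpha> (k - l) / mode_norm (k - l)) p ^ 2) \<le> (5 * L2_set \<alpha> S)\<^sup>2"
  by (simp add: case_prod_unfold)
 have v: "(\<Sum>p\<in>far_pairs S. (\<lambda>(k, l). \<beta> l * \<gamma> k) p ^ 2) \<le> (L2_set \<beta> S * L2_set \<gamma> S)\<^sup>2"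
  using sum_pairs_prod_sq_le[OF S far_pairs_subset, of \<beta> \<gamma>] by (simp only: case_prod_unfold)
 show ?thesis using sum_pairs_Cauchy_Schwarz[OF u v] by (simp add: case_prod_unfold L2_set_nonneg)
qed

lemma near_form_le:
 assumes S: "finite S" and supp: "\<And>j. j \<notin> S \<Longrightarrow> \<alpha> j = 0"
 shows "(\<Sum>(k, l)\<in>near_pairs S. \<alpha> (k - l) * (\<beta> l * \<gamma> k) / mode_norm l) \<le>
   2 * L2_set \<alpha> S * (L2_set \<beta> S * L2_set \<gamma> S)"
proof -
 have finN: "finite {j. mode_norm j \<le> mode_norm l / 2}" for l
  by (rule card_mode_norm_le) simp
 have finP: "finite (near_pairs S)"
  by (rule finite_subset[of _ "S \<times> S"]) (use S in \<open>auto simp: near_pairs_def\<close>)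
 have "(\<Sum>(k, l)\<in>near_pairs S. (\<beta> l / mode_norm l)\<^sup>2) = (\<Sum>(l, j)\<in>(\<lambda>(k, l). (l, k - l)) ` near_pairs S. (\<beta> l / mode_norm l)\<^sup>2)"
  by (subst sum.reindex) (auto simp: inj_on_def intro!: sum.cong)
 also have "\<dots> \<le> (\<Sum>(l, j)\<in>Sigma S (\<lambda>l. {j. mode_norm j \<le> mode_norm l / 2}). (\<beta> l / mode_norm l)\<^sup>2)"
  by (rule sum_mono2[OF finite_SigmaI[OF S finN]]) (auto simp: near_pairs_def)
 also have "\<dots> = (\<Sum>l\<in>S. \<Sum>j\<in>{j. mode_norm j \<le> mode_norm l / 2}. (\<beta> l / mode_norm l)\<^sup>2)"
  by (rule sum.Sigma[symmetric]) (use S finN in auto)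
 also have "\<dots> \<le> (\<Sum>l\<in>S. 4 * (\<beta> l)\<^sup>2)"
 proof (rule sum_mono)
  fix l
  show "(\<Sum>j\<in>{j. mode_norm j \<le> mode_norm l / 2}. (\<beta> l / mode_norm l)\<^sup>2) \<le> 4 * (\<beta> l)\<^sup>2"
  proof (cases "l = 0")
   case False
   have "real (card {j. mode_norm j \<le> mode_norm l / 2}) \<le> (2 * (mode_norm l / 2) + 1)\<^sup>2"
    by (rule card_mode_norm_le) simp
   also have "\<dots> \<le> (2 * mode_norm l)\<^sup>2" using mode_norm_ge_1[OF False] by (intro power_mono) auto
   finally have "real (card {j. mode_norm j \<le> mode_norm l / 2}) * (\<beta> l / mode_norm l)\<^sup>2 \<le>
     (2 * mode_norm l)\<^sup>2 * (\<beta> l / mode_norm l)\<^sup>2" by (rule mult_right_mono) simp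
   also have "\<dots> = 4 * (\<beta> l)\<^sup>2" using False by (simp add: power_mult_distrib power_divide)
   finally show ?thesis by simp
  qed auto
 qed
 also have "\<dots> = (2 * L2_set \<beta> S)\<^sup>2" by (simp add: power_mult_distrib L2_set_sq sum_distrib_left)
 finally have u: "(\<Sum>p\<in>near_pairs S. (\<lambda>(k, l). \<beta> l / mode_norm l) p ^ 2) \<le> (2 * L2_set \<beta> S)\<^sup>2"
  by (simp add: case_prod_unfold)
 have "(\<Sum>(k, l)\<in>near_pairs S. (\<alpha> (k - l) * \<gamma> k)\<^sup>2) =
   (\<Sum>(k, j)\<in>(\<lambda>(k, l). (k, k - l)) ` near_pairs S. (\<alpha> j * \<gamma> k)\<^sup>2)"
  by (subst sum.reindex) (auto simp: inj_on_def intro!: sum.cong)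
 also have "\<dots> = (\<Sum>(k, j)\<in>((\<lambda>(k, l). (k, k - l)) ` near_pairs S) \<inter> S \<times> S. (\<alpha> j * \<gamma> k)\<^sup>2)"
 proof (rule sum.mono_neutral_right)
  show "\<forall>p\<in>(\<lambda>(k, l). (k, k - l)) ` near_pairs S - (\<lambda>(k, l). (k, k - l)) ` near_pairs S \<inter> S \<times> S.
    (case p of (k, j) \<Rightarrow> (\<alpha> j * \<gamma> k)\<^sup>2) = 0"
  proof
   fix p assume p: "p \<in> (\<lambda>(k, l). (k, k - l)) ` near_pairs S - (\<lambda>(k, l). (k, k - l)) ` near_pairs S \<inter> S \<times> S"
   then have "p \<in> (\<lambda>(k, l). (k, k - l)) ` near_pairs S" by (rule DiffD1)
   then obtain q where q: "q \<in> near_pairs S" "p = (case q of (k, l) \<Rightarrow> (k, k - l))" by (elim imageE)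
   define k l where "k = fst q" and "l = snd q"
   have kl: "p = (k, k - l)" "(k, l) \<in> near_pairs S" using q by (simp_all add: k_def l_def case_prod_unfold)
   then have "k \<in> S" using near_pairs_subset by blast
   then have "k - l \<notin> S" using p kl(1) by simp
   then show "(case p of (k, j) \<Rightarrow> (\<alpha> j * \<gamma> k)\<^sup>2) = 0" using supp kl(1) by simp
  qed
 qed (use finP in auto)
 also have "\<dots> \<le> (L2_set \<alpha> S * L2_set \<gamma> S)\<^sup>2" by (rule sum_pairs_prod_sq_le[OF S]) auto
 finally have v: "(\<Sum>p\<in>near_pairs S. (\<lambda>(k, l). \<alpha> (k - l) * \<gamma> k) p ^ 2) \<le> (L2_set \<alpha> S * L2_set \<gamma> S)\<^sup>2"
  by (simp add: case_prod_unfold)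
 show ?thesis using sum_pairs_Cauchy_Schwarz[OF u v]
  by (simp add: case_prod_unfold L2_set_nonneg algebra_simps)
qed

lemma convolution_form_le:
 fixes S T :: "(int \<times> int) set"
 assumes S: "finite S" and supp: "\<And>j. j \<notin> T \<Longrightarrow> \<alpha> j = 0" and pos: "\<And>j. 0 \<le> \<alpha> j"
  and T: "finite T" and P: "P \<subseteq> S \<times> S" and pos': "\<And>j. 0 \<le> \<beta> j" "\<And>j. 0 \<le> \<gamma> j"
 shows "(\<Sum>(k, l)\<in>P. \<alpha> (k - l) * (\<beta> l * \<gamma> k)) \<le> sum \<alpha> T * (L2_set \<beta> S * L2_set \<gamma> S)"
proof -
 have one: "(\<Sum>k\<in>S. if k - j \<in> S then \<beta> (k - j) * \<gamma> k else 0) \<le> L2_set \<beta> S * L2_set \<gamma> S" for j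
 proof -
  let ?P = "{k\<in>S. k - j \<in> S}"
  have "(\<Sum>k\<in>S. if k - j \<in> S then \<beta> (k - j) * \<gamma> k else 0) = (\<Sum>k\<in>?P. \<beta> (k - j) * \<gamma> k)"
   using S by (simp add: sum.If_cases Int_def)
  also have "\<dots> \<le> L2_set \<beta> S * L2_set \<gamma> S"
  proof (rule sum_pairs_Cauchy_Schwarz)
   have "(\<Sum>k\<in>?P. (\<beta> (k - j))\<^sup>2) = (\<Sum>l\<in>(\<lambda>k. k - j) ` ?P. (\<beta> l)\<^sup>2)"
    by (subst sum.reindex[OF inj_on_shift(1)]) simp
   also have "\<dots> \<le> (\<Sum>l\<in>S. (\<beta> l)\<^sup>2)" by (rule sum_mono2) (use S in auto)
   finally show "(\<Sum>k\<in>?P. (\<beta> (k - j))\<^sup>2) \<le> (L2_set \<beta> S)\<^sup>2" by (simp add: L2_set_sq)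
   show "(\<Sum>k\<in>?P. (\<gamma> k)\<^sup>2) \<le> (L2_set \<gamma> S)\<^sup>2"
    unfolding L2_set_sq by (rule sum_mono2) (use S in auto)
  qed (auto simp: L2_set_nonneg)
  finally show ?thesis .
 qed
 have "(\<Sum>(k, l)\<in>P. \<alpha> (k - l) * (\<beta> l * \<gamma> k)) \<le> (\<Sum>(k, l)\<in>S \<times> S. \<alpha> (k - l) * (\<beta> l * \<gamma> k))"
  by (rule sum_mono2) (use S P pos pos' in auto)
 also have "\<dots> = (\<Sum>k\<in>S. \<Sum>l\<in>S. \<alpha> (k - l) * (\<beta> l * \<gamma> k))" by (simp add: sum.cartesian_product)
 also have "\<dots> = (\<Sum>k\<in>S. \<Sum>j\<in>T. if k - j \<in> S then \<alpha> j * (\<beta> (k - j) * \<gamma> k) else 0)"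
 proof (rule sum.cong[OF refl])
  fix k assume "k \<in> S"
  have "(\<Sum>l\<in>S. \<alpha> (k - l) * (\<beta> l * \<gamma> k)) = (\<Sum>j\<in>(\<lambda>l. k - l) ` S. \<alpha> j * (\<beta> (k - j) * \<gamma> k))"
   by (subst sum.reindex[OF inj_on_shift(2)]) simp
  also have "\<dots> = (\<Sum>j\<in>((\<lambda>l. k - l) ` S) \<inter> T. \<alpha> j * (\<beta> (k - j) * \<gamma> k))"
   by (rule sum.mono_neutral_right) (use S supp in auto)
  also have "\<dots> = (\<Sum>j\<in>T. if k - j \<in> S then \<alpha> j * (\<beta> (k - j) * \<gamma> k) else 0)"
  proof -
   have "j \<in> (\<lambda>l. k - l) ` S \<longleftrightarrow> k - j \<in> S" for j
   proof
    assume "k - j \<in> S"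
    then have "k - (k - j) \<in> (\<lambda>l. k - l) ` S" by (rule imageI)
    then show "j \<in> (\<lambda>l. k - l) ` S" by simp
   qed auto
   then have "((\<lambda>l. k - l) ` S) \<inter> T = T \<inter> {j. k - j \<in> S}"
    by auto
   then show ?thesis using T by (simp add: sum.If_cases)
  qed
  finally show "(\<Sum>l\<in>S. \<alpha> (k - l) * (\<beta> l * \<gamma> k)) = \<dots>" .
 qed
 also have "\<dots> = (\<Sum>j\<in>T. \<Sum>k\<in>S. if k - j \<in> S then \<alpha> j * (\<beta> (k - j) * \<gamma> k) else 0)" by (rule sum.swap)
 also have "\<dots> = (\<Sum>j\<in>T. \<alpha> j * (\<Sum>k\<in>S. if k - j \<in> S then \<beta> (k - j) * \<gamma> k else 0))"
  by (rule sum.cong[OF refl], subst sum_distrib_left, rule sum.cong) simp_all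
 also have "\<dots> \<le> (\<Sum>j\<in>T. \<alpha> j * (L2_set \<beta> S * L2_set \<gamma> S))"
  by (rule sum_mono) (use one pos in \<open>auto intro: mult_left_mono\<close>)
 also have "\<dots> = sum \<alpha> T * (L2_set \<beta> S * L2_set \<gamma> S)" by (simp add: sum_distrib_right)
 finally show ?thesis .
qed

section \<open>The trilinear estimate in Gevrey norms\<close>

lemma abs_exp_minus_one_le: "\<bar>exp x - 1\<bar> \<le> \<bar>x\<bar> * exp \<bar>x\<bar>" for x :: real
proof (cases "0 \<le> x")
 case True
 have "1 - x \<le> exp (- x)" using exp_ge_add_one_self[of "- x"] by simp
 then have "(1 - x) * exp x \<le> exp (- x) * exp x" by (rule mult_right_mono) simp
 then have "exp x - 1 \<le> x * exp x" by (simp add: algebra_simps flip: exp_add)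
 then show ?thesis using True by simp
next
 case False
 then have "- x * 1 \<le> - x * exp (- x)" by (intro mult_left_mono) auto
 moreover have "1 + x \<le> exp x" by (rule exp_ge_add_one_self)
 moreover have "exp x \<le> 1" using False by simp
 moreover have "\<bar>exp x - 1\<bar> = 1 - exp x" "\<bar>x\<bar> = - x" using \<open>exp x \<le> 1\<close> False by auto
 ultimately show ?thesis by (simp only: mult_1_right)
qed

text \<open>The quotient \<open>(exp x - 1 - x) / x\<close> is a power series with nonnegative coefficients, hence increasing.\<close>

lemma exp_minus_linear_ratio:
 fixes x y :: real
 assumes "0 < x" "x \<le> y"
 shows "(exp x - 1 - x) * y \<le> (exp y - 1 - y) * x"
proof -
 have "\<exists>z. 0 < z \<and> z < x \<and> exp x - exp 0 = (x - 0) * exp z"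
  by (rule MVT2) (use assms in \<open>auto intro!: derivative_eq_intros\<close>)
 then obtain z where z: "z < x" "exp x - 1 = x * exp z" by auto
 show ?thesis
 proof (cases "x = y")
  case False
  have "\<exists>w. x < w \<and> w < y \<and> exp y - exp x = (y - x) * exp w"
   by (rule MVT2) (use assms False in \<open>auto intro!: derivative_eq_intros\<close>)
  then obtain w where w: "x < w" "exp y - exp x = (y - x) * exp w" by auto
  have "exp z \<le> exp w" using z w by simp
  then have "x * (y - x) * exp z \<le> x * (y - x) * exp w" using assms by (intro mult_left_mono) auto
  moreover have "x * (y - x) * exp z = (exp x - 1) * (y - x)" unfolding z(2) by simp
  moreover have "x * (y - x) * exp w = x * (exp y - exp x)" unfolding w(2) by simp
  ultimately have "(exp x - 1) * (y - x) \<le> x * (exp y - exp x)" by simp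
  then show ?thesis by (simp add: algebra_simps)
 qed simp
qed

text \<open>For small \<open>y\<close> the second-order remainder gains a factor \<open>y\<close>; for large \<open>y\<close> the gain \<open>1 / y\<close> comes from
 convexity. \<open>bump\<close> records both.\<close>

lemma abs_exp_minus_linear_le:
 fixes x y :: real
 assumes "\<bar>x\<bar> \<le> y" "0 < y"
 shows "\<bar>exp x - 1 - x\<bar> \<le> \<bar>x\<bar> * bump y * exp y"
proof (cases "x = 0")
 case False
 define u where "u = \<bar>x\<bar>"
 have u: "0 < u" "u \<le> y" using False assms by (auto simp: u_def)
 have nn: "0 \<le> exp t - 1 - t" for t :: real using exp_ge_add_one_self[of t] by linarith
 have "exp x - 1 - x \<le> exp u - 1 - u"
 proof (cases "0 \<le> x")
  case False
  define g where "g = (\<lambda>t::real. exp t - exp (- t) - 2 * t)"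
  have "g 0 \<le> g u"
  proof (rule DERIV_nonneg_imp_nondecreasing[where f = g and a = 0 and b = u])
   show "0 \<le> u" using u by simp
   fix t :: real
   have "0 \<le> (exp (t/2) - exp (- t/2))\<^sup>2" by simp
   also have "\<dots> = exp t + exp (- t) - 2"
    by (simp add: power2_eq_square algebra_simps flip: exp_add)
   finally show "\<exists>y. (g has_real_derivative y) (at t) \<and> 0 \<le> y"
    unfolding g_def by (intro exI[of _ "exp t + exp (- t) - 2"] conjI) (auto intro!: derivative_eq_intros)
  qed
  then show ?thesis using False by (simp add: g_def u_def)
 qed (simp add: u_def)
 then have a: "\<bar>exp x - 1 - x\<bar> \<le> exp u - 1 - u" using nn[of x] by simp
 have b: "(exp u - 1 - u) * y \<le> (exp y - 1 - y) * u" by (rule exp_minus_linear_ratio[OF u])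
 have c: "exp y - 1 - y \<le> y * bump y * exp y"
 proof (cases "y \<le> 1")
  case True
  then have "bump y = y" using assms by (simp add: bump_def min_def field_simps) (smt (verit) mult_le_one)
  moreover have "exp y - 1 \<le> y * exp y" using abs_exp_minus_one_le[of y] assms by simp
  then have "exp y - 1 - y \<le> y * (exp y - 1)" by (simp add: algebra_simps)
  moreover have "y * (exp y - 1) \<le> y * (y * exp y)"
   using \<open>exp y - 1 \<le> y * exp y\<close> assms by (intro mult_left_mono) auto
  ultimately show ?thesis by (simp add: algebra_simps)
 next
  case False
  then have "1 / y \<le> y" by (simp add: field_simps) (smt (verit) mult_less_cancel_left2)
  then have "bump y = 1 / y" unfolding bump_def by (rule min_absorb2)
  then have "y * bump y = 1" using False by simp
  then show ?thesis using assms by simp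
 qed
 have "(exp u - 1 - u) * y \<le> (u * bump y * exp y) * y"
  using order_trans[OF b mult_right_mono[OF c]] u by (simp add: algebra_simps)
 then have "exp u - 1 - u \<le> u * bump y * exp y" using assms by simp
 with a show ?thesis by (simp add: u_def)
qed simp

lemma abs_powr_minus_one_le:
 fixes q p :: real
 assumes "0 < q" "0 \<le> p" "p \<le> 1"
 shows "\<bar>q powr p - 1\<bar> \<le> \<bar>q - 1\<bar>"
proof (cases "1 \<le> q")
 case True
 then have "q powr p \<le> q powr 1" "q powr 0 \<le> q powr p" using assms by (intro powr_mono; simp)+
 then show ?thesis using True by simp
next
 case False
 then have "q powr 1 \<le> q powr p" "q powr p \<le> q powr 0" using assms by (intro powr_mono'; simp)+
 then show ?thesis using False assms by simp
qed

lemma powr_symmetric_difference_Taylor: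
 fixes q p :: real
 assumes "1 / 4 \<le> q" "0 \<le> p" "p \<le> 1 / 4"
 shows "\<bar>q powr p - q powr (- p) - 2 * p * (q - 1)\<bar> \<le> 18 * (q - 1)\<^sup>2"
proof (cases "q = 1")
 case False
 define f where "f = (\<lambda>m::nat. \<lambda>t::real.
   if m = 0 then t powr p - t powr (- p) - 2 * p * (t - 1)
   else if m = 1 then p * t powr (p - 1) + p * t powr (- p - 1) - 2 * p
   else p * (p - 1) * t powr (p - 2) - p * (p + 1) * t powr (- p - 2))"
 have F: "f 0 = (\<lambda>t. t powr p - t powr (- p) - 2 * p * (t - 1))"
  "f (Suc 0) = (\<lambda>t. p * t powr (p - 1) + p * t powr (- p - 1) - 2 * p)"
  "f (Suc (Suc 0)) = (\<lambda>t. p * (p - 1) * t powr (p - 2) - p * (p + 1) * t powr (- p - 2))"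
  by (auto simp: f_def)
 have "\<exists>t. (if q < 1 then q < t \<and> t < 1 else 1 < t \<and> t < q) \<and>
   f 0 q = (\<Sum>m<2. (f m 1 / fact m) * (q - 1) ^ m) + (f 2 t / fact 2) * (q - 1) ^ 2"
 proof (rule Taylor[where a = "1/4" and b = "max 1 q"])
  show "\<forall>m t. m < 2 \<and> 1/4 \<le> t \<and> t \<le> max 1 q \<longrightarrow> (f m has_real_derivative f (Suc m) t) (at t)"
  proof (intro allI impI)
   fix m :: nat and t :: real assume "m < 2 \<and> 1/4 \<le> t \<and> t \<le> max 1 q"
   then have t: "0 < t" and m: "m = 0 \<or> m = 1" by auto
   have "((\<lambda>t. t powr p - t powr (- p) - 2 * p * (t - 1)) has_real_derivative
     p * t powr (p - 1) + p * t powr (- p - 1) - 2 * p) (at t)"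
    using t by (auto intro!: derivative_eq_intros)
   moreover have "((\<lambda>t. p * t powr (p - 1) + p * t powr (- p - 1) - 2 * p) has_real_derivative
     p * ((p - 1) * t powr (p - 1 - 1)) + p * ((- p - 1) * t powr (- p - 1 - 1))) (at t)"
    using t by (auto intro!: derivative_eq_intros)
   moreover have "p * ((p - 1) * t powr (p - 1 - 1)) + p * ((- p - 1) * t powr (- p - 1 - 1)) =
     p * (p - 1) * t powr (p - 2) - p * (p + 1) * t powr (- p - 2)"
    by (simp add: algebra_simps)
   ultimately show "(f m has_real_derivative f (Suc m) t) (at t)"
    using m F by (elim disjE) (simp_all only: One_nat_def)
  qed
 qed (use assms False in auto)
 then obtain t where t: "1/4 \<le> t" "f 0 q = (\<Sum>m<2. (f m 1 / fact m) * (q - 1) ^ m) + (f 2 t / fact 2) * (q - 1) ^ 2"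
 proof (elim exE)
  fix t assume "(if q < 1 then q < t \<and> t < 1 else 1 < t \<and> t < q) \<and>
   f 0 q = (\<Sum>m<2. (f m 1 / fact m) * (q - 1) ^ m) + (f 2 t / fact 2) * (q - 1) ^ 2"
  moreover from this have "1/4 \<le> t" using assms by (auto split: if_splits)
  ultimately show thesis using that by blast
 qed
 have "f 0 q = (f 2 t / 2) * (q - 1)\<^sup>2" using t(2) by (simp add: f_def numeral_2_eq_2)
 moreover have "\<bar>f 2 t\<bar> \<le> 36"
 proof -
  have "t powr (p - 2) \<le> (1/4) powr (p - 2)" by (rule powr_mono2') (use t assms in auto)
  also have "\<dots> \<le> (1/4) powr (- 3)" using assms by (intro powr_mono') auto
  finally have 1: "t powr (p - 2) \<le> 64" by (simp add: powr_minus powr_numeral power3_eq_cube)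
  have "t powr (- p - 2) \<le> (1/4) powr (- p - 2)" by (rule powr_mono2') (use t assms in auto)
  also have "\<dots> \<le> (1/4) powr (- 3)" using assms by (intro powr_mono') auto
  finally have 2: "t powr (- p - 2) \<le> 64" by (simp add: powr_minus powr_numeral power3_eq_cube)
  have 3: "\<bar>p * (p - 1)\<bar> * t powr (p - 2) \<le> (1/4) * 64"
  proof (rule mult_mono)
   have "p * (1 - p) \<le> 1/4 * 1" using assms by (intro mult_mono) auto
   then show "\<bar>p * (p - 1)\<bar> \<le> 1/4" using assms by (simp add: abs_mult)
  qed (use 1 in auto)
  have 4: "\<bar>p * (p + 1)\<bar> * t powr (- p - 2) \<le> (5/16) * 64"
  proof (rule mult_mono)
   have "p * (p + 1) \<le> 1/4 * (5/4)" using assms by (intro mult_mono) auto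
   then show "\<bar>p * (p + 1)\<bar> \<le> 5/16" using assms by (simp add: abs_mult)
  qed (use 2 in auto)
  have "\<bar>f 2 t\<bar> \<le> \<bar>p * (p - 1)\<bar> * t powr (p - 2) + \<bar>p * (p + 1)\<bar> * t powr (- p - 2)"
   using abs_triangle_ineq4[of "p * (p - 1) * t powr (p - 2)" "p * (p + 1) * t powr (- p - 2)"]
   by (simp add: f_def abs_mult)
  also have "\<dots> \<le> 36" using 3 4 by simp
  finally show ?thesis .
 qed
 moreover from calculation(1) have "\<bar>f 0 q\<bar> = \<bar>f 2 t\<bar> * ((q - 1)\<^sup>2 / 2)"
  by (simp only: abs_mult) simp
 ultimately have "\<bar>f 0 q\<bar> \<le> 36 * ((q - 1)\<^sup>2 / 2)"
  using mult_right_mono[of "\<bar>f 2 t\<bar>" 36 "(q - 1)\<^sup>2 / 2"] by simp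
 then show ?thesis by (simp add: f_def)
qed simp

lemma powr_subadditive:
 fixes a b p :: real
 assumes "0 \<le> a" "0 \<le> b" "0 < p" "p \<le> 1"
 shows "(a + b) powr p \<le> a powr p + b powr p"
proof (cases "a + b = 0")
 case False
 then have c: "0 < a + b" using assms by simp
 have ge: "t \<le> t powr p" if "0 \<le> t" "t \<le> 1" for t :: real
  using powr_mono'[of p 1 t] that assms by simp
 have "1 = a / (a + b) + b / (a + b)" using c by (simp add: add_divide_distrib[symmetric])
 also have "\<dots> \<le> (a / (a + b)) powr p + (b / (a + b)) powr p"
  using assms c by (intro add_mono ge) auto
 also have "\<dots> = (a powr p + b powr p) / (a + b) powr p"
  using assms c by (simp add: powr_divide add_divide_distrib)
 finally show ?thesis using c by (simp add: field_simps)
qed (use assms in simp)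

lemma abs_mode_norm_powr_diff_le:
 assumes "0 < \<sigma>" "\<sigma> \<le> 1"
 shows "\<bar>mode_norm k powr \<sigma> - mode_norm l powr \<sigma>\<bar> \<le> mode_norm (k - l) powr \<sigma>"
proof -
 have one: "mode_norm k powr \<sigma> \<le> mode_norm (k - l) powr \<sigma> + mode_norm l powr \<sigma>" for k l
  using powr_mono2[OF _ _ mode_norm_triangle_sub[of k l], of \<sigma>]
   powr_subadditive[of "mode_norm (k - l)" "mode_norm l" \<sigma>] assms by simp
 show ?thesis using one[of k l] one[of l k] mode_norm_minus_commute[of k l] by simp
qed

definition component :: "bool \<Rightarrow> int \<times> int \<Rightarrow> real" where
 "component i k = (if i then of_int (fst k) else of_int (snd k))"

definition ipmb_symbol :: "real \<Rightarrow> bool \<Rightarrow> int \<times> int \<Rightarrow> real" where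
 "ipmb_symbol \<nu> i k = (if i then ipmb_symbol1 \<nu> k else ipmb_symbol2 \<nu> k)"

definition mode_dot :: "int \<times> int \<Rightarrow> int \<times> int \<Rightarrow> real" where
 "mode_dot k l = (\<Sum>i\<in>UNIV. component i k * component i l)"

lemma drift_eq_sum: "drift \<nu> j l = (\<Sum>i\<in>UNIV. ipmb_symbol \<nu> i j * component i l)"
 by (simp add: drift_def UNIV_bool ipmb_symbol_def component_def)

lemma abs_mode_dot_le: "\<bar>mode_dot k l\<bar> \<le> mode_norm k * mode_norm l"
 unfolding mode_dot_def mode_norm_def
 using abs_pair_dot_le[of "of_int (fst k)" "of_int (fst l)" "of_int (snd k)" "of_int (snd l)"]
 by (simp add: UNIV_bool component_def add.commute)

lemma mode_norm_add_sq: "(mode_norm (l + j))\<^sup>2 = (mode_norm l)\<^sup>2 + 2 * mode_dot l j + (mode_norm j)\<^sup>2"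
 unfolding mode_norm_sq by (simp add: mode_dot_def UNIV_bool component_def power2_eq_square algebra_simps)

lemma abs_component_le: "\<bar>component i k\<bar> \<le> mode_norm k"
 by (simp add: component_def abs_fst_le abs_snd_le)

lemma abs_ipmb_symbol_le: "0 \<le> \<nu> \<Longrightarrow> \<bar>ipmb_symbol \<nu> i j\<bar> \<le> 1 / (1 + \<nu> * (mode_norm j)\<^sup>2)"
 by (simp add: ipmb_symbol_def abs_symbol_le)

text \<open>The difference of the weights' exponents is expanded to first order in \<open>k - l\<close>. The prefactor \<open>P\<close> is
 symmetric in \<open>k\<close> and \<open>l\<close>, so that half a power of the gained derivative goes to each factor.\<close>

lemma near_symbol_expansion:
 fixes \<sigma> :: real
 assumes l: "l \<noteq> 0" and near: "2 * mode_norm (k - l) \<le> mode_norm l" and \<sigma>: "0 < \<sigma>" "\<sigma> \<le> 1"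
 defines "P \<equiv> mode_norm l powr (\<sigma> / 2) * mode_norm k powr (\<sigma> / 2)"
 shows "\<bar>mode_norm k powr \<sigma> - mode_norm l powr \<sigma>\<bar> \<le> 5 / 2 * (mode_norm (k - l) / mode_norm l) * mode_norm l powr \<sigma>"
  and "mode_norm l powr \<sigma> \<le> 2 * P"
  and "\<bar>mode_norm k powr \<sigma> - mode_norm l powr \<sigma> - \<sigma> * (mode_dot l (k - l) / (mode_norm l)\<^sup>2) * P\<bar>
   \<le> 120 * (mode_norm (k - l) / mode_norm l)\<^sup>2 * P"
proof -
 define L J K where "L = mode_norm l" and "J = mode_norm (k - l)" and "K = mode_norm k"
 define q where "q = K\<^sup>2 / L\<^sup>2"
 define d where "d = mode_dot l (k - l)"
 have L: "1 \<le> L" "0 < L" using mode_norm_ge_1[OF l] by (auto simp: L_def)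
 have J: "0 \<le> J" "2 * J \<le> L" using near by (auto simp: J_def L_def)
 have "L \<le> J + K" using mode_norm_triangle_sub[of l k] mode_norm_minus_commute[of k l]
  by (simp add: L_def J_def K_def)
 then have KL: "L / 2 \<le> K" using J by simp
 then have K: "0 < K" using L by linarith
 have q0: "0 < q" using K L by (simp add: q_def)
 have "1/4 * L\<^sup>2 \<le> K\<^sup>2" using power_mono[OF KL, of 2] L by (simp add: power_divide)
 then have q4: "1/4 \<le> q" using L by (simp add: q_def field_simps)
 have K2: "K\<^sup>2 = L\<^sup>2 + 2 * d + J\<^sup>2"
  using mode_norm_add_sq[of l "k - l"] by (simp add: K_def L_def J_def d_def)
 have q1: "q - 1 = (2 * d + J\<^sup>2) / L\<^sup>2" using L by (simp add: q_def K2 field_simps)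
 have d: "\<bar>d\<bar> \<le> L * J" unfolding d_def L_def J_def by (rule abs_mode_dot_le)
 have "\<bar>2 * d + J\<^sup>2\<bar> \<le> 2 * (L * J) + J * J"
  using abs_triangle_ineq[of "2 * d" "J\<^sup>2"] d by (simp add: power2_eq_square)
 also have "\<dots> \<le> 2 * (L * J) + (L / 2) * J" using J by (intro add_mono mult_right_mono) auto
 finally have "\<bar>2 * d + J\<^sup>2\<bar> / L\<^sup>2 \<le> (5 / 2 * (L * J)) / L\<^sup>2" by (intro divide_right_mono) (simp_all add: mult.commute)
 then have q1b: "\<bar>q - 1\<bar> \<le> 5 / 2 * (J / L)" using L by (simp add: q1 power2_eq_square)
 have Kq: "K powr p = L powr p * q powr (p / 2)" for p
 proof -
  have sq: "(x\<^sup>2) powr (p / 2) = x powr p" if "0 < x" for x :: real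
  proof -
   have "x\<^sup>2 = x powr 2" using that by (simp add: powr_numeral)
   then show ?thesis by (simp add: powr_powr)
  qed
  have "q powr (p / 2) = K powr p / L powr p"
   using K L by (simp add: q_def powr_divide sq)
  then show ?thesis using L by simp
 qed
 show "\<bar>mode_norm k powr \<sigma> - mode_norm l powr \<sigma>\<bar> \<le> 5 / 2 * (mode_norm (k - l) / mode_norm l) * mode_norm l powr \<sigma>"
 proof -
  have "K powr \<sigma> - L powr \<sigma> = (q powr (\<sigma> / 2) - 1) * L powr \<sigma>"
   unfolding Kq[of \<sigma>] by (simp add: algebra_simps)
  then have "\<bar>K powr \<sigma> - L powr \<sigma>\<bar> = \<bar>q powr (\<sigma> / 2) - 1\<bar> * L powr \<sigma>" by (simp add: abs_mult)
  also have "\<dots> \<le> 5 / 2 * (J / L) * L powr \<sigma>"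
   using abs_powr_minus_one_le[OF q0, of "\<sigma> / 2"] q1b \<sigma> by (intro mult_right_mono) auto
  finally show ?thesis by (simp add: K_def L_def J_def)
 qed
 have P: "P = L powr \<sigma> * q powr (\<sigma> / 4)"
  unfolding P_def L_def[symmetric] K_def[symmetric] Kq[of "\<sigma> / 2"]
  by (simp add: powr_add[symmetric] mult.assoc[symmetric])
 have P0: "0 \<le> P" by (simp add: P_def)
 show "mode_norm l powr \<sigma> \<le> 2 * P"
 proof -
  have "(1/4) powr (1/4) \<le> (1/4) powr (\<sigma> / 4)" using \<sigma> by (intro powr_mono') auto
  also have "\<dots> \<le> q powr (\<sigma> / 4)" using q4 \<sigma> by (intro powr_mono2) auto
  finally have "(1/4) powr (1/4) \<le> q powr (\<sigma> / 4)" .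
  moreover have "(1/4) powr 1 \<le> (1/4 :: real) powr (1/2)" by (rule powr_mono') auto
  moreover have "(1/4 :: real) powr (1/2) \<le> (1/4) powr (1/4)" by (rule powr_mono') auto
  moreover have "(1/4 :: real) powr (1/2) = 1/2" by (simp add: powr_half_sqrt real_sqrt_divide)
  ultimately have "1/2 \<le> q powr (\<sigma> / 4)" by linarith
  then have "L powr \<sigma> * (1/2) \<le> P" unfolding P by (intro mult_left_mono) auto
  then show ?thesis by (simp add: L_def)
 qed
 show "\<bar>mode_norm k powr \<sigma> - mode_norm l powr \<sigma> - \<sigma> * (mode_dot l (k - l) / (mode_norm l)\<^sup>2) * P\<bar>
   \<le> 120 * (mode_norm (k - l) / mode_norm l)\<^sup>2 * P"
 proof -
  define T where "T = q powr (\<sigma> / 4) - q powr (- (\<sigma> / 4))"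
  have "P * T = L powr \<sigma> * (q powr (\<sigma> / 4) * q powr (\<sigma> / 4)) - L powr \<sigma> * (q powr (\<sigma> / 4) * q powr (- (\<sigma> / 4)))"
   by (simp add: P T_def algebra_simps)
  also have "\<dots> = K powr \<sigma> - L powr \<sigma>"
   using q0 unfolding Kq[of \<sigma>] by (simp add: powr_add[symmetric])
  finally have KL': "K powr \<sigma> - L powr \<sigma> = P * T" by simp
  have "\<bar>T - 2 * (\<sigma> / 4) * (q - 1)\<bar> \<le> 18 * (q - 1)\<^sup>2"
   unfolding T_def by (rule powr_symmetric_difference_Taylor) (use q4 \<sigma> in auto)
  also have "(q - 1)\<^sup>2 \<le> (5 / 2 * (J / L))\<^sup>2"
   using q1b by (metis abs_ge_zero power2_abs power_mono)
  finally have "\<bar>T - \<sigma> / 2 * (q - 1)\<bar> \<le> 18 * (25 / 4) * (J / L)\<^sup>2"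
   by (simp add: power_mult_distrib power_divide)
  moreover have "\<sigma> / 2 * (q - 1) - \<sigma> * (d / L\<^sup>2) = \<sigma> / 2 * (J / L)\<^sup>2"
   using L by (simp add: q1 power_divide field_simps)
  moreover have "\<sigma> / 2 * (J / L)\<^sup>2 \<le> 1 / 2 * (J / L)\<^sup>2" using \<sigma> by (intro mult_right_mono) auto
  moreover have "0 \<le> \<sigma> / 2 * (J / L)\<^sup>2" using \<sigma> by simp
  ultimately have "\<bar>T - \<sigma> * (d / L\<^sup>2)\<bar> \<le> 120 * (J / L)\<^sup>2"
   using zero_le_power2[of "J / L"] by linarith
  then have "P * \<bar>T - \<sigma> * (d / L\<^sup>2)\<bar> \<le> P * (120 * (J / L)\<^sup>2)" using P0 by (rule mult_left_mono)
  moreover have "P * \<bar>T - \<sigma> * (d / L\<^sup>2)\<bar> = \<bar>P * T - \<sigma> * (d / L\<^sup>2) * P\<bar>"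
  proof -
   have "P * T - \<sigma> * (d / L\<^sup>2) * P = P * (T - \<sigma> * (d / L\<^sup>2))" by (simp add: algebra_simps)
   then show ?thesis using P0 by (simp add: abs_mult)
  qed
  ultimately show ?thesis
   unfolding L_def[symmetric] K_def[symmetric] J_def[symmetric] d_def[symmetric] KL'
   by (simp add: mult.commute mult.left_commute)
 qed
qed

text \<open>A bound for convolution by \<open>c\<close>, compressed to \<open>S\<close>, as an operator on square summable families. Both a
 supremum bound in physical space and a summability bound on coefficients imply one, so the two can
 be used interchangeably.\<close>

definition form_bound :: "(int \<times> int) set \<Rightarrow> (int \<times> int \<Rightarrow> complex) \<Rightarrow> real \<Rightarrow> bool" where
 "form_bound S c B \<longleftrightarrow> 0 \<le> B \<and> (\<forall>F G. cmod (\<Sum>k\<in>S. \<Sum>l\<in>S. c (k - l) * F l * cnj (G k)) \<le>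
   B * L2_set (\<lambda>k. cmod (F k)) S * L2_set (\<lambda>k. cmod (G k)) S)"

text \<open>Up to the factor \<open>\<i>\<close>, the coefficients of the derivative in direction \<open>m\<close> of the velocity component \<open>i\<close>.\<close>

definition strain :: "real \<Rightarrow> bool \<Rightarrow> bool \<Rightarrow> (int \<times> int \<Rightarrow> complex) \<Rightarrow> int \<times> int \<Rightarrow> complex" where
 "strain \<nu> i m a j = of_real (ipmb_symbol \<nu> i j * component m j) * a j"

definition trilinear_const :: "real \<Rightarrow> real" where
 "trilinear_const \<sigma> = 260 + 5 * sqrt (96 / min (2 * \<sigma>) 1)"

text \<open>The kernel is a sum of four entries of the strain, each multiplied by two components of the unit
 vector in direction \<open>l\<close>; these are harmless because they act on \<open>f\<close> alone.\<close>

lemma main_form_le: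
 assumes S: "finite S" and B: "\<And>i m. form_bound S (strain \<nu> i m a) B"
 shows "cmod (\<Sum>k\<in>S. \<Sum>l\<in>S. of_real (drift \<nu> (k - l) l * (mode_dot l (k - l) / (mode_norm l)\<^sup>2))
   * a (k - l) * f l * cnj (f k)) \<le> 4 * B * (L2_set (\<lambda>k. cmod (f k)) S)\<^sup>2"
proof -
 have B0: "0 \<le> B" using B by (simp add: form_bound_def)
 let ?c = "\<lambda>i m l. component i l * component m l / (mode_norm l)\<^sup>2"
 let ?F = "\<lambda>i m l. of_real (?c i m l) * f l"
 have c: "\<bar>?c i m l\<bar> \<le> 1" for i m l
 proof (cases "l = 0")
  case False
  have "\<bar>component i l * component m l\<bar> \<le> mode_norm l * mode_norm l"
   unfolding abs_mult by (intro mult_mono abs_component_le) auto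
  then show ?thesis using mode_norm_pos[OF False] by (simp add: power2_eq_square field_simps)
 qed simp
 have "(\<Sum>k\<in>S. \<Sum>l\<in>S. of_real (drift \<nu> (k - l) l * (mode_dot l (k - l) / (mode_norm l)\<^sup>2)) * a (k - l) * f l * cnj (f k)) =
  (\<Sum>k\<in>S. \<Sum>l\<in>S. \<Sum>i\<in>UNIV. \<Sum>m\<in>UNIV. strain \<nu> i m a (k - l) * ?F i m l * cnj (f k))"
  by (intro sum.cong refl)
   (simp add: drift_eq_sum mode_dot_def UNIV_bool strain_def algebra_simps add_divide_distrib)
 also have "\<dots> = (\<Sum>i\<in>UNIV. \<Sum>m\<in>UNIV. \<Sum>k\<in>S. \<Sum>l\<in>S. strain \<nu> i m a (k - l) * ?F i m l * cnj (f k))"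
  by (simp add: UNIV_bool sum.distrib)
 also have "cmod \<dots> \<le> (\<Sum>i\<in>(UNIV :: bool set). \<Sum>m\<in>(UNIV :: bool set). B * (L2_set (\<lambda>k. cmod (f k)) S)\<^sup>2)"
 proof (intro sum_norm_le)
  fix i m
  have "cmod (\<Sum>k\<in>S. \<Sum>l\<in>S. strain \<nu> i m a (k - l) * ?F i m l * cnj (f k)) \<le>
   B * L2_set (\<lambda>k. cmod (?F i m k)) S * L2_set (\<lambda>k. cmod (f k)) S"
   by (rule B[of i m, unfolded form_bound_def, THEN conjunct2, rule_format])
  also have "\<dots> \<le> B * L2_set (\<lambda>k. cmod (f k)) S * L2_set (\<lambda>k. cmod (f k)) S"
  proof (intro mult_right_mono mult_left_mono L2_set_mono)
   fix k show "cmod (?F i m k) \<le> cmod (f k)"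
    unfolding norm_mult norm_of_real using c[where i = i and m = m and l = k] by (intro mult_left_le_one_le) auto
  qed (auto simp: B0 L2_set_nonneg)
  finally show "cmod (\<Sum>k\<in>S. \<Sum>l\<in>S. strain \<nu> i m a (k - l) * ?F i m l * cnj (f k)) \<le> B * (L2_set (\<lambda>k. cmod (f k)) S)\<^sup>2"
   by (simp add: power2_eq_square)
 qed
 finally show ?thesis by (simp add: UNIV_bool)
qed

lemma far_product_le:
 fixes L J :: real
 assumes "0 \<le> L" "L < 2 * J" "0 < \<sigma>" "\<sigma> \<le> 1"
 shows "L * J powr \<sigma> \<le> 2 * J * (J powr (\<sigma> / 2) * L powr (\<sigma> / 2))"
  and "L powr (\<sigma> / 2) \<le> 2 * J powr (\<sigma> / 2)"
proof -
 have J: "0 < J" using assms by linarith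
 have two: "2 powr p \<le> (2 :: real)" if "p \<le> 1" for p using powr_mono[OF that, of 2] by simp
 have up: "L powr p \<le> 2 * J powr p" if "0 \<le> p" "p \<le> 1" for p
 proof -
  have "L powr p \<le> (2 * J) powr p" using assms that by (intro powr_mono2) auto
  also have "\<dots> = 2 powr p * J powr p" using J by (simp add: powr_mult)
  also have "\<dots> \<le> 2 * J powr p" by (intro mult_right_mono two that) auto
  finally show ?thesis .
 qed
 show "L powr (\<sigma> / 2) \<le> 2 * J powr (\<sigma> / 2)" using up[of "\<sigma> / 2"] assms by simp
 have "L = L powr (\<sigma> / 2) * L powr (1 - \<sigma> / 2)" using assms by (simp add: powr_add[symmetric])
 then have "L * J powr \<sigma> = L powr (\<sigma> / 2) * L powr (1 - \<sigma> / 2) * J powr \<sigma>" by simp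
 also have "\<dots> \<le> L powr (\<sigma> / 2) * (2 * J powr (1 - \<sigma> / 2)) * J powr \<sigma>"
  using up[of "1 - \<sigma> / 2"] assms by (intro mult_right_mono mult_left_mono) auto
 also have "\<dots> = 2 * (J powr (1 - \<sigma> / 2) * J powr \<sigma>) * L powr (\<sigma> / 2)" by simp
 also have "J powr (1 - \<sigma> / 2) * J powr \<sigma> = J * J powr (\<sigma> / 2)"
  using J powr_mult_base[of J "\<sigma> / 2"] by (simp add: powr_add[symmetric] add.commute)
 finally show "L * J powr \<sigma> \<le> 2 * J * (J powr (\<sigma> / 2) * L powr (\<sigma> / 2))" by (simp add: mult_ac)
qed

lemma far_term_le:
 fixes A \<beta>k \<beta>l \<beta>j L J K :: real
 assumes "0 < \<nu>" "0 < \<tau>" "0 < \<sigma>" "\<sigma> \<le> 1"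
  and L: "0 < L" "L < 2 * J" and K: "0 \<le> K"
  and D: "\<bar>D\<bar> \<le> L / (\<nu> * J\<^sup>2)" and d: "\<bar>d\<bar> \<le> L * J"
  and x: "\<bar>x\<bar> \<le> \<tau> * J powr \<sigma>" and A: "0 \<le> A" "A * exp (\<tau> * J powr \<sigma>) = \<beta>j"
  and nn: "0 \<le> \<beta>k" "0 \<le> \<beta>l"
 shows "\<beta>k * (\<bar>D\<bar> * A) * \<beta>l * \<bar>exp x - 1\<bar> \<le> 2 * \<tau> / \<nu> * (J powr (\<sigma> / 2) * \<beta>j / J * (L powr (\<sigma> / 2) * \<beta>l * \<beta>k))"
  and "\<tau> * \<sigma> * A * (\<bar>D\<bar> * \<bar>d / L\<^sup>2\<bar>) * (L powr (\<sigma> / 2) * \<beta>l) * (K powr (\<sigma> / 2) * \<beta>k) \<le>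
   2 * \<tau> / \<nu> * (J powr (\<sigma> / 2) * \<beta>j / J * (\<beta>l * (K powr (\<sigma> / 2) * \<beta>k)))"
proof -
 have J: "0 < J" using L by linarith
 have y: "0 < \<tau> * J powr \<sigma>" using J assms by simp
 have j: "0 \<le> \<beta>j" using A by (metis exp_ge_zero mult_nonneg_nonneg)
 have Aj: "A \<le> \<beta>j" using A y mult_left_mono[of 1 "exp (\<tau> * J powr \<sigma>)" A] by simp
 have "\<bar>exp x - 1\<bar> \<le> \<bar>x\<bar> * exp \<bar>x\<bar>" by (rule abs_exp_minus_one_le)
 also have "\<dots> \<le> (\<tau> * J powr \<sigma>) * exp (\<tau> * J powr \<sigma>)" using x y by (intro mult_mono) auto
 finally have "A * \<bar>exp x - 1\<bar> \<le> A * (\<tau> * J powr \<sigma> * exp (\<tau> * J powr \<sigma>))" using A by (intro mult_left_mono)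
 also have "\<dots> = \<tau> * J powr \<sigma> * \<beta>j" by (simp add: A(2)[symmetric])
 finally have 1: "A * \<bar>exp x - 1\<bar> \<le> \<tau> * J powr \<sigma> * \<beta>j" .
 have "\<bar>D\<bar> * (A * \<bar>exp x - 1\<bar>) \<le> L / (\<nu> * J\<^sup>2) * (\<tau> * J powr \<sigma> * \<beta>j)"
  by (rule mult_mono[OF D 1]) (use A(1) L J assms(1) in auto)
 also have "\<dots> = \<tau> / \<nu> * \<beta>j * (L * J powr \<sigma>) / J\<^sup>2" by simp
 also have "\<dots> \<le> \<tau> / \<nu> * \<beta>j * (2 * J * (J powr (\<sigma> / 2) * L powr (\<sigma> / 2))) / J\<^sup>2"
  using far_product_le(1)[of L J \<sigma>] assms j by (intro divide_right_mono mult_left_mono) auto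
 also have "\<dots> = 2 * \<tau> / \<nu> * (J powr (\<sigma> / 2) * \<beta>j / J * L powr (\<sigma> / 2))"
  using J by (simp add: power2_eq_square)
 finally have "(\<bar>D\<bar> * (A * \<bar>exp x - 1\<bar>)) * (\<beta>l * \<beta>k) \<le> 2 * \<tau> / \<nu> * (J powr (\<sigma> / 2) * \<beta>j / J * L powr (\<sigma> / 2)) * (\<beta>l * \<beta>k)"
  using nn by (intro mult_right_mono) auto
 then show "\<beta>k * (\<bar>D\<bar> * A) * \<beta>l * \<bar>exp x - 1\<bar> \<le> 2 * \<tau> / \<nu> * (J powr (\<sigma> / 2) * \<beta>j / J * (L powr (\<sigma> / 2) * \<beta>l * \<beta>k))"
  by (simp add: mult_ac)
 have "\<bar>D\<bar> * \<bar>d / L\<^sup>2\<bar> \<le> L / (\<nu> * J\<^sup>2) * (L * J / L\<^sup>2)"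
 proof (rule mult_mono[OF D])
  show "\<bar>d / L\<^sup>2\<bar> \<le> L * J / L\<^sup>2" using d by (simp add: divide_right_mono)
 qed (use L J assms(1) in auto)
 also have "\<dots> = 1 / (\<nu> * J)" using L J by (simp add: power2_eq_square)
 finally have 2: "\<bar>D\<bar> * \<bar>d / L\<^sup>2\<bar> \<le> 1 / (\<nu> * J)" .
 have "(\<sigma> * A) * (\<bar>D\<bar> * \<bar>d / L\<^sup>2\<bar>) \<le> (1 * \<beta>j) * (1 / (\<nu> * J))"
 proof (rule mult_mono[OF _ 2])
  show "\<sigma> * A \<le> 1 * \<beta>j" using Aj A(1) assms(3,4) by (intro mult_mono) auto
 qed (use j in auto)
 then have "(\<sigma> * A) * (\<bar>D\<bar> * \<bar>d / L\<^sup>2\<bar>) * L powr (\<sigma> / 2) \<le> (1 * \<beta>j) * (1 / (\<nu> * J)) * (2 * J powr (\<sigma> / 2))"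
  by (rule mult_mono[OF _ far_product_le(2)]) (use L J j assms(1,3,4) in auto)
 then have "((\<sigma> * A) * (\<bar>D\<bar> * \<bar>d / L\<^sup>2\<bar>) * L powr (\<sigma> / 2)) * (\<tau> * (\<beta>l * (K powr (\<sigma> / 2) * \<beta>k))) \<le>
  ((1 * \<beta>j) * (1 / (\<nu> * J)) * (2 * J powr (\<sigma> / 2))) * (\<tau> * (\<beta>l * (K powr (\<sigma> / 2) * \<beta>k)))"
  by (rule mult_right_mono) (use nn assms(2) in auto)
 then show "\<tau> * \<sigma> * A * (\<bar>D\<bar> * \<bar>d / L\<^sup>2\<bar>) * (L powr (\<sigma> / 2) * \<beta>l) * (K powr (\<sigma> / 2) * \<beta>k) \<le>
   2 * \<tau> / \<nu> * (J powr (\<sigma> / 2) * \<beta>j / J * (\<beta>l * (K powr (\<sigma> / 2) * \<beta>k)))"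
  by (simp add: mult_ac)
qed

lemma near_term_le:
 fixes A \<beta>k \<beta>l \<beta>j L J K :: real
 assumes "0 < \<nu>" "0 < \<tau>" "0 < \<sigma>" "\<sigma> \<le> 1"
  and L: "0 < L" and J: "0 < J" and K: "0 < K"
  and D: "\<bar>D\<bar> \<le> L / (\<nu> * J\<^sup>2)"
  and x: "x = \<tau> * (K powr \<sigma> - L powr \<sigma>)" "\<bar>x\<bar> \<le> \<tau> * J powr \<sigma>"
  and A: "0 \<le> A" "A * exp (\<tau> * J powr \<sigma>) = \<beta>j"
  and nn: "0 \<le> \<beta>k" "0 \<le> \<beta>l"
  and P: "P = L powr (\<sigma> / 2) * K powr (\<sigma> / 2)"
  and n1: "\<bar>K powr \<sigma> - L powr \<sigma>\<bar> \<le> 5 / 2 * (J / L) * L powr \<sigma>" and n2: "L powr \<sigma> \<le> 2 * P"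
  and n3: "\<bar>K powr \<sigma> - L powr \<sigma> - \<sigma> * d * P\<bar> \<le> 120 * (J / L)\<^sup>2 * P"
 shows "A * \<bar>D\<bar> * \<beta>l * \<beta>k * \<bar>exp x - 1 - \<tau> * \<sigma> * d * P\<bar> \<le>
  \<tau> / \<nu> * (120 * (\<beta>j * (L powr (\<sigma> / 2) * \<beta>l * (K powr (\<sigma> / 2) * \<beta>k)) / L)
   + 5 * (bump (\<tau> * J powr \<sigma>) * \<beta>j / J * (L powr (\<sigma> / 2) * \<beta>l * (K powr (\<sigma> / 2) * \<beta>k))))"
proof -
 let ?y = "\<tau> * J powr \<sigma>"
 have y: "0 < ?y" using J assms by simp
 have b: "0 \<le> bump ?y" using y by (simp add: bump_def)
 have j: "0 \<le> \<beta>j" using A by (metis exp_ge_zero mult_nonneg_nonneg)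
 have Aj: "A \<le> \<beta>j" using A y mult_left_mono[of 1 "exp ?y" A] by simp
 have P0: "0 \<le> P" by (simp add: P)
 have "\<bar>K powr \<sigma> - L powr \<sigma>\<bar> \<le> 5 / 2 * (J / L) * (2 * P)"
  by (rule order_trans[OF n1 mult_left_mono[OF n2]]) (use L J in auto)
 then have "\<tau> * \<bar>K powr \<sigma> - L powr \<sigma>\<bar> \<le> \<tau> * (5 * (J / L) * P)"
  using assms(2) by (intro mult_left_mono) auto
 then have xb: "\<bar>x\<bar> \<le> \<tau> * (5 * (J / L) * P)" using assms(2) by (simp add: abs_mult x(1))
 have "\<bar>exp x - 1 - x\<bar> \<le> \<bar>x\<bar> * bump ?y * exp ?y" by (rule abs_exp_minus_linear_le[OF x(2) y])
 also have "\<dots> \<le> \<tau> * (5 * (J / L) * P) * bump ?y * exp ?y" using xb b by (intro mult_right_mono) auto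
 finally have r: "A * \<bar>exp x - 1 - x\<bar> \<le> A * (\<tau> * (5 * (J / L) * P) * bump ?y * exp ?y)"
  using A by (intro mult_left_mono)
 have r: "A * \<bar>exp x - 1 - x\<bar> \<le> \<tau> * (5 * (J / L) * P) * bump ?y * \<beta>j"
  using r by (simp add: A(2)[symmetric] mult_ac)
 have "\<bar>x - \<tau> * \<sigma> * d * P\<bar> = \<tau> * \<bar>K powr \<sigma> - L powr \<sigma> - \<sigma> * d * P\<bar>"
 proof -
  have "x - \<tau> * \<sigma> * d * P = \<tau> * (K powr \<sigma> - L powr \<sigma> - \<sigma> * d * P)" by (simp add: x algebra_simps)
  then show ?thesis using assms(2) by (simp add: abs_mult)
 qed
 also have "\<dots> \<le> \<tau> * (120 * (J / L)\<^sup>2 * P)" using n3 assms(2) by (intro mult_left_mono) auto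
 finally have "A * \<bar>x - \<tau> * \<sigma> * d * P\<bar> \<le> \<beta>j * (\<tau> * (120 * (J / L)\<^sup>2 * P))"
  by (rule mult_mono[OF Aj]) (use j in auto)
 moreover have "\<bar>exp x - 1 - \<tau> * \<sigma> * d * P\<bar> \<le> \<bar>exp x - 1 - x\<bar> + \<bar>x - \<tau> * \<sigma> * d * P\<bar>"
  using abs_triangle_ineq[of "exp x - 1 - x" "x - \<tau> * \<sigma> * d * P"] by simp
 from mult_left_mono[OF this A(1)]
 have "A * \<bar>exp x - 1 - \<tau> * \<sigma> * d * P\<bar> \<le> A * \<bar>exp x - 1 - x\<bar> + A * \<bar>x - \<tau> * \<sigma> * d * P\<bar>"
  by (simp only: distrib_left)
 ultimately have s: "A * \<bar>exp x - 1 - \<tau> * \<sigma> * d * P\<bar> \<le>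
   \<tau> * (5 * (J / L) * P) * bump ?y * \<beta>j + \<beta>j * (\<tau> * (120 * (J / L)\<^sup>2 * P))"
  using r by linarith
 have nn2: "0 \<le> \<tau> * (5 * (J / L) * P) * bump ?y * \<beta>j + \<beta>j * (\<tau> * (120 * (J / L)\<^sup>2 * P))"
  using j b P0 J L assms by (intro add_nonneg_nonneg mult_nonneg_nonneg) auto
 have "\<bar>D\<bar> * (A * \<bar>exp x - 1 - \<tau> * \<sigma> * d * P\<bar>) \<le>
   L / (\<nu> * J\<^sup>2) * (\<tau> * (5 * (J / L) * P) * bump ?y * \<beta>j + \<beta>j * (\<tau> * (120 * (J / L)\<^sup>2 * P)))"
  by (rule mult_mono[OF D s]) (use A(1) L J assms(1) in simp_all)
 also have "\<dots> = \<tau> / \<nu> * (5 * (bump ?y * \<beta>j / J * P) + 120 * (\<beta>j * P / L))"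
  using L J assms by (simp add: field_simps power2_eq_square)
 finally have "\<bar>D\<bar> * (A * \<bar>exp x - 1 - \<tau> * \<sigma> * d * P\<bar>) * (\<beta>l * \<beta>k) \<le>
   \<tau> / \<nu> * (5 * (bump ?y * \<beta>j / J * P) + 120 * (\<beta>j * P / L)) * (\<beta>l * \<beta>k)"
  by (rule mult_right_mono) (use nn in simp)
 then show ?thesis by (simp add: P algebra_simps)
qed

text \<open>By neutrality of transport only the difference of the weights at \<open>k\<close> and \<open>l\<close> matters, that is
 \<open>exp x - 1\<close> with \<open>x = \<tau> * (mode_norm k powr \<sigma> - mode_norm l powr \<sigma>)\<close>. Its linear part sees the velocity
 only through its gradient and costs \<open>B\<close>; the remainder is of second order and is paid for by the
 Gevrey norm itself. Both come with the half-derivatives that a shrinking radius controls.\<close>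

theorem gevrey_trilinear_le:
 fixes \<nu> \<sigma> \<tau> B :: real
 assumes \<nu>: "0 < \<nu>" and \<sigma>: "0 < \<sigma>" "\<sigma> \<le> 1" and \<tau>: "0 < \<tau>"
  and S: "finite S" "0 \<notin> S" and supp: "\<And>k. k \<notin> S \<Longrightarrow> a k = 0" and herm: "hermitian a"
  and B: "\<And>i m. form_bound S (strain \<nu> i m a) B"
 defines "w \<equiv> \<lambda>k. exp (\<tau> * mode_norm k powr \<sigma>)"
 defines "Y \<equiv> L2_set (\<lambda>k. w k * cmod (a k)) S"
 defines "Z \<equiv> L2_set (\<lambda>k. mode_norm k powr (\<sigma> / 2) * (w k * cmod (a k))) S"
 shows "\<bar>Re (\<Sum>k\<in>S. of_real ((w k)\<^sup>2) * cnj (a k) * advection \<nu> S a a k)\<bar> \<le>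
   \<tau> * (4 * B + trilinear_const \<sigma> / \<nu> * Y) * Z\<^sup>2"
proof -
 define b where "b = (\<lambda>k. of_real (w k) * a k)"
 define \<beta> where "\<beta> = (\<lambda>k. cmod (b k))"
 define f where "f = (\<lambda>k. of_real (mode_norm k powr (\<sigma> / 2)) * b k)"
 define F where "F = (\<lambda>k. cmod (f k))"
 have \<beta>: "\<beta> k = w k * cmod (a k)" for k by (simp add: \<beta>_def b_def norm_mult w_def)
 have F: "F k = mode_norm k powr (\<sigma> / 2) * \<beta> k" for k by (simp add: F_def f_def \<beta>_def norm_mult)
 have \<beta>0: "0 \<le> \<beta> k" and F0: "0 \<le> F k" for k by (simp_all add: \<beta>_def F_def)
 have \<beta>supp: "\<beta> k = 0" and Fsupp: "F k = 0" if "k \<notin> S" for k using that supp by (simp_all add: \<beta> F)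
 have Y: "Y = L2_set \<beta> S" unfolding Y_def by (rule arg_cong[where f = "\<lambda>g. L2_set g S"]) (simp add: \<beta> fun_eq_iff)
 have Z: "Z = L2_set F S" unfolding Z_def by (rule arg_cong[where f = "\<lambda>g. L2_set g S"]) (simp add: F \<beta> fun_eq_iff)
 have B0: "0 \<le> B" using B by (simp add: form_bound_def)
 define x where "x = (\<lambda>k l. \<tau> * (mode_norm k powr \<sigma> - mode_norm l powr \<sigma>))"
 have wx: "w k = w l * exp (x k l)" for k l
  by (simp add: w_def x_def exp_add[symmetric] algebra_simps)
 define H where "H = (\<lambda>k l. \<i> * of_real (drift \<nu> (k - l) l) * a (k - l))"
 define e where "e = (\<lambda>k l. cnj (b k) * H k l * b l * of_real (exp (x k l) - 1))"
 define M where "M = (\<lambda>k l. \<i> * of_real (\<tau> * \<sigma>) * (of_real (drift \<nu> (k - l) l * (mode_dot l (k - l) / (mode_norm l)\<^sup>2))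
   * a (k - l) * f l * cnj (f k)))"
 have neutral: "Re (\<Sum>k\<in>S. \<Sum>l\<in>S. cnj (b k) * H k l * b l) = 0"
  using advection_neutral[OF S(1) herm, of b \<nu>]
  by (simp add: advection_def H_def sum_distrib_left mult.assoc)
 have "(\<Sum>k\<in>S. of_real ((w k)\<^sup>2) * cnj (a k) * advection \<nu> S a a k) =
   (\<Sum>k\<in>S. \<Sum>l\<in>S. of_real ((w k)\<^sup>2) * cnj (a k) * (H k l * a l))"
  by (simp add: advection_def H_def sum_distrib_left mult.assoc)
 also have "\<dots> = (\<Sum>k\<in>S. \<Sum>l\<in>S. cnj (b k) * H k l * b l + e k l)"
 proof (intro sum.cong refl)
  fix k l
  have "of_real ((w k)\<^sup>2) * cnj (a k) * (H k l * a l) = of_real (w k) * cnj (a k) * H k l * (of_real (w k) * a l)"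
   by (simp add: power2_eq_square)
  also have "of_real (w k) * a l = b l * of_real (exp (x k l))"
   by (simp add: b_def wx[of k l])
  finally show "of_real ((w k)\<^sup>2) * cnj (a k) * (H k l * a l) = cnj (b k) * H k l * b l + e k l"
   by (simp add: e_def b_def algebra_simps)
 qed
 finally have "Re (\<Sum>k\<in>S. of_real ((w k)\<^sup>2) * cnj (a k) * advection \<nu> S a a k) =
   Re (\<Sum>k\<in>S. \<Sum>l\<in>S. cnj (b k) * H k l * b l) + Re (\<Sum>k\<in>S. \<Sum>l\<in>S. e k l)"
  by (simp only: sum.distrib plus_complex.sel)
 then have red: "\<bar>Re (\<Sum>k\<in>S. of_real ((w k)\<^sup>2) * cnj (a k) * advection \<nu> S a a k)\<bar> \<le>
   cmod (\<Sum>k\<in>S. \<Sum>l\<in>S. e k l)"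
  using neutral abs_Re_le_cmod[of "\<Sum>k\<in>S. \<Sum>l\<in>S. e k l"] by simp
 have main: "cmod (\<Sum>k\<in>S. \<Sum>l\<in>S. M k l) \<le> \<tau> * (4 * B) * Z\<^sup>2"
 proof -
  have "cmod (\<Sum>k\<in>S. \<Sum>l\<in>S. M k l) = \<tau> * \<sigma> * cmod (\<Sum>k\<in>S. \<Sum>l\<in>S.
    of_real (drift \<nu> (k - l) l * (mode_dot l (k - l) / (mode_norm l)\<^sup>2)) * a (k - l) * f l * cnj (f k))"
  proof -
   have "cmod (\<i> * of_real (\<tau> * \<sigma>)) = \<tau> * \<sigma>" using \<tau> \<sigma> by (simp add: norm_mult)
   then show ?thesis unfolding M_def sum_distrib_left[symmetric] norm_mult[of "\<i> * of_real (\<tau> * \<sigma>)"] by (rule arg_cong)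
  qed
  also have "\<dots> \<le> \<tau> * 1 * (4 * B * Z\<^sup>2)"
   using main_form_le[OF S(1) B, of f] \<tau> \<sigma> B0 unfolding Z F_def
   by (intro mult_mono) auto
  finally show ?thesis by simp
 qed
 define Q where "Q = (\<lambda>k l. e k l - M k l)"
 have a0: "a 0 = 0" using supp S by simp
 have diag: "Q k k = 0" for k by (simp add: Q_def e_def M_def H_def a0)
 have cQ: "cmod (H k l) = \<bar>drift \<nu> (k - l) l\<bar> * cmod (a (k - l))" for k l
  by (simp add: H_def norm_mult)
 have A2: "cmod (a j) * exp (\<tau> * mode_norm j powr \<sigma>) = \<beta> j" for j by (simp add: \<beta> w_def mult.commute)
 have xb: "\<bar>x k l\<bar> \<le> \<tau> * mode_norm (k - l) powr \<sigma>" for k l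
  using abs_mode_norm_powr_diff_le[OF \<sigma>, of k l] \<tau> by (simp add: x_def abs_mult)
 have far: "cmod (Q k l) \<le> 2 * \<tau> / \<nu> * (F (k - l) / mode_norm (k - l) * (F l * \<beta> k))
    + 2 * \<tau> / \<nu> * (F (k - l) / mode_norm (k - l) * (\<beta> l * F k))" if kl: "(k, l) \<in> far_pairs S" for k l
 proof -
  have l: "k \<noteq> l" "l \<noteq> 0" "mode_norm l < 2 * mode_norm (k - l)" "k - l \<noteq> 0"
   using kl S by (auto simp: far_pairs_def)
  have 1: "cmod (e k l) = \<beta> k * (\<bar>drift \<nu> (k - l) l\<bar> * cmod (a (k - l))) * \<beta> l * \<bar>exp (x k l) - 1\<bar>"
   by (simp only: e_def norm_mult norm_of_real complex_mod_cnj cQ \<beta>_def)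
  have 2: "cmod (M k l) = \<tau> * \<sigma> * cmod (a (k - l)) * (\<bar>drift \<nu> (k - l) l\<bar> * \<bar>mode_dot l (k - l) / (mode_norm l)\<^sup>2\<bar>)
    * (mode_norm l powr (\<sigma> / 2) * \<beta> l) * (mode_norm k powr (\<sigma> / 2) * \<beta> k)"
   unfolding M_def F[symmetric] F_def norm_mult norm_of_real complex_mod_cnj norm_ii
   using \<tau> \<sigma> by (simp add: abs_mult)
  have "cmod (Q k l) \<le> cmod (e k l) + cmod (M k l)" unfolding Q_def by (rule norm_triangle_ineq4)
  also have "\<dots> \<le> 2 * \<tau> / \<nu> * (F (k - l) / mode_norm (k - l) * (F l * \<beta> k))
    + 2 * \<tau> / \<nu> * (F (k - l) / mode_norm (k - l) * (\<beta> l * F k))"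
   unfolding 1 2 F
   by (intro add_mono far_term_le[OF \<nu> \<tau> \<sigma> mode_norm_pos[OF l(2)] l(3) mode_norm_nonneg[of k]
      abs_drift_le'[OF \<nu> l(4)] abs_mode_dot_le xb norm_ge_zero A2 \<beta>0 \<beta>0])
  finally show ?thesis .
 qed
 have near: "cmod (Q k l) \<le> \<tau> / \<nu> * (120 * (\<beta> (k - l) * (F l * F k) / mode_norm l)
   + 5 * (bump (\<tau> * mode_norm (k - l) powr \<sigma>) * \<beta> (k - l) / mode_norm (k - l) * (F l * F k)))"
  if kl: "(k, l) \<in> near_pairs S" for k l
 proof -
  have l: "k \<noteq> l" "l \<noteq> 0" "k \<noteq> 0" "2 * mode_norm (k - l) \<le> mode_norm l" "k - l \<noteq> 0"
   using kl S by (auto simp: near_pairs_def)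
  define P where "P = mode_norm l powr (\<sigma> / 2) * mode_norm k powr (\<sigma> / 2)"
  define d where "d = mode_dot l (k - l) / (mode_norm l)\<^sup>2"
  have "Q k l = H k l * b l * cnj (b k) * of_real (exp (x k l) - 1 - \<tau> * \<sigma> * d * P)"
   by (simp add: Q_def e_def M_def H_def f_def P_def d_def algebra_simps)
  then have "cmod (Q k l) = cmod (a (k - l)) * \<bar>drift \<nu> (k - l) l\<bar> * \<beta> l * \<beta> k * \<bar>exp (x k l) - 1 - \<tau> * \<sigma> * d * P\<bar>"
   by (simp only: norm_mult norm_of_real complex_mod_cnj cQ \<beta>_def) simp
  also have "\<dots> \<le> \<tau> / \<nu> * (120 * (\<beta> (k - l) * (F l * F k) / mode_norm l)
   + 5 * (bump (\<tau> * mode_norm (k - l) powr \<sigma>) * \<beta> (k - l) / mode_norm (k - l) * (F l * F k)))"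
   unfolding F
  proof (rule near_term_le[OF \<nu> \<tau> \<sigma> mode_norm_pos[OF l(2)] mode_norm_pos[OF l(5)] mode_norm_pos[OF l(3)]
      abs_drift_le'[OF \<nu> l(5)] _ xb norm_ge_zero A2 \<beta>0 \<beta>0 P_def])
   note ns = near_symbol_expansion[OF l(2) l(4) \<sigma>]
   show "\<bar>mode_norm k powr \<sigma> - mode_norm l powr \<sigma>\<bar> \<le> 5 / 2 * (mode_norm (k - l) / mode_norm l) * mode_norm l powr \<sigma>"
    by (rule ns(1))
   show "mode_norm l powr \<sigma> \<le> 2 * P" unfolding P_def by (rule ns(2))
   show "\<bar>mode_norm k powr \<sigma> - mode_norm l powr \<sigma> - \<sigma> * d * P\<bar> \<le> 120 * (mode_norm (k - l) / mode_norm l)\<^sup>2 * P"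
    unfolding P_def d_def by (rule ns(3))
  qed (simp add: x_def)
  finally show ?thesis .
 qed
 define \<gamma> where "\<gamma> = (\<lambda>j. bump (\<tau> * mode_norm j powr \<sigma>) / mode_norm j)"
 have \<gamma>0: "0 \<le> \<gamma> j" for j using \<tau> by (simp add: \<gamma>_def bump_def)
 have gsum: "(\<Sum>j\<in>S. \<gamma> j * \<beta> j) \<le> sqrt (96 / min (2 * \<sigma>) 1) * Y"
 proof (rule sum_pairs_Cauchy_Schwarz)
  show "(\<Sum>j\<in>S. (\<gamma> j)\<^sup>2) \<le> (sqrt (96 / min (2 * \<sigma>) 1))\<^sup>2"
   using sum_bump_le[OF S \<sigma> \<tau>] \<sigma> by (simp add: \<gamma>_def)
  show "(\<Sum>j\<in>S. (\<beta> j)\<^sup>2) \<le> Y\<^sup>2" by (simp add: Y L2_set_sq)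
 qed (use \<sigma> in \<open>auto simp: Y L2_set_nonneg\<close>)
 have finP: "finite (far_pairs S)" "finite (near_pairs S)"
  by (rule finite_subset[OF far_pairs_subset] finite_subset[OF near_pairs_subset], simp add: S(1))+
 have YZ: "0 \<le> Y" "0 \<le> Z" by (simp_all add: Y Z L2_set_nonneg)
 have "(\<Sum>k\<in>S. \<Sum>l\<in>S. Q k l) = (\<Sum>(k, l)\<in>S \<times> S. Q k l)" by (simp add: sum.cartesian_product)
 also have "\<dots> = (\<Sum>(k, l)\<in>far_pairs S \<union> near_pairs S. Q k l)"
  by (rule sum.mono_neutral_right)
   (use S(1) diag in \<open>auto simp: far_pairs_def near_pairs_def not_less simp del: split_paired_All\<close>)
 also have "\<dots> = (\<Sum>(k, l)\<in>far_pairs S. Q k l) + (\<Sum>(k, l)\<in>near_pairs S. Q k l)"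
  by (rule sum.union_disjoint) (use finP in \<open>auto simp: far_pairs_def near_pairs_def\<close>)
 finally have split: "cmod (\<Sum>k\<in>S. \<Sum>l\<in>S. Q k l) \<le>
   cmod (\<Sum>(k, l)\<in>far_pairs S. Q k l) + cmod (\<Sum>(k, l)\<in>near_pairs S. Q k l)"
  by (simp only: norm_triangle_ineq)
 have "cmod (\<Sum>(k, l)\<in>far_pairs S. Q k l) \<le>
   (\<Sum>(k, l)\<in>far_pairs S. 2 * \<tau> / \<nu> * (F (k - l) / mode_norm (k - l) * (F l * \<beta> k))
    + 2 * \<tau> / \<nu> * (F (k - l) / mode_norm (k - l) * (\<beta> l * F k)))"
  by (rule sum_norm_le) (use far in auto)
 also have "\<dots> = 2 * \<tau> / \<nu> * ((\<Sum>(k, l)\<in>far_pairs S. F (k - l) / mode_norm (k - l) * (F l * \<beta> k))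
    + (\<Sum>(k, l)\<in>far_pairs S. F (k - l) / mode_norm (k - l) * (\<beta> l * F k)))"
  unfolding distrib_left sum_distrib_left sum.distrib[symmetric] by (simp add: case_prod_unfold)
 also have "\<dots> \<le> 2 * \<tau> / \<nu> * (5 * Z * (Z * Y) + 5 * Z * (Y * Z))"
  unfolding Y Z using \<nu> \<tau> by (intro mult_left_mono add_mono far_form_le S Fsupp) auto
 finally have farsum: "cmod (\<Sum>(k, l)\<in>far_pairs S. Q k l) \<le> \<tau> / \<nu> * (20 * Y * Z\<^sup>2)"
  by (simp add: power2_eq_square algebra_simps)
 have "cmod (\<Sum>(k, l)\<in>near_pairs S. Q k l) \<le>
   (\<Sum>(k, l)\<in>near_pairs S. \<tau> / \<nu> * (120 * (\<beta> (k - l) * (F l * F k) / mode_norm l)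
   + 5 * ((\<gamma> (k - l) * \<beta> (k - l)) * (F l * F k))))"
  by (rule sum_norm_le) (use near in \<open>auto simp: \<gamma>_def\<close>)
 also have "\<dots> = \<tau> / \<nu> * (120 * (\<Sum>(k, l)\<in>near_pairs S. \<beta> (k - l) * (F l * F k) / mode_norm l)
   + 5 * (\<Sum>(k, l)\<in>near_pairs S. (\<gamma> (k - l) * \<beta> (k - l)) * (F l * F k)))"
  unfolding distrib_left sum_distrib_left sum.distrib[symmetric] by (simp add: case_prod_unfold)
 also have "\<dots> \<le> \<tau> / \<nu> * (120 * (2 * Y * (Z * Z)) + 5 * ((\<Sum>j\<in>S. \<gamma> j * \<beta> j) * (Z * Z)))"
 proof (intro mult_left_mono add_mono)
  show "(\<Sum>(k, l)\<in>near_pairs S. \<beta> (k - l) * (F l * F k) / mode_norm l) \<le> 2 * Y * (Z * Z)"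
   unfolding Y Z by (intro near_form_le S \<beta>supp)
  show "(\<Sum>(k, l)\<in>near_pairs S. (\<gamma> (k - l) * \<beta> (k - l)) * (F l * F k)) \<le> (\<Sum>j\<in>S. \<gamma> j * \<beta> j) * (Z * Z)"
   unfolding Z by (rule convolution_form_le[OF S(1) _ _ S(1) near_pairs_subset])
    (use \<beta>supp \<gamma>0 \<beta>0 F0 in auto)
 qed (use \<nu> \<tau> in auto)
 also have "\<dots> \<le> \<tau> / \<nu> * (120 * (2 * Y * (Z * Z)) + 5 * ((sqrt (96 / min (2 * \<sigma>) 1) * Y) * (Z * Z)))"
  using gsum \<nu> \<tau> by (intro mult_left_mono add_mono mult_right_mono order_refl) auto
 finally have nearsum: "cmod (\<Sum>(k, l)\<in>near_pairs S. Q k l) \<le>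
   \<tau> / \<nu> * ((240 + 5 * sqrt (96 / min (2 * \<sigma>) 1)) * Y * Z\<^sup>2)"
  by (simp add: power2_eq_square algebra_simps)
 have "(\<Sum>k\<in>S. \<Sum>l\<in>S. e k l) = (\<Sum>k\<in>S. \<Sum>l\<in>S. M k l) + (\<Sum>k\<in>S. \<Sum>l\<in>S. Q k l)"
  unfolding sum.distrib[symmetric] by (simp add: Q_def)
 then have "cmod (\<Sum>k\<in>S. \<Sum>l\<in>S. e k l) \<le> cmod (\<Sum>k\<in>S. \<Sum>l\<in>S. M k l) + cmod (\<Sum>k\<in>S. \<Sum>l\<in>S. Q k l)"
  by (simp only: norm_triangle_ineq)
 also have "\<dots> \<le> \<tau> * (4 * B) * Z\<^sup>2 + (\<tau> / \<nu> * (20 * Y * Z\<^sup>2)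
   + \<tau> / \<nu> * ((240 + 5 * sqrt (96 / min (2 * \<sigma>) 1)) * Y * Z\<^sup>2))"
  using main split farsum nearsum by linarith
 also have "\<dots> = \<tau> * (4 * B + trilinear_const \<sigma> / \<nu> * Y) * Z\<^sup>2"
  by (simp add: trilinear_const_def algebra_simps add_divide_distrib)
 finally show ?thesis using red by linarith
qed

section \<open>Ordinary differential equations\<close>

lemma at_within_atLeastAtMost_eq:
 fixes t :: real
 assumes "0 \<le> t" "t < T"
 shows "at t within {0..T} = at t within {0..}"
 by (rule at_within_nhd[of t "{..<T}"]) (use assms in auto)

lemma indefinite_integral_derivative:
 fixes h :: "real \<Rightarrow> 'a::banach"
 assumes "continuous_on {0..} h" "0 \<le> t"
 shows "((\<lambda>t. integral {0..t} h) has_vector_derivative h t) (at t within {0..})"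
proof -
 have "((\<lambda>t. integral {0..t} h) has_vector_derivative h t) (at t within {0..t + 1})"
  by (rule integral_has_vector_derivative) (use assms in \<open>auto intro: continuous_on_subset\<close>)
 then show ?thesis using at_within_atLeastAtMost_eq[of t "t + 1"] assms by simp
qed

lemma integral_exp_le:
 fixes c t :: real
 assumes "0 < c" "0 \<le> t"
 shows "integral {0..t} (\<lambda>s. exp (c * s)) \<le> exp (c * t) / c"
proof -
 have "((\<lambda>s. exp (c * s)) has_integral (exp (c * t) / c - exp (c * 0) / c)) {0..t}"
  by (rule fundamental_theorem_of_calculus)
   (use assms in \<open>auto intro!: derivative_eq_intros simp: has_real_derivative_iff_has_vector_derivative[symmetric]\<close>)
 then have "integral {0..t} (\<lambda>s. exp (c * s)) = exp (c * t) / c - 1 / c" by (simp add: integral_unique)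
 then show ?thesis using assms by simp
qed

text \<open>Picard's theorem. In the norm \<open>sup (exp (- 2 L t) * norm (u t))\<close> over all positive times the
 integral operator contracts by \<open>1/2\<close>, so no continuation argument is needed.\<close>

lemma lipschitz_ode_global:
 fixes f :: "'a::banach \<Rightarrow> 'a"
 assumes lip: "\<And>x y. norm (f x - f y) \<le> L * norm (x - y)" and bd: "\<And>x. norm (f x) \<le> K" and L: "0 < L"
 shows "\<exists>u. u 0 = u0 \<and> (\<forall>t\<ge>0. (u has_vector_derivative f (u t)) (at t within {0..}))"
proof -
 define c where "c = 2 * L"
 have c: "0 < c" using L by (simp add: c_def)
 have K: "0 \<le> K" using bd[of undefined] norm_ge_zero order_trans by blast
 have contf: "continuous_on UNIV f"
 proof (rule continuous_onI)
  fix x e :: "real" fix x :: 'a assume "0 < e"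
  then show "\<exists>d>0. \<forall>x'\<in>UNIV. dist x' x < d \<longrightarrow> dist (f x') (f x) \<le> e"
   using L lip by (intro exI[of _ "e / L"])
    (auto simp: dist_norm field_simps intro: order_trans[OF lip])
 qed
 define h where "h = (\<lambda>(y :: real \<Rightarrow>\<^sub>C 'a) s. f (exp (c * s) *\<^sub>R apply_bcontfun y s))"
 have conth: "continuous_on A (h y)" for y A
  unfolding h_def
  by (rule continuous_on_compose2[OF contf]) (auto intro!: continuous_intros)
 have inth: "h y integrable_on {0..t}" for y t
  by (rule integrable_continuous_real[OF conth])
 define g where "g = (\<lambda>y t. exp (- (c * t)) *\<^sub>R (u0 + integral {0..t} (h y)))"
 have contg: "continuous_on {0..} (g y)" for y
 proof -
  have "continuous_on {0..} (\<lambda>t. integral {0..t} (h y))"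
   by (rule differentiable_imp_continuous_on)
    (use indefinite_integral_derivative[OF conth] in \<open>auto simp: differentiable_on_def intro: differentiableI_vector\<close>)
  then show ?thesis unfolding g_def by (intro continuous_intros)
 qed
 have bdg: "norm (g y t) \<le> norm u0 + K / c" if "0 \<le> t" for y t
 proof -
  have "norm (integral {0..t} (h y)) \<le> K * t"
   using integral_bound[of 0 t "h y" K] that conth bd by (simp add: h_def)
  then have "norm (g y t) \<le> exp (- (c * t)) * (norm u0 + K * t)"
   unfolding g_def by (simp add: norm_triangle_mono)
  also have "\<dots> = exp (- (c * t)) * norm u0 + K / c * (exp (- (c * t)) * (c * t))" using c by (simp add: field_simps)
  also have "\<dots> \<le> 1 * norm u0 + K / c * 1"
  proof (intro add_mono mult_right_mono mult_left_mono)
   have "c * t \<le> exp (c * t)" using exp_ge_add_one_self[of "c * t"] by linarith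
   then show "exp (- (c * t)) * (c * t) \<le> 1" by (simp add: exp_minus field_simps)
  qed (use c that K in auto)
  finally show ?thesis by simp
 qed
 define \<Psi> where "\<Psi> = (\<lambda>y. Bcontfun (\<lambda>t. g y (max 0 t)))"
 have \<Psi>: "apply_bcontfun (\<Psi> y) t = g y (max 0 t)" for y t
 proof -
  have "(\<lambda>t. g y (max 0 t)) \<in> bcontfun"
   unfolding bcontfun_def mem_Collect_eq
  proof (rule conjI)
   show "continuous_on UNIV (\<lambda>t. g y (max 0 t))"
    by (rule continuous_on_compose2[OF contg]) (auto intro!: continuous_intros)
   show "bounded (range (\<lambda>t. g y (max 0 t)))"
    unfolding bounded_iff using bdg[of "max 0 _" y] by (intro exI[of _ "norm u0 + K / c"]) auto
  qed
  then show ?thesis by (simp add: \<Psi>_def Bcontfun_inverse)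
 qed
 have contract: "dist (\<Psi> y) (\<Psi> z) \<le> 1 / 2 * dist y z" for y z
 proof (rule dist_bound)
  fix s :: real
  define t where "t = max 0 s"
  have t: "0 \<le> t" by (simp add: t_def)
  have "norm (integral {0..t} (h y) - integral {0..t} (h z)) = norm (integral {0..t} (\<lambda>s. h y s - h z s))"
   by (simp add: integral_diff inth)
  also have "\<dots> \<le> integral {0..t} (\<lambda>s. L * dist y z * exp (c * s))"
  proof (rule integral_norm_bound_integral)
   show "(\<lambda>s. h y s - h z s) integrable_on {0..t}" by (intro integrable_diff inth)
   show "(\<lambda>s. L * dist y z * exp (c * s)) integrable_on {0..t}"
    by (intro integrable_continuous_real continuous_intros)
   fix s
   have "norm (h y s - h z s) \<le> L * norm (exp (c * s) *\<^sub>R (apply_bcontfun y s - apply_bcontfun z s))"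
    unfolding h_def scaleR_diff_right by (rule lip)
   also have "\<dots> = L * exp (c * s) * dist (apply_bcontfun y s) (apply_bcontfun z s)" by (simp add: dist_norm)
   also have "\<dots> \<le> L * exp (c * s) * dist y z" using L by (intro mult_left_mono dist_bounded) auto
   finally show "norm (h y s - h z s) \<le> L * dist y z * exp (c * s)" by (simp add: mult_ac)
  qed
  also have "\<dots> \<le> L * dist y z * (exp (c * t) / c)"
  proof -
   have "L * dist y z * integral {0..t} (\<lambda>s. exp (c * s)) \<le> L * dist y z * (exp (c * t) / c)"
    using integral_exp_le[OF c t] L by (intro mult_left_mono) auto
   then show ?thesis by (simp only: integral_mult_right)
  qed
  finally have *: "norm (integral {0..t} (h y) - integral {0..t} (h z)) \<le> exp (c * t) * (1 / 2 * dist y z)"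
   using L by (simp add: c_def mult.commute)
  have "dist (g y t) (g z t) = exp (- (c * t)) * norm (integral {0..t} (h y) - integral {0..t} (h z))"
   by (simp add: g_def dist_norm flip: scaleR_diff_right)
  also have "\<dots> \<le> exp (- (c * t)) * (exp (c * t) * (1 / 2 * dist y z))"
   using * by (intro mult_left_mono) auto
  also have "\<dots> = 1 / 2 * dist y z" by (simp add: exp_minus field_simps)
  finally show "dist (apply_bcontfun (\<Psi> y) s) (apply_bcontfun (\<Psi> z) s) \<le> 1 / 2 * dist y z"
   by (simp add: \<Psi> t_def)
 qed
 obtain y where y: "\<Psi> y = y"
  using banach_fix_type[of "1/2" \<Psi>] contract by auto
 define u where "u = (\<lambda>t. exp (c * t) *\<^sub>R apply_bcontfun y t)"
 have ut: "u t = u0 + integral {0..t} (h y)" if "0 \<le> t" for t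
  using \<Psi>[of y t] that by (simp add: y u_def g_def exp_minus)
 have "(u has_vector_derivative f (u t)) (at t within {0..})" if t: "0 \<le> t" for t
 proof -
  have "((\<lambda>t. u0 + integral {0..t} (h y)) has_vector_derivative 0 + h y t) (at t within {0..})"
   by (intro derivative_intros indefinite_integral_derivative[OF conth t])
  then have "((\<lambda>t. u0 + integral {0..t} (h y)) has_vector_derivative f (u t)) (at t within {0..})"
   by (simp add: h_def u_def)
  then show ?thesis
   by (rule has_vector_derivative_transform[rotated 2]) (use t ut in auto)
 qed
 moreover have "u 0 = u0" using ut[of 0] by simp
 ultimately show ?thesis by blast
qed

lemma has_derivative_cmod_sq:
 assumes "(z has_vector_derivative z') (at t within T)"
 shows "((\<lambda>t. (cmod (z t))\<^sup>2) has_real_derivative 2 * Re (cnj (z t) * z')) (at t within T)"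
proof -
 have re: "((\<lambda>t. Re (z t)) has_real_derivative Re z') (at t within T)"
  and im: "((\<lambda>t. Im (z t)) has_real_derivative Im z') (at t within T)"
  using bounded_linear.has_vector_derivative[OF bounded_linear_Re assms]
   bounded_linear.has_vector_derivative[OF bounded_linear_Im assms]
  by (auto simp: has_real_derivative_iff_has_vector_derivative)
 show ?thesis unfolding cmod_power2
  by (rule derivative_eq_intros re im refl)+ simp
qed

lemma derivative_zero_imp_eq_initial:
 fixes f :: "real \<Rightarrow> 'a::real_normed_vector"
 assumes "\<And>t. 0 \<le> t \<Longrightarrow> (f has_vector_derivative 0) (at t within {0..})" "0 \<le> t"
 shows "f t = f 0"
proof -
 obtain c where "\<And>x. x \<in> {0..} \<Longrightarrow> f x = c"
  by (rule has_vector_derivative_zero_constant[of "{0..}" f]) (use assms(1) in auto)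
 then show ?thesis using assms(2) by simp
qed

lemma radial_retraction_Lipschitz:
 fixes u v :: "'a::real_normed_vector"
 assumes R: "0 < R"
 defines "r \<equiv> \<lambda>u :: 'a. (1 / max 1 (norm u / R))"
 shows "norm (r u *\<^sub>R u) \<le> R" "norm (r u *\<^sub>R u - r v *\<^sub>R v) \<le> 2 * norm (u - v)"
proof -
 have r01: "0 < r u" "r u \<le> 1" for u by (auto simp: r_def)
 have bound: "norm (r u *\<^sub>R u) \<le> R" for u
 proof (cases "norm u \<le> R")
  case True
  then have "r u = 1" using R by (simp add: r_def max_def)
  then show ?thesis using True by simp
 next
  case False
  then have "r u = R / norm u" using R by (simp add: r_def max_def field_simps)
  then show ?thesis using False R by simp
 qed
 then show "norm (r u *\<^sub>R u) \<le> R" .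
 have rv: "\<bar>r u - r v\<bar> * norm v \<le> norm (u - v)"
 proof -
  have mx: "\<bar>max 1 (norm u / R) - max 1 (norm v / R)\<bar> \<le> norm (u - v) / R"
  proof -
   have "\<bar>norm u / R - norm v / R\<bar> \<le> norm (u - v) / R"
    using norm_triangle_ineq3[of u v] R by (simp add: diff_divide_distrib[symmetric] divide_right_mono)
   then show ?thesis by (auto simp: max_def abs_if split: if_splits)
  qed
  have "\<bar>r u - r v\<bar> = \<bar>max 1 (norm u / R) - max 1 (norm v / R)\<bar> * (r u * r v)"
  proof -
   have *: "\<bar>1 / a - 1 / b\<bar> = \<bar>a - b\<bar> * (1 / a * (1 / b))" if "0 < a" "0 < b" for a b :: real
   proof -
    have "1 / a - 1 / b = (b - a) * (1 / a * (1 / b))" using that by (simp add: field_simps)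
    then show ?thesis using that by (simp add: abs_mult abs_minus_commute)
   qed
   show ?thesis unfolding r_def by (rule *) (auto simp: less_max_iff_disj)
  qed
  then have "\<bar>r u - r v\<bar> * norm v = \<bar>max 1 (norm u / R) - max 1 (norm v / R)\<bar> * (r u * norm (r v *\<^sub>R v))"
   using r01(1)[of v] by simp
  also have "\<dots> \<le> norm (u - v) / R * (1 * R)"
   using mx bound[of v] r01[of u] R by (intro mult_mono) auto
  finally show ?thesis using R by simp
 qed
 have "r u *\<^sub>R u - r v *\<^sub>R v = r u *\<^sub>R (u - v) + (r u - r v) *\<^sub>R v" by (simp add: algebra_simps)
 also have "norm \<dots> \<le> r u * norm (u - v) + \<bar>r u - r v\<bar> * norm v"
  using r01(1)[of u] by (metis abs_of_pos norm_scaleR norm_triangle_ineq)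
 also have "\<dots> \<le> 1 * norm (u - v) + norm (u - v)"
  using rv r01[of u] by (intro add_mono mult_right_mono) auto
 finally show "norm (r u *\<^sub>R u - r v *\<^sub>R v) \<le> 2 * norm (u - v)" by simp
qed

section \<open>Galerkin approximations\<close>

lemma open_int_pairs: "open (U :: (int \<times> int) set)"
 unfolding open_prod_def
proof
 fix p assume "p \<in> U"
 then show "\<exists>A B. open A \<and> open B \<and> p \<in> A \<times> B \<and> A \<times> B \<subseteq> U"
  by (intro exI[of _ "{fst p}"] exI[of _ "{snd p}"]) (auto simp: open_discrete)
qed

text \<open>States with finitely many modes have to live in a Banach space. Here a family of
 coefficients indexed by \<open>S\<close> is the functional \<open>\<phi> \<mapsto> (\<Sum>k\<in>S. g k * \<phi> k)\<close> on bounded functions, and the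
 coefficients are recovered by testing with indicators.\<close>

type_synonym mode_state = "((int \<times> int) \<Rightarrow>\<^sub>C real) \<Rightarrow>\<^sub>L complex"

definition mode_indicator :: "int \<times> int \<Rightarrow> (int \<times> int) \<Rightarrow>\<^sub>C real" where
 "mode_indicator k = Bcontfun (\<lambda>j. if j = k then 1 else 0)"

definition mode_coeff :: "mode_state \<Rightarrow> int \<times> int \<Rightarrow> complex" where
 "mode_coeff u k = blinfun_apply u (mode_indicator k)"

definition mode_functional :: "(int \<times> int) set \<Rightarrow> (int \<times> int \<Rightarrow> complex) \<Rightarrow> mode_state" where
 "mode_functional S g = Blinfun (\<lambda>\<phi>. \<Sum>k\<in>S. apply_bcontfun \<phi> k *\<^sub>R g k)"

lemma apply_mode_indicator: "apply_bcontfun (mode_indicator k) j = (if j = k then 1 else 0)"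
 and norm_mode_indicator: "norm (mode_indicator k) \<le> 1"
proof -
 have "range (\<lambda>j. if j = k then 1 else 0 :: real) \<subseteq> {0, 1}" by auto
 then have "bounded (range (\<lambda>j. if j = k then 1 else 0 :: real))"
  by (rule bounded_subset[rotated]) simp
 then have "(\<lambda>j. if j = k then 1 else 0 :: real) \<in> bcontfun"
  by (simp add: bcontfun_def continuous_on_open_vimage open_int_pairs)
 then show 1: "apply_bcontfun (mode_indicator k) j = (if j = k then 1 else 0)" for j
  by (simp add: mode_indicator_def Bcontfun_inverse)
 show "norm (mode_indicator k) \<le> 1" by (rule norm_bound) (simp add: 1)
qed

lemma apply_mode_functional:
 assumes "finite S"
 shows "blinfun_apply (mode_functional S g) \<phi> = (\<Sum>k\<in>S. apply_bcontfun \<phi> k *\<^sub>R g k)"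
proof -
 have "bounded_linear (\<lambda>\<phi> :: (int \<times> int) \<Rightarrow>\<^sub>C real. \<Sum>k\<in>S. apply_bcontfun \<phi> k *\<^sub>R g k)"
 proof (rule bounded_linear_intro[where K = "\<Sum>k\<in>S. cmod (g k)"])
  fix \<phi> :: "(int \<times> int) \<Rightarrow>\<^sub>C real"
  have "cmod (\<Sum>k\<in>S. apply_bcontfun \<phi> k *\<^sub>R g k) \<le> (\<Sum>k\<in>S. norm \<phi> * cmod (g k))"
   by (rule sum_norm_le) (use norm_bounded[of \<phi>] in \<open>auto intro!: mult_right_mono\<close>)
  then show "cmod (\<Sum>k\<in>S. apply_bcontfun \<phi> k *\<^sub>R g k) \<le> norm \<phi> * (\<Sum>k\<in>S. cmod (g k))"
   by (simp add: sum_distrib_left)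
 qed (simp_all add: plus_bcontfun.rep_eq scaleR_bcontfun.rep_eq scaleR_left_distrib sum.distrib scaleR_sum_right)
 then show ?thesis by (simp add: mode_functional_def bounded_linear_Blinfun_apply)
qed

lemma norm_mode_functional_le:
 assumes "finite S"
 shows "norm (mode_functional S g) \<le> (\<Sum>k\<in>S. cmod (g k))"
proof (rule norm_blinfun_bound)
 fix \<phi> :: "(int \<times> int) \<Rightarrow>\<^sub>C real"
 have "cmod (\<Sum>k\<in>S. apply_bcontfun \<phi> k *\<^sub>R g k) \<le> (\<Sum>k\<in>S. norm \<phi> * cmod (g k))"
  by (rule sum_norm_le) (use norm_bounded[of \<phi>] in \<open>auto intro!: mult_right_mono\<close>)
 then show "cmod (blinfun_apply (mode_functional S g) \<phi>) \<le> (\<Sum>k\<in>S. cmod (g k)) * norm \<phi>"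
  by (simp add: apply_mode_functional[OF assms] sum_distrib_left mult.commute)
qed (simp add: sum_nonneg)

lemma mode_functional_diff:
 "finite S \<Longrightarrow> mode_functional S g - mode_functional S h = mode_functional S (\<lambda>k. g k - h k)"
 by (rule blinfun_eqI) (simp add: apply_mode_functional blinfun.diff_left sum_subtractf scaleR_diff_right)

lemma mode_coeff_functional:
 assumes "finite S"
 shows "mode_coeff (mode_functional S g) k = (if k \<in> S then g k else 0)"
proof -
 have "mode_coeff (mode_functional S g) k = (\<Sum>j\<in>S. if j = k then g j else 0)"
  unfolding mode_coeff_def apply_mode_functional[OF assms] apply_mode_indicator
  by (intro sum.cong) auto
 then show ?thesis using assms by simp
qed

lemma mode_coeff_linear:
 "mode_coeff (u - v) k = mode_coeff u k - mode_coeff v k"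
 "mode_coeff (c *\<^sub>R u) k = c *\<^sub>R mode_coeff u k"
 "bounded_linear (\<lambda>u. mode_coeff u k)"
 by (simp_all add: mode_coeff_def blinfun.diff_left blinfun.scaleR_left blinfun.bounded_linear_left)

lemma cmod_mode_coeff_le: "cmod (mode_coeff u k) \<le> norm u"
proof -
 have "cmod (mode_coeff u k) \<le> norm u * norm (mode_indicator k)"
  unfolding mode_coeff_def by (rule norm_blinfun)
 also have "\<dots> \<le> norm u * 1" by (intro mult_left_mono norm_mode_indicator) auto
 finally show ?thesis by simp
qed

lemma advection_scaleR: "advection \<nu> S (\<lambda>k. r *\<^sub>R a k) (\<lambda>k. r *\<^sub>R a k) k = (r * r) *\<^sub>R advection \<nu> S a a k"
 by (simp add: advection_def scaleR_conv_of_real sum_distrib_left mult_ac)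

lemma advection_diff_le:
 assumes "finite S" "\<And>k. cmod (a k) \<le> A" "\<And>k. cmod (b k) \<le> B" "\<And>k. cmod (a k - b k) \<le> D"
 shows "cmod (advection \<nu> S a a k - advection \<nu> S b b k) \<le> (\<Sum>l\<in>S. \<bar>drift \<nu> (k - l) l\<bar>) * ((A + B) * D)"
proof -
 have D: "0 \<le> D" and B: "0 \<le> B" using assms(3,4)[of 0] norm_ge_zero order_trans by blast+
 have "advection \<nu> S a a k - advection \<nu> S b b k =
   (\<Sum>l\<in>S. \<i> * of_real (drift \<nu> (k - l) l) * (a (k - l) * (a l - b l) + (a (k - l) - b (k - l)) * b l))"
  by (simp add: advection_def sum_subtractf[symmetric] algebra_simps)
 also have "cmod \<dots> \<le> (\<Sum>l\<in>S. \<bar>drift \<nu> (k - l) l\<bar> * ((A + B) * D))"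
 proof (rule sum_norm_le)
  fix l
  have "cmod (a (k - l) * (a l - b l) + (a (k - l) - b (k - l)) * b l) \<le>
    cmod (a (k - l)) * cmod (a l - b l) + cmod (a (k - l) - b (k - l)) * cmod (b l)"
   by (rule order_trans[OF norm_triangle_ineq]) (simp add: norm_mult)
  also have "\<dots> \<le> A * D + D * B"
   using assms D B by (intro add_mono mult_mono') auto
  also have "\<dots> = (A + B) * D" by (simp add: algebra_simps)
  finally have le: "cmod (a (k - l) * (a l - b l) + (a (k - l) - b (k - l)) * b l) \<le> (A + B) * D" .
  have "cmod (\<i> * of_real d * x) = \<bar>d\<bar> * cmod x" for d x by (simp add: norm_mult)
  then show "cmod (\<i> * of_real (drift \<nu> (k - l) l) * (a (k - l) * (a l - b l) + (a (k - l) - b (k - l)) * b l))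
    \<le> \<bar>drift \<nu> (k - l) l\<bar> * ((A + B) * D)"
   using mult_left_mono[OF le abs_ge_zero] by metis
 qed
 finally show ?thesis by (simp add: sum_distrib_right)
qed

lemma advection_hermitian:
 assumes "finite S" "\<And>k. k \<in> S \<Longrightarrow> - k \<in> S" "hermitian a" "hermitian b"
 shows "advection \<nu> S a b (- k) = cnj (advection \<nu> S a b k)"
proof -
 have "uminus ` S = S"
 proof
  show "S \<subseteq> uminus ` S" using assms(2) by (metis image_eqI minus_minus subsetI)
 qed (use assms(2) in auto)
 then have "advection \<nu> S a b (- k) = (\<Sum>l\<in>uminus ` S. \<i> * of_real (drift \<nu> (- k - l) l) * a (- k - l) * b l)"
  by (simp add: advection_def)
 also have "\<dots> = (\<Sum>l\<in>S. \<i> * of_real (drift \<nu> (- k + l) (- l)) * a (- k + l) * b (- l))"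
  by (subst sum.reindex) (auto simp: inj_on_def)
 also have "\<dots> = (\<Sum>l\<in>S. cnj (\<i> * of_real (drift \<nu> (k - l) l) * a (k - l) * b l))"
 proof (rule sum.cong[OF refl])
  fix l
  have e: "- k + l = - (k - l)" by simp
  have "drift \<nu> (- (k - l)) (- l) = - drift \<nu> (k - l) l"
   unfolding drift_minus by (simp add: drift_def)
  moreover have "a (- (k - l)) = cnj (a (k - l))" "b (- l) = cnj (b l)"
   by (rule assms(3)[unfolded hermitian_def, THEN spec], rule assms(4)[unfolded hermitian_def, THEN spec])
  ultimately show "\<i> * of_real (drift \<nu> (- k + l) (- l)) * a (- k + l) * b (- l) =
    cnj (\<i> * of_real (drift \<nu> (k - l) l) * a (k - l) * b l)"
   unfolding e by (simp only: complex_cnj_mult complex_cnj_i complex_cnj_complex_of_real of_real_minus mult_minus_left mult_minus_right)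
 qed
 finally show ?thesis by (simp add: advection_def)
qed

text \<open>Values at negative times are left open; the derivative at \<open>t = 0\<close> is one-sided.\<close>

definition galerkin_solution ::
 "real \<Rightarrow> (int \<times> int) set \<Rightarrow> (int \<times> int \<Rightarrow> complex) \<Rightarrow> (real \<Rightarrow> int \<times> int \<Rightarrow> complex) \<Rightarrow> bool" where
 "galerkin_solution \<nu> S a0 a \<longleftrightarrow> a 0 = a0 \<and>
   (\<forall>t\<ge>0. hermitian (a t) \<and> (\<forall>k. k \<notin> S \<longrightarrow> a t k = 0) \<and>
    (\<forall>k\<in>S. ((\<lambda>t. a t k) has_vector_derivative - advection \<nu> S (a t) (a t) k) (at t within {0..})))"

text \<open>The vector field is quadratic, so it is made globally Lipschitz by a radial retraction
 \<open>\<pi>\<close>; being radial, \<open>\<pi>\<close> does not spoil conservation of the \<open>L\<^sup>2\<close> norm, which keeps the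
 solution where \<open>\<pi>\<close> is the identity. Symmetrising the field makes reality of the solution
 immediate.\<close>

lemma galerkin_solution_exists:
 assumes S: "finite S" "\<And>k. k \<in> S \<Longrightarrow> - k \<in> S"
  and a0: "hermitian a0" "\<And>k. k \<notin> S \<Longrightarrow> a0 k = 0"
 shows "\<exists>a. galerkin_solution \<nu> S a0 a"
proof -
 define R where "R = real (card S) * L2_set (\<lambda>k. cmod (a0 k)) S + 1"
 have R: "0 < R" by (simp add: R_def L2_set_nonneg add_nonneg_pos)
 define C where "C = (\<Sum>k\<in>S. \<Sum>l\<in>S. \<bar>drift \<nu> (k - l) l\<bar>) + 1"
 have C: "0 < C" by (simp add: C_def sum_nonneg add_nonneg_pos)
 have CS: "(\<Sum>l\<in>S. \<bar>drift \<nu> (k - l) l\<bar>) \<le> C" if "k \<in> S" for k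
  using member_le_sum[OF that, of "\<lambda>k. \<Sum>l\<in>S. \<bar>drift \<nu> (k - l) l\<bar>"] S(1) by (simp add: C_def sum_nonneg)
 define N where "N = (\<lambda>u k. - ((1 / 2) *\<^sub>R (advection \<nu> S u u k + cnj (advection \<nu> S u u (- k)))))"
 define F where "F = (\<lambda>u. mode_functional S (N (mode_coeff u)))"
 define r where "r = (\<lambda>u :: mode_state. (1 / max 1 (norm u / R)))"
 define m where "m = real (card S)"
 have Fap: "mode_coeff (F u) k = (if k \<in> S then N (mode_coeff u) k else 0)" for u k
  unfolding F_def by (rule mode_coeff_functional[OF S(1)])
 have Fdiff: "norm (F u - F v) \<le> m * (C * ((norm u + norm v) * norm (u - v)))" for u v
 proof -
  define e where "e = C * ((norm u + norm v) * norm (u - v))"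
  define d where "d = (\<lambda>k. advection \<nu> S (mode_coeff u) (mode_coeff u) k - advection \<nu> S (mode_coeff v) (mode_coeff v) k)"
  have adv: "cmod (d k) \<le> e" if "k \<in> S" for k
  proof -
   have "cmod (d k) \<le> (\<Sum>l\<in>S. \<bar>drift \<nu> (k - l) l\<bar>) * ((norm u + norm v) * norm (u - v))"
    unfolding d_def by (rule advection_diff_le[OF S(1) cmod_mode_coeff_le cmod_mode_coeff_le])
     (simp add: cmod_mode_coeff_le flip: mode_coeff_linear(1))
   also have "\<dots> \<le> e" unfolding e_def using CS[OF that] by (intro mult_right_mono) auto
   finally show ?thesis .
  qed
  have "norm (F u - F v) \<le> (\<Sum>k\<in>S. cmod (N (mode_coeff u) k - N (mode_coeff v) k))"
   unfolding F_def mode_functional_diff[OF S(1)] by (rule norm_mode_functional_le[OF S(1)])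
  also have "\<dots> \<le> (\<Sum>k\<in>S. e)"
  proof (rule sum_mono)
   fix k assume k: "k \<in> S"
   have eq: "N (mode_coeff u) k - N (mode_coeff v) k = - ((1 / 2) *\<^sub>R (d k + cnj (d (- k))))"
    by (simp add: N_def d_def algebra_simps)
   have "cmod (d k + cnj (d (- k))) \<le> e + e"
    using norm_triangle_ineq[of "d k" "cnj (d (- k))"] adv[OF k] adv[OF S(2)[OF k]] by simp
   then show "cmod (N (mode_coeff u) k - N (mode_coeff v) k) \<le> e" unfolding eq by simp
  qed
  also have "\<dots> = m * e" by (simp add: m_def)
  finally show ?thesis by (simp only: e_def)
 qed
 have F0: "F 0 = 0"
  by (rule blinfun_eqI)
   (simp add: F_def apply_mode_functional[OF S(1)] N_def advection_def mode_coeff_def)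
 have rbound: "norm (r u *\<^sub>R u) \<le> R" and rlip: "norm (r u *\<^sub>R u - r v *\<^sub>R v) \<le> 2 * norm (u - v)" for u v
  unfolding r_def by (rule radial_retraction_Lipschitz[OF R])+
 define f where "f = (\<lambda>u. F (r u *\<^sub>R u))"
 have m: "0 \<le> m" by (simp add: m_def)
 have "norm (f u - f v) \<le> (4 * m * C * R + 1) * norm (u - v)" for u v
 proof -
  have "norm (f u - f v) \<le> m * (C * ((norm (r u *\<^sub>R u) + norm (r v *\<^sub>R v)) * norm (r u *\<^sub>R u - r v *\<^sub>R v)))"
   unfolding f_def by (rule Fdiff)
  also have "\<dots> \<le> m * (C * ((R + R) * (2 * norm (u - v))))"
   using C R m by (intro mult_left_mono mult_mono add_mono rbound rlip) auto
  also have "\<dots> \<le> (4 * m * C * R + 1) * norm (u - v)" by (simp add: algebra_simps)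
  finally show ?thesis .
 qed
 moreover have "norm (f u) \<le> m * (C * (R * R))" for u
 proof -
  have "norm (f u) \<le> m * (C * (norm (r u *\<^sub>R u) * norm (r u *\<^sub>R u)))"
   using Fdiff[of "r u *\<^sub>R u" 0] unfolding f_def F0 by simp
  also have "\<dots> \<le> m * (C * (R * R))" using C R m rbound[of u] by (intro mult_left_mono mult_mono) auto
  finally show ?thesis .
 qed
 moreover have "0 < 4 * m * C * R + 1" using C R m by (intro add_nonneg_pos) auto
 ultimately obtain u where u0: "u 0 = mode_functional S a0"
  and u: "\<And>t. 0 \<le> t \<Longrightarrow> (u has_vector_derivative f (u t)) (at t within {0..})"
  using lipschitz_ode_global[of f "4 * m * C * R + 1" "m * (C * (R * R))"] by blast
 define a where "a = (\<lambda>t. mode_coeff (u t))"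
 define \<rho> where "\<rho> = (\<lambda>t. r (u t) * r (u t))"
 have N_scale: "N (mode_coeff (c *\<^sub>R v)) k = (c * c) *\<^sub>R N (mode_coeff v) k" for c v k
  unfolding N_def mode_coeff_linear(2) advection_scaleR
  by (simp add: scaleR_conv_of_real algebra_simps)
 have da: "((\<lambda>t. a t k) has_vector_derivative (if k \<in> S then \<rho> t *\<^sub>R N (a t) k else 0)) (at t within {0..})" if "0 \<le> t" for t k
  using bounded_linear.has_vector_derivative[OF mode_coeff_linear(3) u[OF that], of k]
  unfolding f_def Fap N_scale a_def \<rho>_def .
 have a00: "a 0 = a0"
  unfolding a_def u0 using a0(2) by (auto simp: mode_coeff_functional[OF S(1)])
 have supp: "a t k = 0" if "0 \<le> t" "k \<notin> S" for t k
  using derivative_zero_imp_eq_initial[of "\<lambda>t. a t k" t] da[of _ k] that a0(2) by (simp add: a00)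
 have herm: "hermitian (a t)" if t: "0 \<le> t" for t
  unfolding hermitian_def
 proof
  fix k
  have Nsym: "N v (- k) = cnj (N v k)" for v by (simp add: N_def add.commute)
  have "((\<lambda>t. a t (- k) - cnj (a t k)) has_vector_derivative 0) (at t within {0..})" if "0 \<le> t" for t
  proof -
   have "((\<lambda>t. a t (- k) - cnj (a t k)) has_vector_derivative
     (if - k \<in> S then \<rho> t *\<^sub>R N (a t) (- k) else 0) - cnj (if k \<in> S then \<rho> t *\<^sub>R N (a t) k else 0)) (at t within {0..})"
    by (intro has_vector_derivative_diff da that bounded_linear.has_vector_derivative[OF bounded_linear_cnj])
   moreover have "- k \<in> S \<longleftrightarrow> k \<in> S" using S(2)[of k] S(2)[of "- k"] by auto
   ultimately show ?thesis by (simp add: Nsym split: if_splits)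
  qed
  moreover have "a0 (- k) = cnj (a0 k)" by (rule a0(1)[unfolded hermitian_def, THEN spec])
  ultimately show "a t (- k) = cnj (a t k)"
   using derivative_zero_imp_eq_initial[of "\<lambda>t. a t (- k) - cnj (a t k)" t] t by (simp add: a00)
 qed
 have N_adv: "N (a t) k = - advection \<nu> S (a t) (a t) k" if "0 \<le> t" for t k
  using advection_hermitian[OF S herm[OF that] herm[OF that], of \<nu> k]
  by (simp add: N_def scaleR_conv_of_real)
 have energy: "(\<Sum>k\<in>S. (cmod (a t k))\<^sup>2) = (\<Sum>k\<in>S. (cmod (a 0 k))\<^sup>2)" if t: "0 \<le> t" for t
 proof (rule derivative_zero_imp_eq_initial[OF _ t])
  fix t :: real assume t: "0 \<le> t"
  have "((\<lambda>t. \<Sum>k\<in>S. (cmod (a t k))\<^sup>2) has_real_derivative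
    (\<Sum>k\<in>S. 2 * Re (cnj (a t k) * (\<rho> t *\<^sub>R N (a t) k)))) (at t within {0..})"
  proof (intro DERIV_sum has_derivative_cmod_sq)
   fix k assume "k \<in> S"
   then show "((\<lambda>t. a t k) has_vector_derivative \<rho> t *\<^sub>R N (a t) k) (at t within {0..})"
    using da[OF t, of k] by simp
  qed
  also have "(\<Sum>k\<in>S. 2 * Re (cnj (a t k) * (\<rho> t *\<^sub>R N (a t) k))) =
    - (2 * \<rho> t) * Re (\<Sum>k\<in>S. cnj (a t k) * advection \<nu> S (a t) (a t) k)"
   unfolding N_adv[OF t] Re_sum sum_distrib_left by (intro sum.cong refl) (simp add: algebra_simps)
  also have "\<dots> = 0" using advection_neutral[OF S(1) herm[OF t]] by simp
  finally show "((\<lambda>t. \<Sum>k\<in>S. (cmod (a t k))\<^sup>2) has_vector_derivative 0) (at t within {0..})"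
   by (simp add: has_real_derivative_iff_has_vector_derivative)
 qed
 have \<rho>1: "\<rho> t = 1" if t: "0 \<le> t" for t
 proof -
  have P: "bounded_linear (\<lambda>v. mode_functional S (mode_coeff v))"
  proof (rule bounded_linear_intro[where K = m])
   fix v w :: mode_state and c :: real
   show "mode_functional S (mode_coeff (v + w)) = mode_functional S (mode_coeff v) + mode_functional S (mode_coeff w)"
    "mode_functional S (mode_coeff (c *\<^sub>R v)) = c *\<^sub>R mode_functional S (mode_coeff v)"
    by (rule blinfun_eqI; simp add: apply_mode_functional[OF S(1)] mode_coeff_def blinfun.add_left
      blinfun.scaleR_left scaleR_right_distrib sum.distrib scaleR_sum_right mult.commute)+
   have "(\<Sum>k\<in>S. cmod (mode_coeff v k)) \<le> (\<Sum>k\<in>S. norm v)" by (intro sum_mono cmod_mode_coeff_le)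
   then show "norm (mode_functional S (mode_coeff v)) \<le> norm v * m"
    using norm_mode_functional_le[OF S(1), of "mode_coeff v"] by (simp add: m_def mult.commute)
  qed
  have PF: "mode_functional S (mode_coeff (F v)) = F v" for v
   by (rule blinfun_eqI) (simp add: F_def apply_mode_functional[OF S(1)] mode_coeff_functional[OF S(1)])
  have "((\<lambda>t. u t - mode_functional S (mode_coeff (u t))) has_vector_derivative 0) (at t within {0..})" if "0 \<le> t" for t
   using has_vector_derivative_diff[OF u[OF that] bounded_linear.has_vector_derivative[OF P u[OF that]]]
   by (simp add: f_def PF)
  from derivative_zero_imp_eq_initial[OF this t]
  have "u t - mode_functional S (a t) = u 0 - mode_functional S (mode_coeff (u 0))" by (simp add: a_def)
  moreover have "mode_functional S (mode_coeff (u 0)) = u 0"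
   by (rule blinfun_eqI) (simp add: u0 apply_mode_functional[OF S(1)] mode_coeff_functional[OF S(1)])
  ultimately have ut: "u t = mode_functional S (a t)" by simp
  have "cmod (a t k) \<le> L2_set (\<lambda>k. cmod (a0 k)) S" if "k \<in> S" for k
  proof -
   have "(cmod (a t k))\<^sup>2 \<le> (\<Sum>k\<in>S. (cmod (a t k))\<^sup>2)" using that S(1) by (intro member_le_sum) auto
   then show ?thesis unfolding energy[OF t] L2_set_def a00 by (rule real_le_rsqrt)
  qed
  then have "(\<Sum>k\<in>S. cmod (a t k)) \<le> (\<Sum>k\<in>S. L2_set (\<lambda>k. cmod (a0 k)) S)" by (rule sum_mono)
  then have "norm (u t) \<le> R"
   using norm_mode_functional_le[OF S(1), of "a t"] unfolding ut by (simp add: R_def)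
  then show ?thesis using R by (simp add: \<rho>_def r_def max_def)
 qed
 have "galerkin_solution \<nu> S a0 a"
  unfolding galerkin_solution_def
 proof (intro conjI allI impI ballI)
  fix t :: real and k assume t: "0 \<le> t" and "k \<in> S"
  then show "((\<lambda>t. a t k) has_vector_derivative - advection \<nu> S (a t) (a t) k) (at t within {0..})"
   using da[OF t, of k] by (simp add: \<rho>1[OF t] N_adv[OF t])
 qed (use a00 herm supp in auto)
 then show ?thesis by blast
qed

section \<open>Gevrey bounds for Galerkin approximations\<close>

lemma nonpos_derivative_imp_le:
 fixes f :: "real \<Rightarrow> real"
 assumes "a \<le> b" and d: "\<And>t. a \<le> t \<Longrightarrow> t \<le> b \<Longrightarrow> (f has_real_derivative f' t) (at t within {a..b})"
  and "\<And>t. a \<le> t \<Longrightarrow> t \<le> b \<Longrightarrow> f' t \<le> 0"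
 shows "f b \<le> f a"
proof -
 have "\<exists>x\<in>{a..b}. f b - f a = (*) (f' x) (b - a)"
  by (rule mvt_very_simple) (use assms in \<open>auto simp: has_field_derivative_def\<close>)
 then obtain x where "x \<in> {a..b}" "f b - f a = f' x * (b - a)" by auto
 then show ?thesis using assms mult_nonpos_nonneg[of "f' x" "b - a"] by auto
qed

text \<open>\<open>E\<close> does not increase while it is below \<open>4 * e\<close>, so it never leaves that range.\<close>

lemma continuity_bootstrap:
 fixes E E' :: "real \<Rightarrow> real"
 assumes d: "\<And>t. 0 \<le> t \<Longrightarrow> (E has_real_derivative E' t) (at t within {0..})"
  and E0: "E 0 \<le> e" and e: "0 < e"
  and neg: "\<And>t. 0 \<le> t \<Longrightarrow> t \<le> T \<Longrightarrow> E t \<le> 4 * e \<Longrightarrow> E' t \<le> 0"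
  and t: "0 \<le> t" "t \<le> T"
 shows "E t \<le> e"
proof (rule ccontr)
 assume "\<not> E t \<le> e"
 define c where "c = min (E t) (4 * e)"
 have c: "e < c" "c \<le> E t" "c \<le> 4 * e" using \<open>\<not> E t \<le> e\<close> e by (auto simp: c_def)
 have cont: "continuous_on {0..t} E"
  by (rule continuous_on_subset[of "{0..}"])
   (use d in \<open>auto intro!: DERIV_continuous_on[of "{0..}" E E']\<close>)
 define A where "A = {s \<in> {0..t}. c \<le> E s}"
 have "closed A" unfolding A_def
  by (rule continuous_closed_preimage[of "{0..t}" E "{c..}", simplified vimage_def, simplified Int_def mem_Collect_eq atLeast_iff]) (use cont in auto)
 moreover have "bounded A" by (rule bounded_subset[of "{0..t}"]) (auto simp: A_def)
 ultimately have "compact A" by (simp add: compact_eq_bounded_closed)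
 moreover have "t \<in> A" using t c by (simp add: A_def)
 ultimately obtain s where s: "s \<in> A" "\<And>r. r \<in> A \<Longrightarrow> s \<le> r"
  using compact_attains_inf[of A] by blast
 have s0: "0 \<le> s" "s \<le> t" "c \<le> E s" using s(1) by (auto simp: A_def)
 have below: "E r < c" if "0 \<le> r" "r < s" for r
  using s(2)[of r] that s0 by (force simp: A_def)
 have spos: "0 < s" using E0 c s0 by (cases "s = 0") auto
 have "E s \<le> c"
 proof (rule tendsto_upperbound)
  show "(E \<longlongrightarrow> E s) (at s within {0..<s})"
  proof (rule tendsto_within_subset)
   show "(E \<longlongrightarrow> E s) (at s within {0..t})" using cont s0 by (simp add: continuous_on_def)
  qed (use s0 in auto)
  show "\<forall>\<^sub>F r in at s within {0..<s}. E r \<le> c"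
   unfolding eventually_at_filter by (rule always_eventually) (use below in force)
  show "at s within {0..<s} \<noteq> bot"
   using spos by (simp add: at_within_eq_bot_iff)
 qed
 have "E s \<le> E 0"
 proof (rule nonpos_derivative_imp_le[where f = E and f' = E' and a = 0 and b = s])
  fix r assume r: "0 \<le> r" "r \<le> s"
  show "(E has_real_derivative E' r) (at r within {0..s})"
   by (rule has_field_derivative_subset[OF d]) (use r in auto)
  have "E r \<le> c" using below[of r] r \<open>E s \<le> c\<close> by (cases "r = s") auto
  then show "E' r \<le> 0" using neg[of r] r s0 t c by simp
 qed (use s0 in auto)
 then show False using E0 c s0 by linarith
qed

text \<open>The Gevrey norm with shrinking radius \<open>\<tau>0 * exp (- R t)\<close> cannot grow as long as the
 dissipation \<open>R * \<tau>\<close> gained from the shrinking beats the trilinear term. The factor 2 leaves room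
 for a continuity argument.\<close>

lemma galerkin_gevrey_bound:
 fixes \<nu> \<sigma> \<tau>0 \<beta> R G T :: real
 assumes \<nu>: "0 < \<nu>" and \<sigma>: "0 < \<sigma>" "\<sigma> \<le> 1" and \<tau>0: "0 < \<tau>0"
  and S: "finite S" "0 \<notin> S" and sol: "galerkin_solution \<nu> S a0 a"
  and G: "0 < G" "L2_set (\<lambda>k. exp (\<tau>0 * mode_norm k powr \<sigma>) * cmod (a0 k)) S \<le> G"
  and form: "\<And>t i m. 0 \<le> t \<Longrightarrow> t \<le> T \<Longrightarrow>
   L2_set (\<lambda>k. exp (\<tau>0 * exp (- R * t) * mode_norm k powr \<sigma>) * cmod (a t k)) S \<le> 2 * G \<Longrightarrow>
   form_bound S (strain \<nu> i m (a t)) \<beta>"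
  and R: "4 * \<beta> + trilinear_const \<sigma> / \<nu> * (2 * G) \<le> R"
  and t: "0 \<le> t" "t \<le> T"
 shows "L2_set (\<lambda>k. exp (\<tau>0 * exp (- R * t) * mode_norm k powr \<sigma>) * cmod (a t k)) S \<le> G"
proof -
 define \<tau> where "\<tau> = (\<lambda>t. \<tau>0 * exp (- R * t))"
 have \<tau>: "0 < \<tau> t" for t using \<tau>0 by (simp add: \<tau>_def)
 define w where "w = (\<lambda>t k. exp (\<tau> t * mode_norm k powr \<sigma>))"
 define Y where "Y = (\<lambda>t. L2_set (\<lambda>k. w t k * cmod (a t k)) S)"
 define Z where "Z = (\<lambda>t. L2_set (\<lambda>k. mode_norm k powr (\<sigma> / 2) * (w t k * cmod (a t k))) S)"
 define X where "X = (\<lambda>t. Re (\<Sum>k\<in>S. of_real ((w t k)\<^sup>2) * cnj (a t k) * advection \<nu> S (a t) (a t) k))"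
 define E' where "E' = (\<lambda>t. - 2 * R * \<tau> t * (Z t)\<^sup>2 - 2 * X t)"
 have Ynn: "0 \<le> Y t" for t by (simp add: Y_def L2_set_nonneg)
 have dE: "((\<lambda>t. (Y t)\<^sup>2) has_real_derivative E' t) (at t within {0..})" if t: "0 \<le> t" for t
 proof -
  let ?g = "\<lambda>k. mode_norm k powr \<sigma>"
  have "((\<lambda>t. \<Sum>k\<in>S. (w t k)\<^sup>2 * (cmod (a t k))\<^sup>2) has_real_derivative
   (\<Sum>k\<in>S. (2 * (- R * \<tau> t) * ?g k * (w t k)\<^sup>2) * (cmod (a t k))\<^sup>2
     + 2 * Re (cnj (a t k) * (- advection \<nu> S (a t) (a t) k)) * (w t k)\<^sup>2)) (at t within {0..})"
  proof (intro DERIV_sum DERIV_mult)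
   fix k assume k: "k \<in> S"
   show "((\<lambda>t. (w t k)\<^sup>2) has_real_derivative 2 * (- R * \<tau> t) * ?g k * (w t k)\<^sup>2) (at t within {0..})"
    unfolding w_def \<tau>_def
    by (rule derivative_eq_intros refl)+ (simp add: power2_eq_square algebra_simps)
   show "((\<lambda>t. (cmod (a t k))\<^sup>2) has_real_derivative 2 * Re (cnj (a t k) * (- advection \<nu> S (a t) (a t) k))) (at t within {0..})"
    using sol t k by (intro has_derivative_cmod_sq) (auto simp: galerkin_solution_def)
  qed
  also have "(\<lambda>t. \<Sum>k\<in>S. (w t k)\<^sup>2 * (cmod (a t k))\<^sup>2) = (\<lambda>t. (Y t)\<^sup>2)"
   by (simp add: Y_def L2_set_sq power_mult_distrib)
  also have "(\<Sum>k\<in>S. (2 * (- R * \<tau> t) * ?g k * (w t k)\<^sup>2) * (cmod (a t k))\<^sup>2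
     + 2 * Re (cnj (a t k) * (- advection \<nu> S (a t) (a t) k)) * (w t k)\<^sup>2) = E' t"
  proof -
   have gg: "(mode_norm k powr (\<sigma> / 2))\<^sup>2 = ?g k" for k
    by (simp add: power2_eq_square powr_add[symmetric])
   have Z2: "(Z t)\<^sup>2 = (\<Sum>k\<in>S. ?g k * ((w t k)\<^sup>2 * (cmod (a t k))\<^sup>2))"
    by (simp add: Z_def L2_set_sq power_mult_distrib gg)
   have "Re (of_real ((w t k)\<^sup>2) * cnj (a t k) * advection \<nu> S (a t) (a t) k) =
     (w t k)\<^sup>2 * Re (cnj (a t k) * advection \<nu> S (a t) (a t) k)" for k
    unfolding mult.assoc by simp
   then have X: "X t = (\<Sum>k\<in>S. (w t k)\<^sup>2 * Re (cnj (a t k) * advection \<nu> S (a t) (a t) k))"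
    by (simp only: X_def Re_sum)
   show ?thesis unfolding E'_def Z2 X sum_distrib_left sum_subtractf[symmetric]
    by (intro sum.cong refl) (simp add: algebra_simps)
  qed
  finally show ?thesis .
 qed
 have "(Y t)\<^sup>2 \<le> G\<^sup>2"
 proof (rule continuity_bootstrap[OF dE _ _ _ t])
  have "w 0 = (\<lambda>k. exp (\<tau>0 * mode_norm k powr \<sigma>))" by (simp add: w_def \<tau>_def)
  then have "Y 0 \<le> G" using G sol by (simp add: Y_def galerkin_solution_def)
  then show "(Y 0)\<^sup>2 \<le> G\<^sup>2" using Ynn by (intro power_mono)
  show "0 < G\<^sup>2" using G by simp
  fix t assume t: "0 \<le> t" "t \<le> T" and "(Y t)\<^sup>2 \<le> 4 * G\<^sup>2"
  then have "(Y t)\<^sup>2 \<le> (2 * G)\<^sup>2" by (simp add: power_mult_distrib)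
  then have Y2: "Y t \<le> 2 * G" by (rule power2_le_imp_le) (use G in simp)
  have fb: "form_bound S (strain \<nu> i m (a t)) \<beta>" for i m
   using form[OF t] Y2 by (simp add: Y_def w_def \<tau>_def)
  have "\<bar>X t\<bar> \<le> \<tau> t * (4 * \<beta> + trilinear_const \<sigma> / \<nu> * Y t) * (Z t)\<^sup>2"
   unfolding X_def Y_def Z_def w_def
   by (rule gevrey_trilinear_le[OF \<nu> \<sigma> \<tau> S _ _ fb])
    (use sol t in \<open>auto simp: galerkin_solution_def\<close>)
  also have "\<dots> \<le> \<tau> t * R * (Z t)\<^sup>2"
  proof (intro mult_right_mono mult_left_mono)
   have "trilinear_const \<sigma> / \<nu> * Y t \<le> trilinear_const \<sigma> / \<nu> * (2 * G)"
    using Y2 \<nu> \<sigma> by (intro mult_left_mono) (auto simp: trilinear_const_def intro!: divide_nonneg_pos add_nonneg_nonneg)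
   then show "4 * \<beta> + trilinear_const \<sigma> / \<nu> * Y t \<le> R" using R by linarith
  qed (use \<tau>[of t] in auto)
  finally have "- X t \<le> \<tau> t * R * (Z t)\<^sup>2" by (simp only: abs_le_iff)
  moreover have "- 2 * R * \<tau> t * (Z t)\<^sup>2 = - 2 * (\<tau> t * R * (Z t)\<^sup>2)" by simp
  ultimately show "E' t \<le> 0" unfolding E'_def by linarith
 qed
 then have "Y t \<le> G" by (rule power2_le_imp_le) (use G in simp)
 then show ?thesis by (simp add: Y_def w_def \<tau>_def)
qed

lemma sum_cmod_form_bound:
 assumes S: "finite S" and B: "\<And>T. finite T \<Longrightarrow> (\<Sum>j\<in>T. cmod (c j)) \<le> B"
 shows "form_bound S c B"
 unfolding form_bound_def
proof (intro conjI allI)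
 show "0 \<le> B" using B[of "{}"] by simp
 fix F G :: "int \<times> int \<Rightarrow> complex"
 let ?T = "(\<lambda>(k, l). k - l) ` (S \<times> S)"
 let ?c = "\<lambda>j. if j \<in> ?T then cmod (c j) else 0"
 have T: "finite ?T" using S by simp
 have "cmod (\<Sum>k\<in>S. \<Sum>l\<in>S. c (k - l) * F l * cnj (G k)) = cmod (\<Sum>(k, l)\<in>S \<times> S. c (k - l) * F l * cnj (G k))"
  by (simp add: sum.cartesian_product)
 also have "\<dots> \<le> (\<Sum>(k, l)\<in>S \<times> S. ?c (k - l) * (cmod (F l) * cmod (G k)))"
 proof (rule sum_norm_le)
  fix p assume p: "p \<in> S \<times> S"
  then have "fst p - snd p \<in> ?T" by (intro image_eqI[of _ _ p]) (simp_all add: case_prod_unfold)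
  then show "cmod (case p of (k, l) \<Rightarrow> c (k - l) * F l * cnj (G k)) \<le>
    (case p of (k, l) \<Rightarrow> ?c (k - l) * (cmod (F l) * cmod (G k)))"
   by (simp add: case_prod_unfold norm_mult)
 qed
 also have "\<dots> \<le> sum ?c ?T * (L2_set (\<lambda>k. cmod (F k)) S * L2_set (\<lambda>k. cmod (G k)) S)"
  by (rule convolution_form_le[OF S _ _ T]) auto
 also have "sum ?c ?T = (\<Sum>j\<in>?T. cmod (c j))" by (rule sum.cong) auto
 also have "\<dots> * (L2_set (\<lambda>k. cmod (F k)) S * L2_set (\<lambda>k. cmod (G k)) S)
   \<le> B * (L2_set (\<lambda>k. cmod (F k)) S * L2_set (\<lambda>k. cmod (G k)) S)"
  by (intro mult_right_mono B T mult_nonneg_nonneg L2_set_nonneg)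
 finally show "cmod (\<Sum>k\<in>S. \<Sum>l\<in>S. c (k - l) * F l * cnj (G k)) \<le>
   B * L2_set (\<lambda>k. cmod (F k)) S * L2_set (\<lambda>k. cmod (G k)) S" by (simp add: mult.assoc)
qed

lemma form_bound_add:
 assumes "form_bound S c B" "form_bound S d D"
 shows "form_bound S (\<lambda>j. c j + d j) (B + D)"
 unfolding form_bound_def
proof (intro conjI allI)
 fix F G :: "int \<times> int \<Rightarrow> complex"
 have "cmod (\<Sum>k\<in>S. \<Sum>l\<in>S. (c (k - l) + d (k - l)) * F l * cnj (G k)) \<le>
   cmod (\<Sum>k\<in>S. \<Sum>l\<in>S. c (k - l) * F l * cnj (G k)) + cmod (\<Sum>k\<in>S. \<Sum>l\<in>S. d (k - l) * F l * cnj (G k))"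
  unfolding distrib_right sum.distrib by (rule norm_triangle_ineq)
 also have "\<dots> \<le> B * L2_set (\<lambda>k. cmod (F k)) S * L2_set (\<lambda>k. cmod (G k)) S
   + D * L2_set (\<lambda>k. cmod (F k)) S * L2_set (\<lambda>k. cmod (G k)) S"
  using assms by (intro add_mono) (auto simp: form_bound_def)
 finally show "cmod (\<Sum>k\<in>S. \<Sum>l\<in>S. (c (k - l) + d (k - l)) * F l * cnj (G k)) \<le>
   (B + D) * L2_set (\<lambda>k. cmod (F k)) S * L2_set (\<lambda>k. cmod (G k)) S" by (simp add: algebra_simps)
qed (use assms in \<open>simp add: form_bound_def\<close>)

lemma form_bound_mono: "form_bound S c B \<Longrightarrow> B \<le> B' \<Longrightarrow> form_bound S c B'"
 unfolding form_bound_def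
proof (intro conjI allI)
 fix F G :: "int \<times> int \<Rightarrow> complex"
 assume *: "0 \<le> B \<and> (\<forall>F G. cmod (\<Sum>k\<in>S. \<Sum>l\<in>S. c (k - l) * F l * cnj (G k)) \<le>
   B * L2_set (\<lambda>k. cmod (F k)) S * L2_set (\<lambda>k. cmod (G k)) S)" and le: "B \<le> B'"
 have "B * L2_set (\<lambda>k. cmod (F k)) S * L2_set (\<lambda>k. cmod (G k)) S \<le>
   B' * L2_set (\<lambda>k. cmod (F k)) S * L2_set (\<lambda>k. cmod (G k)) S"
  by (intro mult_right_mono le L2_set_nonneg)
 then show "cmod (\<Sum>k\<in>S. \<Sum>l\<in>S. c (k - l) * F l * cnj (G k)) \<le>
   B' * L2_set (\<lambda>k. cmod (F k)) S * L2_set (\<lambda>k. cmod (G k)) S"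
  using * order_trans by blast
qed simp

lemma cmod_strain_le:
 assumes "0 < \<nu>"
 shows "cmod (strain \<nu> i m a j) \<le> 1 / \<nu> * (cmod (a j) / mode_norm j)"
proof (cases "j = 0")
 case False
 have J: "0 < mode_norm j" by (rule mode_norm_pos[OF False])
 have "\<bar>ipmb_symbol \<nu> i j\<bar> \<le> 1 / (\<nu> * (mode_norm j)\<^sup>2)"
 proof (rule order_trans[OF abs_ipmb_symbol_le])
  show "1 / (1 + \<nu> * (mode_norm j)\<^sup>2) \<le> 1 / (\<nu> * (mode_norm j)\<^sup>2)"
   by (rule frac_le) (use assms False in auto)
 qed (use assms in simp)
 then have "\<bar>ipmb_symbol \<nu> i j\<bar> * \<bar>component m j\<bar> \<le> 1 / (\<nu> * (mode_norm j)\<^sup>2) * mode_norm j"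
  using assms by (intro mult_mono abs_component_le) auto
 also have "\<dots> = 1 / \<nu> * (1 / mode_norm j)" using J assms by (simp add: power2_eq_square)
 finally have "\<bar>ipmb_symbol \<nu> i j * component m j\<bar> * cmod (a j) \<le> 1 / \<nu> * (1 / mode_norm j) * cmod (a j)"
  unfolding abs_mult by (rule mult_right_mono) simp
 then show ?thesis by (simp add: strain_def norm_mult abs_mult)
qed (simp add: strain_def ipmb_symbol_def)

text \<open>The \<open>L\<^sup>2\<close>-based bound on the strain fails only logarithmically: an arbitrarily small power
 \<open>\<tau> powr - \<epsilon>\<close> is lost, with constant of order \<open>1 / sqrt \<epsilon>\<close>.\<close>

lemma strain_form_bound_crude:
 assumes \<nu>: "0 < \<nu>" and \<sigma>: "0 < \<sigma>" and \<tau>: "0 < \<tau>" and \<epsilon>: "0 < \<epsilon>" "\<epsilon> \<le> 1"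
  and S: "finite S" "0 \<notin> S" and supp: "\<And>k. k \<notin> S \<Longrightarrow> a k = 0"
 shows "form_bound S (strain \<nu> i m a)
   (1 / \<nu> * (\<tau> powr (- \<epsilon>) * sqrt (12 * (1 + 1 / (2 * \<epsilon> * \<sigma>))) * L2_set (\<lambda>k. exp (\<tau> * mode_norm k powr \<sigma>) * cmod (a k)) S))"
proof (rule sum_cmod_form_bound[OF S(1)])
 fix T :: "(int \<times> int) set" assume T: "finite T"
 let ?b = "\<lambda>k. exp (\<tau> * mode_norm k powr \<sigma>) * cmod (a k)"
 let ?p = "\<epsilon> * \<sigma>"
 have ptw: "cmod (a j) / mode_norm j \<le> \<tau> powr (- \<epsilon>) * (mode_norm j powr (- 1 - ?p) * ?b j)" if "j \<in> S" for j
 proof -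
  have "j \<noteq> 0" using that S(2) by auto
  then have J: "0 < mode_norm j" by (rule mode_norm_pos)
  let ?y = "\<tau> * mode_norm j powr \<sigma>"
  have y: "0 < ?y" using \<tau> \<open>j \<noteq> 0\<close> by simp
  have "?y powr \<epsilon> \<le> exp ?y"
  proof -
   have "?y powr \<epsilon> \<le> (1 + ?y) powr \<epsilon>" using y \<epsilon> by (intro powr_mono2) auto
   also have "\<dots> \<le> (1 + ?y) powr 1" using y \<epsilon> by (intro powr_mono) auto
   also have "\<dots> \<le> exp ?y" using y exp_ge_add_one_self[of ?y] by simp
   finally show ?thesis .
  qed
  moreover have "0 < ?y powr \<epsilon>" using y by (metis less_irrefl powr_gt_zero)
  ultimately have "1 \<le> exp ?y / ?y powr \<epsilon>" by (simp only: le_divide_eq_1_pos)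
  then have "1 \<le> ?y powr (- \<epsilon>) * exp ?y" by (simp only: powr_minus_divide) simp
  also have "?y powr (- \<epsilon>) = \<tau> powr (- \<epsilon>) * mode_norm j powr (- ?p)"
   using \<tau> J by (simp add: powr_mult powr_powr mult.commute)
  finally have "1 * (cmod (a j) / mode_norm j) \<le> (\<tau> powr (- \<epsilon>) * mode_norm j powr (- ?p) * exp ?y) * (cmod (a j) / mode_norm j)"
   using J by (intro mult_right_mono) auto
  also have "\<dots> = \<tau> powr (- \<epsilon>) * (mode_norm j powr (- 1 - ?p) * ?b j)"
   using J by (simp add: powr_diff powr_minus field_simps)
  finally show ?thesis by simp
 qed
 have "(\<Sum>j\<in>T. cmod (strain \<nu> i m a j)) = (\<Sum>j\<in>T \<inter> S. cmod (strain \<nu> i m a j))"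
  by (rule sum.mono_neutral_right) (use T supp in \<open>auto simp: strain_def\<close>)
 also have "\<dots> \<le> (\<Sum>j\<in>S. cmod (strain \<nu> i m a j))" by (rule sum_mono2) (use S in auto)
 also have "\<dots> \<le> (\<Sum>j\<in>S. 1 / \<nu> * (\<tau> powr (- \<epsilon>) * (mode_norm j powr (- 1 - ?p) * ?b j)))"
  by (rule sum_mono, rule order_trans[OF cmod_strain_le[OF \<nu>]], rule mult_left_mono, rule ptw) (use \<nu> in auto)
 also have "\<dots> = 1 / \<nu> * (\<tau> powr (- \<epsilon>) * (\<Sum>j\<in>S. mode_norm j powr (- 1 - ?p) * ?b j))"
  by (simp add: sum_distrib_left)
 also have "\<dots> \<le> 1 / \<nu> * (\<tau> powr (- \<epsilon>) * (sqrt (12 * (1 + 1 / (2 * \<epsilon> * \<sigma>))) * L2_set ?b S))"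
 proof (intro mult_left_mono sum_pairs_Cauchy_Schwarz)
  have "(\<Sum>j\<in>S. (mode_norm j powr (- 1 - ?p))\<^sup>2) = (\<Sum>j\<in>S. mode_norm j powr (- 2 - 2 * ?p))"
   by (simp add: power2_eq_square powr_add[symmetric])
  also have "\<dots> \<le> 12 * (1 + 1 / (2 * ?p))"
   by (rule sum_mode_norm_powr_le) (use S \<epsilon> \<sigma> in auto)
  finally show "(\<Sum>j\<in>S. (mode_norm j powr (- 1 - ?p))\<^sup>2) \<le> (sqrt (12 * (1 + 1 / (2 * \<epsilon> * \<sigma>))))\<^sup>2"
   using \<epsilon> \<sigma> by (simp add: mult.assoc)
  show "(\<Sum>j\<in>S. (?b j)\<^sup>2) \<le> (L2_set ?b S)\<^sup>2" by (simp add: L2_set_sq)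
 qed (use \<nu> \<epsilon> \<sigma> in \<open>auto simp: L2_set_nonneg\<close>)
 finally show "(\<Sum>j\<in>T. cmod (strain \<nu> i m a j)) \<le>
   1 / \<nu> * (\<tau> powr (- \<epsilon>) * sqrt (12 * (1 + 1 / (2 * \<epsilon> * \<sigma>))) * L2_set ?b S)" by (simp add: mult.assoc)
qed

section \<open>Fourier series on the torus\<close>

subsection \<open>Integration over the period cell\<close>

definition cell_measure :: "(real \<times> real) measure" where
 "cell_measure = restrict_space lborel torus_cell"

lemma torus_cell_eq_cbox: "torus_cell = cbox (0, 0) (2 * pi, 2 * pi)"
 by (simp add: torus_cell_def cbox_Pair_eq)

lemma torus_cell_sets [measurable, simp]: "torus_cell \<in> sets borel"
 by (simp add: torus_cell_eq_cbox)

lemma space_cell_measure [simp]: "space cell_measure = torus_cell"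
 by (simp add: cell_measure_def space_restrict_space)

lemma measure_cell: "measure cell_measure torus_cell = (2 * pi)\<^sup>2" "emeasure cell_measure torus_cell < \<infinity>"
proof -
 have "emeasure cell_measure torus_cell = emeasure lborel torus_cell"
  by (simp add: cell_measure_def emeasure_restrict_space)
 also have "\<dots> = ennreal ((2 * pi)\<^sup>2)"
  unfolding torus_cell_eq_cbox
  by (subst emeasure_lborel_cbox) (auto simp: Basis_prod_def inner_Pair power2_eq_square)
 finally have e: "emeasure cell_measure torus_cell = ennreal ((2 * pi)\<^sup>2)" .
 then show "measure cell_measure torus_cell = (2 * pi)\<^sup>2" "emeasure cell_measure torus_cell < \<infinity>"
  by (auto simp: measure_def)
qed

interpretation cell: finite_measure cell_measure
 by standard (use measure_cell(2) in auto)

lemma borel_measurable_cellI: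
 "f \<in> borel_measurable borel \<Longrightarrow> f \<in> borel_measurable cell_measure"
 unfolding cell_measure_def by (intro measurable_restrict_space1) simp

lemma set_lebesgue_integral_cell:
 fixes f :: "real \<times> real \<Rightarrow> 'a::{banach, second_countable_topology}"
 shows "(LINT x:torus_cell|lborel. f x) = (LINT x|cell_measure. f x)"
 unfolding cell_measure_def set_lebesgue_integral_def by (subst integral_restrict_space) auto

lemma integrable_cell_bounded:
 fixes f :: "real \<times> real \<Rightarrow> 'a::{banach, second_countable_topology}"
 assumes "f \<in> borel_measurable cell_measure" "\<And>x. x \<in> torus_cell \<Longrightarrow> norm (f x) \<le> B"
 shows "integrable cell_measure f"
 by (rule cell.integrable_const_bound[where B = B]) (use assms in auto)

lemma compact_torus_cell: "compact torus_cell"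
 by (simp add: torus_cell_eq_cbox)

lemma borel_measurable_cell_continuous:
 fixes f :: "real \<times> real \<Rightarrow> 'a::{banach, second_countable_topology}"
 assumes "continuous_on torus_cell f"
 shows "f \<in> borel_measurable cell_measure"
proof -
 have "f \<in> borel_measurable (restrict_space borel torus_cell)"
  by (rule borel_measurable_continuous_on_restrict[OF assms])
 moreover have "sets (restrict_space borel torus_cell) = sets cell_measure"
  unfolding cell_measure_def by (rule sets_restrict_space_cong) simp
 ultimately show ?thesis using measurable_cong_sets by blast
qed

lemma integrable_cell_continuous:
 fixes f :: "real \<times> real \<Rightarrow> 'a::{banach, second_countable_topology}"
 assumes "continuous_on torus_cell f"
 shows "integrable cell_measure f"
proof -
 have "bounded (f ` torus_cell)"
  by (intro compact_imp_bounded compact_continuous_image assms compact_torus_cell)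
 then obtain B where "\<And>x. x \<in> torus_cell \<Longrightarrow> norm (f x) \<le> B" by (auto simp: bounded_iff)
 then show ?thesis by (rule integrable_cell_bounded[OF borel_measurable_cell_continuous[OF assms]])
qed

lemma integral_cell_eq:
 fixes f :: "real \<times> real \<Rightarrow> 'a::euclidean_space"
 assumes "continuous_on torus_cell f"
 shows "(LINT x|cell_measure. f x) = integral torus_cell f"
proof -
 have "set_integrable lborel torus_cell f"
  unfolding set_integrable_def
  by (rule borel_integrable_compact[OF compact_torus_cell assms])
 then show ?thesis
  using set_borel_integral_eq_integral(2) set_lebesgue_integral_cell by metis
qed

lemma integral_cell_bound:
 fixes f :: "real \<times> real \<Rightarrow> 'a::{banach, second_countable_topology}"
 assumes "\<And>x. x \<in> torus_cell \<Longrightarrow> norm (f x) \<le> B" "0 \<le> B"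
 shows "norm (LINT x|cell_measure. f x) \<le> (2 * pi)\<^sup>2 * B"
proof -
 have "norm (LINT x|cell_measure. f x) \<le> (LINT x|cell_measure. norm (f x))" by (rule integral_norm_bound)
 also have "\<dots> \<le> (LINT x|cell_measure. B)"
 proof (cases "integrable cell_measure (\<lambda>x. norm (f x))")
  case True
  then show ?thesis by (rule integral_mono) (use assms in auto)
 qed (use assms in \<open>simp add: not_integrable_integral_eq\<close>)
 also have "\<dots> = (2 * pi)\<^sup>2 * B" using measure_cell by simp
 finally show ?thesis .
qed

subsection \<open>Characters\<close>

definition mode :: "int \<times> int \<Rightarrow> real \<times> real \<Rightarrow> complex" where
 "mode k x = cis (mode_phase k x)"

lemma mode_add: "mode (k + l) x = mode k x * mode l x"
 by (simp add: mode_def cis_mult mode_phase_def algebra_simps)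

lemma mode_minus: "mode (- k) x = cnj (mode k x)"
 by (simp add: mode_def cis_cnj mode_phase_def)

lemma mode_diff: "mode (k - l) x = mode k x * cnj (mode l x)"
 using mode_add[of k "- l" x] by (simp add: mode_minus)

lemma mode_zero [simp]: "mode 0 x = 1"
 by (simp add: mode_def mode_phase_def)

lemma cmod_mode [simp]: "cmod (mode k x) = 1"
 by (simp add: mode_def)

lemma mode_shift: "mode k (x + y) = mode k x * mode k y"
 by (simp add: mode_def cis_mult mode_phase_def algebra_simps)

lemma continuous_on_mode [continuous_intros]: "continuous_on A (mode k)"
 unfolding mode_def mode_phase_def cis_conv_exp by (intro continuous_intros)

lemma mode_periodic: "mode k (x + 2 * pi, y) = mode k (x, y)" "mode k (x, y + 2 * pi) = mode k (x, y)"
proof -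
 have e: "cis (of_int n * (t + 2 * pi)) = cis (of_int n * t)" for n :: int and t
 proof -
  have "cis (2 * pi * of_int n) = 1" by (rule cis_multiple_2pi) simp
  then show ?thesis by (simp add: distrib_left cis_mult[symmetric] mult.commute[of _ "2 * pi"])
 qed
 have "mode k (x, y) = cis (of_int (fst k) * x) * cis (of_int (snd k) * y)" for x y
  by (simp add: mode_def mode_phase_def cis_mult)
 then show "mode k (x + 2 * pi, y) = mode k (x, y)" "mode k (x, y + 2 * pi) = mode k (x, y)"
  by (simp_all only: e)
qed

lemma integral_cis_period: "integral {0..2 * pi} (\<lambda>x. cis (of_int n * x)) = (if n = 0 then 2 * pi else 0)"
proof (cases "n = 0")
 case False
 have "((\<lambda>x. cis (of_int n * x)) has_integral
   (cis (of_int n * (2 * pi)) / (\<i> * of_int n) - cis (of_int n * 0) / (\<i> * of_int n))) {0..2 * pi}"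
 proof (rule fundamental_theorem_of_calculus)
  fix x :: real
  have "((\<lambda>z. exp (\<i> * of_int n * z) / (\<i> * of_int n)) has_field_derivative exp (\<i> * of_int n * of_real x)) (at (of_real x))"
   using False by (auto intro!: derivative_eq_intros)
  from has_vector_derivative_real_field[OF this]
  show "((\<lambda>x. cis (of_int n * x) / (\<i> * of_int n)) has_vector_derivative cis (of_int n * x)) (at x within {0..2 * pi})"
   by (simp add: cis_conv_exp mult.assoc)
 qed simp
 moreover have "cis (of_int n * (2 * pi)) = 1"
  using cis_multiple_2pi[of "of_int n"] by (simp add: mult.commute)
 ultimately show ?thesis using False by (simp add: integral_unique)
qed (simp add: scaleR_conv_of_real)

lemma integral_mode: "(LINT x|cell_measure. mode k x) = (if k = 0 then (2 * pi)\<^sup>2 else 0)"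
proof -
 have "(LINT x|cell_measure. mode k x) = integral (cbox (0, 0) (2 * pi, 2 * pi)) (mode k)"
  by (simp add: integral_cell_eq continuous_on_mode torus_cell_eq_cbox)
 also have "\<dots> = integral (cbox 0 (2 * pi)) (\<lambda>x. integral (cbox 0 (2 * pi)) (\<lambda>y. mode k (x, y)))"
  by (rule integral_prod_continuous) (rule continuous_on_mode)
 also have "\<dots> = integral {0..2 * pi} (\<lambda>x. integral {0..2 * pi} (\<lambda>y. cis (of_int (fst k) * x) * cis (of_int (snd k) * y)))"
  by (simp add: mode_def mode_phase_def cis_mult)
 also have "\<dots> = integral {0..2 * pi} (\<lambda>x. cis (of_int (fst k) * x)) * integral {0..2 * pi} (\<lambda>y. cis (of_int (snd k) * y))"
  by simp
 also have "\<dots> = (if k = 0 then (2 * pi)\<^sup>2 else 0)"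
  by (auto simp: integral_cis_period power2_eq_square zero_prod_def prod_eq_iff)
 finally show ?thesis .
qed

subsection \<open>Fourier coefficients and absolutely convergent series\<close>

definition cell_coeff :: "(real \<times> real \<Rightarrow> complex) \<Rightarrow> int \<times> int \<Rightarrow> complex" where
 "cell_coeff f k = (LINT x|cell_measure. f x * mode (- k) x) / of_real ((2 * pi)\<^sup>2)"

lemma fourier_coeff_eq_cell_coeff: "fourier_coeff f k = cell_coeff (\<lambda>x. of_real (f x)) k"
 by (simp add: fourier_coeff_def cell_coeff_def set_lebesgue_integral_cell mode_def mode_phase_def)

definition fseries :: "(int \<times> int \<Rightarrow> complex) \<Rightarrow> real \<times> real \<Rightarrow> complex" where
 "fseries c x = (\<Sum>\<^sub>\<infinity>k. c k * mode k x)"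

lemma fseries_uniform_limit:
 assumes "(\<lambda>k. cmod (c k)) summable_on UNIV"
 shows "uniform_limit UNIV (\<lambda>F x. \<Sum>k\<in>F. c k * mode k x) (fseries c) (finite_subsets_at_top UNIV)"
 unfolding fseries_def
 by (rule Weierstrass_m_test_general[where M = "\<lambda>k. cmod (c k)"]) (use assms in \<open>auto simp: norm_mult\<close>)

lemma continuous_on_fseries:
 assumes "(\<lambda>k. cmod (c k)) summable_on UNIV"
 shows "continuous_on A (fseries c)"
proof -
 have "continuous_on UNIV (fseries c)"
  by (rule uniform_limit_theorem[OF _ fseries_uniform_limit[OF assms]])
   (auto intro!: always_eventually continuous_intros)
 then show ?thesis by (rule continuous_on_subset) simp
qed

lemma fseries_summable:
 assumes "(\<lambda>k. cmod (c k)) summable_on UNIV"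
 shows "(\<lambda>k. cmod (c k * mode k x)) summable_on UNIV" "(\<lambda>k. c k * mode k x) summable_on UNIV"
proof -
 show "(\<lambda>k. cmod (c k * mode k x)) summable_on UNIV" using assms by (simp add: norm_mult)
 then show "(\<lambda>k. c k * mode k x) summable_on UNIV" by (rule Infinite_Sum.abs_summable_summable)
qed

lemma cmod_fseries_le:
 assumes "(\<lambda>k. cmod (c k)) summable_on UNIV"
 shows "cmod (fseries c x) \<le> (\<Sum>\<^sub>\<infinity>k. cmod (c k))"
 unfolding fseries_def using norm_infsum_bound[OF fseries_summable(1)[OF assms, of x]] by (simp add: norm_mult)

lemma fseries_mult_integral:
 assumes c: "(\<lambda>k. cmod (c k)) summable_on UNIV" and g: "g \<in> borel_measurable cell_measure"
  and B: "\<And>x. x \<in> torus_cell \<Longrightarrow> cmod (g x) \<le> B"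
 shows "((\<lambda>k. c k * (LINT x|cell_measure. mode k x * g x)) has_sum (LINT x|cell_measure. fseries c x * g x)) UNIV"
proof -
 have B0: "0 \<le> B" using B[of "(0, 0)"] by (auto simp: torus_cell_def intro: order_trans[OF norm_ge_zero])
 have mode_meas: "mode k \<in> borel_measurable cell_measure" for k
  by (rule borel_measurable_cell_continuous[OF continuous_on_mode])
 have ser_meas: "fseries c \<in> borel_measurable cell_measure"
  by (rule borel_measurable_cell_continuous[OF continuous_on_fseries[OF c]])
 have int_k: "integrable cell_measure (\<lambda>x. c k * mode k x * g x)" for k
  by (rule integrable_cell_bounded[where B = "cmod (c k) * B"])
   (use g mode_meas B in \<open>auto simp: norm_mult intro!: mult_left_mono\<close>)
 have int_s: "integrable cell_measure (\<lambda>x. fseries c x * g x)"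
  by (rule integrable_cell_bounded[where B = "(\<Sum>\<^sub>\<infinity>k. cmod (c k)) * B"])
   (use g ser_meas B B0 cmod_fseries_le[OF c] in \<open>auto simp: norm_mult intro!: mult_mono infsum_nonneg\<close>)
 show ?thesis
  unfolding has_sum_def tendsto_iff
 proof (intro allI impI)
  fix e :: real assume e: "0 < e"
  define d where "d = e / ((2 * pi)\<^sup>2 * (B + 1) + 1)"
  have pos: "0 < (2 * pi)\<^sup>2 * (B + 1) + 1" using B0 by (intro add_nonneg_pos) auto
  have d: "0 < d" using e pos by (simp add: d_def)
  have "\<forall>\<^sub>F F in finite_subsets_at_top UNIV. \<forall>x\<in>UNIV. dist (\<Sum>k\<in>F. c k * mode k x) (fseries c x) < d"
   using fseries_uniform_limit[OF c] d by (simp add: uniform_limit_iff)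
  then show "\<forall>\<^sub>F F in finite_subsets_at_top UNIV.
    dist (\<Sum>k\<in>F. c k * (LINT x|cell_measure. mode k x * g x)) (LINT x|cell_measure. fseries c x * g x) < e"
  proof eventually_elim
   case (elim F)
   have "(\<Sum>k\<in>F. c k * (LINT x|cell_measure. mode k x * g x)) = (\<Sum>k\<in>F. (LINT x|cell_measure. c k * mode k x * g x))"
    by (simp add: mult.assoc)
   also have "\<dots> = (LINT x|cell_measure. (\<Sum>k\<in>F. c k * mode k x * g x))"
    by (rule Bochner_Integration.integral_sum[symmetric]) (rule int_k)
   finally have "dist (\<Sum>k\<in>F. c k * (LINT x|cell_measure. mode k x * g x)) (LINT x|cell_measure. fseries c x * g x) =
     cmod (LINT x|cell_measure. (\<Sum>k\<in>F. c k * mode k x * g x) - fseries c x * g x)"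
    by (simp add: dist_norm Bochner_Integration.integral_diff[OF Bochner_Integration.integrable_sum[OF int_k] int_s])
   also have "\<dots> \<le> (2 * pi)\<^sup>2 * (d * (B + 1))"
   proof (rule integral_cell_bound)
    fix x assume x: "x \<in> torus_cell"
    have "(\<Sum>k\<in>F. c k * mode k x * g x) - fseries c x * g x = ((\<Sum>k\<in>F. c k * mode k x) - fseries c x) * g x"
     by (simp add: sum_distrib_right left_diff_distrib)
    also have "cmod \<dots> \<le> d * (B + 1)"
    proof -
     have "dist (\<Sum>k\<in>F. c k * mode k x) (fseries c x) < d" using elim by blast
     then show ?thesis
      unfolding norm_mult using B[OF x] B0 d by (intro mult_mono) (simp_all add: dist_norm)
    qed
    finally show "cmod ((\<Sum>k\<in>F. c k * mode k x * g x) - fseries c x * g x) \<le> d * (B + 1)" .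
   qed (use d B0 in auto)
   also have "\<dots> = d * ((2 * pi)\<^sup>2 * (B + 1))" by simp
   also have "\<dots> < d * ((2 * pi)\<^sup>2 * (B + 1) + 1)" using d by simp
   also have "\<dots> = e" using pos by (simp add: d_def)
   finally show ?case .
  qed
 qed
qed

lemma cell_coeff_fseries:
 assumes "(\<lambda>k. cmod (c k)) summable_on UNIV"
 shows "cell_coeff (fseries c) m = c m"
proof -
 have "((\<lambda>k. c k * (LINT x|cell_measure. mode k x * mode (- m) x)) has_sum
   (LINT x|cell_measure. fseries c x * mode (- m) x)) UNIV"
  by (rule fseries_mult_integral[OF assms, where B = 1])
   (auto intro!: borel_measurable_cell_continuous continuous_intros)
 moreover have "(LINT x|cell_measure. mode k x * mode (- m) x) = (if k = m then (2 * pi)\<^sup>2 else 0)" for k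
  using integral_mode[of "k - m"] mode_add[of k "- m"] by simp
 ultimately have "((\<lambda>k. if k = m then c m * (2 * pi)\<^sup>2 else 0) has_sum
   (LINT x|cell_measure. fseries c x * mode (- m) x)) UNIV"
  by (simp add: if_distrib cong: if_cong)
 moreover have "((\<lambda>k. if k = m then c m * (2 * pi)\<^sup>2 else 0) has_sum (c m * (2 * pi)\<^sup>2)) UNIV"
  by (rule has_sum_finite_neutralI[where B = "{m}"]) auto
 ultimately have "(LINT x|cell_measure. fseries c x * mode (- m) x) = c m * (2 * pi)\<^sup>2"
  by (rule has_sum_unique)
 then show ?thesis by (simp add: cell_coeff_def)
qed

lemma integral_trigonometric_polynomial_sq:
 assumes F: "finite F"
 shows "(LINT x|cell_measure. (\<Sum>k\<in>F. c k * mode k x) * cnj (\<Sum>k\<in>F. c k * mode k x)) = (2 * pi)\<^sup>2 * (\<Sum>k\<in>F. c k * cnj (c k))"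
proof -
 have "(LINT x|cell_measure. (\<Sum>k\<in>F. c k * mode k x) * cnj ((\<Sum>k\<in>F. c k * mode k x))) =
   (LINT x|cell_measure. (\<Sum>k\<in>F. \<Sum>l\<in>F. c k * cnj (c l) * mode (k - l) x))"
  by (simp add: sum_product mode_diff mult_ac)
 also have "\<dots> = (\<Sum>k\<in>F. \<Sum>l\<in>F. (LINT x|cell_measure. c k * cnj (c l) * mode (k - l) x))"
  by (subst Bochner_Integration.integral_sum, intro integrable_cell_continuous continuous_intros,
    rule sum.cong[OF refl], rule Bochner_Integration.integral_sum, intro integrable_cell_continuous continuous_intros)
 also have "\<dots> = (\<Sum>k\<in>F. \<Sum>l\<in>F. if l = k then c k * cnj (c l) * (2 * pi)\<^sup>2 else 0)"
  by (intro sum.cong refl) (simp add: integral_mode)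
 also have "\<dots> = (\<Sum>k\<in>F. c k * cnj (c k) * (2 * pi)\<^sup>2)" using F by (intro sum.cong) auto
 finally show ?thesis by (simp add: sum_distrib_left mult_ac)
qed

text \<open>Only measurability and boundedness are assumed: the lemma is applied to functions cut off to strips.\<close>

lemma Bessel_inequality:
 assumes f: "f \<in> borel_measurable cell_measure" and B: "\<And>x. x \<in> torus_cell \<Longrightarrow> cmod (f x) \<le> B" and F: "finite F"
 shows "(\<Sum>k\<in>F. (cmod (cell_coeff f k))\<^sup>2) \<le> (LINT x|cell_measure. (cmod (f x))\<^sup>2) / (2 * pi)\<^sup>2"
proof -
 define c where "c = cell_coeff f"
 let ?s = "\<lambda>x. \<Sum>k\<in>F. c k * mode k x"
 have mode_meas: "mode k \<in> borel_measurable cell_measure" for k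
  by (rule borel_measurable_cell_continuous[OF continuous_on_mode])
 have fm: "integrable cell_measure (\<lambda>x. f x * mode (- k) x)" for k
  by (rule integrable_cell_bounded[where B = B]) (use f mode_meas B in \<open>auto simp: norm_mult\<close>)
 have coeff: "(LINT x|cell_measure. f x * mode (- k) x) = (2 * pi)\<^sup>2 * c k" for k
  by (simp add: c_def cell_coeff_def)
 have ff: "integrable cell_measure (\<lambda>x. f x * cnj (f x))"
  unfolding complex_norm_square[symmetric]
  by (rule integrable_cell_bounded[where B = "B\<^sup>2"])
   (use f B in \<open>auto simp: norm_power intro!: power_mono\<close>)
 have fs: "integrable cell_measure (\<lambda>x. f x * cnj (?s x))"
  unfolding cnj_sum sum_distrib_left complex_cnj_mult mode_minus[symmetric]
 proof (rule Bochner_Integration.integrable_sum)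
  fix n
  show "integrable cell_measure (\<lambda>x. f x * (cnj (c n) * mode (- n) x))"
   using Bochner_Integration.integrable_mult_right[OF fm, of "cnj (c n)" n] by (simp only: mult_ac)
 qed
 have ss: "integrable cell_measure (\<lambda>x. ?s x * cnj (?s x))"
  by (intro integrable_cell_continuous continuous_intros)
 have ifs: "(LINT x|cell_measure. f x * cnj (?s x)) = (2 * pi)\<^sup>2 * (\<Sum>k\<in>F. c k * cnj (c k))"
 proof -
  have "(LINT x|cell_measure. f x * cnj (?s x)) = (LINT x|cell_measure. (\<Sum>k\<in>F. cnj (c k) * (f x * mode (- k) x)))"
   by (simp add: sum_distrib_left mode_minus mult.left_commute)
  also have "\<dots> = (\<Sum>k\<in>F. (LINT x|cell_measure. cnj (c k) * (f x * mode (- k) x)))"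
   by (rule Bochner_Integration.integral_sum) (intro Bochner_Integration.integrable_mult_right fm)
  also have "\<dots> = (\<Sum>k\<in>F. cnj (c k) * ((2 * pi)\<^sup>2 * c k))" by (simp add: coeff)
  finally show ?thesis by (simp add: sum_distrib_left mult_ac)
 qed
 note iss = integral_trigonometric_polynomial_sq[OF F, of c]
 have "0 \<le> (LINT x|cell_measure. (cmod (f x - ?s x))\<^sup>2)" by (rule integral_nonneg_AE) simp
 also have "\<dots> = Re (LINT x|cell_measure. (f x - ?s x) * cnj (f x - ?s x))"
  by (simp only: complex_norm_square[symmetric] integral_complex_of_real Re_complex_of_real)
 also have "(LINT x|cell_measure. (f x - ?s x) * cnj (f x - ?s x)) =
   (LINT x|cell_measure. f x * cnj (f x) - f x * cnj (?s x) - cnj (f x * cnj (?s x)) + ?s x * cnj (?s x))"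
  by (simp only: complex_cnj_diff complex_cnj_mult complex_cnj_cnj) (simp add: algebra_simps)
 also have "\<dots> = (LINT x|cell_measure. f x * cnj (f x)) - (LINT x|cell_measure. f x * cnj (?s x))
   - cnj (LINT x|cell_measure. f x * cnj (?s x)) + (LINT x|cell_measure. ?s x * cnj (?s x))"
  using ff fs ss integrable_bounded_linear[OF bounded_linear_cnj fs] integral_bounded_linear[OF bounded_linear_cnj fs]
  by (simp only: Bochner_Integration.integral_add Bochner_Integration.integral_diff
    Bochner_Integration.integrable_diff)
 also have "Re \<dots> = (LINT x|cell_measure. (cmod (f x))\<^sup>2) - (2 * pi)\<^sup>2 * (\<Sum>k\<in>F. (cmod (c k))\<^sup>2)"
  unfolding ifs iss
  by (simp only: complex_norm_square[symmetric] of_real_sum[symmetric] integral_complex_of_real) simp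
 finally show ?thesis by (simp add: c_def field_simps)
qed

subsection \<open>Termwise differentiation\<close>

lemma infsum_has_vector_derivative:
 fixes f f' :: "int \<times> int \<Rightarrow> real \<Rightarrow> complex"
 assumes X: "convex X" and d: "\<And>k t. t \<in> X \<Longrightarrow> (f k has_vector_derivative f' k t) (at t within X)"
  and M: "\<And>k t. t \<in> X \<Longrightarrow> cmod (f' k t) \<le> M k" "M summable_on UNIV"
  and s: "\<And>t. t \<in> X \<Longrightarrow> (\<lambda>k. f k t) summable_on UNIV" and t: "t \<in> X"
 shows "((\<lambda>t. \<Sum>\<^sub>\<infinity>k. f k t) has_vector_derivative (\<Sum>\<^sub>\<infinity>k. f' k t)) (at t within X)"
proof -
 obtain b :: "nat \<Rightarrow> int \<times> int" where b: "bij b"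
 proof -
  have "infinite (UNIV :: (int \<times> int) set)" by (simp add: finite_prod)
  then show thesis using that bij_betw_from_nat_into[of "UNIV :: (int \<times> int) set"] by simp
 qed
 have M_nat: "summable (\<lambda>n. M (b n))"
  using summable_on_reindex_bij_betw[OF b, of M] M(2) summable_on_imp_summable by blast
 have sums: "(\<lambda>n. g (b n)) sums (\<Sum>\<^sub>\<infinity>k. g k)" if "g summable_on UNIV" for g :: "int \<times> int \<Rightarrow> complex"
 proof -
  have "(g has_sum (\<Sum>\<^sub>\<infinity>k. g k)) UNIV" by (rule has_sum_infsum[OF that])
  then have "((\<lambda>n. g (b n)) has_sum (\<Sum>\<^sub>\<infinity>k. g k)) UNIV" using has_sum_reindex_bij_betw[OF b] by blast
  then show ?thesis by (rule has_sum_imp_sums)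
 qed
 have sf': "(\<lambda>k. f' k t) summable_on UNIV" if "t \<in> X" for t
  by (rule Infinite_Sum.abs_summable_summable, rule Infinite_Sum.summable_on_comparison_test[OF M(2)]) (use M(1) that in auto)
 define g where "g = (\<lambda>t h. h *\<^sub>R (\<Sum>\<^sub>\<infinity>k. f' k t))"
 have "\<exists>S. \<forall>t\<in>X. (\<lambda>n. f (b n) t) sums S t \<and> (S has_derivative g t) (at t within X)"
 proof (rule has_derivative_series[OF X, where f' = "\<lambda>n t h. h *\<^sub>R f' (b n) t"])
  show "(f (b n) has_derivative (\<lambda>h. h *\<^sub>R f' (b n) t)) (at t within X)" if "t \<in> X" for n t
   using d[OF that] by (simp add: has_vector_derivative_def)
  show "(\<lambda>n. f (b n) t) sums (\<Sum>\<^sub>\<infinity>k. f k t)" by (rule sums[OF s[OF t]])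
  fix e :: real assume e: "0 < e"
  have "uniform_limit X (\<lambda>n t. \<Sum>i<n. f' (b i) t) (\<lambda>t. \<Sum>i. f' (b i) t) sequentially"
   by (rule Weierstrass_m_test[OF _ M_nat]) (use M(1) in auto)
  then have "\<forall>\<^sub>F n in sequentially. \<forall>t\<in>X. dist (\<Sum>i<n. f' (b i) t) (\<Sum>i. f' (b i) t) < e"
   using e by (simp add: uniform_limit_iff)
  then show "\<forall>\<^sub>F n in sequentially. \<forall>t\<in>X. \<forall>h. norm ((\<Sum>i<n. h *\<^sub>R f' (b i) t) - g t h) \<le> e * norm h"
  proof eventually_elim
   case (elim n)
   show ?case
   proof (intro ballI allI)
    fix t h assume t: "t \<in> X"
    have "(\<Sum>i<n. h *\<^sub>R f' (b i) t) - g t h = h *\<^sub>R ((\<Sum>i<n. f' (b i) t) - (\<Sum>i. f' (b i) t))"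
     by (simp add: g_def scaleR_sum_right scaleR_diff_right sums_unique[OF sums[OF sf'[OF t]]])
    also have "norm \<dots> = \<bar>h\<bar> * dist (\<Sum>i<n. f' (b i) t) (\<Sum>i. f' (b i) t)" by (simp add: dist_norm)
    also have "\<dots> \<le> \<bar>h\<bar> * e" using elim t by (intro mult_left_mono) (auto intro: less_imp_le)
    finally show "norm ((\<Sum>i<n. h *\<^sub>R f' (b i) t) - g t h) \<le> e * norm h" by (simp add: mult.commute)
   qed
  qed
 qed (rule t)
 then obtain S where S: "\<And>t. t \<in> X \<Longrightarrow> (\<lambda>n. f (b n) t) sums S t" "\<And>t. t \<in> X \<Longrightarrow> (S has_derivative g t) (at t within X)" by blast
 have "S t = (\<Sum>\<^sub>\<infinity>k. f k t)" if "t \<in> X" for t using sums_unique2[OF S(1) sums[OF s]] that by blast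
 then have "((\<lambda>t. \<Sum>\<^sub>\<infinity>k. f k t) has_derivative g t) (at t within X)"
  using has_derivative_transform[OF t, of "\<lambda>t. \<Sum>\<^sub>\<infinity>k. f k t" S "g t"] S(2)[OF t] by simp
 then show ?thesis by (simp add: has_vector_derivative_def g_def)
qed

lemma mode_has_vector_derivative:
 "((\<lambda>x. mode k (x, y)) has_vector_derivative \<i> * of_int (fst k) * mode k (x, y)) (at x within A)"
 "((\<lambda>y. mode k (x, y)) has_vector_derivative \<i> * of_int (snd k) * mode k (x, y)) (at y within B)"
proof -
 have e: "mode k (x, y) = exp (\<i> * (of_int (fst k) * of_real x + of_int (snd k) * of_real y))" for x y
  by (simp add: mode_def mode_phase_def cis_conv_exp)
 have "((\<lambda>z. exp (\<i> * (of_int (fst k) * z + of_int (snd k) * of_real y))) has_field_derivative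
   \<i> * of_int (fst k) * mode k (x, y)) (at (of_real x))"
  unfolding e by (auto intro!: derivative_eq_intros)
 from has_vector_derivative_real_field[OF this, of A]
 show "((\<lambda>x. mode k (x, y)) has_vector_derivative \<i> * of_int (fst k) * mode k (x, y)) (at x within A)"
  by (simp only: e)
 have "((\<lambda>z. exp (\<i> * (of_int (fst k) * of_real x + of_int (snd k) * z))) has_field_derivative
   \<i> * of_int (snd k) * mode k (x, y)) (at (of_real y))"
  unfolding e by (auto intro!: derivative_eq_intros)
 from has_vector_derivative_real_field[OF this, of B]
 show "((\<lambda>y. mode k (x, y)) has_vector_derivative \<i> * of_int (snd k) * mode k (x, y)) (at y within B)"
  by (simp only: e)
qed

lemma abs_summable_le:
 assumes "g summable_on UNIV" "\<And>k. cmod (c k) \<le> g k"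
 shows "(\<lambda>k. cmod (c k)) summable_on UNIV"
 by (rule Infinite_Sum.summable_on_comparison_test[OF assms(1)]) (use assms(2) in auto)

lemma fseries_has_vector_derivative:
 assumes c: "(\<lambda>k. cmod (c k)) summable_on UNIV" and c1: "(\<lambda>k. mode_norm k * cmod (c k)) summable_on UNIV"
 shows "((\<lambda>x. fseries c (x, y)) has_vector_derivative fseries (\<lambda>k. \<i> * of_int (fst k) * c k) (x, y)) (at x)"
  and "((\<lambda>y. fseries c (x, y)) has_vector_derivative fseries (\<lambda>k. \<i> * of_int (snd k) * c k) (x, y)) (at y)"
proof -
 have le: "cmod (\<i> * of_int (fst k) * c k * mode k z) \<le> mode_norm k * cmod (c k)"
  "cmod (\<i> * of_int (snd k) * c k * mode k z) \<le> mode_norm k * cmod (c k)" for k z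
  by (simp_all add: norm_mult mult_right_mono abs_fst_le abs_snd_le)
 have "((\<lambda>x. \<Sum>\<^sub>\<infinity>k. c k * mode k (x, y)) has_vector_derivative (\<Sum>\<^sub>\<infinity>k. \<i> * of_int (fst k) * c k * mode k (x, y))) (at x within UNIV)"
  by (rule infsum_has_vector_derivative[OF _ _ le(1) c1])
   (use fseries_summable(2)[OF c] mode_has_vector_derivative(1) in
    \<open>auto intro!: derivative_eq_intros mode_has_vector_derivative\<close>)
 then show "((\<lambda>x. fseries c (x, y)) has_vector_derivative fseries (\<lambda>k. \<i> * of_int (fst k) * c k) (x, y)) (at x)"
  by (simp add: fseries_def)
 have "((\<lambda>y. \<Sum>\<^sub>\<infinity>k. c k * mode k (x, y)) has_vector_derivative (\<Sum>\<^sub>\<infinity>k. \<i> * of_int (snd k) * c k * mode k (x, y))) (at y within UNIV)"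
  by (rule infsum_has_vector_derivative[OF _ _ le(2) c1])
   (use fseries_summable(2)[OF c] in
    \<open>auto intro!: derivative_eq_intros mode_has_vector_derivative\<close>)
 then show "((\<lambda>y. fseries c (x, y)) has_vector_derivative fseries (\<lambda>k. \<i> * of_int (snd k) * c k) (x, y)) (at y)"
  by (simp add: fseries_def)
qed

lemma fseries_hermitian_real:
 assumes "hermitian c"
 shows "cnj (fseries c x) = fseries c x" "of_real (Re (fseries c x)) = fseries c x"
proof -
 have "cnj (fseries c x) = (\<Sum>\<^sub>\<infinity>k. cnj (c k * mode k x))"
  unfolding fseries_def by (rule infsum_cnj[symmetric])
 also have "\<dots> = (\<Sum>\<^sub>\<infinity>k. c (- k) * mode (- k) x)"
  by (simp only: assms[unfolded hermitian_def, THEN spec] mode_minus complex_cnj_mult)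
 also have "\<dots> = fseries c x"
  unfolding fseries_def
  by (rule infsum_reindex_bij_betw[of uminus UNIV UNIV "\<lambda>k. c k * mode k x"]) (rule bij_uminus)
 finally show 1: "cnj (fseries c x) = fseries c x" .
 then show "of_real (Re (fseries c x)) = fseries c x" by (simp add: Reals_cnj_iff)
qed

lemma fseries_periodic: "fseries c (x + 2 * pi, y) = fseries c (x, y)" "fseries c (x, y + 2 * pi) = fseries c (x, y)"
 by (simp_all add: fseries_def mode_periodic)

lemma torus_fun_fseries:
 assumes "(\<lambda>k. cmod (c k)) summable_on UNIV"
 shows "torus_fun (\<lambda>x. Re (fseries c x))"
 unfolding torus_fun_def using fseries_periodic
 by (auto intro!: continuous_intros continuous_on_fseries[OF assms])

lemma fourier_coeff_fseries:
 assumes "(\<lambda>k. cmod (c k)) summable_on UNIV" "hermitian c"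
 shows "fourier_coeff (\<lambda>x. Re (fseries c x)) k = c k"
 by (simp add: fourier_coeff_eq_cell_coeff fseries_hermitian_real[OF assms(2)] cell_coeff_fseries[OF assms(1)])

lemma torus_fun_continuous: "torus_fun f \<Longrightarrow> continuous_on A f"
 unfolding torus_fun_def using continuous_on_subset by blast

lemma hermitian_fourier_coeff:
 assumes "torus_fun f"
 shows "hermitian (fourier_coeff f)"
 unfolding hermitian_def
proof
 fix k
 have "cnj (LINT x|cell_measure. of_real (f x) * mode (- k) x) = (LINT x|cell_measure. of_real (f x) * mode k x)"
  by (subst Bochner_Integration.integral_cnj[symmetric]) (simp add: mode_minus)
 then show "fourier_coeff f (- k) = cnj (fourier_coeff f k)"
  by (simp add: fourier_coeff_eq_cell_coeff cell_coeff_def)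
qed

lemma fourier_coeff_diff:
 assumes "torus_fun f" "torus_fun g"
 shows "fourier_coeff (\<lambda>x. f x - g x) k = fourier_coeff f k - fourier_coeff g k"
proof -
 have i: "integrable cell_measure (\<lambda>x. of_real (f x) * mode (- k) x)" if "torus_fun f" for f
  by (intro integrable_cell_continuous continuous_intros torus_fun_continuous[OF that])
 show ?thesis unfolding fourier_coeff_eq_cell_coeff cell_coeff_def
  using Bochner_Integration.integral_diff[OF i[OF assms(1)] i[OF assms(2)]]
  by (simp add: left_diff_distrib diff_divide_distrib)
qed

subsection \<open>Uniqueness of Fourier coefficients\<close>

lemma torus_fun_int_periodic:
 assumes "torus_fun f"
 shows "f (x + 2 * pi * of_int m, y + 2 * pi * of_int n) = f (x, y)"
proof -
 have nat: "g (x + 2 * pi * of_int m) = g x" if g: "\<And>x. g (x + 2 * pi) = g x" for g :: "real \<Rightarrow> real" and x m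
 proof (induction m rule: int_induct[where k = 0])
  case (step1 i) then show ?case using g[of "x + 2 * pi * of_int i"] by (simp add: algebra_simps)
 next
  case (step2 i) then show ?case using g[of "x + 2 * pi * of_int (i - 1)"] by (simp add: algebra_simps)
 qed simp
 have p: "f (x + 2 * pi, y) = f (x, y)" "f (x, y + 2 * pi) = f (x, y)" for x y
  using assms by (auto simp: torus_fun_def)
 have "f (x + 2 * pi * of_int m, y + 2 * pi * of_int n) = f (x, y + 2 * pi * of_int n)"
  by (rule nat[of "\<lambda>x. f (x, y + 2 * pi * of_int n)"]) (rule p)
 also have "\<dots> = f (x, y)" by (rule nat[of "\<lambda>y. f (x, y)"]) (rule p)
 finally show ?thesis .
qed

lemma Arg2pi_cis_shift: "\<exists>n::int. Arg2pi (cis x) = x + 2 * pi * of_int n"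
proof -
 have "cis (Arg2pi (cis x)) = cis x"
  using complex_norm_eq_1_exp[of "cis x"] by (simp add: cis_conv_exp)
 then have "sin (Arg2pi (cis x)) = sin x \<and> cos (Arg2pi (cis x)) = cos x"
  by (metis cis.sel)
 then show ?thesis using sin_cos_eq_iff by blast
qed

lemma torus_fun_reduce:
 assumes "torus_fun f"
 shows "f (Arg2pi (cis x), Arg2pi (cis y)) = f (x, y)"
 using Arg2pi_cis_shift[of x] Arg2pi_cis_shift[of y] torus_fun_int_periodic[OF assms] by metis

lemma Arg2pi_in_cell: "(Arg2pi z, Arg2pi w) \<in> torus_cell"
 using Arg2pi[of z] Arg2pi[of w] by (simp add: torus_cell_def)

lemma torus_fun_zero_if_L2_zero:
 assumes f: "torus_fun f" and z: "integral torus_cell (\<lambda>x. (f x)\<^sup>2) = 0"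
 shows "f x = 0"
proof -
 have "\<forall>x\<in>torus_cell. (f x)\<^sup>2 = 0"
  using z unfolding torus_cell_eq_cbox
  by (subst (asm) integral_cbox_eq_0_iff)
   (auto intro!: continuous_intros torus_fun_continuous[OF f] simp: box_ne_empty Basis_prod_def inner_Pair)
 then have "f (Arg2pi (cis (fst x)), Arg2pi (cis (snd x))) = 0" using Arg2pi_in_cell by force
 then show ?thesis by (simp add: torus_fun_reduce[OF f])
qed

text \<open>Stone-Weierstrass on the product of two circles. A function on the product of circles is
 admitted if multiplication by it preserves the property of having no Fourier coefficients; in this
 form closure under products is immediate.\<close>

theorem fourier_uniqueness:
 assumes f: "torus_fun f" and zero: "\<And>k. fourier_coeff f k = 0"
 shows "f x = 0"
proof -
 define p where "p = (\<lambda>x :: real \<times> real. (cis (fst x), cis (snd x)))"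
 define S where "S = sphere (0::complex) 1 \<times> sphere (0::complex) 1"
 define g where "g = (\<lambda>z. f (Arg2pi (fst z), Arg2pi (snd z)))"
 have S: "compact S" unfolding S_def by (intro compact_Times compact_sphere)
 have contp: "continuous_on A p" for A
  unfolding p_def cis_conv_exp by (intro continuous_intros)
 have pS: "p x \<in> S" for x by (simp add: p_def S_def)
 have gp: "g (p x) = f x" for x using torus_fun_reduce[OF f, of "fst x" "snd x"] by (simp add: g_def p_def)
 have inv: "p (Arg2pi (fst z), Arg2pi (snd z)) = z" if "z \<in> S" for z
 proof -
  have "cmod (fst z) = 1" "cmod (snd z) = 1" using that by (auto simp: S_def)
  then have "cis (Arg2pi (fst z)) = fst z" "cis (Arg2pi (snd z)) = snd z"
   unfolding complex_norm_eq_1_exp cis_conv_exp by simp_all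
  then show ?thesis by (simp add: p_def)
 qed
 have contg: "continuous_on S g"
  unfolding continuous_on_closed_vimage[OF compact_imp_closed[OF S]]
 proof (intro allI impI)
  fix B :: "real set" assume B: "closed B"
  have "g -` B \<inter> S = p ` (torus_cell \<inter> f -` B)"
  proof (intro equalityI subsetI)
   fix z assume z: "z \<in> g -` B \<inter> S"
   then show "z \<in> p ` (torus_cell \<inter> f -` B)"
    using inv[of z] Arg2pi_in_cell[of "fst z" "snd z"]
    by (intro image_eqI[of _ _ "(Arg2pi (fst z), Arg2pi (snd z))"]) (auto simp: g_def)
  next
   fix z assume "z \<in> p ` (torus_cell \<inter> f -` B)"
   then show "z \<in> g -` B \<inter> S" using pS gp by auto
  qed
  moreover have "closed (f -` B)"
   using continuous_on_closed_vimage[of UNIV f] torus_fun_continuous[OF f, of UNIV] B by simp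
  ultimately show "closed (g -` B \<inter> S)"
   by (metis compact_Int_closed compact_continuous_image compact_imp_closed compact_torus_cell contp)
 qed
 define N where "N = (\<lambda>\<phi> :: real \<times> real \<Rightarrow> complex. continuous_on torus_cell \<phi> \<and>
   (\<forall>m. (LINT x|cell_measure. \<phi> x * mode m x) = 0))"
 define R where "R = {r :: complex \<times> complex \<Rightarrow> real. continuous_on S r \<and>
   (\<forall>\<phi>. N \<phi> \<longrightarrow> N (\<lambda>x. \<phi> x * of_real (r (p x))))}"
 have contr: "continuous_on torus_cell (\<lambda>x. r (p x))" if "continuous_on S r" for r :: "complex \<times> complex \<Rightarrow> real"
  by (rule continuous_on_compose2[OF that contp]) (use pS in auto)
 have trig: "N (\<lambda>x. \<phi> x * (a * mode k x + b * mode (- k) x))" if "N \<phi>" for \<phi> a b k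
 proof -
  have c: "continuous_on torus_cell \<phi>" and z: "\<And>m. (LINT x|cell_measure. \<phi> x * mode m x) = 0"
   using that by (auto simp: N_def)
  have i: "integrable cell_measure (\<lambda>x. \<phi> x * mode m x)" for m
   by (intro integrable_cell_continuous continuous_intros c)
  have "(LINT x|cell_measure. \<phi> x * (a * mode k x + b * mode (- k) x) * mode m x) = 0" for m
  proof -
   have "(LINT x|cell_measure. \<phi> x * (a * mode k x + b * mode (- k) x) * mode m x) =
    (LINT x|cell_measure. a * (\<phi> x * mode (k + m) x) + b * (\<phi> x * mode (- k + m) x))"
    unfolding mode_add by (simp add: algebra_simps)
   also have "\<dots> = a * (LINT x|cell_measure. \<phi> x * mode (k + m) x) + b * (LINT x|cell_measure. \<phi> x * mode (- k + m) x)"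
    using i by (subst Bochner_Integration.integral_add) auto
   finally show ?thesis by (simp add: z)
  qed
  then show ?thesis unfolding N_def by (intro conjI allI continuous_intros c)
 qed
 have N_add: "N (\<lambda>x. \<phi> x + \<psi> x)" if "N \<phi>" "N \<psi>" for \<phi> \<psi>
 proof -
  have "integrable cell_measure (\<lambda>x. \<phi> x * mode m x)" "integrable cell_measure (\<lambda>x. \<psi> x * mode m x)" for m
   using that by (auto simp: N_def intro!: integrable_cell_continuous continuous_intros)
  then show ?thesis using that by (auto simp: N_def distrib_right intro!: continuous_intros)
 qed
 have coord: "(\<lambda>z. Re (fst z)) \<in> R" "(\<lambda>z. Im (fst z)) \<in> R" "(\<lambda>z. Re (snd z)) \<in> R" "(\<lambda>z. Im (snd z)) \<in> R"
 proof -
  have m1: "mode (1, 0) x = cis (fst x)" "mode (- (1, 0)) x = cnj (cis (fst x))"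
   and m2: "mode (0, 1) x = cis (snd x)" "mode (- (0, 1)) x = cnj (cis (snd x))" for x
   unfolding mode_minus by (simp_all add: mode_def mode_phase_def)
  have re: "of_real (Re w) = 1/2 * w + 1/2 * cnj w" and im: "of_real (Im w) = (- \<i>/2) * w + (\<i>/2) * cnj w" for w
   by (simp_all add: complex_eq_iff)
  show "(\<lambda>z. Re (fst z)) \<in> R" "(\<lambda>z. Im (fst z)) \<in> R"
   unfolding R_def mem_Collect_eq
   using trig[of _ "1/2" "(1, 0)" "1/2"] trig[of _ "- \<i>/2" "(1, 0)" "\<i>/2"]
   by (auto intro!: continuous_intros simp only: p_def fst_conv re im m1)
  show "(\<lambda>z. Re (snd z)) \<in> R" "(\<lambda>z. Im (snd z)) \<in> R"
   unfolding R_def mem_Collect_eq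
   using trig[of _ "1/2" "(0, 1)" "1/2"] trig[of _ "- \<i>/2" "(0, 1)" "\<i>/2"]
   by (auto intro!: continuous_intros simp only: p_def snd_conv re im m2)
 qed
 interpret function_ring_on R S
 proof
  show "compact S" by (rule S)
  show "continuous_on S r" if "r \<in> R" for r using that by (simp add: R_def)
  show "(\<lambda>x. r x + r' x) \<in> R" if "r \<in> R" "r' \<in> R" for r r'
   using that N_add by (auto simp: R_def distrib_left intro!: continuous_intros)
  show "(\<lambda>x. r x * r' x) \<in> R" if "r \<in> R" "r' \<in> R" for r r'
   using that by (auto simp: R_def mult.assoc[symmetric] intro!: continuous_intros)
  show "(\<lambda>_. c) \<in> R" for c
   using trig[of _ "of_real c" 0 0] by (auto simp: R_def intro!: continuous_intros)
  show "\<exists>r\<in>R. r x \<noteq> r y" if "x \<noteq> y" for x y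
  proof (rule ccontr)
   assume "\<not> (\<exists>r\<in>R. r x \<noteq> r y)"
   then have eq: "r x = r y" if "r \<in> R" for r using that by simp
   show False using that eq[OF coord(1)] eq[OF coord(2)] eq[OF coord(3)] eq[OF coord(4)]
    by (simp add: prod_eq_iff complex_eq_iff)
  qed
 qed
 have Nf: "N (\<lambda>x. of_real (f x))"
  unfolding N_def
 proof (intro conjI allI continuous_intros torus_fun_continuous[OF f])
  fix m
  show "(LINT x|cell_measure. complex_of_real (f x) * mode m x) = 0"
   using zero[of "- m"] by (simp add: fourier_coeff_eq_cell_coeff cell_coeff_def)
 qed
 obtain B where B: "\<And>x. x \<in> torus_cell \<Longrightarrow> \<bar>f x\<bar> \<le> B"
  using compact_imp_bounded[OF compact_continuous_image[OF torus_fun_continuous[OF f] compact_torus_cell]]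
  by (auto simp: bounded_iff)
 have B0: "0 \<le> B" using B[OF Arg2pi_in_cell[of 0 0]] abs_ge_zero order_trans by blast
 have "\<bar>LINT x|cell_measure. (f x)\<^sup>2\<bar> \<le> e" if e: "0 < e" for e
 proof -
  define d where "d = e / ((2 * pi)\<^sup>2 * (B + 1))"
  have d: "0 < d" using e B0 by (simp add: d_def)
  obtain r where r: "r \<in> R" "\<And>z. z \<in> S \<Longrightarrow> \<bar>g z - r z\<bar> < d"
   using Stone_Weierstrass_basic[OF contg d] by blast
  have cr: "continuous_on torus_cell (\<lambda>x. r (p x))" using r(1) contr by (simp add: R_def)
  have "N (\<lambda>x. of_real (f x) * of_real (r (p x)))" using r(1) Nf by (auto simp: R_def)
  then have "(LINT x|cell_measure. complex_of_real (f x) * of_real (r (p x)) * mode 0 x) = 0" unfolding N_def by blast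
  then have "complex_of_real (LINT x|cell_measure. f x * r (p x)) = 0"
   by (simp only: mode_zero mult_1_right of_real_mult[symmetric] integral_complex_of_real)
  then have 0: "(LINT x|cell_measure. f x * r (p x)) = 0" by simp
  have "(LINT x|cell_measure. (f x)\<^sup>2) = (LINT x|cell_measure. (f x)\<^sup>2 - f x * r (p x))"
   using 0 by (subst Bochner_Integration.integral_diff)
    (auto intro!: integrable_cell_continuous continuous_intros torus_fun_continuous[OF f] cr)
  also have "norm \<dots> \<le> (2 * pi)\<^sup>2 * ((B + 1) * d)"
  proof (rule integral_cell_bound)
   fix x assume x: "x \<in> torus_cell"
   have "(f x)\<^sup>2 - f x * r (p x) = f x * (g (p x) - r (p x))" by (simp add: gp power2_eq_square algebra_simps)
   also have "norm \<dots> \<le> (B + 1) * d"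
    unfolding norm_mult using B[OF x] r(2)[OF pS[of x]] B0 by (intro mult_mono) auto
   finally show "norm ((f x)\<^sup>2 - f x * r (p x)) \<le> (B + 1) * d" .
  qed (use B0 d in auto)
  also have "\<dots> = e" using B0 by (simp add: d_def)
  finally show ?thesis by simp
 qed
 then have "(LINT x|cell_measure. (f x)\<^sup>2) = 0" by (metis abs_ge_zero abs_le_zero_iff dual_order.refl field_le_epsilon add_0)
 then have "integral torus_cell (\<lambda>x. (f x)\<^sup>2) = 0"
  by (simp add: integral_cell_eq continuous_on_power torus_fun_continuous[OF f])
 then show ?thesis by (rule torus_fun_zero_if_L2_zero[OF f])
qed

corollary fourier_inversion:
 assumes f: "torus_fun f" and s: "(\<lambda>k. cmod (fourier_coeff f k)) summable_on UNIV"
 shows "f x = Re (fseries (fourier_coeff f) x)"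
proof -
 let ?g = "\<lambda>x. Re (fseries (fourier_coeff f) x)"
 have g: "torus_fun ?g" by (rule torus_fun_fseries[OF s])
 have "torus_fun (\<lambda>x. f x - ?g x)"
  using f g by (auto simp: torus_fun_def intro!: continuous_intros)
 moreover have "fourier_coeff (\<lambda>x. f x - ?g x) k = 0" for k
  by (simp add: fourier_coeff_diff[OF f g] fourier_coeff_fseries[OF s hermitian_fourier_coeff[OF f]])
 ultimately have "f x - ?g x = 0" by (rule fourier_uniqueness)
 then show ?thesis by simp
qed

lemma integral_partial_derivative_periodic:
 fixes G Gx Gy :: "real \<times> real \<Rightarrow> real"
 shows "continuous_on UNIV Gx \<Longrightarrow> (\<And>x y. ((\<lambda>x. G (x, y)) has_real_derivative Gx (x, y)) (at x)) \<Longrightarrow>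
   (\<And>x y. G (x + 2 * pi, y) = G (x, y)) \<Longrightarrow> integral torus_cell Gx = 0"
  and "continuous_on UNIV Gy \<Longrightarrow> (\<And>x y. ((\<lambda>y. G (x, y)) has_real_derivative Gy (x, y)) (at y)) \<Longrightarrow>
   (\<And>x y. G (x, y + 2 * pi) = G (x, y)) \<Longrightarrow> integral torus_cell Gy = 0"
proof -
 have ftc: "integral {0..2 * pi} h' = 0"
  if "\<And>x. (h has_real_derivative h' x) (at x)" "h (0 + 2 * pi) = h 0" for h h' :: "real \<Rightarrow> real"
 proof -
  have "(h' has_integral (h (2 * pi) - h 0)) {0..2 * pi}"
   by (rule fundamental_theorem_of_calculus)
    (use that in \<open>auto simp: has_real_derivative_iff_has_vector_derivative[symmetric] intro: has_field_derivative_at_within\<close>)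
  then show ?thesis using that(2) by (simp add: integral_unique)
 qed
 {
  assume c: "continuous_on UNIV Gx" and d: "\<And>x y. ((\<lambda>x. G (x, y)) has_real_derivative Gx (x, y)) (at x)"
   and p: "\<And>x y. G (x + 2 * pi, y) = G (x, y)"
  have c': "continuous_on A Gx" for A using c continuous_on_subset by blast
  have "integral torus_cell Gx = integral (cbox 0 (2 * pi)) (\<lambda>x. integral (cbox 0 (2 * pi)) (\<lambda>y. Gx (x, y)))"
   unfolding torus_cell_eq_cbox by (rule integral_prod_continuous[OF c'])
  also have "\<dots> = integral (cbox 0 (2 * pi)) (\<lambda>y. integral (cbox 0 (2 * pi)) (\<lambda>x. Gx (x, y)))"
   by (rule integral_swap_continuous) (simp add: c')
  also have "\<dots> = 0" using ftc[OF d p] by simp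
  finally show "integral torus_cell Gx = 0" .
 }
 {
  assume c: "continuous_on UNIV Gy" and d: "\<And>x y. ((\<lambda>y. G (x, y)) has_real_derivative Gy (x, y)) (at y)"
   and p: "\<And>x y. G (x, y + 2 * pi) = G (x, y)"
  have c': "continuous_on A Gy" for A using c continuous_on_subset by blast
  have "integral torus_cell Gy = integral (cbox 0 (2 * pi)) (\<lambda>x. integral (cbox 0 (2 * pi)) (\<lambda>y. Gy (x, y)))"
   unfolding torus_cell_eq_cbox by (rule integral_prod_continuous[OF c'])
  also have "\<dots> = 0" using ftc[OF d p] by simp
  finally show "integral torus_cell Gy = 0" .
 }
qed

section \<open>Bounding the strain by the supremum\<close>

lemma infsum_tendsto_dominated:
 fixes f :: "nat \<Rightarrow> 'k \<Rightarrow> complex"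
 assumes "\<And>k. (\<lambda>N. f N k) \<longlonglongrightarrow> l k" and M: "\<And>N k. cmod (f N k) \<le> M k" "M summable_on UNIV"
 shows "(\<lambda>N. \<Sum>\<^sub>\<infinity>k. f N k) \<longlonglongrightarrow> (\<Sum>\<^sub>\<infinity>k. l k)"
proof -
 have "cmod (l k) \<le> M k" for k
  by (rule tendsto_upperbound[OF tendsto_norm[OF assms(1)] always_eventually]) (use M(1) in auto)
 then have "(\<lambda>k. cmod (l k)) summable_on UNIV"
  by (intro Infinite_Sum.summable_on_comparison_test[OF M(2)]) auto
 then have sl: "l summable_on UNIV" by (rule Infinite_Sum.abs_summable_summable)
 show ?thesis
 proof (rule swap_uniform_limit'[where f = "\<lambda>F N. \<Sum>k\<in>F. f N k" and F = "finite_subsets_at_top UNIV" and g = "\<lambda>F. \<Sum>k\<in>F. l k" and S = UNIV])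
  show "\<forall>\<^sub>F F in finite_subsets_at_top UNIV. ((\<lambda>N. \<Sum>k\<in>F. f N k) \<longlongrightarrow> (\<Sum>k\<in>F. l k)) sequentially"
   by (intro always_eventually allI tendsto_sum assms(1))
  show "((\<lambda>F. \<Sum>k\<in>F. l k) \<longlongrightarrow> (\<Sum>\<^sub>\<infinity>k. l k)) (finite_subsets_at_top UNIV)"
   using has_sum_infsum[OF sl] by (simp add: has_sum_def)
  show "uniform_limit UNIV (\<lambda>F N. \<Sum>k\<in>F. f N k) (\<lambda>N. \<Sum>\<^sub>\<infinity>k. f N k) (finite_subsets_at_top UNIV)"
   by (rule Weierstrass_m_test_general) (use M in auto)
 qed auto
qed

subsection \<open>Quadratic forms with bounded symbols in physical space\<close>

text \<open>By Parseval the form is the mean over the cell of \<open>fseries c\<close> times two trigonometric polynomials.\<close>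

lemma form_bound_sup:
 assumes S: "finite S" and c: "(\<lambda>k. cmod (c k)) summable_on UNIV" and B: "\<And>x. cmod (fseries c x) \<le> B"
 shows "form_bound S c B"
 unfolding form_bound_def
proof (intro conjI allI)
 show B0: "0 \<le> B" using B norm_ge_zero order_trans by blast
 fix F G :: "int \<times> int \<Rightarrow> complex"
 define f where "f = (\<lambda>x. \<Sum>k\<in>S. F k * mode k x)"
 define g where "g = (\<lambda>x. \<Sum>k\<in>S. G k * mode k x)"
 define X where "X = (\<Sum>k\<in>S. \<Sum>l\<in>S. c (k - l) * F l * cnj (G k))"
 define u v where "u = L2_set (\<lambda>k. cmod (F k)) S" and "v = L2_set (\<lambda>k. cmod (G k)) S"
 have cont: "continuous_on A (fseries c)" "continuous_on A f" "continuous_on A g" for A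
  unfolding f_def g_def by (intro continuous_on_fseries[OF c] continuous_intros)+
 have sq: "(LINT x|cell_measure. (cmod (\<Sum>k\<in>S. H k * mode k x))\<^sup>2) = (2 * pi)\<^sup>2 * (\<Sum>k\<in>S. (cmod (H k))\<^sup>2)" for H
 proof -
  have "complex_of_real (LINT x|cell_measure. (cmod (\<Sum>k\<in>S. H k * mode k x))\<^sup>2) =
    (LINT x|cell_measure. (\<Sum>k\<in>S. H k * mode k x) * cnj (\<Sum>k\<in>S. H k * mode k x))"
   unfolding complex_norm_square[symmetric] by (rule integral_complex_of_real[symmetric])
  also have "\<dots> = complex_of_real ((2 * pi)\<^sup>2 * (\<Sum>k\<in>S. (cmod (H k))\<^sup>2))"
   unfolding integral_trigonometric_polynomial_sq[OF S] by (simp add: complex_norm_square[symmetric] del: of_real_power)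
  finally show ?thesis by (simp only: of_real_eq_iff)
 qed
 have fg2: "(LINT x|cell_measure. (cmod (f x))\<^sup>2) = (2 * pi)\<^sup>2 * u\<^sup>2" "(LINT x|cell_measure. (cmod (g x))\<^sup>2) = (2 * pi)\<^sup>2 * v\<^sup>2"
  unfolding f_def g_def u_def v_def L2_set_sq by (rule sq)+
 have "(LINT x|cell_measure. fseries c x * f x * cnj (g x)) =
   (LINT x|cell_measure. (\<Sum>k\<in>S. \<Sum>l\<in>S. (F l * cnj (G k)) * (fseries c x * mode (- (k - l)) x)))"
 proof (rule Bochner_Integration.integral_cong[OF refl])
  fix x
  have "fseries c x * f x * cnj (g x) = (\<Sum>k\<in>S. \<Sum>l\<in>S. fseries c x * (F l * mode l x) * cnj (G k * mode k x))"
   by (simp add: f_def g_def sum_distrib_left sum_distrib_right sum_product mult.assoc)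
  also have "\<dots> = (\<Sum>k\<in>S. \<Sum>l\<in>S. (F l * cnj (G k)) * (fseries c x * mode (- (k - l)) x))"
   by (intro sum.cong refl) (simp add: mode_diff mult_ac)
  finally show "fseries c x * f x * cnj (g x) = \<dots>" .
 qed
 also have "\<dots> = (\<Sum>k\<in>S. \<Sum>l\<in>S. (LINT x|cell_measure. (F l * cnj (G k)) * (fseries c x * mode (- (k - l)) x)))"
  by (subst Bochner_Integration.integral_sum, intro integrable_cell_continuous continuous_intros cont,
    rule sum.cong[OF refl], rule Bochner_Integration.integral_sum, intro integrable_cell_continuous continuous_intros cont)
 also have "\<dots> = (\<Sum>k\<in>S. \<Sum>l\<in>S. (F l * cnj (G k)) * ((2 * pi)\<^sup>2 * c (k - l)))"
 proof (intro sum.cong refl)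
  fix k l
  have "(LINT x|cell_measure. fseries c x * mode (- (k - l)) x) = (2 * pi)\<^sup>2 * c (k - l)"
   using cell_coeff_fseries[OF c, of "k - l"] by (simp add: cell_coeff_def field_simps)
  then show "(LINT x|cell_measure. (F l * cnj (G k)) * (fseries c x * mode (- (k - l)) x)) = (F l * cnj (G k)) * ((2 * pi)\<^sup>2 * c (k - l))"
   by (simp only: Bochner_Integration.integral_mult_right_zero)
 qed
 also have "\<dots> = (2 * pi)\<^sup>2 * X" by (simp add: X_def sum_distrib_left mult_ac)
 finally have IX: "(LINT x|cell_measure. fseries c x * f x * cnj (g x)) = (2 * pi)\<^sup>2 * X" .
 have est: "cmod X \<le> B * (\<epsilon> * u\<^sup>2 + v\<^sup>2 / \<epsilon>) / 2" if e: "0 < \<epsilon>" for \<epsilon>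
 proof -
  have "(2 * pi)\<^sup>2 * cmod X = cmod (LINT x|cell_measure. fseries c x * f x * cnj (g x))"
   unfolding IX norm_mult by (simp add: norm_power)
  also have "\<dots> \<le> (LINT x|cell_measure. cmod (fseries c x * f x * cnj (g x)))" by (rule integral_norm_bound)
  also have "\<dots> \<le> (LINT x|cell_measure. B / 2 * \<epsilon> * (cmod (f x))\<^sup>2 + B / (2 * \<epsilon>) * (cmod (g x))\<^sup>2)"
  proof (rule integral_mono)
   show "integrable cell_measure (\<lambda>x. cmod (fseries c x * f x * cnj (g x)))"
    "integrable cell_measure (\<lambda>x. B / 2 * \<epsilon> * (cmod (f x))\<^sup>2 + B / (2 * \<epsilon>) * (cmod (g x))\<^sup>2)"
    using e by (auto intro!: integrable_cell_continuous continuous_intros cont)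
   fix x
   have "0 \<le> (\<epsilon> * cmod (f x) - cmod (g x))\<^sup>2 / \<epsilon>" using e by simp
   also have "\<dots> = \<epsilon> * (cmod (f x))\<^sup>2 + (cmod (g x))\<^sup>2 / \<epsilon> - 2 * (cmod (f x) * cmod (g x))"
    using e by (simp add: power2_eq_square field_simps)
   finally have "B * (cmod (f x) * cmod (g x)) \<le> B * ((\<epsilon> * (cmod (f x))\<^sup>2 + (cmod (g x))\<^sup>2 / \<epsilon>) / 2)"
    using B0 by (intro mult_left_mono) auto
   moreover have "cmod (fseries c x * f x * cnj (g x)) \<le> B * (cmod (f x) * cmod (g x))"
    unfolding norm_mult complex_mod_cnj mult.assoc using B[of x] by (intro mult_right_mono) auto
   moreover have "B * ((\<epsilon> * (cmod (f x))\<^sup>2 + (cmod (g x))\<^sup>2 / \<epsilon>) / 2) = B / 2 * \<epsilon> * (cmod (f x))\<^sup>2 + B / (2 * \<epsilon>) * (cmod (g x))\<^sup>2"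
    using e by (simp add: field_simps)
   ultimately show "cmod (fseries c x * f x * cnj (g x)) \<le> B / 2 * \<epsilon> * (cmod (f x))\<^sup>2 + B / (2 * \<epsilon>) * (cmod (g x))\<^sup>2" by linarith
  qed
  also have "\<dots> = B / 2 * \<epsilon> * ((2 * pi)\<^sup>2 * u\<^sup>2) + B / (2 * \<epsilon>) * ((2 * pi)\<^sup>2 * v\<^sup>2)"
   unfolding fg2[symmetric] using e
   by (subst Bochner_Integration.integral_add) (auto intro!: integrable_cell_continuous continuous_intros cont)
  also have "\<dots> = (2 * pi)\<^sup>2 * (B * (\<epsilon> * u\<^sup>2 + v\<^sup>2 / \<epsilon>) / 2)" using e by (simp add: field_simps)
  finally show ?thesis by (simp only: mult_le_cancel_left_pos zero_less_power pi_gt_zero zero_less_mult_iff zero_less_numeral simp_thms)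
 qed
 have uv: "0 \<le> u" "0 \<le> v" by (simp_all add: u_def v_def L2_set_nonneg)
 have "cmod X \<le> B * u * v"
 proof (cases "u = 0 \<or> v = 0")
  case True
  then have "(\<forall>k\<in>S. F k = 0) \<or> (\<forall>k\<in>S. G k = 0)"
   using S by (auto simp: u_def v_def L2_set_eq_0_iff)
  then have "X = 0" by (auto simp: X_def)
  then show ?thesis using B0 uv by simp
 next
  case False
  then have "0 < u" "0 < v" using uv by auto
  then show ?thesis using est[of "v / u"] by (simp add: power2_eq_square field_simps)
 qed
 then show "cmod (\<Sum>k\<in>S. \<Sum>l\<in>S. c (k - l) * F l * cnj (G k)) \<le>
   B * L2_set (\<lambda>k. cmod (F k)) S * L2_set (\<lambda>k. cmod (G k)) S"
  by (simp only: X_def u_def v_def)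
qed

subsection \<open>Symbols of order zero\<close>

text \<open>Symbols that behave like functions homogeneous of degree zero, expressed by first differences so that
 no extension off the lattice is needed.\<close>

definition order_zero :: "(int \<times> int \<Rightarrow> real) \<Rightarrow> real \<Rightarrow> bool" where
 "order_zero \<phi> C \<longleftrightarrow> (\<forall>x. x \<noteq> 0 \<longrightarrow> \<bar>\<phi> x\<bar> \<le> C) \<and>
   (\<forall>x y. x \<noteq> 0 \<longrightarrow> y \<noteq> 0 \<longrightarrow> \<bar>\<phi> x - \<phi> y\<bar> \<le> C * (mode_norm (x - y) / mode_norm y))"

lemma order_zeroD:
 assumes "order_zero \<phi> C" "x \<noteq> 0"
 shows "\<bar>\<phi> x\<bar> \<le> C" "0 \<le> C" "y \<noteq> 0 \<Longrightarrow> \<bar>\<phi> x - \<phi> y\<bar> \<le> C * (mode_norm (x - y) / mode_norm y)"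
 using assms order_trans[OF abs_ge_zero, of "\<phi> x" C] unfolding order_zero_def by blast+

lemma order_zero_mult:
 assumes "order_zero \<phi> C" "order_zero \<psi> D" "0 \<le> C" "0 \<le> D"
 shows "order_zero (\<lambda>x. \<phi> x * \<psi> x) (2 * C * D)"
 unfolding order_zero_def
proof (intro conjI allI impI)
 fix x y :: "int \<times> int" assume xy: "x \<noteq> 0" "y \<noteq> 0"
 let ?r = "mode_norm (x - y) / mode_norm y"
 have "\<bar>\<phi> x * \<psi> x - \<phi> y * \<psi> y\<bar> = \<bar>\<phi> x * (\<psi> x - \<psi> y) + (\<phi> x - \<phi> y) * \<psi> y\<bar>" by (simp add: algebra_simps)
 also have "\<dots> \<le> \<bar>\<phi> x\<bar> * \<bar>\<psi> x - \<psi> y\<bar> + \<bar>\<phi> x - \<phi> y\<bar> * \<bar>\<psi> y\<bar>"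
  using abs_triangle_ineq[of "\<phi> x * (\<psi> x - \<psi> y)" "(\<phi> x - \<phi> y) * \<psi> y"] by (simp add: abs_mult)
 also have "\<dots> \<le> C * (D * ?r) + (C * ?r) * D"
  using order_zeroD[OF assms(1)] order_zeroD[OF assms(2)] assms(3,4) xy
  by (intro add_mono mult_mono) simp_all
 finally show "\<bar>\<phi> x * \<psi> x - \<phi> y * \<psi> y\<bar> \<le> 2 * C * D * ?r" by (simp add: algebra_simps)
next
 fix x :: "int \<times> int" assume "x \<noteq> 0"
 then have "\<bar>\<phi> x\<bar> * \<bar>\<psi> x\<bar> \<le> C * D" using order_zeroD[OF assms(1)] order_zeroD[OF assms(2)] assms(3,4)
  by (intro mult_mono) simp_all
 moreover have "0 \<le> C * D" using assms by simp
 ultimately show "\<bar>\<phi> x * \<psi> x\<bar> \<le> 2 * C * D" unfolding abs_mult by linarith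
qed

lemma abs_mode_norm_diff: "\<bar>mode_norm x - mode_norm y\<bar> \<le> mode_norm (x - y)"
 using mode_norm_triangle_sub[of x y] mode_norm_triangle_sub[of y x] mode_norm_minus_commute[of x y] by linarith

lemma order_zero_direction: "order_zero (\<lambda>x. component i x / mode_norm x) 2"
 unfolding order_zero_def
proof (intro conjI allI impI)
 fix x :: "int \<times> int" assume "x \<noteq> 0"
 then have "\<bar>component i x / mode_norm x\<bar> \<le> 1"
  using abs_component_le[of i x] mode_norm_pos[of x] by (simp add: field_simps)
 then show "\<bar>component i x / mode_norm x\<bar> \<le> 2" by simp
next
 fix x y :: "int \<times> int" assume xy: "x \<noteq> 0" "y \<noteq> 0"
 have p: "0 < mode_norm x" "0 < mode_norm y" using xy mode_norm_pos by auto
 have "component i x / mode_norm x - component i y / mode_norm y =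
   component i (x - y) / mode_norm y + component i x / mode_norm x * ((mode_norm y - mode_norm x) / mode_norm y)"
  using xy by (simp add: component_def field_simps)
 also have "\<bar>\<dots>\<bar> \<le> \<bar>component i (x - y) / mode_norm y\<bar> + \<bar>component i x / mode_norm x * ((mode_norm y - mode_norm x) / mode_norm y)\<bar>"
  by (rule abs_triangle_ineq)
 also have "\<dots> \<le> mode_norm (x - y) / mode_norm y + 1 * (mode_norm (x - y) / mode_norm y)"
  unfolding abs_mult abs_divide
  using p abs_component_le[of i x] abs_component_le[of i "x - y"] abs_mode_norm_diff[of y x] mode_norm_minus_commute[of x y]
  by (intro add_mono mult_mono divide_right_mono) (auto simp: field_simps)
 finally show "\<bar>component i x / mode_norm x - component i y / mode_norm y\<bar> \<le> 2 * (mode_norm (x - y) / mode_norm y)" by simp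
qed

lemma order_zero_brinkman:
 assumes \<nu>: "0 < \<nu>"
 shows "order_zero (\<lambda>x. (mode_norm x)\<^sup>2 / (1 + \<nu> * (mode_norm x)\<^sup>2)) (3 / (2 * \<nu>))"
 unfolding order_zero_def
proof (intro conjI allI impI)
 fix x :: "int \<times> int"
 have "0 < 1 + \<nu> * (mode_norm x)\<^sup>2" using \<nu> by (simp add: add_pos_nonneg)
 then show "\<bar>(mode_norm x)\<^sup>2 / (1 + \<nu> * (mode_norm x)\<^sup>2)\<bar> \<le> 3 / (2 * \<nu>)"
  using \<nu> by (simp add: field_simps)
next
 fix x y :: "int \<times> int" assume xy: "x \<noteq> 0" "y \<noteq> 0"
 define a b d where "a = mode_norm x" and "b = mode_norm y" and "d = mode_norm (x - y)"
 have ab: "0 < a" "0 < b" using xy mode_norm_pos by (auto simp: a_def b_def)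
 have D: "0 < 1 + \<nu> * a\<^sup>2" "0 < 1 + \<nu> * b\<^sup>2" using \<nu> by (simp_all add: add_pos_nonneg)
 have dd: "\<bar>a - b\<bar> \<le> d" unfolding a_def b_def d_def by (rule abs_mode_norm_diff)
 have "a\<^sup>2 / (1 + \<nu> * a\<^sup>2) - b\<^sup>2 / (1 + \<nu> * b\<^sup>2) = (a - b) * ((a + b) / ((1 + \<nu> * a\<^sup>2) * (1 + \<nu> * b\<^sup>2)))"
  using D by (simp add: divide_simps) (simp add: power2_eq_square algebra_simps)
 also have "\<bar>\<dots>\<bar> \<le> d * (3 / (2 * \<nu>) / b)"
  unfolding abs_mult
 proof (rule mult_mono[OF dd])
  have "(a + b) * b \<le> (a\<^sup>2 + 3 * b\<^sup>2) / 2"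
   using zero_le_power2[of "a - b"] by (simp add: power2_eq_square algebra_simps)
  also have "\<dots> \<le> 3 / (2 * \<nu>) * (\<nu> * a\<^sup>2 + \<nu> * b\<^sup>2)" using \<nu> by (simp add: field_simps)
  also have "\<dots> \<le> 3 / (2 * \<nu>) * ((1 + \<nu> * a\<^sup>2) * (1 + \<nu> * b\<^sup>2))"
   using \<nu> by (intro mult_left_mono) (auto simp: algebra_simps)
  finally have le: "(a + b) * b \<le> 3 / (2 * \<nu>) * ((1 + \<nu> * a\<^sup>2) * (1 + \<nu> * b\<^sup>2))" .
  have "(a + b) / ((1 + \<nu> * a\<^sup>2) * (1 + \<nu> * b\<^sup>2)) \<le> 3 / (2 * \<nu>) / b"
  proof -
   have gen: "s / D \<le> R / b" if "s * b \<le> R * D" "0 < D" for s D R :: real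
    using that ab by (simp add: field_simps)
   show ?thesis using le by (rule gen) (use D in simp)
  qed
  then show "\<bar>(a + b) / ((1 + \<nu> * a\<^sup>2) * (1 + \<nu> * b\<^sup>2))\<bar> \<le> 3 / (2 * \<nu>) / b"
   using ab D by simp
 qed (use ab dd in auto)
 finally show "\<bar>(mode_norm x)\<^sup>2 / (1 + \<nu> * (mode_norm x)\<^sup>2) - (mode_norm y)\<^sup>2 / (1 + \<nu> * (mode_norm y)\<^sup>2)\<bar>
   \<le> 3 / (2 * \<nu>) * (mode_norm (x - y) / mode_norm y)"
  by (simp add: a_def b_def d_def mult_ac)
qed

lemma order_zero_cutoff:
 assumes N: "0 < N"
 shows "order_zero (\<lambda>x. max 0 (1 - mode_norm x / N)) 2"
 unfolding order_zero_def
proof (intro conjI allI impI)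
 fix x
 have "0 \<le> mode_norm x / N" using N by simp
 then show "\<bar>max 0 (1 - mode_norm x / N)\<bar> \<le> 2" by (auto simp: max_def)
next
 fix x y :: "int \<times> int" assume xy: "x \<noteq> 0" "y \<noteq> 0"
 define a b d where "a = mode_norm x" and "b = mode_norm y" and "d = mode_norm (x - y)"
 have ab: "0 < a" "0 < b" using xy mode_norm_pos by (auto simp: a_def b_def)
 have dd: "\<bar>a - b\<bar> \<le> d" unfolding a_def b_def d_def by (rule abs_mode_norm_diff)
 have "\<bar>max 0 (1 - a / N) - max 0 (1 - b / N)\<bar> \<le> 2 * (d / b)"
 proof (cases "b \<le> 2 * N")
  case True
  have "\<bar>max 0 (1 - a / N) - max 0 (1 - b / N)\<bar> \<le> \<bar>a / N - b / N\<bar>" by (auto simp: max_def)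
  also have "\<dots> = \<bar>a - b\<bar> / N" using N by (simp add: diff_divide_distrib[symmetric])
  also have "\<dots> \<le> d / N" using dd N by (simp add: divide_right_mono)
  also have "\<dots> \<le> d / (b / 2)" using True ab N dd by (intro divide_left_mono) auto
  finally show ?thesis by (simp add: mult.commute)
 next
  case False
  show ?thesis
  proof (cases "a < N")
   case True
   have "0 \<le> a / N" "0 \<le> b / N" using ab N by simp_all
   then have "\<bar>max 0 (1 - a / N) - max 0 (1 - b / N)\<bar> \<le> 1" by (simp only: max_def abs_if) (simp split: if_splits)
   also have "\<dots> \<le> 2 * (d / b)" using True False dd ab by (simp add: field_simps)
   finally show ?thesis .
  next
   case False': False
   have "max 0 (1 - a / N) = 0" "max 0 (1 - b / N) = 0" using False False' N by (auto simp: max_def field_simps)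
   then show ?thesis using dd ab by simp
  qed
 qed
 then show "\<bar>max 0 (1 - mode_norm x / N) - max 0 (1 - mode_norm y / N)\<bar> \<le> 2 * (mode_norm (x - y) / mode_norm y)"
  by (simp add: a_def b_def d_def)
qed

lemma order_minus_one_diff:
 assumes \<phi>: "order_zero \<phi> C" and xy: "x \<noteq> 0" "y \<noteq> 0"
 shows "\<bar>\<phi> x / mode_norm x - \<phi> y / mode_norm y\<bar> \<le> 2 * C * (mode_norm (x - y) / (mode_norm x * mode_norm y))"
proof -
 define a b d where "a = mode_norm x" and "b = mode_norm y" and "d = mode_norm (x - y)"
 have ab: "0 < a" "0 < b" using xy mode_norm_pos by (auto simp: a_def b_def)
 have dd: "\<bar>a - b\<bar> \<le> d" unfolding a_def b_def d_def by (rule abs_mode_norm_diff)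
 have "\<phi> x / a - \<phi> y / b = (\<phi> x - \<phi> y) / a + \<phi> y * ((b - a) / (a * b))"
  using ab by (simp add: field_simps)
 also have "\<bar>\<dots>\<bar> \<le> \<bar>\<phi> x - \<phi> y\<bar> / a + \<bar>\<phi> y\<bar> * (\<bar>b - a\<bar> / (a * b))"
  using abs_triangle_ineq[of "(\<phi> x - \<phi> y) / a" "\<phi> y * ((b - a) / (a * b))"] ab by (simp add: abs_mult)
 also have "\<dots> \<le> (C * (d / b)) / a + C * (d / (a * b))"
  using order_zeroD(3)[OF \<phi> xy, folded b_def d_def] order_zeroD(1,2)[OF \<phi> xy(2)] dd ab
  by (intro add_mono mult_mono divide_right_mono) (simp_all add: abs_minus_commute)
 finally show ?thesis using ab by (simp add: a_def b_def d_def field_simps)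
qed

definition strain_symbol :: "real \<Rightarrow> bool \<Rightarrow> bool \<Rightarrow> int \<times> int \<Rightarrow> real" where
 "strain_symbol \<nu> i m j = ipmb_symbol \<nu> i j * component m j"

lemma strain_symbol_order:
 assumes \<nu>: "0 < \<nu>"
 shows "\<exists>\<phi>. order_zero \<phi> (192 / \<nu>) \<and> (\<forall>j. strain_symbol \<nu> i m j = \<phi> j / mode_norm j)"
proof -
 define e where "e = (\<lambda>i x. component i x / mode_norm x)"
 define \<rho> where "\<rho> = (\<lambda>x. (mode_norm x)\<^sup>2 / (1 + \<nu> * (mode_norm x)\<^sup>2))"
 define s :: real where "s = (if i then 1 else - 1)"
 have "order_zero (\<lambda>x. s) 1" by (auto simp: order_zero_def s_def)
 then have "order_zero (\<lambda>x. s * (e m x * (e True x * (e (\<not> i) x * \<rho> x))))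
   (2 * 1 * (2 * 2 * (2 * 2 * (2 * 2 * (3 / (2 * \<nu>))))))"
  unfolding e_def \<rho>_def using \<nu>
  by (intro order_zero_mult order_zero_direction order_zero_brinkman) auto
 moreover have "2 * 1 * (2 * 2 * (2 * 2 * (2 * 2 * (3 / (2 * \<nu>))))) = 192 / \<nu>" by simp
 moreover have "strain_symbol \<nu> i m j = (s * (e m j * (e True j * (e (\<not> i) j * \<rho> j)))) / mode_norm j" for j
 proof (cases "j = 0")
  case False
  then have n: "0 < mode_norm j" by (rule mode_norm_pos)
  have D: "0 < 1 + \<nu> * (mode_norm j)\<^sup>2" using \<nu> by (simp add: add_pos_nonneg)
  have "ipmb_symbol \<nu> i j = s * (component True j * component (\<not> i) j) / ((1 + \<nu> * (mode_norm j)\<^sup>2) * (mode_norm j)\<^sup>2)"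
   unfolding mode_norm_sq
   by (cases i) (simp_all add: ipmb_symbol_def ipmb_symbol1_def ipmb_symbol2_def s_def component_def power2_eq_square)
  moreover have "s * (A * B) / (D * N\<^sup>2) * M = (s * (M / N * (A / N * (B / N * (N\<^sup>2 / D))))) / N"
   if "0 < N" "0 < D" for A B D M N :: real
   using that by (simp add: field_simps power2_eq_square)
  ultimately show ?thesis using n D by (simp only: strain_symbol_def e_def \<rho>_def)
 qed (simp add: strain_symbol_def component_def)
 ultimately show ?thesis by (intro exI[of _ "\<lambda>x. s * (e m x * (e True x * (e (\<not> i) x * \<rho> x)))"]) metis
qed

text \<open>The symbol behaves like \<open>1 / mode_norm\<close>, so its square just fails to be summable; its
 differences are square summable with a bound that grows slower than the step.\<close>

lemma sum_shifted_difference_sq_le: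
 fixes h :: nat
 assumes \<phi>: "order_zero \<phi> C" and h: "1 \<le> h" and T: "finite T"
 defines "q \<equiv> \<lambda>j. \<phi> j / mode_norm j"
 shows "(\<Sum>j\<in>T. (q (j + (int h, 0)) - q j)\<^sup>2) \<le> 1200 * C\<^sup>2 * sqrt (real h)"
proof -
 define e where "e = (int h, 0 :: int)"
 have e: "mode_norm e = real h" "e \<noteq> 0" using h by (auto simp: e_def mode_norm_def zero_prod_def)
 have C: "0 \<le> C" using order_zeroD(2)[OF \<phi> e(2)] .
 have s1: "1 \<le> sqrt (real h)" using h by simp
 let ?T = "T - {0, - e}"
 let ?g = "\<lambda>j. mode_norm j powr (- 2 - 1/2)"
 have main: "(q (j + e) - q j)\<^sup>2 \<le> 16 * C\<^sup>2 * sqrt (real h) * (?g (j + e) + ?g j)" if "j \<in> ?T" for j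
 proof -
  have nz: "j + e \<noteq> 0" "j \<noteq> 0" using that by (auto simp: add_eq_0_iff2)
  define u v where "u = 1 / mode_norm (j + e)" and "v = 1 / mode_norm j"
  have uv: "0 < u" "0 < v" using nz mode_norm_pos by (simp_all add: u_def v_def)
  define x where "x = real h * (u * v)"
  have x0: "0 \<le> x" using uv by (simp add: x_def)
  have "\<bar>q (j + e) - q j\<bar> \<le> 2 * C * (mode_norm (j + e - j) / (mode_norm (j + e) * mode_norm j))"
   unfolding q_def by (rule order_minus_one_diff[OF \<phi> nz])
  then have "\<bar>q (j + e) - q j\<bar> \<le> 2 * C * x" by (simp add: e(1) x_def u_def v_def)
  then have "(q (j + e) - q j)\<^sup>2 \<le> (2 * C * x)\<^sup>2"
   using power_mono[of "\<bar>q (j + e) - q j\<bar>" "2 * C * x" 2] by simp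
  moreover have "x\<^sup>2 \<le> 4 * sqrt (real h) * (?g (j + e) + ?g j)"
  proof -
   have "real h \<le> mode_norm (j + e) + mode_norm j"
    using mode_norm_triangle[of "j + e" "- j"] by (simp add: e(1))
   then have "x \<le> (mode_norm (j + e) + mode_norm j) * (u * v)"
    unfolding x_def using uv by (intro mult_right_mono) auto
   also have "\<dots> = u + v" using nz by (simp add: u_def v_def field_simps)
   finally have xuv: "x \<le> u + v" .
   define M where "M = max u v"
   have M: "0 < M" "u \<le> M" "v \<le> M" using uv by (auto simp: M_def)
   have "x\<^sup>2 = x powr (1/2) * x powr (3/2)"
    using x0 by (simp add: powr_add[symmetric])
   also have "\<dots> \<le> (real h * (M * M)) powr (1/2) * (2 * M) powr (3/2)"
   proof (intro mult_mono powr_mono2)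
    show "x \<le> real h * (M * M)" unfolding x_def using M uv by (intro mult_left_mono mult_mono) auto
    show "x \<le> 2 * M" using xuv M by linarith
   qed (use x0 M in auto)
   also have "\<dots> = sqrt (real h) * M * (2 powr (3/2) * M powr (3/2))"
    using M by (simp add: powr_mult powr_half_sqrt real_sqrt_mult)
   also have "\<dots> = 2 powr (3/2) * sqrt (real h) * M powr (5/2)"
    using M powr_mult_base[of M "3/2"] by simp
   also have "\<dots> \<le> 4 * sqrt (real h) * M powr (5/2)"
   proof -
    have "2 powr (3/2) \<le> (2 :: real) powr 2" by (rule powr_mono) auto
    then show ?thesis by (intro mult_right_mono) auto
   qed
   also have "\<dots> \<le> 4 * sqrt (real h) * (?g (j + e) + ?g j)"
   proof (rule mult_left_mono)
    have ue: "u powr (5/2) = ?g (j + e)" "v powr (5/2) = ?g j"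
     using nz mode_norm_pos[of j] mode_norm_pos[of "j + e"] by (simp_all add: u_def v_def powr_divide powr_minus_divide[symmetric])
    show "M powr (5/2) \<le> ?g (j + e) + ?g j" unfolding M_def ue[symmetric] by (cases "u \<le> v") (auto simp: max_def)
   qed simp
   finally show ?thesis .
  qed
  ultimately have "(q (j + e) - q j)\<^sup>2 \<le> 4 * C\<^sup>2 * x\<^sup>2"
   and le: "x\<^sup>2 \<le> 4 * sqrt (real h) * (?g (j + e) + ?g j)" by (simp_all only: power_mult_distrib) simp_all
  note this(1)
  also have "4 * C\<^sup>2 * x\<^sup>2 \<le> 4 * C\<^sup>2 * (4 * sqrt (real h) * (?g (j + e) + ?g j))"
   by (rule mult_left_mono[OF le]) simp
  also have "\<dots> = 16 * C\<^sup>2 * sqrt (real h) * (?g (j + e) + ?g j)"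
   by (simp add: algebra_simps)
  finally show ?thesis .
 qed
 have g1: "(\<Sum>j\<in>?T. ?g j) \<le> 36"
  using sum_mode_norm_powr_le[of ?T "1/2"] T by simp
 have g2: "(\<Sum>j\<in>?T. ?g (j + e)) \<le> 36"
 proof -
  have "(\<Sum>j\<in>?T. ?g (j + e)) = (\<Sum>j\<in>(\<lambda>j. j + e) ` ?T. ?g j)"
   by (subst sum.reindex) (auto simp: inj_on_def)
  also have "\<dots> \<le> 12 * (1 + 1 / (1/2))"
   by (rule sum_mode_norm_powr_le) (use T in \<open>auto simp: add_eq_0_iff2\<close>)
  finally show ?thesis by simp
 qed
 have q0: "q 0 = 0" by (simp add: q_def)
 have qe: "\<bar>q x\<bar> \<le> C" if "x \<noteq> 0" for x
 proof -
  have "\<bar>q x\<bar> = \<bar>\<phi> x\<bar> / mode_norm x" by (simp add: q_def)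
  also have "\<dots> \<le> C / 1" using order_zeroD(1)[OF \<phi> that] mode_norm_ge_1[OF that] C by (intro frac_le) auto
  finally show ?thesis by simp
 qed
 have qb: "(q x)\<^sup>2 \<le> C\<^sup>2" for x
  using qe[of x] q0 by (cases "x = 0") (auto simp: abs_le_square_iff[symmetric] C)
 have "(\<Sum>j\<in>T. (q (j + e) - q j)\<^sup>2) \<le> (\<Sum>j\<in>?T \<union> {0, - e}. (q (j + e) - q j)\<^sup>2)"
  by (rule sum_mono2) (use T in auto)
 also have "\<dots> = (\<Sum>j\<in>?T. (q (j + e) - q j)\<^sup>2) + (\<Sum>j\<in>{0, - e}. (q (j + e) - q j)\<^sup>2)"
  by (rule sum.union_disjoint) (use T in auto)
 also have "(\<Sum>j\<in>{0, - e}. (q (j + e) - q j)\<^sup>2) \<le> C\<^sup>2 + C\<^sup>2"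
  using e(2) qb[of e] qb[of "- e"] by (simp add: q0)
 also have "(\<Sum>j\<in>?T. (q (j + e) - q j)\<^sup>2) \<le> (\<Sum>j\<in>?T. 16 * C\<^sup>2 * sqrt (real h) * (?g (j + e) + ?g j))"
  by (rule sum_mono) (rule main)
 also have "\<dots> = 16 * C\<^sup>2 * sqrt (real h) * ((\<Sum>j\<in>?T. ?g (j + e)) + (\<Sum>j\<in>?T. ?g j))"
  by (simp only: sum_distrib_left[symmetric] sum.distrib)
 also have "\<dots> \<le> 16 * C\<^sup>2 * sqrt (real h) * (36 + 36)"
  by (intro mult_left_mono add_mono g1 g2) auto
 finally have "(\<Sum>j\<in>T. (q (j + e) - q j)\<^sup>2) \<le> 16 * C\<^sup>2 * sqrt (real h) * (36 + 36) + (C\<^sup>2 + C\<^sup>2)" by simp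
 also have "\<dots> \<le> 1200 * C\<^sup>2 * sqrt (real h)"
 proof -
  have "C\<^sup>2 \<le> C\<^sup>2 * sqrt (real h)" using mult_left_mono[OF s1, of "C\<^sup>2"] by simp
  moreover have "16 * C\<^sup>2 * sqrt (real h) * (36 + 36) = 1152 * (C\<^sup>2 * sqrt (real h))"
   "1200 * C\<^sup>2 * sqrt (real h) = 1200 * (C\<^sup>2 * sqrt (real h))" by simp_all
  moreover have "0 \<le> C\<^sup>2" by simp
  ultimately show ?thesis by linarith
 qed
 finally show ?thesis by (simp add: e_def)
qed

subsection \<open>Strips\<close>

text \<open>Neighbourhoods of the line \<open>fst x = 0\<close> of the torus, shrinking by a factor of two.\<close>

definition edge_strip :: "nat \<Rightarrow> (real \<times> real) set" where
 "edge_strip p = {x \<in> torus_cell. fst x \<le> pi / 2 ^ p \<or> 2 * pi - pi / 2 ^ p \<le> fst x}"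

lemma edge_strip_eq:
 "edge_strip p = cbox (0, 0) (pi / 2 ^ p, 2 * pi) \<union> cbox (2 * pi - pi / 2 ^ p, 0) (2 * pi, 2 * pi)"
proof -
 have "pi / 2 ^ p \<le> pi / 1" by (rule divide_left_mono) auto
 then have "pi / 2 ^ p \<le> 2 * pi" using pi_gt_zero by linarith
 then show ?thesis by (auto simp: edge_strip_def torus_cell_def cbox_Pair_eq)
qed

lemma measure_edge_strip: "edge_strip p \<in> sets cell_measure" "measure cell_measure (edge_strip p) \<le> (2 * pi)\<^sup>2 / 2 ^ p"
proof -
 have sub: "edge_strip p \<subseteq> torus_cell" by (auto simp: edge_strip_def)
 have b: "edge_strip p \<in> sets borel" unfolding edge_strip_eq by simp
 then show s: "edge_strip p \<in> sets cell_measure"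
  using sub by (auto simp: cell_measure_def sets_restrict_space)
 let ?A = "cbox (0, 0) (pi / 2 ^ p, 2 * pi) :: (real \<times> real) set"
 let ?B = "cbox (2 * pi - pi / 2 ^ p, 0) (2 * pi, 2 * pi) :: (real \<times> real) set"
 have "measure cell_measure (edge_strip p) = measure lborel (edge_strip p)"
  using sub by (simp add: cell_measure_def measure_restrict_space)
 also have "\<dots> \<le> measure lborel ?A + measure lborel ?B"
  unfolding edge_strip_eq by (rule measure_Un_le) auto
 also have "\<dots> = pi / 2 ^ p * (2 * pi) + pi / 2 ^ p * (2 * pi)"
  by (subst (1 2) measure_lborel_cbox) (auto simp: Basis_prod_def inner_Pair)
 also have "\<dots> = (2 * pi)\<^sup>2 / 2 ^ p" by (simp add: power2_eq_square)
 finally show "measure cell_measure (edge_strip p) \<le> (2 * pi)\<^sup>2 / 2 ^ p" .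
qed

lemma mode_minus_one_ge_on_strip:
 assumes "x \<in> edge_strip p" "x \<notin> edge_strip (Suc p)"
 shows "1 \<le> cmod (mode (2 ^ p, 0) x - 1)"
proof -
 define t where "t = 2 ^ p * fst x"
 have cos_le: "cos t \<le> 0"
 proof -
  have c: "0 \<le> fst x" "fst x \<le> 2 * pi" using assms(1) by (auto simp: edge_strip_def torus_cell_def)
  have n: "pi / 2 < 2 ^ p * fst x" "2 ^ p * fst x < 2 ^ p * (2 * pi) - pi / 2"
   using assms by (auto simp: edge_strip_def field_simps)
  consider "2 ^ p * fst x \<le> pi" | "2 ^ p * (2 * pi) - pi \<le> 2 ^ p * fst x"
   using assms(1) by (auto simp: edge_strip_def field_simps)
  then show ?thesis
  proof cases
   case 1
   have "cos t \<le> cos (pi / 2)" by (rule cos_monotone_0_pi_le) (use n 1 in \<open>auto simp: t_def\<close>)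
   then show ?thesis by simp
  next
   case 2
   define r where "r = 2 ^ p * (2 * pi) - t"
   have r: "pi / 2 \<le> r" "r \<le> pi" using n 2 by (auto simp: r_def t_def)
   have "cos t = cos (- t)" by simp
   also have "- t = r - 2 * pi * of_int (2 ^ p)" by (simp add: r_def)
   also have "cos \<dots> = cos r"
    using cos_int_2pin[of "2 ^ p"] sin_int_2pin[of "2 ^ p"] by (simp only: cos_diff)
   also have "\<dots> \<le> cos (pi / 2)" by (rule cos_monotone_0_pi_le) (use r in auto)
   finally show ?thesis by simp
  qed
 qed
 have "mode (2 ^ p, 0) x = cis t" by (simp add: mode_def mode_phase_def t_def)
 then have "(cmod (mode (2 ^ p, 0) x - 1))\<^sup>2 = (cos t - 1)\<^sup>2 + (sin t)\<^sup>2" by (simp add: cmod_power2)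
 also have "\<dots> = 2 - 2 * cos t" using sin_cos_squared_add[of t] by (simp add: power2_eq_square algebra_simps)
 finally have "1\<^sup>2 \<le> (cmod (mode (2 ^ p, 0) x - 1))\<^sup>2" using cos_le by simp
 then show ?thesis by (rule power2_le_imp_le) simp
qed

definition strip_ratio :: real where
 "strip_ratio = sqrt (sqrt (1 / 2))"

lemma strip_ratio: "0 \<le> strip_ratio" "strip_ratio < 1"
 by (simp_all add: strip_ratio_def)

text \<open>On the \<open>p\<close>-th strip \<open>f\<close> is divided by the difference \<open>mode (2 ^ p, 0) - 1\<close>, which is bounded below
 there; on the Fourier side this turns the symbol into its difference with step \<open>2 ^ p\<close>.\<close>

lemma strip_functional_le:
 assumes \<phi>: "order_zero \<phi> C" and T: "finite T" "\<And>j. j \<notin> T \<Longrightarrow> \<phi> j = 0"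
  and f: "f \<in> borel_measurable cell_measure" "\<And>x. x \<in> torus_cell \<Longrightarrow> cmod (f x) \<le> S" and S: "0 \<le> S"
 shows "cmod (\<Sum>j\<in>T. of_real (\<phi> j / mode_norm j) *
   cell_coeff (\<lambda>x. if x \<in> edge_strip p - edge_strip (Suc p) then f x else 0) j) \<le> sqrt 1200 * C * S * strip_ratio ^ p"
proof -
 define q where "q = (\<lambda>j. \<phi> j / mode_norm j)"
 have C: "0 \<le> C" using order_zeroD(2)[OF \<phi>, of "(1, 0)"] by (simp add: zero_prod_def)
 define E where "E = edge_strip p - edge_strip (Suc p)"
 define h :: "int \<times> int" where "h = (2 ^ p, 0)"
 define \<xi> where "\<xi> = (\<lambda>x. if x \<in> E then f x / (mode h x - 1) else 0)"
 have E: "E \<in> sets cell_measure" unfolding E_def using measure_edge_strip(1) by (intro sets.Diff)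
 have Esub: "E \<subseteq> torus_cell" by (auto simp: E_def edge_strip_def)
 have lower: "1 \<le> cmod (mode h x - 1)" if "x \<in> E" for x
  using mode_minus_one_ge_on_strip[of x p] that by (simp add: E_def h_def)
 have mode_meas: "mode k \<in> borel_measurable cell_measure" for k
  by (rule borel_measurable_cell_continuous[OF continuous_on_mode])
 have \<xi>m: "\<xi> \<in> borel_measurable cell_measure"
  unfolding \<xi>_def by (rule measurable_If_set) (use f(1) mode_meas E sets.Int[OF E sets.top] in auto)
 have \<xi>b: "cmod (\<xi> x) \<le> S * indicator E x" for x
 proof (cases "x \<in> E")
  case True
  have "cmod (f x) / cmod (mode h x - 1) \<le> S / 1"
   using f(2)[of x] lower[OF True] True Esub S by (intro frac_le) auto
  then show ?thesis using True by (simp add: \<xi>_def norm_divide)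
 qed (simp add: \<xi>_def)
 have \<xi>b': "cmod (\<xi> x) \<le> S" for x using \<xi>b[of x] S by (cases "x \<in> E") auto
 have im: "integrable cell_measure (\<lambda>x. \<xi> x * mode k x)" for k
  by (rule integrable_cell_bounded[where B = S]) (use \<xi>m mode_meas \<xi>b' in \<open>auto simp: norm_mult\<close>)
 have coeff: "cell_coeff (\<lambda>x. if x \<in> E then f x else 0) j = cell_coeff \<xi> (j - h) - cell_coeff \<xi> j" for j
 proof -
  have "(if x \<in> E then f x else 0) * mode (- j) x = \<xi> x * mode (- (j - h)) x - \<xi> x * mode (- j) x" for x
  proof (cases "x \<in> E")
   case True
   then have "mode h x - 1 \<noteq> 0" using lower[of x] by auto
   then have eq: "\<xi> x * (mode h x - 1) = f x" using True by (simp add: \<xi>_def)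
   have m: "mode (- (j - h)) x = mode (- j) x * mode h x" using mode_add[of "- j" h x] by (simp add: algebra_simps)
   have "\<xi> x * mode (- (j - h)) x - \<xi> x * mode (- j) x = (\<xi> x * (mode h x - 1)) * mode (- j) x"
    unfolding m by (simp add: algebra_simps)
   then show ?thesis using True by (simp only: eq if_True)
  qed (simp add: \<xi>_def)
  then show ?thesis
   unfolding cell_coeff_def using Bochner_Integration.integral_diff[OF im im, of "- (j - h)" "- j"]
   by (simp add: diff_divide_distrib)
 qed
 define T' where "T' = T \<union> (\<lambda>j. j - h) ` T"
 have T': "finite T'" using T by (simp add: T'_def)
 have q0: "q j = 0" if "j \<notin> T" for j using T(2)[OF that] by (simp add: q_def)
 have "(\<Sum>j\<in>T. of_real (q j) * cell_coeff (\<lambda>x. if x \<in> E then f x else 0) j) =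
   (\<Sum>j\<in>T. of_real (q j) * cell_coeff \<xi> (j - h)) - (\<Sum>j\<in>T. of_real (q j) * cell_coeff \<xi> j)"
  by (simp add: coeff right_diff_distrib sum_subtractf)
 also have "(\<Sum>j\<in>T. of_real (q j) * cell_coeff \<xi> (j - h)) = (\<Sum>j\<in>(\<lambda>j. j - h) ` T. of_real (q (j + h)) * cell_coeff \<xi> j)"
  by (subst sum.reindex[OF inj_on_shift(1)]) simp
 also have "\<dots> = (\<Sum>j\<in>T'. of_real (q (j + h)) * cell_coeff \<xi> j)"
 proof (rule sum.mono_neutral_left[OF T'])
  show "\<forall>j\<in>T' - (\<lambda>j. j - h) ` T. of_real (q (j + h)) * cell_coeff \<xi> j = 0"
  proof
   fix j assume "j \<in> T' - (\<lambda>j. j - h) ` T"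
   then have "j + h \<notin> T" by (metis DiffD2 add_diff_cancel image_eqI)
   then show "of_real (q (j + h)) * cell_coeff \<xi> j = 0" by (simp add: q0)
  qed
 qed (simp add: T'_def)
 also have "(\<Sum>j\<in>T. of_real (q j) * cell_coeff \<xi> j) = (\<Sum>j\<in>T'. of_real (q j) * cell_coeff \<xi> j)"
  by (rule sum.mono_neutral_left[OF T']) (use q0 in \<open>simp_all add: T'_def\<close>)
 finally have "cmod (\<Sum>j\<in>T. of_real (q j) * cell_coeff (\<lambda>x. if x \<in> E then f x else 0) j) =
   cmod (\<Sum>j\<in>T'. of_real (q (j + h) - q j) * cell_coeff \<xi> j)"
  by (simp add: sum_subtractf[symmetric] left_diff_distrib)
 also have "\<dots> \<le> (\<Sum>j\<in>T'. \<bar>q (j + h) - q j\<bar> * cmod (cell_coeff \<xi> j))"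
  by (rule sum_norm_le) (simp add: norm_mult flip: of_real_diff)
 also have "\<dots> \<le> sqrt (1200 * C\<^sup>2 * sqrt (2 ^ p)) * sqrt (S\<^sup>2 / 2 ^ p)"
 proof (rule sum_pairs_Cauchy_Schwarz)
  have "(\<Sum>j\<in>T'. \<bar>q (j + h) - q j\<bar>\<^sup>2) \<le> 1200 * C\<^sup>2 * sqrt (real (2 ^ p))"
   using sum_shifted_difference_sq_le[OF \<phi> _ T', of "2 ^ p"] by (simp add: q_def h_def)
  then show "(\<Sum>j\<in>T'. \<bar>q (j + h) - q j\<bar>\<^sup>2) \<le> (sqrt (1200 * C\<^sup>2 * sqrt (2 ^ p)))\<^sup>2" by simp
  have "(\<Sum>j\<in>T'. (cmod (cell_coeff \<xi> j))\<^sup>2) \<le> (LINT x|cell_measure. (cmod (\<xi> x))\<^sup>2) / (2 * pi)\<^sup>2"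
   by (rule Bessel_inequality[OF \<xi>m \<xi>b' T'])
  also have "(LINT x|cell_measure. (cmod (\<xi> x))\<^sup>2) \<le> (LINT x|cell_measure. S\<^sup>2 * indicator E x)"
  proof (rule integral_mono)
   show "integrable cell_measure (\<lambda>x. (cmod (\<xi> x))\<^sup>2)"
    by (rule integrable_cell_bounded[where B = "S\<^sup>2"]) (use \<xi>m \<xi>b' in \<open>auto intro!: power_mono\<close>)
   show "integrable cell_measure (\<lambda>x. S\<^sup>2 * indicator E x)"
    by (rule integrable_cell_bounded[where B = "S\<^sup>2"]) (use E in \<open>auto simp: indicator_def\<close>)
   show "(cmod (\<xi> x))\<^sup>2 \<le> S\<^sup>2 * indicator E x" for x
    using power_mono[OF \<xi>b[of x], of 2] by (cases "x \<in> E") auto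
  qed
  also have "\<dots> = S\<^sup>2 * measure cell_measure E"
   using E Esub by (simp add: Int_absorb2)
  also have "measure cell_measure E \<le> (2 * pi)\<^sup>2 / 2 ^ p"
   by (rule order_trans[OF cell.finite_measure_mono measure_edge_strip(2)]) (use measure_edge_strip(1) in \<open>auto simp: E_def\<close>)
  finally have "(\<Sum>j\<in>T'. (cmod (cell_coeff \<xi> j))\<^sup>2) \<le> (S\<^sup>2 * ((2 * pi)\<^sup>2 / 2 ^ p)) / (2 * pi)\<^sup>2"
   by (simp add: divide_right_mono mult_left_mono)
  then show "(\<Sum>j\<in>T'. (cmod (cell_coeff \<xi> j))\<^sup>2) \<le> (sqrt (S\<^sup>2 / 2 ^ p))\<^sup>2" by simp
 qed auto
 also have "\<dots> = sqrt 1200 * C * S * strip_ratio ^ p"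
 proof -
  have "strip_ratio ^ p = sqrt (sqrt (1 / 2 ^ p))"
   by (simp add: strip_ratio_def real_sqrt_power[symmetric] power_one_over)
  also have "1 / 2 ^ p = sqrt (2 ^ p) * sqrt (2 ^ p) * ((1 / 2 ^ p) * (1 / 2 ^ p))" by (simp add: field_simps)
  also have "sqrt \<dots> = sqrt (2 ^ p) * (1 / 2 ^ p)" by (simp only: real_sqrt_mult real_sqrt_mult_self) simp
  finally have "strip_ratio ^ p = sqrt (sqrt (2 ^ p)) * sqrt (1 / 2 ^ p)" by (simp only: real_sqrt_mult)
  moreover have "sqrt (1200 * C\<^sup>2 * sqrt (2 ^ p)) * sqrt (S\<^sup>2 / 2 ^ p) = sqrt 1200 * C * S * (sqrt (sqrt (2 ^ p)) * sqrt (1 / 2 ^ p))"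
   using C S by (simp add: real_sqrt_mult real_sqrt_divide)
  ultimately show ?thesis by simp
 qed
 finally show ?thesis by (simp add: q_def E_def)
qed

definition strip_const :: real where
 "strip_const = sqrt 1200 / (1 - strip_ratio)"

text \<open>The cell is the disjoint union of differences of consecutive strips, up to a null set, and their
 contributions form a geometric series.\<close>

lemma singular_functional_le:
 assumes \<phi>: "order_zero \<phi> C" and T: "finite T" "\<And>j. j \<notin> T \<Longrightarrow> \<phi> j = 0"
  and f: "f \<in> borel_measurable cell_measure" "\<And>x. x \<in> torus_cell \<Longrightarrow> cmod (f x) \<le> S" and S: "0 \<le> S"
 shows "cmod (\<Sum>j\<in>T. of_real (\<phi> j / mode_norm j) * cell_coeff f j) \<le> strip_const * C * S"
proof -
 define Q where "Q = (\<lambda>g. \<Sum>j\<in>T. of_real (\<phi> j / mode_norm j) * cell_coeff g j)"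
 have C: "0 \<le> C" using order_zeroD(2)[OF \<phi>, of "(1, 0)"] by (simp add: zero_prod_def)
 define restr where "restr = (\<lambda>A x. if x \<in> A then f x else 0)"
 have mode_meas: "mode k \<in> borel_measurable cell_measure" for k
  by (rule borel_measurable_cell_continuous[OF continuous_on_mode])
 have rm: "restr A \<in> borel_measurable cell_measure" if "A \<in> sets cell_measure" for A
  unfolding restr_def by (rule measurable_If_set) (use f(1) that sets.Int[OF that sets.top] in auto)
 have rb: "cmod (restr A x) \<le> S" if "x \<in> torus_cell" for A x using f(2)[OF that] S by (simp add: restr_def)
 have ri: "integrable cell_measure (\<lambda>x. restr A x * mode k x)" if "A \<in> sets cell_measure" for A k
  by (rule integrable_cell_bounded[where B = S]) (use rm[OF that] mode_meas rb in \<open>auto simp: norm_mult\<close>)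
 have Qstep: "Q (restr (edge_strip p)) = Q (restr (edge_strip p - edge_strip (Suc p))) + Q (restr (edge_strip (Suc p)))" for p
 proof -
  have sub: "edge_strip (Suc p) \<subseteq> edge_strip p"
  proof -
   have "pi / 2 ^ Suc p \<le> pi / 2 ^ p" by (rule divide_left_mono) auto
   then show ?thesis by (auto simp: edge_strip_def)
  qed
  have "cell_coeff (restr (edge_strip p)) j = cell_coeff (restr (edge_strip p - edge_strip (Suc p))) j + cell_coeff (restr (edge_strip (Suc p))) j" for j
  proof -
   have "restr (edge_strip p) x * mode (- j) x =
    restr (edge_strip p - edge_strip (Suc p)) x * mode (- j) x + restr (edge_strip (Suc p)) x * mode (- j) x" for x
    using sub by (auto simp: restr_def)
   then show ?thesis unfolding cell_coeff_def
    using Bochner_Integration.integral_add[OF ri[OF sets.Diff[OF measure_edge_strip(1) measure_edge_strip(1)]] ri[OF measure_edge_strip(1)], of p "Suc p" "- j" "Suc p" "- j"]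
    by (simp add: add_divide_distrib)
  qed
  then show ?thesis by (simp only: Q_def distrib_left sum.distrib)
 qed
 have Qpart: "cmod (Q (restr (edge_strip p - edge_strip (Suc p)))) \<le> sqrt 1200 * C * S * strip_ratio ^ p" for p
  unfolding Q_def restr_def by (rule strip_functional_le[OF \<phi> T f S])
 have E0: "edge_strip 0 = torus_cell" by (auto simp: edge_strip_def)
 have Q0: "Q (restr (edge_strip 0)) = Q f"
 proof -
  have "cell_coeff (restr torus_cell) = cell_coeff f"
   unfolding cell_coeff_def by (intro ext arg_cong2[where f = "(/)"] Bochner_Integration.integral_cong refl) (simp add: restr_def)
  then show ?thesis by (simp add: Q_def E0)
 qed
 have iter: "cmod (Q f) \<le> (\<Sum>p<P. sqrt 1200 * C * S * strip_ratio ^ p) + cmod (Q (restr (edge_strip P)))" for P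
 proof (induction P)
  case (Suc P)
  have "cmod (Q (restr (edge_strip P))) \<le> sqrt 1200 * C * S * strip_ratio ^ P + cmod (Q (restr (edge_strip (Suc P))))"
   unfolding Qstep[of P] using norm_triangle_ineq Qpart order_trans add_right_mono by metis
  then show ?case using Suc by simp
 qed (simp add: Q0)
 have rest: "cmod (Q (restr (edge_strip P))) \<le> (\<Sum>j\<in>T. \<bar>\<phi> j / mode_norm j\<bar>) * S * (1 / 2) ^ P" for P
 proof -
  have "cmod (cell_coeff (restr (edge_strip P)) j) \<le> S * (1 / 2) ^ P" for j
  proof -
   have "cmod (LINT x|cell_measure. restr (edge_strip P) x * mode (- j) x) \<le> (LINT x|cell_measure. cmod (restr (edge_strip P) x * mode (- j) x))"
    by (rule integral_norm_bound)
   also have "\<dots> \<le> (LINT x|cell_measure. S * indicator (edge_strip P) x)"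
   proof (rule integral_mono)
    show "integrable cell_measure (\<lambda>x. cmod (restr (edge_strip P) x * mode (- j) x))"
     by (rule integrable_norm[OF ri[OF measure_edge_strip(1)]])
    show "integrable cell_measure (\<lambda>x. S * indicator (edge_strip P) x)"
     by (rule integrable_cell_bounded[where B = S]) (use S measure_edge_strip(1) in \<open>auto simp: indicator_def\<close>)
    show "cmod (restr (edge_strip P) x * mode (- j) x) \<le> S * indicator (edge_strip P) x" if "x \<in> space cell_measure" for x
     using f(2)[of x] that by (simp add: restr_def norm_mult)
   qed
   also have "\<dots> = S * measure cell_measure (edge_strip P)"
    using measure_edge_strip(1)[of P] sets.sets_into_space[OF measure_edge_strip(1)[of P]] by (simp add: Int_absorb2)
   also have "\<dots> \<le> S * ((2 * pi)\<^sup>2 / 2 ^ P)" by (intro mult_left_mono measure_edge_strip(2) S)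
   finally have "cmod (LINT x|cell_measure. restr (edge_strip P) x * mode (- j) x) / (2 * pi)\<^sup>2 \<le> S * ((2 * pi)\<^sup>2 / 2 ^ P) / (2 * pi)\<^sup>2"
    by (rule divide_right_mono) simp
   then show ?thesis by (simp add: cell_coeff_def norm_divide norm_power power_one_over)
  qed
  then have "cmod (Q (restr (edge_strip P))) \<le> (\<Sum>j\<in>T. \<bar>\<phi> j / mode_norm j\<bar> * (S * (1 / 2) ^ P))"
   unfolding Q_def by (intro sum_norm_le) (simp only: norm_mult norm_of_real mult_left_mono abs_ge_zero)
  then show ?thesis by (simp add: sum_distrib_right mult.assoc)
 qed
 have "cmod (Q f) \<le> strip_const * C * S + (\<Sum>j\<in>T. \<bar>\<phi> j / mode_norm j\<bar>) * S * (1 / 2) ^ P" for P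
 proof -
  have "(\<Sum>p<P. strip_ratio ^ p) = (1 - strip_ratio ^ P) / (1 - strip_ratio)"
   using strip_ratio by (simp add: sum_gp_strict)
  also have "\<dots> \<le> 1 / (1 - strip_ratio)" using strip_ratio by (intro divide_right_mono) auto
  finally have "sqrt 1200 * C * S * (\<Sum>p<P. strip_ratio ^ p) \<le> sqrt 1200 * C * S * (1 / (1 - strip_ratio))"
   using C S by (intro mult_left_mono) auto
  then have "(\<Sum>p<P. sqrt 1200 * C * S * strip_ratio ^ p) \<le> strip_const * C * S"
   unfolding sum_distrib_left[symmetric] by (simp add: strip_const_def mult_ac)
  then show ?thesis using iter[of P] rest[of P] by linarith
 qed
 moreover have "(\<lambda>P. strip_const * C * S + (\<Sum>j\<in>T. \<bar>\<phi> j / mode_norm j\<bar>) * S * (1 / 2) ^ P) \<longlonglongrightarrow>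
   strip_const * C * S + (\<Sum>j\<in>T. \<bar>\<phi> j / mode_norm j\<bar>) * S * 0"
  by (intro tendsto_intros LIMSEQ_power_zero) simp
 ultimately have "cmod (Q f) \<le> strip_const * C * S + (\<Sum>j\<in>T. \<bar>\<phi> j / mode_norm j\<bar>) * S * 0"
  by (intro LIMSEQ_le_const) auto
 then show ?thesis by (simp add: Q_def)
qed

text \<open>The velocity gradient is bounded by the supremum of the scalar, which is the quantity the
 transport equation conserves; no bound by the \<open>L\<^sup>2\<close> norm is possible. A cutoff makes all sums over
 modes finite.\<close>

theorem fseries_strain_le:
 assumes \<nu>: "0 < \<nu>" and a: "(\<lambda>k. cmod (a k)) summable_on UNIV" and S: "\<And>x. cmod (fseries a x) \<le> S"
 shows "cmod (fseries (strain \<nu> i m a) x) \<le> (768 * strip_const / \<nu>) * S"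
proof -
 obtain \<phi> where \<phi>: "order_zero \<phi> (192 / \<nu>)" "\<And>j. strain_symbol \<nu> i m j = \<phi> j / mode_norm j"
  using strain_symbol_order[OF \<nu>] by blast
 have S0: "0 \<le> S" using S norm_ge_zero order_trans by blast
 define c where "c = (\<lambda>j. a j * mode j x)"
 have c: "(\<lambda>k. cmod (c k)) summable_on UNIV" using a by (simp add: c_def norm_mult)
 have fc: "fseries c y = fseries a (x + y)" for y by (simp add: fseries_def c_def mode_shift mult.assoc)
 define m' where "m' = (\<lambda>N j. max 0 (1 - mode_norm j / real (Suc N)))"
 have m01: "0 \<le> m' N j" "m' N j \<le> 1" for N j
 proof -
  have "0 \<le> mode_norm j / real (Suc N)" by simp
  then show "0 \<le> m' N j" "m' N j \<le> 1" by (auto simp: m'_def max_def simp del: of_nat_Suc)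
 qed
 have bd: "cmod (\<Sum>\<^sub>\<infinity>j. of_real (m' N j) * (of_real (strain_symbol \<nu> i m j) * c j)) \<le> strip_const * (768 / \<nu>) * S" for N
 proof -
  let ?T = "{j. mode_norm j \<le> real (Suc N)}"
  have T: "finite ?T" by (rule card_mode_norm_le(1)) simp
  have "order_zero (\<lambda>j. \<phi> j * m' N j) (2 * (192 / \<nu>) * 2)"
   unfolding m'_def using \<nu> by (intro order_zero_mult \<phi>(1) order_zero_cutoff) auto
  then have oz: "order_zero (\<lambda>j. \<phi> j * m' N j) (768 / \<nu>)" by simp
  have z: "m' N j = 0" if "j \<notin> ?T" for j using that by (simp add: m'_def field_simps del: of_nat_Suc)
  have "(\<Sum>\<^sub>\<infinity>j. of_real (m' N j) * (of_real (strain_symbol \<nu> i m j) * c j)) =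
    (\<Sum>\<^sub>\<infinity>j\<in>?T. of_real (m' N j) * (of_real (strain_symbol \<nu> i m j) * c j))"
   by (rule infsum_cong_neutral) (use z in auto)
  also have "\<dots> = (\<Sum>j\<in>?T. of_real (\<phi> j * m' N j / mode_norm j) * cell_coeff (fseries c) j)"
   using T by (simp add: infsum_finite cell_coeff_fseries[OF c] \<phi>(2) mult_ac)
  also have "cmod \<dots> \<le> strip_const * (768 / \<nu>) * S"
   by (rule singular_functional_le[OF oz T])
    (use z S S0 in \<open>auto simp: fc intro!: borel_measurable_cell_continuous continuous_on_fseries[OF c]\<close>)
  finally show ?thesis .
 qed
 have "(\<lambda>N. \<Sum>\<^sub>\<infinity>j. of_real (m' N j) * (of_real (strain_symbol \<nu> i m j) * c j)) \<longlonglongrightarrow>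
   (\<Sum>\<^sub>\<infinity>j. of_real (strain_symbol \<nu> i m j) * c j)"
 proof (rule infsum_tendsto_dominated[where M = "\<lambda>j. 192 / \<nu> * cmod (c j)"])
  show "(\<lambda>j. 192 / \<nu> * cmod (c j)) summable_on UNIV" by (rule summable_on_cmult_right[OF c])
  fix j
  have "(\<lambda>N. max 0 (1 - mode_norm j * inverse (real (Suc N)))) \<longlonglongrightarrow> max 0 (1 - mode_norm j * 0)"
   by (intro tendsto_intros LIMSEQ_inverse_real_of_nat)
  then have "(\<lambda>N. m' N j) \<longlonglongrightarrow> 1" by (simp add: m'_def divide_inverse)
  then have "(\<lambda>N. of_real (m' N j) * (of_real (strain_symbol \<nu> i m j) * c j)) \<longlonglongrightarrow> of_real 1 * (of_real (strain_symbol \<nu> i m j) * c j)"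
   by (intro tendsto_intros)
  then show "(\<lambda>N. of_real (m' N j) * (of_real (strain_symbol \<nu> i m j) * c j)) \<longlonglongrightarrow> of_real (strain_symbol \<nu> i m j) * c j" by simp
  fix N
  have "\<bar>strain_symbol \<nu> i m j\<bar> \<le> 192 / \<nu>"
  proof (cases "j = 0")
   case False
   have "\<bar>\<phi> j\<bar> / mode_norm j \<le> (192 / \<nu>) / 1"
    using order_zeroD(1)[OF \<phi>(1) False] mode_norm_ge_1[OF False] \<nu> by (intro frac_le) auto
   then show ?thesis by (simp add: \<phi>(2))
  qed (use \<nu> in \<open>simp add: strain_symbol_def component_def\<close>)
  then have "m' N j * (\<bar>strain_symbol \<nu> i m j\<bar> * cmod (c j)) \<le> 1 * (192 / \<nu> * cmod (c j))"
   using m01 \<nu> by (intro mult_mono) auto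
  then show "cmod (of_real (m' N j) * (of_real (strain_symbol \<nu> i m j) * c j)) \<le> 192 / \<nu> * cmod (c j)"
   using m01 by (simp add: norm_mult)
 qed
 from tendsto_norm[OF this] have "cmod (\<Sum>\<^sub>\<infinity>j. of_real (strain_symbol \<nu> i m j) * c j) \<le> strip_const * (768 / \<nu>) * S"
  by (rule LIMSEQ_le_const2) (use bd in auto)
 moreover have "fseries (strain \<nu> i m a) x = (\<Sum>\<^sub>\<infinity>j. of_real (strain_symbol \<nu> i m j) * c j)"
  by (simp add: fseries_def strain_def strain_symbol_def c_def mult.assoc)
 ultimately show ?thesis by (simp add: mult_ac)
qed

section \<open>Gevrey regularity and the velocity field\<close>

subsection \<open>Summability of Gevrey weights\<close>

lemma bounded_sums_summable_on:
 fixes f :: "'a \<Rightarrow> real"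
 assumes "\<And>x. 0 \<le> f x" "\<And>F. finite F \<Longrightarrow> sum f F \<le> B"
 shows "f summable_on UNIV" "infsum f UNIV \<le> B"
proof -
 show s: "f summable_on UNIV"
  by (rule nonneg_bdd_above_summable_on) (use assms in \<open>auto intro!: bdd_aboveI2\<close>)
 show "infsum f UNIV \<le> B"
  by (rule infsum_le_finite_sums[OF s]) (use assms in auto)
qed

lemma mode_norm_powr_summable:
 assumes "0 < p"
 shows "(\<lambda>k. mode_norm k powr (- 2 - p)) summable_on UNIV"
proof (rule bounded_sums_summable_on(1))
 fix F :: "(int \<times> int) set" assume F: "finite F"
 have "(\<Sum>k\<in>F. mode_norm k powr (- 2 - p)) = (\<Sum>k\<in>F - {0}. mode_norm k powr (- 2 - p))"
  by (rule sum.mono_neutral_right) (use F in auto)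
 also have "\<dots> \<le> 12 * (1 + 1 / p)" by (rule sum_mode_norm_powr_le) (use F assms in auto)
 finally show "(\<Sum>k\<in>F. mode_norm k powr (- 2 - p)) \<le> 12 * (1 + 1 / p)" .
qed simp

lemma power_times_exp_bound:
 assumes \<tau>: "0 < \<tau>" and \<sigma>: "0 < \<sigma>"
 shows "\<exists>C\<ge>0. \<forall>k. mode_norm k ^ n * exp (- \<tau> * mode_norm k powr \<sigma>) \<le> (if k = 0 then 1 else C * mode_norm k powr (- 3))"
proof -
 define p where "p = real n + 3"
 define m where "m = p / \<sigma>"
 have m: "0 < m" using \<sigma> by (simp add: m_def p_def)
 show ?thesis
 proof (intro exI[of _ "(m / \<tau>) powr m"] conjI allI)
  fix k
  show "mode_norm k ^ n * exp (- \<tau> * mode_norm k powr \<sigma>) \<le> (if k = 0 then 1 else (m / \<tau>) powr m * mode_norm k powr (- 3))"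
  proof (cases "k = 0")
   case True
   then show ?thesis by (cases n) auto
  next
   case False
   define r where "r = mode_norm k"
   have r: "0 < r" using mode_norm_pos[OF False] by (simp add: r_def)
   define y where "y = \<tau> * r powr \<sigma>"
   have y: "0 < y" unfolding y_def using \<tau> r by (intro mult_pos_pos) auto
   have "(y / m) powr m \<le> exp (y / m) powr m"
   proof (rule powr_mono2)
    show "y / m \<le> exp (y / m)" using exp_ge_add_one_self[of "y / m"] by linarith
   qed (use y m in auto)
   also have "\<dots> = exp y" using m by (simp add: powr_def)
   finally have "(y / m) powr m \<le> exp y" .
   moreover have "(y / m) powr m = (\<tau> / m) powr m * r powr p"
   proof -
    have "y / m = (\<tau> / m) * r powr \<sigma>" by (simp add: y_def)
    also have "\<dots> powr m = (\<tau> / m) powr m * (r powr \<sigma>) powr m"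
     by (rule powr_mult)
    also have "(r powr \<sigma>) powr m = r powr p" using \<sigma> by (simp add: powr_powr m_def)
    finally show ?thesis .
   qed
   ultimately have "(\<tau> / m) powr m * r powr p * exp (- y) \<le> exp y * exp (- y)" by (intro mult_right_mono) auto
   then have "(\<tau> / m) powr m * (r powr p * exp (- y)) \<le> 1" by (simp add: exp_minus mult.assoc)
   then have "(m / \<tau>) powr m * ((\<tau> / m) powr m * (r powr p * exp (- y))) \<le> (m / \<tau>) powr m * 1"
    by (intro mult_left_mono) auto
   moreover have "(m / \<tau>) powr m * (\<tau> / m) powr m = 1"
    using \<tau> m by (simp add: powr_mult[symmetric])
   ultimately have "r powr p * exp (- y) \<le> (m / \<tau>) powr m" by (simp only: mult.assoc[symmetric] mult_1_left mult_1_right)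
   then have le: "r powr (- 3) * (r powr p * exp (- y)) \<le> r powr (- 3) * (m / \<tau>) powr m" by (intro mult_left_mono) auto
   have rn: "r powr (- 3) * r powr p = r ^ n"
    using r by (simp add: powr_add[symmetric] p_def powr_realpow)
   have "r ^ n * exp (- y) = r powr (- 3) * (r powr p * exp (- y))" by (simp only: rn[symmetric] mult.assoc)
   also note le
   also have "r powr (- 3) * (m / \<tau>) powr m = (m / \<tau>) powr m * r powr (- 3)" by (rule mult.commute)
   finally have "r ^ n * exp (- y) \<le> (m / \<tau>) powr m * r powr (- 3)" .
   then show ?thesis using False by (simp add: r_def y_def)
  qed
 qed simp
qed

lemma gevrey_weight_summable:
 assumes \<tau>: "0 < \<tau>" and \<sigma>: "0 < \<sigma>"
 shows "(\<lambda>k. mode_norm k ^ n * exp (- \<tau> * mode_norm k powr \<sigma>)) summable_on UNIV"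
proof -
 obtain C where C: "0 \<le> C" "\<And>k. mode_norm k ^ n * exp (- \<tau> * mode_norm k powr \<sigma>) \<le> (if k = 0 then 1 else C * mode_norm k powr (- 3))"
  using power_times_exp_bound[OF \<tau> \<sigma>, of n] by blast
 have "(\<lambda>k. (if k = 0 then 1 else 0) + C * mode_norm k powr (- 2 - 1)) summable_on UNIV"
 proof (intro summable_on_add summable_on_cmult_right mode_norm_powr_summable)
  show "(\<lambda>k :: int \<times> int. if k = 0 then 1 else 0 :: real) summable_on UNIV"
   by (rule bounded_sums_summable_on(1)[where B = 1]) (auto simp: sum.If_cases)
 qed simp
 then show ?thesis
 proof (rule Infinite_Sum.summable_on_comparison_test)
  fix k
  show "mode_norm k ^ n * exp (- \<tau> * mode_norm k powr \<sigma>) \<le> (if k = 0 then 1 else 0) + C * mode_norm k powr (- 2 - 1)"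
   using C(2)[of k] C(1) by (auto split: if_splits)
 qed simp
qed

lemma gevrey_class_moments:
 assumes "gevrey_class s f" "1 \<le> s"
 shows "(\<lambda>k. mode_norm k ^ n * cmod (fourier_coeff f k)) summable_on UNIV"
proof -
 obtain \<tau> where \<tau>: "0 < \<tau>" "gevrey_term 0 s \<tau> f summable_on lattice_star"
  using assms(1) by (auto simp: gevrey_class_def has_gevrey_radius_def gevrey_domain_def)
 have "(\<lambda>k. mode_norm k ^ (2 * n) * exp (- (2 * \<tau>) * mode_norm k powr (1 / s)) + gevrey_term 0 s \<tau> f k) summable_on lattice_star"
  by (intro summable_on_add \<tau> summable_on_subset_banach[OF gevrey_weight_summable]) (use \<tau> assms in auto)
 then have "(\<lambda>k. mode_norm k ^ n * cmod (fourier_coeff f k)) summable_on lattice_star"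
 proof (rule Infinite_Sum.summable_on_comparison_test)
  fix k assume "k \<in> lattice_star"
  then have k: "k \<noteq> 0" by (auto simp: lattice_star_def zero_prod_def)
  define e where "e = exp (\<tau> * mode_norm k powr (1 / s))"
  define u where "u = mode_norm k ^ n * inverse e"
  define v where "v = e * cmod (fourier_coeff f k)"
  have e: "0 < e" by (simp add: e_def)
  have u2: "u\<^sup>2 = mode_norm k ^ (2 * n) * exp (- (2 * \<tau>) * mode_norm k powr (1 / s))"
  proof -
   have "inverse e * inverse e = exp (- (2 * \<tau>) * mode_norm k powr (1 / s))"
    by (simp add: e_def exp_minus[symmetric] mult_exp_exp)
   moreover have "mode_norm k ^ (2 * n) = mode_norm k ^ n * mode_norm k ^ n" by (simp add: mult_2 power_add)
   ultimately show ?thesis by (simp add: u_def power2_eq_square mult_ac)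
  qed
  have v2: "v\<^sup>2 = gevrey_term 0 s \<tau> f k"
   using k by (simp add: v_def e_def gevrey_term_def power_mult_distrib exp_double[symmetric] mult.assoc)
  have "u * v \<le> u\<^sup>2 + v\<^sup>2"
   using zero_le_power2[of "u - v"] zero_le_power2[of u] zero_le_power2[of v] by (simp only: power2_diff)
  moreover have "u * v = mode_norm k ^ n * cmod (fourier_coeff f k)" using e by (simp add: u_def v_def)
  ultimately show "mode_norm k ^ n * cmod (fourier_coeff f k) \<le>
    mode_norm k ^ (2 * n) * exp (- (2 * \<tau>) * mode_norm k powr (1 / s)) + gevrey_term 0 s \<tau> f k"
   by (simp add: u2 v2)
 qed simp
 then have "(\<lambda>k. mode_norm k ^ n * cmod (fourier_coeff f k)) summable_on insert 0 lattice_star"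
  by (simp add: summable_on_insert_iff)
 moreover have "insert 0 lattice_star = (UNIV :: (int \<times> int) set)" by (auto simp: lattice_star_def zero_prod_def)
 ultimately show ?thesis by simp
qed

subsection \<open>Products of absolutely convergent Fourier series\<close>

definition conv :: "(int \<times> int \<Rightarrow> complex) \<Rightarrow> (int \<times> int \<Rightarrow> complex) \<Rightarrow> int \<times> int \<Rightarrow> complex" where
 "conv c d k = (\<Sum>\<^sub>\<infinity>l. c (k - l) * d l)"

lemma abs_summable_times:
 assumes c: "(\<lambda>k. cmod (c k)) summable_on UNIV" and d: "(\<lambda>k. cmod (d k)) summable_on UNIV"
 shows "(\<lambda>(j, l). cmod (c j * d l)) summable_on UNIV \<times> UNIV"
proof -
 have "(\<lambda>p. cmod (c (fst p) * d (snd p))) summable_on UNIV"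
 proof (rule bounded_sums_summable_on(1))
  fix F :: "('a \<times> 'b) set" assume F: "finite F"
  have "(\<Sum>p\<in>F. cmod (c (fst p) * d (snd p))) \<le> (\<Sum>p\<in>fst ` F \<times> snd ` F. cmod (c (fst p) * d (snd p)))"
   by (rule sum_mono2[OF _ subset_fst_snd]) (use F in auto)
  also have "\<dots> = (\<Sum>j\<in>fst ` F. cmod (c j)) * (\<Sum>l\<in>snd ` F. cmod (d l))"
   by (simp add: sum_product sum.cartesian_product norm_mult case_prod_unfold)
  also have "\<dots> \<le> (\<Sum>\<^sub>\<infinity>j. cmod (c j)) * (\<Sum>\<^sub>\<infinity>l. cmod (d l))"
   using F by (intro mult_mono finite_sum_le_infsum c d infsum_nonneg sum_nonneg) auto
  finally show "(\<Sum>p\<in>F. cmod (c (fst p) * d (snd p))) \<le> (\<Sum>\<^sub>\<infinity>j. cmod (c j)) * (\<Sum>\<^sub>\<infinity>l. cmod (d l))" .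
 qed simp
 then show ?thesis by (simp add: case_prod_unfold)
qed

lemma conv_summable:
 assumes c: "(\<lambda>k. cmod (c k)) summable_on UNIV" and d: "(\<lambda>k. cmod (d k)) summable_on UNIV"
 shows "(\<lambda>(k, l). cmod (c (k - l) * d l)) summable_on UNIV \<times> UNIV"
  and "(\<lambda>l. c (k - l) * d l) summable_on UNIV"
  and "(\<lambda>k. cmod (conv c d k)) summable_on UNIV"
proof -
 have p: "(\<lambda>(j, l). norm (c j * d l)) summable_on UNIV \<times> UNIV"
  by (rule abs_summable_times[OF c d])
 have bij: "bij_betw (\<lambda>(k :: int \<times> int, l). (k - l, l)) (UNIV \<times> UNIV) (UNIV \<times> UNIV)"
  by (rule bij_betwI[where g = "\<lambda>(j, l). (j + l, l)"]) auto
 show P: "(\<lambda>(k, l). cmod (c (k - l) * d l)) summable_on UNIV \<times> UNIV"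
  using summable_on_reindex_bij_betw[OF bij, of "\<lambda>(j, l). norm (c j * d l)"] p by (simp add: case_prod_unfold)
 have S: "(\<lambda>l. cmod (c (k - l) * d l)) summable_on UNIV" for k
  using P unfolding case_prod_unfold
  using summable_on_SigmaD1[of "\<lambda>k l. cmod (c (k - l) * d l)" UNIV "\<lambda>_. UNIV" k] by (simp add: case_prod_unfold)
 then show "(\<lambda>l. c (k - l) * d l) summable_on UNIV" by (rule Infinite_Sum.abs_summable_summable)
 have "(\<lambda>k. \<Sum>\<^sub>\<infinity>l. cmod (c (k - l) * d l)) summable_on UNIV"
  by (rule summable_on_Sigma_banach[of "\<lambda>k l. cmod (c (k - l) * d l)" UNIV "\<lambda>_. UNIV"]) (use P in simp)
 then show "(\<lambda>k. cmod (conv c d k)) summable_on UNIV"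
  by (rule Infinite_Sum.summable_on_comparison_test) (use norm_infsum_bound[OF S] in \<open>auto simp: conv_def\<close>)
qed

lemma fseries_mult:
 assumes c: "(\<lambda>k. cmod (c k)) summable_on UNIV" and d: "(\<lambda>k. cmod (d k)) summable_on UNIV"
 shows "fseries c x * fseries d x = fseries (conv c d) x"
proof -
 let ?f = "\<lambda>(k, l). c (k - l) * d l * mode k x"
 have P: "?f summable_on UNIV \<times> UNIV"
  by (rule Infinite_Sum.abs_summable_summable) (use conv_summable(1)[OF c d] in \<open>simp add: norm_mult case_prod_unfold\<close>)
 have bij: "bij_betw (\<lambda>(j :: int \<times> int, l). (j + l, l)) (UNIV \<times> UNIV) (UNIV \<times> UNIV)"
  by (rule bij_betwI[where g = "\<lambda>(k, l). (k - l, l)"]) auto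
 have "fseries (conv c d) x = (\<Sum>\<^sub>\<infinity>k. \<Sum>\<^sub>\<infinity>l. c (k - l) * d l * mode k x)"
  unfolding fseries_def conv_def by (simp only: infsum_cmult_left')
 also have "\<dots> = infsum ?f (UNIV \<times> UNIV)" using infsum_Sigma'_banach[OF P] by simp
 also have "\<dots> = (\<Sum>\<^sub>\<infinity>p\<in>UNIV \<times> UNIV. ?f (case p of (j, l) \<Rightarrow> (j + l, l)))"
  by (rule infsum_reindex_bij_betw[OF bij, symmetric])
 also have "\<dots> = (\<Sum>\<^sub>\<infinity>(j, l)\<in>UNIV \<times> UNIV. (c j * mode j x) * (d l * mode l x))"
  by (simp add: case_prod_unfold mode_add mult_ac)
 also have "\<dots> = (\<Sum>\<^sub>\<infinity>j. \<Sum>\<^sub>\<infinity>l. (c j * mode j x) * (d l * mode l x))"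
 proof (rule infsum_Sigma'_banach[symmetric, where B = "\<lambda>_. UNIV"])
  have "(\<lambda>(j, l). norm ((c j * mode j x) * (d l * mode l x))) summable_on UNIV \<times> UNIV"
   by (rule abs_summable_times[OF fseries_summable(1)[OF c, of x] fseries_summable(1)[OF d, of x]])
  then show "(\<lambda>(j, l). (c j * mode j x) * (d l * mode l x)) summable_on UNIV \<times> UNIV"
   unfolding case_prod_unfold by (rule Infinite_Sum.abs_summable_summable)
 qed
 also have "\<dots> = fseries c x * fseries d x"
  unfolding fseries_def by (simp only: infsum_cmult_right' infsum_cmult_left')
 finally show ?thesis by simp
qed

subsection \<open>The velocity field\<close>

lemma ipmb_velocity_eq_fseries:
 assumes "\<And>k. fourier_coeff \<theta> k = c k"
 shows "ipmb_velocity1 \<nu> \<theta> x = Re (fseries (\<lambda>k. of_real (ipmb_symbol1 \<nu> k) * c k) x)"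
  and "ipmb_velocity2 \<nu> \<theta> x = Re (fseries (\<lambda>k. of_real (ipmb_symbol2 \<nu> k) * c k) x)"
proof -
 have *: "fourier_multiplier m \<theta> x = Re (fseries (\<lambda>k. of_real (m k) * c k) x)" if "m 0 = 0" for m
 proof -
  have "(\<Sum>\<^sub>\<infinity>k\<in>lattice_star. of_real (m k) * c k * mode k x) = (\<Sum>\<^sub>\<infinity>k. of_real (m k) * c k * mode k x)"
   by (rule infsum_cong_neutral) (use that in \<open>auto simp: lattice_star_def zero_prod_def\<close>)
  then show ?thesis by (simp add: fourier_multiplier_def fseries_def assms mode_def)
 qed
 show "ipmb_velocity1 \<nu> \<theta> x = Re (fseries (\<lambda>k. of_real (ipmb_symbol1 \<nu> k) * c k) x)"
  "ipmb_velocity2 \<nu> \<theta> x = Re (fseries (\<lambda>k. of_real (ipmb_symbol2 \<nu> k) * c k) x)"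
  unfolding ipmb_velocity1_def ipmb_velocity2_def by (rule *; simp)+
qed

lemma symbol_times_le:
 assumes "0 \<le> \<nu>"
 shows "cmod (of_real (ipmb_symbol1 \<nu> k) * z) \<le> cmod z" "cmod (of_real (ipmb_symbol2 \<nu> k) * z) \<le> cmod z"
proof -
 have "1 / (1 + \<nu> * (mode_norm k)\<^sup>2) \<le> 1 / 1" by (rule frac_le) (use assms in auto)
 then have "\<bar>ipmb_symbol1 \<nu> k\<bar> \<le> 1" "\<bar>ipmb_symbol2 \<nu> k\<bar> \<le> 1"
  using abs_symbol_le[OF assms, of k] by auto
 then show "cmod (of_real (ipmb_symbol1 \<nu> k) * z) \<le> cmod z" "cmod (of_real (ipmb_symbol2 \<nu> k) * z) \<le> cmod z"
  by (simp_all add: norm_mult mult_left_le_one_le)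
qed

lemma velocity_divergence_free:
 assumes \<nu>: "0 \<le> \<nu>" and c: "(\<lambda>k. cmod (c k)) summable_on UNIV" and c1: "(\<lambda>k. mode_norm k * cmod (c k)) summable_on UNIV"
 defines "u1 \<equiv> \<lambda>x. Re (fseries (\<lambda>k. of_real (ipmb_symbol1 \<nu> k) * c k) x)"
  and "u2 \<equiv> \<lambda>x. Re (fseries (\<lambda>k. of_real (ipmb_symbol2 \<nu> k) * c k) x)"
 shows "torus_fun u1" "torus_fun u2"
  and "\<exists>u1x. continuous_on UNIV u1x \<and> (\<forall>x y. ((\<lambda>x. u1 (x, y)) has_real_derivative u1x (x, y)) (at x)) \<and>
   (\<forall>x y. ((\<lambda>y. u2 (x, y)) has_real_derivative - u1x (x, y)) (at y))"
proof -
 let ?c1 = "\<lambda>k. of_real (ipmb_symbol1 \<nu> k) * c k" and ?c2 = "\<lambda>k. of_real (ipmb_symbol2 \<nu> k) * c k"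
 have s: "(\<lambda>k. cmod (?c1 k)) summable_on UNIV" "(\<lambda>k. cmod (?c2 k)) summable_on UNIV"
  by (rule abs_summable_le[OF c] symbol_times_le[OF \<nu>])+
 have m: "(\<lambda>k. mode_norm k * cmod (?c1 k)) summable_on UNIV" "(\<lambda>k. mode_norm k * cmod (?c2 k)) summable_on UNIV"
  by (rule Infinite_Sum.summable_on_comparison_test[OF c1]; simp add: mult_left_mono symbol_times_le[OF \<nu>])+
 show "torus_fun u1" "torus_fun u2" unfolding u1_def u2_def by (rule torus_fun_fseries[OF s(1)], rule torus_fun_fseries[OF s(2)])
 define d where "d = fseries (\<lambda>k. \<i> * of_int (fst k) * ?c1 k)"
 have d': "fseries (\<lambda>k. \<i> * of_int (snd k) * ?c2 k) x = - d x" for x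
 proof -
  have "\<i> * of_int (snd k) * ?c2 k * mode k x = - (\<i> * of_int (fst k) * ?c1 k * mode k x)" for k
  proof -
   have "of_int (snd k) * of_real (ipmb_symbol2 \<nu> k) + of_int (fst k) * of_real (ipmb_symbol1 \<nu> k) = complex_of_real (drift \<nu> k k)"
    by (simp add: drift_def)
   then have e: "of_int (snd k) * of_real (ipmb_symbol2 \<nu> k) = - (of_int (fst k) * complex_of_real (ipmb_symbol1 \<nu> k))"
    by (simp add: drift_self eq_neg_iff_add_eq_0)
   have "\<i> * of_int (snd k) * ?c2 k * mode k x = (of_int (snd k) * of_real (ipmb_symbol2 \<nu> k)) * (\<i> * c k * mode k x)" by simp
   then show ?thesis unfolding e by simp
  qed
  then show ?thesis unfolding fseries_def d_def by (simp only: infsum_uminus)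
 qed
 have "continuous_on UNIV d"
  unfolding d_def
 proof (rule continuous_on_fseries)
  show "(\<lambda>k. cmod (\<i> * of_int (fst k) * ?c1 k)) summable_on UNIV"
   by (rule Infinite_Sum.summable_on_comparison_test[OF m(1)]) (simp_all add: norm_mult mult_right_mono abs_fst_le)
 qed
 then show "\<exists>u1x. continuous_on UNIV u1x \<and> (\<forall>x y. ((\<lambda>x. u1 (x, y)) has_real_derivative u1x (x, y)) (at x)) \<and>
   (\<forall>x y. ((\<lambda>y. u2 (x, y)) has_real_derivative - u1x (x, y)) (at y))"
  using bounded_linear.has_vector_derivative[OF bounded_linear_Re fseries_has_vector_derivative(1)[OF s(1) m(1)]]
   bounded_linear.has_vector_derivative[OF bounded_linear_Re fseries_has_vector_derivative(2)[OF s(2) m(2)]]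
  by (intro exI[of _ "\<lambda>z. Re (d z)"])
   (auto simp: u1_def u2_def d_def[symmetric] d' has_real_derivative_iff_has_vector_derivative intro!: continuous_intros)
qed

section \<open>Transport by a divergence-free velocity\<close>

text \<open>Continuity in \<open>t\<close> and \<open>z\<close> jointly is recovered by integrating the time derivative along rays.\<close>

lemma continuous_on_time_space:
 fixes \<phi> :: "real \<Rightarrow> real \<times> real \<Rightarrow> real"
 assumes ct: "continuous_on ({0..} \<times> UNIV) (\<lambda>(t, z). \<phi>t t z)"
  and d: "\<And>t z. 0 \<le> t \<Longrightarrow> ((\<lambda>t. \<phi> t z) has_real_derivative \<phi>t t z) (at t within {0..})"
  and c0: "continuous_on UNIV (\<phi> 0)"
 shows "continuous_on ({0..} \<times> UNIV) (\<lambda>(t, z). \<phi> t z)"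
proof -
 have eq: "\<phi> t z = \<phi> 0 z + integral (cbox 0 1) (\<lambda>u. t * \<phi>t (t * u) z)" if t: "0 \<le> t" for t z
 proof -
  have "((\<lambda>u. t * \<phi>t (t * u) z) has_integral \<phi> (t * 1) z - \<phi> (t * 0) z) {0..1}"
  proof (rule fundamental_theorem_of_calculus[where f = "\<lambda>u. \<phi> (t * u) z"])
   fix u :: real assume u: "u \<in> {0..1}"
   have g: "((\<lambda>u. t * u) has_vector_derivative t) (at u within {0..1})"
    unfolding has_real_derivative_iff_has_vector_derivative[symmetric] by (auto intro!: derivative_eq_intros)
   have "((\<lambda>t. \<phi> t z) has_field_derivative \<phi>t (t * u) z) (at (t * u) within (*) t ` {0..1})"
    by (rule DERIV_subset[OF d]) (use u t in auto)
   from vector_diff_chain_within[OF g this[unfolded has_real_derivative_iff_has_vector_derivative]]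
   show "((\<lambda>u. \<phi> (t * u) z) has_vector_derivative t * \<phi>t (t * u) z) (at u within {0..1})"
    by (simp add: o_def)
  qed simp
  from integral_unique[OF this] show ?thesis by simp
 qed
 have "continuous_on (({0..} \<times> UNIV) \<times> cbox 0 1) (\<lambda>(p, u). fst p * \<phi>t (fst p * u) (snd p))"
  unfolding case_prod_unfold
 proof (intro continuous_on_mult)
  show "continuous_on (({0..} \<times> UNIV) \<times> cbox 0 1) (\<lambda>x. \<phi>t (fst (fst x) * snd x) (snd (fst x)))"
   by (rule continuous_on_compose2[OF ct[unfolded case_prod_unfold], where f = "\<lambda>x. (fst (fst x) * snd x, snd (fst x))", simplified])
    (auto intro!: continuous_intros)
 qed (intro continuous_intros)
 then have I: "continuous_on ({0..} \<times> UNIV) (\<lambda>p. integral (cbox 0 1) (\<lambda>u. fst p * \<phi>t (fst p * u) (snd p)))"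
  by (rule integral_continuous_on_param)
 have "continuous_on ({0..} \<times> UNIV) (\<lambda>p :: real \<times> real \<times> real. \<phi> 0 (snd p))"
  by (rule continuous_on_compose2[OF c0 continuous_on_snd[OF continuous_on_id] subset_UNIV])
 from continuous_on_add[OF this I] show ?thesis
 proof (rule continuous_on_eq)
  fix p :: "real \<times> real \<times> real" assume "p \<in> {0..} \<times> UNIV"
  then have "0 \<le> fst p" by auto
  from eq[OF this, of "snd p"] show "\<phi> 0 (snd p) + integral (cbox 0 1) (\<lambda>u. fst p * \<phi>t (fst p * u) (snd p)) = (case p of (t, z) \<Rightarrow> \<phi> t z)"
   by (simp only: case_prod_unfold)
 qed
qed

text \<open>Integration by parts moves the derivatives off \<open>\<phi>\<close>; the velocity being divergence free, only
 the source \<open>s\<close> survives. With \<open>s = 0\<close> every integral of a function of \<open>\<phi>\<close> is conserved.\<close>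

lemma transport_integral_derivative:
 fixes \<phi> \<phi>t \<phi>x \<phi>y :: "real \<Rightarrow> real \<times> real \<Rightarrow> real"
 assumes ct: "continuous_on ({0..} \<times> UNIV) (\<lambda>(t, z). \<phi>t t z)"
  and cx: "continuous_on UNIV (\<phi>x t)" and cy: "continuous_on UNIV (\<phi>y t)"
  and tor: "\<And>t. 0 \<le> t \<Longrightarrow> torus_fun (\<phi> t)"
  and dt: "\<And>t z. 0 \<le> t \<Longrightarrow> ((\<lambda>t. \<phi> t z) has_real_derivative \<phi>t t z) (at t within {0..})"
  and dx: "\<And>x y. ((\<lambda>x. \<phi> t (x, y)) has_real_derivative \<phi>x t (x, y)) (at x)"
  and dy: "\<And>x y. ((\<lambda>y. \<phi> t (x, y)) has_real_derivative \<phi>y t (x, y)) (at y)"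
  and \<beta>: "\<And>r. (\<beta> has_real_derivative \<beta>' r) (at r)" "continuous_on UNIV \<beta>'"
  and U: "torus_fun U1" "torus_fun U2" "continuous_on UNIV U1x"
   "\<And>x y. ((\<lambda>x. U1 (x, y)) has_real_derivative U1x (x, y)) (at x)"
   "\<And>x y. ((\<lambda>y. U2 (x, y)) has_real_derivative - U1x (x, y)) (at y)"
  and t: "0 \<le> t" and pde: "\<And>z. \<phi>t t z = s z - (U1 z * \<phi>x t z + U2 z * \<phi>y t z)"
 shows "((\<lambda>t. integral torus_cell (\<lambda>z. \<beta> (\<phi> t z))) has_real_derivative
   integral torus_cell (\<lambda>z. \<beta>' (\<phi> t z) * s z)) (at t within {0..})"
proof -
 have c: "continuous_on ({0..} \<times> UNIV) (\<lambda>(t, z). \<phi> t z)"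
  by (rule continuous_on_time_space[OF ct dt]) (use torus_fun_continuous[OF tor[of 0]] in auto)
 have c\<beta>: "continuous_on UNIV \<beta>" by (rule DERIV_continuous_on) (use \<beta>(1) in auto)
 have c\<phi>: "continuous_on A (\<phi> t)" if "0 \<le> t" for t A by (rule torus_fun_continuous[OF tor[OF that]])
 have cb: "continuous_on A (\<lambda>z. \<beta> (\<phi> t z))" "continuous_on A (\<lambda>z. \<beta>' (\<phi> t z))" if "0 \<le> t" for t A
  by (rule continuous_on_compose2[OF c\<beta> c\<phi>[OF that]] continuous_on_compose2[OF \<beta>(2) c\<phi>[OF that]]; simp)+
 have cbt: "continuous_on ({0..} \<times> UNIV) (\<lambda>(t, z). \<beta>' (\<phi> t z) * \<phi>t t z)"
  unfolding case_prod_unfold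
  by (intro continuous_on_mult ct[unfolded case_prod_unfold] continuous_on_compose2[OF \<beta>(2) c[unfolded case_prod_unfold]]) auto
 have deriv: "((\<lambda>t. integral torus_cell (\<lambda>z. \<beta> (\<phi> t z))) has_vector_derivative
   integral torus_cell (\<lambda>z. \<beta>' (\<phi> t z) * \<phi>t t z)) (at t within {0..})"
  unfolding torus_cell_eq_cbox
 proof (rule leibniz_rule_vector_derivative)
  fix t :: real and z :: "real \<times> real" assume "t \<in> {0..}"
  then show "((\<lambda>t. \<beta> (\<phi> t z)) has_vector_derivative \<beta>' (\<phi> t z) * \<phi>t t z) (at t within {0..})"
   using DERIV_chain2[OF \<beta>(1) dt, of t z] by (simp add: has_real_derivative_iff_has_vector_derivative)
 next
  fix t :: real assume "t \<in> {0..}"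
  then show "(\<lambda>z. \<beta> (\<phi> t z)) integrable_on cbox (0, 0) (2 * pi, 2 * pi)" by (intro integrable_continuous cb) auto
 next
  show "continuous_on ({0..} \<times> cbox (0, 0) (2 * pi, 2 * pi)) (\<lambda>(t, z). \<beta>' (\<phi> t z) * \<phi>t t z)"
   by (rule continuous_on_subset[OF cbt]) auto
 qed (use t in auto)
 have cs: "continuous_on UNIV s"
 proof -
  have "continuous_on UNIV (\<lambda>z. \<phi>t t z)"
   using continuous_on_compose2[OF ct[unfolded case_prod_unfold], of UNIV "\<lambda>z. (t, z)"] t
   by (simp add: continuous_on_Pair image_subset_iff)
  then have "continuous_on UNIV (\<lambda>z. \<phi>t t z + (U1 z * \<phi>x t z + U2 z * \<phi>y t z))"
   by (rule continuous_on_add) (intro continuous_intros cx cy torus_fun_continuous U)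
  then show ?thesis by (simp add: pde)
 qed
 define Gx where "Gx = (\<lambda>z. U1x z * \<beta> (\<phi> t z) + U1 z * (\<beta>' (\<phi> t z) * \<phi>x t z))"
 define Gy where "Gy = (\<lambda>z. - U1x z * \<beta> (\<phi> t z) + U2 z * (\<beta>' (\<phi> t z) * \<phi>y t z))"
 have cG: "continuous_on UNIV Gx" "continuous_on UNIV Gy"
  unfolding Gx_def Gy_def by (intro continuous_intros cx cy cb t torus_fun_continuous U(1,2) U(3))+
 have per: "U1 (x + 2 * pi, y) = U1 (x, y)" "U2 (x, y + 2 * pi) = U2 (x, y)"
  "\<phi> t (x + 2 * pi, y) = \<phi> t (x, y)" "\<phi> t (x, y + 2 * pi) = \<phi> t (x, y)" for x y
  using U(1,2) tor[OF t] by (auto simp: torus_fun_def)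
 have "integral torus_cell Gx = 0"
 proof (rule integral_partial_derivative_periodic(1)[where G = "\<lambda>z. U1 z * \<beta> (\<phi> t z)"])
  fix x y show "((\<lambda>x. U1 (x, y) * \<beta> (\<phi> t (x, y))) has_real_derivative Gx (x, y)) (at x)"
   using DERIV_mult[OF U(4)[where x = x and y = y] DERIV_chain2[OF \<beta>(1) dx[where x = x and y = y]]] by (simp add: Gx_def algebra_simps)
 qed (use cG per in auto)
 moreover have "integral torus_cell Gy = 0"
 proof (rule integral_partial_derivative_periodic(2)[where G = "\<lambda>z. U2 z * \<beta> (\<phi> t z)"])
  fix x y show "((\<lambda>y. U2 (x, y) * \<beta> (\<phi> t (x, y))) has_real_derivative Gy (x, y)) (at y)"
   using DERIV_mult[OF U(5)[where x = x and y = y] DERIV_chain2[OF \<beta>(1) dy[where x = x and y = y]]] by (simp add: Gy_def algebra_simps)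
 qed (use cG per in auto)
 moreover have int: "f integrable_on torus_cell" if "continuous_on UNIV f" for f :: "real \<times> real \<Rightarrow> real"
  unfolding torus_cell_eq_cbox by (rule integrable_continuous[OF continuous_on_subset[OF that]]) simp
 ultimately have G0: "integral torus_cell (\<lambda>z. Gx z + Gy z) = 0"
  by (simp add: Henstock_Kurzweil_Integration.integral_add cG)
 have "integral torus_cell (\<lambda>z. \<beta>' (\<phi> t z) * \<phi>t t z)
   = integral torus_cell (\<lambda>z. \<beta>' (\<phi> t z) * s z - (Gx z + Gy z))"
  by (rule arg_cong[where f = "integral torus_cell"]) (auto simp: fun_eq_iff pde Gx_def Gy_def algebra_simps)
 also have "\<dots> = integral torus_cell (\<lambda>z. \<beta>' (\<phi> t z) * s z) - integral torus_cell (\<lambda>z. Gx z + Gy z)"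
  by (intro Henstock_Kurzweil_Integration.integral_diff int continuous_intros cG cb t cs)
 finally show ?thesis using deriv by (simp add: G0 has_real_derivative_iff_has_vector_derivative)
qed

lemma squared_positive_part_derivative:
 "((\<lambda>r. (max 0 (r - S))\<^sup>2) has_real_derivative 2 * max 0 (r - S)) (at r)" for r S :: real
proof -
 consider "r < S" | "r = S" | "S < r" by linarith
 then show ?thesis
 proof cases
  case 1
  have "((\<lambda>_. 0) has_real_derivative 2 * max 0 (r - S)) (at r)" using 1 by simp
  then show ?thesis
   by (rule has_field_derivative_transform_within_open[where S = "{..<S}"]) (use 1 in auto)
 next
  case 2
  have "(\<lambda>h :: real. max 0 h) \<midarrow>0\<rightarrow> max 0 0" by (intro tendsto_intros)
  moreover have "((max 0 (r + h - S))\<^sup>2 - (max 0 (r - S))\<^sup>2) / h = max 0 h" for h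
   using 2 by (auto simp: max_def power2_eq_square)
  ultimately show ?thesis using 2 by (simp add: DERIV_def)
 next
  case 3
  have "((\<lambda>r. (r - S)\<^sup>2) has_real_derivative 2 * max 0 (r - S)) (at r)"
   using 3 by (auto intro!: derivative_eq_intros)
  then show ?thesis
   by (rule has_field_derivative_transform_within_open[where S = "{S<..}"]) (use 3 in auto)
 qed
qed

text \<open>The integral of the squared positive part of \<open>\<phi> - S\<close> is conserved and vanishes at the start.\<close>

lemma transport_le_initial:
 fixes \<phi> \<phi>t \<phi>x \<phi>y :: "real \<Rightarrow> real \<times> real \<Rightarrow> real"
 assumes ct: "continuous_on ({0..} \<times> UNIV) (\<lambda>(t, z). \<phi>t t z)"
  and cx: "\<And>t. 0 \<le> t \<Longrightarrow> continuous_on UNIV (\<phi>x t)" and cy: "\<And>t. 0 \<le> t \<Longrightarrow> continuous_on UNIV (\<phi>y t)"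
  and tor: "\<And>t. 0 \<le> t \<Longrightarrow> torus_fun (\<phi> t)"
  and dt: "\<And>t z. 0 \<le> t \<Longrightarrow> ((\<lambda>t. \<phi> t z) has_real_derivative \<phi>t t z) (at t within {0..})"
  and dx: "\<And>t x y. 0 \<le> t \<Longrightarrow> ((\<lambda>x. \<phi> t (x, y)) has_real_derivative \<phi>x t (x, y)) (at x)"
  and dy: "\<And>t x y. 0 \<le> t \<Longrightarrow> ((\<lambda>y. \<phi> t (x, y)) has_real_derivative \<phi>y t (x, y)) (at y)"
  and U: "\<And>t. 0 \<le> t \<Longrightarrow> torus_fun (U1 t)" "\<And>t. 0 \<le> t \<Longrightarrow> torus_fun (U2 t)"
   "\<And>t. 0 \<le> t \<Longrightarrow> \<exists>u1x. continuous_on UNIV u1x \<and> (\<forall>x y. ((\<lambda>x. U1 t (x, y)) has_real_derivative u1x (x, y)) (at x)) \<and>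
   (\<forall>x y. ((\<lambda>y. U2 t (x, y)) has_real_derivative - u1x (x, y)) (at y))"
  and pde: "\<And>t z. 0 \<le> t \<Longrightarrow> \<phi>t t z = - (U1 t z * \<phi>x t z + U2 t z * \<phi>y t z)"
  and init: "\<And>z. \<phi> 0 z \<le> S" and t: "0 \<le> t"
 shows "\<phi> t z \<le> S"
proof -
 define E where "E = (\<lambda>t. integral torus_cell (\<lambda>z. (max 0 (\<phi> t z - S))\<^sup>2))"
 have dE: "(E has_real_derivative 0) (at t within {0..})" if t: "0 \<le> t" for t
 proof -
  obtain u1x where u: "continuous_on UNIV u1x" "\<And>x y. ((\<lambda>x. U1 t (x, y)) has_real_derivative u1x (x, y)) (at x)"
   "\<And>x y. ((\<lambda>y. U2 t (x, y)) has_real_derivative - u1x (x, y)) (at y)"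
   using U(3)[OF t] by blast
  have "((\<lambda>t. integral torus_cell (\<lambda>z. (max 0 (\<phi> t z - S))\<^sup>2)) has_real_derivative
   integral torus_cell (\<lambda>z. 2 * max 0 (\<phi> t z - S) * 0)) (at t within {0..})"
   by (rule transport_integral_derivative[where \<beta> = "\<lambda>r. (max 0 (r - S))\<^sup>2" and \<beta>' = "\<lambda>r. 2 * max 0 (r - S)" and s = "\<lambda>_. 0"
       and \<phi> = \<phi> and \<phi>t = \<phi>t and \<phi>x = \<phi>x and \<phi>y = \<phi>y and t = t and ?U1.0 = "U1 t" and ?U2.0 = "U2 t" and U1x = u1x,
      OF ct cx[OF t] cy[OF t] tor dt dx[OF t] dy[OF t] squared_positive_part_derivative _ U(1,2)[OF t] u t])
    (use pde t in \<open>auto intro!: continuous_intros\<close>)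
  then show ?thesis by (simp add: E_def)
 qed
 have "E t = E 0"
  by (rule derivative_zero_imp_eq_initial) (use dE t in \<open>auto simp: has_real_derivative_iff_has_vector_derivative\<close>)
 also have "\<dots> = 0"
 proof -
  have "(\<lambda>z. (max 0 (\<phi> 0 z - S))\<^sup>2) = (\<lambda>z. 0)"
  proof
   fix z show "(max 0 (\<phi> 0 z - S))\<^sup>2 = 0" using init[of z] by simp
  qed
  then show ?thesis unfolding E_def by (simp only: Henstock_Kurzweil_Integration.integral_0)
 qed
 finally have I: "integral torus_cell (\<lambda>z. (max 0 (\<phi> t z - S))\<^sup>2) = 0" by (simp only: E_def)
 have "torus_fun (\<lambda>z. max 0 (\<phi> t z - S))"
  using tor[OF t] by (auto simp: torus_fun_def intro!: continuous_intros)
 from torus_fun_zero_if_L2_zero[OF this I] have "max 0 (\<phi> t z - S) = 0" .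
 then have "\<phi> t z - S \<le> 0" by (metis max.cobounded2)
 then show ?thesis by (rule iffD1[OF diff_le_0_iff_le])
qed

section \<open>From Fourier coefficients to classical solutions\<close>

text \<open>The limit of \<open>advection\<close> as all modes are admitted.\<close>

definition transport_coeff :: "real \<Rightarrow> (int \<times> int \<Rightarrow> complex) \<Rightarrow> int \<times> int \<Rightarrow> complex" where
 "transport_coeff \<nu> c k = (\<Sum>\<^sub>\<infinity>l. \<i> * of_real (drift \<nu> (k - l) l) * c (k - l) * c l)"

lemma continuous_on_infsum:
 fixes f :: "'a \<Rightarrow> 'b::topological_space \<Rightarrow> complex"
 assumes "\<And>k. continuous_on X (f k)" "\<And>k x. x \<in> X \<Longrightarrow> cmod (f k x) \<le> M k" "M summable_on UNIV"
 shows "continuous_on X (\<lambda>x. \<Sum>\<^sub>\<infinity>k. f k x)"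
proof (rule uniform_limit_theorem)
 show "uniform_limit X (\<lambda>F x. \<Sum>k\<in>F. f k x) (\<lambda>x. \<Sum>\<^sub>\<infinity>k. f k x) (finite_subsets_at_top UNIV)"
  by (rule Weierstrass_m_test_general) (use assms in auto)
qed (auto intro!: always_eventually continuous_on_sum assms)

lemma continuous_on_half_line_times:
 fixes f :: "real \<times> 'a::t2_space \<Rightarrow> 'b::topological_space"
 assumes "\<And>T :: real. 0 \<le> T \<Longrightarrow> continuous_on ({0..T} \<times> S) f"
 shows "continuous_on ({0 :: real..} \<times> S) f"
 unfolding continuous_on_eq_continuous_within
proof
 fix p assume p: "p \<in> {0 :: real..} \<times> S"
 obtain t :: real and z where tz: "p = (t, z)" "0 \<le> t" "z \<in> S" using p by auto
 have "at (t, z) within {0 :: real..t + 1} \<times> S = at (t, z) within {0..} \<times> S"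
  by (rule at_within_nhd[of _ "{..<t + 1} \<times> UNIV"]) (auto intro!: open_Times)
 moreover have "continuous (at (t, z) within {0..t + 1} \<times> S) f"
  using assms[of "t + 1"] tz by (auto simp: continuous_on_eq_continuous_within)
 ultimately show "continuous (at p within {0..} \<times> S) f" by (simp add: tz(1))
qed

lemma continuous_on_fseries_time:
 fixes b :: "real \<Rightarrow> int \<times> int \<Rightarrow> complex"
 assumes b: "\<And>T k. 0 \<le> T \<Longrightarrow> continuous_on {0..T} (\<lambda>t. b t k)"
  and M: "\<And>T. 0 \<le> T \<Longrightarrow> \<exists>M. M summable_on UNIV \<and> (\<forall>t\<in>{0..T}. \<forall>k. cmod (b t k) \<le> M k)"
 shows "continuous_on ({0..} \<times> UNIV) (\<lambda>(t, z). Re (fseries (b t) z))"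
proof (rule continuous_on_half_line_times[of UNIV "\<lambda>(t, z). Re (fseries (b t) z)"])
 fix T :: real assume T: "0 \<le> T"
 obtain M where M: "M summable_on UNIV" "\<And>t k. t \<in> {0..T} \<Longrightarrow> cmod (b t k) \<le> M k"
  using M[OF T] by metis
 have "continuous_on ({0..T} \<times> UNIV) (\<lambda>p. \<Sum>\<^sub>\<infinity>k. b (fst p) k * mode k (snd p))"
 proof (rule continuous_on_infsum[OF _ _ M(1)])
  fix k
  have "continuous_on ({0..T} \<times> UNIV) (\<lambda>p :: real \<times> real \<times> real. b (fst p) k)"
   by (rule continuous_on_compose2[OF b[OF T]]) (auto intro!: continuous_intros)
  moreover have "continuous_on ({0..T} \<times> UNIV) (\<lambda>p :: real \<times> real \<times> real. mode k (snd p))"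
   by (rule continuous_on_compose2[OF continuous_on_mode]) (auto intro!: continuous_intros)
  ultimately show "continuous_on ({0..T} \<times> UNIV) (\<lambda>p. b (fst p) k * mode k (snd p))" by (rule continuous_on_mult)
 next
  fix k p assume "p \<in> {0..T} \<times> (UNIV :: (real \<times> real) set)"
  then show "cmod (b (fst p) k * mode k (snd p)) \<le> M k" using M(2)[of "fst p" k] by (auto simp: norm_mult)
 qed
 then show "continuous_on ({0..T} \<times> UNIV) (\<lambda>(t, z). Re (fseries (b t) z))"
  unfolding case_prod_unfold fseries_def by (rule continuous_on_Re)
qed

lemma transport_coeff_eq_conv:
 assumes \<nu>: "0 \<le> \<nu>" and c: "(\<lambda>k. cmod (c k)) summable_on UNIV" and c1: "(\<lambda>k. mode_norm k * cmod (c k)) summable_on UNIV"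
 shows "transport_coeff \<nu> c k = conv (\<lambda>k. of_real (ipmb_symbol1 \<nu> k) * c k) (\<lambda>k. \<i> * of_int (fst k) * c k) k
  + conv (\<lambda>k. of_real (ipmb_symbol2 \<nu> k) * c k) (\<lambda>k. \<i> * of_int (snd k) * c k) k"
proof -
 have s: "(\<lambda>k. cmod (of_real (ipmb_symbol1 \<nu> k) * c k)) summable_on UNIV" "(\<lambda>k. cmod (of_real (ipmb_symbol2 \<nu> k) * c k)) summable_on UNIV"
  by (rule abs_summable_le[OF c] symbol_times_le[OF \<nu>])+
 have d: "(\<lambda>k. cmod (\<i> * of_int (fst k) * c k)) summable_on UNIV" "(\<lambda>k. cmod (\<i> * of_int (snd k) * c k)) summable_on UNIV"
  by (rule abs_summable_le[OF c1]; simp add: norm_mult mult_right_mono abs_fst_le abs_snd_le)+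
 have "transport_coeff \<nu> c k = (\<Sum>\<^sub>\<infinity>l. of_real (ipmb_symbol1 \<nu> (k - l)) * c (k - l) * (\<i> * of_int (fst l) * c l)
   + of_real (ipmb_symbol2 \<nu> (k - l)) * c (k - l) * (\<i> * of_int (snd l) * c l))"
  unfolding transport_coeff_def by (rule infsum_cong) (simp add: drift_def algebra_simps)
 also have "\<dots> = conv (\<lambda>k. of_real (ipmb_symbol1 \<nu> k) * c k) (\<lambda>k. \<i> * of_int (fst k) * c k) k
   + conv (\<lambda>k. of_real (ipmb_symbol2 \<nu> k) * c k) (\<lambda>k. \<i> * of_int (snd k) * c k) k"
  unfolding conv_def by (rule infsum_add[OF conv_summable(2)[OF s(1) d(1)] conv_summable(2)[OF s(2) d(2)]])
 finally show ?thesis .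
qed

lemma transport_coeff_summable_bound:
 assumes \<nu>: "0 \<le> \<nu>" and M: "M summable_on UNIV" "(\<lambda>k. mode_norm k * M k) summable_on UNIV" and M0: "\<And>k. 0 \<le> M k"
 shows "(\<lambda>l. M (k - l) * (mode_norm l * M l)) summable_on UNIV"
  and "(\<lambda>k. \<Sum>\<^sub>\<infinity>l. M (k - l) * (mode_norm l * M l)) summable_on UNIV"
  and "(\<And>k. cmod (c k) \<le> M k) \<Longrightarrow> cmod (\<i> * of_real (drift \<nu> (k - l) l) * c (k - l) * c l) \<le> M (k - l) * (mode_norm l * M l)"
  and "(\<And>k. cmod (c k) \<le> M k) \<Longrightarrow> cmod (transport_coeff \<nu> c k) \<le> (\<Sum>\<^sub>\<infinity>l. M (k - l) * (mode_norm l * M l))"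
proof -
 have s: "(\<lambda>k. cmod (of_real (M k))) summable_on UNIV" "(\<lambda>k. cmod (of_real (mode_norm k * M k))) summable_on UNIV"
  using M M0 by (simp_all del: of_real_mult add: abs_mult)
 have r: "of_real (M (k - l)) * of_real (mode_norm l * M l) = complex_of_real (M (k - l) * (mode_norm l * M l))" for k l
  by simp
 have P: "(\<lambda>l. M (k - l) * (mode_norm l * M l)) summable_on UNIV" for k
  using summable_on_Re[OF conv_summable(2)[OF s, of k, unfolded r]] by simp
 then show "(\<lambda>l. M (k - l) * (mode_norm l * M l)) summable_on UNIV" .
 have nn: "0 \<le> (\<Sum>\<^sub>\<infinity>l. M (k - l) * (mode_norm l * M l))" for k by (intro infsum_nonneg mult_nonneg_nonneg) (use M0 in auto)
 have "conv (\<lambda>k. of_real (M k)) (\<lambda>k. of_real (mode_norm k * M k)) k = of_real (\<Sum>\<^sub>\<infinity>l. M (k - l) * (mode_norm l * M l))" for k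
  unfolding conv_def r by (rule infsumI) (intro has_sum_of_real has_sum_infsum P)
 then show "(\<lambda>k. \<Sum>\<^sub>\<infinity>l. M (k - l) * (mode_norm l * M l)) summable_on UNIV"
  using conv_summable(3)[OF s] nn by simp
 assume c: "\<And>k. cmod (c k) \<le> M k"
 have le: "cmod (\<i> * of_real (drift \<nu> (k - l) l) * c (k - l) * c l) \<le> M (k - l) * (mode_norm l * M l)" for k l
 proof -
  have "cmod (\<i> * of_real (drift \<nu> (k - l) l) * c (k - l) * c l) = cmod (c (k - l)) * (\<bar>drift \<nu> (k - l) l\<bar> * cmod (c l))"
   by (simp add: norm_mult)
  also have "\<dots> \<le> M (k - l) * (mode_norm l * M l)"
   by (intro mult_mono c abs_drift_le_mode_norm[OF \<nu>] M0 mult_nonneg_nonneg) auto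
  finally show ?thesis .
 qed
 then show "cmod (\<i> * of_real (drift \<nu> (k - l) l) * c (k - l) * c l) \<le> M (k - l) * (mode_norm l * M l)" .
 have Q: "(\<lambda>l. cmod (\<i> * of_real (drift \<nu> (k - l) l) * c (k - l) * c l)) summable_on UNIV" for k
  by (rule Infinite_Sum.summable_on_comparison_test[OF P le]) simp
 show "cmod (transport_coeff \<nu> c k) \<le> (\<Sum>\<^sub>\<infinity>l. M (k - l) * (mode_norm l * M l))"
  unfolding transport_coeff_def by (rule order_trans[OF norm_infsum_bound[OF Q] infsum_mono[OF Q P le]])
qed

text \<open>Exponential decay, uniform on bounded time intervals, dominates every series involved together with
 its derivatives, so the equation for the coefficients can be summed termwise.\<close>

theorem coefficients_ipmb_solution:
 fixes a :: "real \<Rightarrow> int \<times> int \<Rightarrow> complex"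
 assumes \<nu>: "0 \<le> \<nu>" and \<sigma>: "0 < \<sigma>" and tor: "torus_fun \<theta>0" and init: "a 0 = fourier_coeff \<theta>0"
  and herm: "\<And>t. 0 \<le> t \<Longrightarrow> hermitian (a t)" and zero: "\<And>t. 0 \<le> t \<Longrightarrow> a t 0 = 0"
  and decay: "\<And>T. 0 \<le> T \<Longrightarrow> \<exists>\<tau>>0. \<exists>G. \<forall>t\<in>{0..T}. \<forall>k. cmod (a t k) \<le> G * exp (- \<tau> * mode_norm k powr \<sigma>)"
  and ode: "\<And>t k. 0 \<le> t \<Longrightarrow> ((\<lambda>t. a t k) has_vector_derivative - transport_coeff \<nu> (a t) k) (at t within {0..})"
 shows "ipmb_solution \<nu> \<theta>0 (\<lambda>t x. Re (fseries (a t) x))"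
proof -
 have bound: "\<exists>M. (\<forall>n. (\<lambda>k. mode_norm k ^ n * M k) summable_on UNIV) \<and> (\<forall>k. 0 \<le> M k) \<and> (\<forall>t\<in>{0..T}. \<forall>k. cmod (a t k) \<le> M k)"
  if T: "0 \<le> T" for T
 proof -
  obtain \<tau> G where \<tau>: "0 < \<tau>" and G: "\<And>t k. t \<in> {0..T} \<Longrightarrow> cmod (a t k) \<le> G * exp (- \<tau> * mode_norm k powr \<sigma>)"
   using decay[OF T] by metis
  have G0: "0 \<le> G" using order_trans[OF norm_ge_zero G[of 0 0]] T by simp
  have "(\<lambda>k. mode_norm k ^ n * (G * exp (- \<tau> * mode_norm k powr \<sigma>))) summable_on UNIV" for n
   using summable_on_cmult_right[OF gevrey_weight_summable[OF \<tau> \<sigma>, of n], of G] by (simp add: mult.left_commute)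
  then show ?thesis using G G0 by (intro exI[of _ "\<lambda>k. G * exp (- \<tau> * mode_norm k powr \<sigma>)"]) auto
 qed
 have M1: "M summable_on UNIV" "(\<lambda>k. mode_norm k * M k) summable_on UNIV"
  if "\<And>n. (\<lambda>k. mode_norm k ^ n * M k) summable_on UNIV" for M
  using that[of 0] that[of 1] by simp_all
 have abs: "(\<lambda>k. cmod (a t k)) summable_on UNIV" "(\<lambda>k. mode_norm k * cmod (a t k)) summable_on UNIV" if t: "0 \<le> t" for t
 proof -
  obtain M where M: "\<And>n. (\<lambda>k. mode_norm k ^ n * M k) summable_on UNIV" "\<And>k. cmod (a t k) \<le> M k"
   using bound[OF t] t by (metis atLeastAtMost_iff order_refl)
  show "(\<lambda>k. cmod (a t k)) summable_on UNIV" by (rule abs_summable_le[OF M1(1)[OF M(1)] M(2)])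
  show "(\<lambda>k. mode_norm k * cmod (a t k)) summable_on UNIV"
   by (rule Infinite_Sum.summable_on_comparison_test[OF M1(2)[OF M(1)]]) (use M(2) in \<open>auto intro: mult_left_mono\<close>)
 qed
 have cont_a: "continuous_on {0..T} (\<lambda>t. a t k)" for T k
 proof (rule continuous_on_vector_derivative)
  fix t assume "t \<in> {0..T}"
  then show "((\<lambda>t. a t k) has_vector_derivative - transport_coeff \<nu> (a t) k) (at t within {0..T})"
   by (intro has_vector_derivative_within_subset[OF ode]) auto
 qed
 define bt where "bt = (\<lambda>t k. - transport_coeff \<nu> (a t) k)"
 define ax where "ax = (\<lambda>t k. \<i> * of_int (fst k) * a t k)"
 define ay where "ay = (\<lambda>t k. \<i> * of_int (snd k) * a t k)"
 have bt_bound: "\<exists>N. N summable_on UNIV \<and> (\<forall>t\<in>{0..T}. \<forall>k. cmod (bt t k) \<le> N k)"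
  and cont_bt: "continuous_on {0..T} (\<lambda>t. bt t k)" if T: "0 \<le> T" for T k
 proof -
  obtain M where M: "\<And>n. (\<lambda>k. mode_norm k ^ n * M k) summable_on UNIV" "\<And>k. 0 \<le> M k"
   "\<And>t k. t \<in> {0..T} \<Longrightarrow> cmod (a t k) \<le> M k"
   using bound[OF T] by metis
  note B = transport_coeff_summable_bound[OF \<nu> M1[OF M(1)] M(2)]
  show "\<exists>N. N summable_on UNIV \<and> (\<forall>t\<in>{0..T}. \<forall>k. cmod (bt t k) \<le> N k)"
   using B(2) B(4)[OF M(3)] by (intro exI[of _ "\<lambda>k. \<Sum>\<^sub>\<infinity>l. M (k - l) * (mode_norm l * M l)"]) (auto simp: bt_def)
  show "continuous_on {0..T} (\<lambda>t. bt t k)"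
   unfolding bt_def transport_coeff_def
   by (intro continuous_on_minus continuous_on_infsum[OF _ B(3)[OF M(3)] B(1)] continuous_intros cont_a) auto
 qed
 have grad_bound: "\<exists>N. N summable_on UNIV \<and> (\<forall>t\<in>{0..T}. \<forall>k. cmod (ax t k) \<le> N k)"
  "\<exists>N. N summable_on UNIV \<and> (\<forall>t\<in>{0..T}. \<forall>k. cmod (ay t k) \<le> N k)" if T: "0 \<le> T" for T
 proof -
  obtain M where M: "\<And>n. (\<lambda>k. mode_norm k ^ n * M k) summable_on UNIV" "\<And>k. 0 \<le> M k"
   "\<And>t k. t \<in> {0..T} \<Longrightarrow> cmod (a t k) \<le> M k"
   using bound[OF T] by metis
  have "cmod (ax t k) \<le> mode_norm k * M k" "cmod (ay t k) \<le> mode_norm k * M k" if "t \<in> {0..T}" for t k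
   unfolding ax_def ay_def norm_mult
   using mult_mono[OF abs_fst_le M(3)[OF that], of k k] mult_mono[OF abs_snd_le M(3)[OF that], of k k] by simp_all
  then show "\<exists>N. N summable_on UNIV \<and> (\<forall>t\<in>{0..T}. \<forall>k. cmod (ax t k) \<le> N k)"
   "\<exists>N. N summable_on UNIV \<and> (\<forall>t\<in>{0..T}. \<forall>k. cmod (ay t k) \<le> N k)"
   using M1(2)[OF M(1)] by blast+
 qed
 have dt: "((\<lambda>t. Re (fseries (a t) z)) has_real_derivative Re (fseries (bt t) z)) (at t within {0..})" if t: "0 \<le> t" for t z
 proof -
  obtain N where N: "N summable_on UNIV" "\<And>u k. u \<in> {0..t + 1} \<Longrightarrow> cmod (bt u k) \<le> N k"
   using bt_bound[of "t + 1"] t by (metis add_nonneg_nonneg zero_le_one)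
  have "((\<lambda>t. \<Sum>\<^sub>\<infinity>k. a t k * mode k z) has_vector_derivative (\<Sum>\<^sub>\<infinity>k. bt t k * mode k z)) (at t within {0..t + 1})"
  proof (rule infsum_has_vector_derivative[OF _ _ _ N(1)])
   fix k u assume u: "u \<in> {0..t + 1}"
   show "((\<lambda>t. a t k * mode k z) has_vector_derivative bt u k * mode k z) (at u within {0..t + 1})"
    unfolding bt_def by (intro has_vector_derivative_mult_left has_vector_derivative_within_subset[OF ode]) (use u in auto)
   show "cmod (bt u k * mode k z) \<le> N k" using N(2)[OF u, of k] by (simp add: norm_mult)
   show "(\<lambda>k. a u k * mode k z) summable_on UNIV" using fseries_summable(2)[OF abs(1)] u by auto
  qed (use t in auto)
  then have "((\<lambda>t. fseries (a t) z) has_vector_derivative fseries (bt t) z) (at t within {0..})"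
   using at_within_atLeastAtMost_eq[of t "t + 1"] t by (simp add: fseries_def)
  from bounded_linear.has_vector_derivative[OF bounded_linear_Re this] show ?thesis
   by (simp add: has_real_derivative_iff_has_vector_derivative)
 qed
 have dxy: "((\<lambda>x. Re (fseries (a t) (x, y))) has_real_derivative Re (fseries (ax t) (x, y))) (at x)"
  "((\<lambda>y. Re (fseries (a t) (x, y))) has_real_derivative Re (fseries (ay t) (x, y))) (at y)" if t: "0 \<le> t" for t x y
  using bounded_linear.has_vector_derivative[OF bounded_linear_Re fseries_has_vector_derivative(1)[OF abs[OF t]]]
   bounded_linear.has_vector_derivative[OF bounded_linear_Re fseries_has_vector_derivative(2)[OF abs[OF t]]]
  by (simp_all add: ax_def ay_def has_real_derivative_iff_has_vector_derivative)
 have coeff: "fourier_coeff (\<lambda>x. Re (fseries (a t) x)) k = a t k" if t: "0 \<le> t" for t k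
  by (rule fourier_coeff_fseries[OF abs(1)[OF t] herm[OF t]])
 have pde: "Re (fseries (bt t) z) + (ipmb_velocity1 \<nu> (\<lambda>x. Re (fseries (a t) x)) z * Re (fseries (ax t) z)
   + ipmb_velocity2 \<nu> (\<lambda>x. Re (fseries (a t) x)) z * Re (fseries (ay t) z)) = 0" if t: "0 \<le> t" for t z
 proof -
  let ?c1 = "\<lambda>k. of_real (ipmb_symbol1 \<nu> k) * a t k" and ?c2 = "\<lambda>k. of_real (ipmb_symbol2 \<nu> k) * a t k"
  have s: "(\<lambda>k. cmod (?c1 k)) summable_on UNIV" "(\<lambda>k. cmod (?c2 k)) summable_on UNIV"
   by (rule abs_summable_le[OF abs(1)[OF t]] symbol_times_le[OF \<nu>])+
  have d: "(\<lambda>k. cmod (ax t k)) summable_on UNIV" "(\<lambda>k. cmod (ay t k)) summable_on UNIV"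
   unfolding ax_def ay_def
   by (rule abs_summable_le[OF abs(2)[OF t]]; simp add: norm_mult mult_right_mono abs_fst_le abs_snd_le)+
  have h: "hermitian ?c1" "hermitian ?c2"
   using herm[OF t, unfolded hermitian_def, THEN spec]
   by (simp_all only: hermitian_def symbol1_minus symbol2_minus complex_cnj_mult complex_cnj_complex_of_real simp_thms)
  have re: "Re (fseries c z) * Re w = Re (fseries c z * w)" if "hermitian c" for c w
  proof -
   have "Re (fseries c z * w) = Re (of_real (Re (fseries c z)) * w)" by (simp only: fseries_hermitian_real(2)[OF that])
   then show ?thesis by simp
  qed
  have "fseries (transport_coeff \<nu> (a t)) z = fseries (conv ?c1 (ax t)) z + fseries (conv ?c2 (ay t)) z"
   unfolding fseries_def ax_def ay_def transport_coeff_eq_conv[OF \<nu> abs[OF t]] distrib_right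
   by (rule infsum_add[OF fseries_summable(2)[OF conv_summable(3)[OF s(1) d(1)[unfolded ax_def]]]
     fseries_summable(2)[OF conv_summable(3)[OF s(2) d(2)[unfolded ay_def]]]])
  also have "\<dots> = fseries ?c1 z * fseries (ax t) z + fseries ?c2 z * fseries (ay t) z"
   by (simp only: fseries_mult[OF s(1) d(1)] fseries_mult[OF s(2) d(2)])
  finally have T: "fseries (transport_coeff \<nu> (a t)) z = \<dots>" .
  have "fseries (bt t) z = - fseries (transport_coeff \<nu> (a t)) z"
   by (simp only: fseries_def bt_def mult_minus_left infsum_uminus)
  then have "Re (fseries (bt t) z) = - (Re (fseries ?c1 z * fseries (ax t) z) + Re (fseries ?c2 z * fseries (ay t) z))"
   by (simp only: T uminus_complex.sel plus_complex.sel)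
  then show ?thesis
   by (simp only: ipmb_velocity_eq_fseries[OF coeff[OF t]] re[OF h(1)] re[OF h(2)])
 qed
 have mean: "mean_zero (\<lambda>x. Re (fseries (a t) x))" if t: "0 \<le> t" for t
 proof -
  let ?f = "\<lambda>x. Re (fseries (a t) x)"
  have "(LINT x:torus_cell|lborel. complex_of_real (?f x)) = 0"
   using coeff[OF t, of 0] zero[OF t] by (simp add: fourier_coeff_def mode_phase_def)
  moreover have "(LINT x:torus_cell|lborel. complex_of_real (?f x)) = of_real (LINT x:torus_cell|lborel. ?f x)"
   by (simp only: set_lebesgue_integral_cell integral_complex_of_real)
  ultimately show ?thesis by (simp only: mean_zero_def of_real_eq_0_iff)
 qed
 have start: "(\<lambda>x. Re (fseries (a 0) x)) = \<theta>0"
  using fourier_inversion[OF tor] abs(1)[of 0] by (auto simp: init)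
 have ct: "continuous_on ({0..} \<times> UNIV) (\<lambda>(t, z). Re (fseries (bt t) z))"
  by (rule continuous_on_fseries_time[OF cont_bt bt_bound])
 have cx: "continuous_on ({0..} \<times> UNIV) (\<lambda>(t, z). Re (fseries (ax t) z))"
  by (rule continuous_on_fseries_time[OF _ grad_bound(1)]) (auto simp: ax_def intro!: continuous_intros cont_a)
 have cy: "continuous_on ({0..} \<times> UNIV) (\<lambda>(t, z). Re (fseries (ay t) z))"
  by (rule continuous_on_fseries_time[OF _ grad_bound(2)]) (auto simp: ay_def intro!: continuous_intros cont_a)
 show ?thesis
  unfolding ipmb_solution_def
 proof (intro conjI; (rule exI[of _ "\<lambda>t z. Re (fseries (bt t) z)"], rule exI[of _ "\<lambda>t z. Re (fseries (ax t) z)"],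
   rule exI[of _ "\<lambda>t z. Re (fseries (ay t) z)"])?)
 qed (use start ct cx cy dt dxy pde mean torus_fun_fseries[OF abs(1)] in \<open>auto\<close>)
qed

section \<open>Passage to the limit in the Galerkin approximation\<close>

text \<open>A first bound lets the radius of analyticity shrink as fast as the equation demands. The crude
 bound on the strain grows only like the square root of the decay rate, so some rate suffices.\<close>

lemma square_root_growth:
 fixes c p q d :: real
 assumes "0 < q" "0 \<le> p" "0 \<le> c"
 shows "\<exists>R>0. c * sqrt (p + q * R) + d \<le> R"
proof -
 define R where "R = c\<^sup>2 * q + p / q + 2 * \<bar>d\<bar> + 1"
 have R: "0 < R" using assms by (simp add: R_def add_nonneg_pos)
 have "c * sqrt (p + q * R) = sqrt ((c\<^sup>2 * q) * ((p + q * R) / q))"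
  using assms by (simp add: real_sqrt_mult)
 also have "\<dots> \<le> (c\<^sup>2 * q + (p + q * R) / q) / 2"
  using assms R by (intro arith_geo_mean_sqrt) auto
 also have "(p + q * R) / q = p / q + R" using assms by (simp add: add_divide_distrib)
 finally have "c * sqrt (p + q * R) + d \<le> (c\<^sup>2 * q + (p / q + R)) / 2 + \<bar>d\<bar>" by linarith
 also have "\<dots> \<le> R" unfolding R_def by (simp add: field_simps)
 finally show ?thesis using R by blast
qed

lemma galerkin_solution_support: "galerkin_solution \<nu> S a0 a \<Longrightarrow> 0 \<le> t \<Longrightarrow> k \<notin> S \<Longrightarrow> a t k = 0"
 unfolding galerkin_solution_def by blast

lemma galerkin_uniform_decay:
 assumes \<nu>: "0 < \<nu>" and \<sigma>: "0 < \<sigma>" "\<sigma> \<le> 1" and \<tau>0: "0 < \<tau>0" and T: "0 < T" and G: "0 < G"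
 shows "\<exists>\<tau>>0. \<forall>S a0 a t k. finite S \<longrightarrow> 0 \<notin> S \<longrightarrow> galerkin_solution \<nu> S a0 a \<longrightarrow>
  L2_set (\<lambda>k. exp (\<tau>0 * mode_norm k powr \<sigma>) * cmod (a0 k)) S \<le> G \<longrightarrow> 0 \<le> t \<longrightarrow> t \<le> T \<longrightarrow>
  cmod (a t k) \<le> G * exp (- \<tau> * mode_norm k powr \<sigma>)"
proof -
 define L where "L = \<bar>ln \<tau>0\<bar> + 1"
 have L: "1 \<le> L" by (simp add: L_def)
 define c where "c = 4 * (1 / \<nu> * (exp 1 * (2 * G)))"
 define p where "p = 12 * (1 + L / (2 * \<sigma>))"
 define q where "q = 12 * T / (2 * \<sigma>)"
 have c: "0 \<le> c" using \<nu> G by (simp add: c_def)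
 have p: "0 \<le> p" and q: "0 < q" using L \<sigma> T by (simp_all add: p_def q_def)
 obtain R where R: "0 < R" "c * sqrt (p + q * R) + trilinear_const \<sigma> / \<nu> * (2 * G) \<le> R"
  using square_root_growth[OF q p c] by blast
 \<comment> \<open>With this exponent the loss \<open>\<tau> powr - \<epsilon>\<close> stays below \<open>exp 1\<close> up to the time \<open>T\<close>.\<close>
 define \<epsilon> where "\<epsilon> = 1 / (L + R * T)"
 have LR: "1 \<le> L + R * T" using L R T by (simp add: add_increasing2)
 then have \<epsilon>: "0 < \<epsilon>" "\<epsilon> \<le> 1" by (simp_all add: \<epsilon>_def)
 define Q where "Q = sqrt (12 * (1 + 1 / (2 * \<epsilon> * \<sigma>)))"
 have Q: "Q = sqrt (p + q * R)"
  using \<sigma> LR by (simp add: Q_def \<epsilon>_def p_def q_def field_simps)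
 have Q0: "0 \<le> Q" unfolding Q using p q R by simp
 define \<tau> where "\<tau> = \<tau>0 * exp (- R * T)"
 have \<tau>: "0 < \<tau>" using \<tau>0 by (simp add: \<tau>_def)
 show ?thesis
 proof (intro exI[of _ \<tau>] conjI allI impI)
  fix S a0 a t k
  assume S: "finite S" "0 \<notin> S" and sol: "galerkin_solution \<nu> S a0 a"
   and G0: "L2_set (\<lambda>k. exp (\<tau>0 * mode_norm k powr \<sigma>) * cmod (a0 k)) S \<le> G" and t: "0 \<le> t" "t \<le> T"
  have bound: "L2_set (\<lambda>k. exp (\<tau>0 * exp (- R * t) * mode_norm k powr \<sigma>) * cmod (a t k)) S \<le> G"
  proof (rule galerkin_gevrey_bound[OF \<nu> \<sigma> \<tau>0 S sol G G0, where \<beta> = "1 / \<nu> * (exp 1 * Q * (2 * G))" and T = T and R = R])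
   fix t i m assume t: "0 \<le> t" "t \<le> T"
    and Y: "L2_set (\<lambda>k. exp (\<tau>0 * exp (- R * t) * mode_norm k powr \<sigma>) * cmod (a t k)) S \<le> 2 * G"
   have "(\<tau>0 * exp (- R * t)) powr (- \<epsilon>) = exp (\<epsilon> * (R * t - ln \<tau>0))"
    using \<tau>0 by (simp add: powr_def ln_mult algebra_simps)
   also have "\<dots> \<le> exp (\<epsilon> * (L + R * T))"
   proof -
    have "R * t \<le> R * T" using R(1) t by (intro mult_left_mono) auto
    then have "R * t - ln \<tau>0 \<le> L + R * T" by (simp add: L_def abs_if split: if_splits)
    then show ?thesis using \<epsilon> by (simp add: mult_left_mono)
   qed
   also have "\<epsilon> * (L + R * T) = 1" using LR by (simp add: \<epsilon>_def)
   finally have pw: "(\<tau>0 * exp (- R * t)) powr (- \<epsilon>) \<le> exp 1" .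
   have "form_bound S (strain \<nu> i m (a t)) (1 / \<nu> * ((\<tau>0 * exp (- R * t)) powr (- \<epsilon>) * Q *
     L2_set (\<lambda>k. exp (\<tau>0 * exp (- R * t) * mode_norm k powr \<sigma>) * cmod (a t k)) S))"
    unfolding Q_def by (rule strain_form_bound_crude[OF \<nu> \<sigma>(1) _ \<epsilon> S]) (use \<tau>0 sol t in \<open>auto simp: galerkin_solution_def\<close>)
   then show "form_bound S (strain \<nu> i m (a t)) (1 / \<nu> * (exp 1 * Q * (2 * G)))"
    by (rule form_bound_mono) (intro mult_left_mono mult_mono pw Y, use \<nu> Q0 in \<open>auto\<close>)
  next
   show "4 * (1 / \<nu> * (exp 1 * Q * (2 * G))) + trilinear_const \<sigma> / \<nu> * (2 * G) \<le> R"
    using R(2) by (simp add: c_def Q mult_ac)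
  qed (use t in auto)
  show "cmod (a t k) \<le> G * exp (- \<tau> * mode_norm k powr \<sigma>)"
  proof (cases "k \<in> S")
   case True
   have "\<tau> \<le> \<tau>0 * exp (- R * t)" unfolding \<tau>_def using \<tau>0 R(1) t by (simp add: mult_left_mono)
   then have "exp (\<tau> * mode_norm k powr \<sigma>) * cmod (a t k) \<le> exp (\<tau>0 * exp (- R * t) * mode_norm k powr \<sigma>) * cmod (a t k)"
    by (intro mult_right_mono) (simp_all add: mult_right_mono)
   also have "\<dots> \<le> G" by (rule order_trans[OF member_le_L2_set bound]) (use S True in auto)
   finally have "exp (\<tau> * mode_norm k powr \<sigma>) * cmod (a t k) \<le> G" .
   then show ?thesis by (simp add: exp_minus field_simps)
  next
   case False
   then have "a t k = 0" by (rule galerkin_solution_support[OF sol t(1)])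
   then show ?thesis using G by simp
  qed
 qed (rule \<tau>)
qed

text \<open>The energy of the difference: transport by the first solution is neutral, the stretching term is
 absorbed by Gronwall, and the modes missing in the second solution enter only through the tail of
 the majorant \<open>m\<close>.\<close>

lemma galerkin_difference_bound:
 fixes m :: "int \<times> int \<Rightarrow> real"
 assumes \<nu>: "0 \<le> \<nu>" and S: "finite S" "M \<subseteq> S"
  and a: "galerkin_solution \<nu> S a0 a" and b: "galerkin_solution \<nu> M b0 b" and init: "\<And>k. k \<in> M \<Longrightarrow> b0 k = a0 k"
  and m: "\<And>k. 0 \<le> m k" "\<And>k. m k \<le> B" and A: "(\<Sum>l\<in>S. mode_norm l * m l) \<le> A" and \<delta>: "(\<Sum>k\<in>S - M. m k) \<le> \<delta>"
  and am: "\<And>t k. 0 \<le> t \<Longrightarrow> t \<le> T \<Longrightarrow> cmod (a t k) \<le> m k" and bm: "\<And>t k. 0 \<le> t \<Longrightarrow> t \<le> T \<Longrightarrow> cmod (b t k) \<le> m k"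
  and t: "0 \<le> t" "t \<le> T"
 shows "(\<Sum>k\<in>S. (cmod (a t k - b t k))\<^sup>2) \<le> exp (2 * A * T) * (B + 2 * B * A * T) * \<delta>"
proof -
 define d where "d = (\<lambda>t k. a t k - b t k)"
 define D where "D = (\<lambda>t. \<Sum>k\<in>S. (cmod (d t k))\<^sup>2)"
 define r where "r = (\<lambda>t k. if k \<in> M then 0 else advection \<nu> S (b t) (b t) k)"
 have a': "hermitian (a t)" "\<And>k. k \<notin> S \<Longrightarrow> a t k = 0"
  "\<And>k. k \<in> S \<Longrightarrow> ((\<lambda>t. a t k) has_vector_derivative - advection \<nu> S (a t) (a t) k) (at t within {0..})" if "0 \<le> t" for t
  using a that by (auto simp: galerkin_solution_def)
 have b': "\<And>k. k \<notin> M \<Longrightarrow> b t k = 0"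
  "\<And>k. k \<in> M \<Longrightarrow> ((\<lambda>t. b t k) has_vector_derivative - advection \<nu> M (b t) (b t) k) (at t within {0..})" if "0 \<le> t" for t
  using b that by (auto simp: galerkin_solution_def)
 have B: "0 \<le> B" using m[of 0] by linarith
 have A0: "0 \<le> A" using order_trans[OF sum_nonneg A] m(1) by simp
 have \<delta>0: "0 \<le> \<delta>" using order_trans[OF sum_nonneg \<delta>] m(1) by simp
 have dk: "((\<lambda>t. d t k) has_vector_derivative - advection \<nu> S (a t) (d t) k - advection \<nu> S (d t) (b t) k - r t k) (at t within {0..})"
  if t: "0 \<le> t" and k: "k \<in> S" for t k
 proof -
  have split: "advection \<nu> S (a t) (a t) k - advection \<nu> S (b t) (b t) k = advection \<nu> S (a t) (d t) k + advection \<nu> S (d t) (b t) k"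
   by (simp add: advection_def d_def sum.distrib[symmetric] sum_subtractf[symmetric] algebra_simps)
  have hb: "((\<lambda>t. b t k) has_vector_derivative - advection \<nu> S (b t) (b t) k + r t k) (at t within {0..})"
  proof (cases "k \<in> M")
   case True
   have "advection \<nu> M (b t) (b t) k = advection \<nu> S (b t) (b t) k"
    unfolding advection_def by (rule sum.mono_neutral_left) (use S b'(1)[OF t] in auto)
   then show ?thesis using b'(2)[OF t True] True by (simp add: r_def)
  next
   case False
   have "((\<lambda>t. b t k) has_vector_derivative 0) (at t within {0..})"
    by (rule has_vector_derivative_transform[where f = "\<lambda>_. 0"]) (use t b'(1) False in auto)
   then show ?thesis using False by (simp add: r_def)
  qed
  have "- advection \<nu> S (a t) (a t) k - (- advection \<nu> S (b t) (b t) k + r t k) =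
    - (advection \<nu> S (a t) (a t) k - advection \<nu> S (b t) (b t) k) - r t k" by simp
  then have e: "- advection \<nu> S (a t) (a t) k - (- advection \<nu> S (b t) (b t) k + r t k) =
    - advection \<nu> S (a t) (d t) k - advection \<nu> S (d t) (b t) k - r t k" unfolding split by simp
  show ?thesis
   using has_vector_derivative_diff[OF a'(3)[OF t k] hb] unfolding e by (simp only: d_def)
 qed
 define D' where "D' = (\<lambda>t. \<Sum>k\<in>S. 2 * Re (cnj (d t k) * (- advection \<nu> S (a t) (d t) k - advection \<nu> S (d t) (b t) k - r t k)))"
 have D': "(D has_real_derivative D' t) (at t within {0..})" if "0 \<le> t" for t
  unfolding D_def D'_def by (intro DERIV_sum has_derivative_cmod_sq dk that)
 have le: "D' t \<le> 2 * A * D t + 2 * B * A * \<delta>" if t: "0 \<le> t" "t \<le> T" for t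
 proof -
  have e: "D' t = - 2 * Re (\<Sum>k\<in>S. cnj (d t k) * advection \<nu> S (a t) (d t) k)
    - 2 * Re (\<Sum>k\<in>S. cnj (d t k) * advection \<nu> S (d t) (b t) k) - 2 * Re (\<Sum>k\<in>S. cnj (d t k) * r t k)"
   by (simp add: D'_def sum_distrib_left sum_subtractf[symmetric] algebra_simps)
  have n: "Re (\<Sum>k\<in>S. cnj (d t k) * advection \<nu> S (a t) (d t) k) = 0"
   by (rule advection_neutral[OF S(1) a'(1)[OF t(1)]])
  have d0: "d t k = 0" if "k \<notin> S" for k
  proof -
   have "k \<notin> M" using that S(2) by blast
   from b'(1)[OF t(1) this] a'(2)[OF t(1) that] show ?thesis by (simp add: d_def)
  qed
  have shift: "(\<Sum>k\<in>S. (cmod (d t (k - l)))\<^sup>2) \<le> D t" for l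
  proof -
   have "(\<Sum>k\<in>S. (cmod (d t (k - l)))\<^sup>2) = (\<Sum>j\<in>(\<lambda>k. k - l) ` S. (cmod (d t j))\<^sup>2)"
    by (subst sum.reindex) (auto simp: inj_on_def o_def)
   also have "\<dots> = (\<Sum>j\<in>(\<lambda>k. k - l) ` S \<inter> S. (cmod (d t j))\<^sup>2)"
    by (rule sum.mono_neutral_right) (use S d0 in auto)
   also have "\<dots> \<le> D t" unfolding D_def by (rule sum_mono2) (use S in auto)
   finally show ?thesis .
  qed
  have stretching: "cmod (\<Sum>k\<in>S. cnj (d t k) * advection \<nu> S (d t) (b t) k) \<le> A * D t"
  proof -
   have "cmod (\<Sum>k\<in>S. cnj (d t k) * advection \<nu> S (d t) (b t) k) =
     cmod (\<Sum>l\<in>S. \<Sum>k\<in>S. cnj (d t k) * (\<i> * of_real (drift \<nu> (k - l) l) * d t (k - l) * b t l))"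
    unfolding advection_def sum_distrib_left by (subst sum.swap) simp
   also have "\<dots> \<le> (\<Sum>l\<in>S. mode_norm l * m l * D t)"
   proof (rule sum_norm_le)
    fix l assume "l \<in> S"
    have "cmod (\<Sum>k\<in>S. cnj (d t k) * (\<i> * of_real (drift \<nu> (k - l) l) * d t (k - l) * b t l)) \<le>
      (\<Sum>k\<in>S. (mode_norm l * m l) * (((cmod (d t k))\<^sup>2 + (cmod (d t (k - l)))\<^sup>2) / 2))"
    proof (rule sum_norm_le)
     fix k
     have "cmod (cnj (d t k) * (\<i> * of_real (drift \<nu> (k - l) l) * d t (k - l) * b t l)) =
       (\<bar>drift \<nu> (k - l) l\<bar> * cmod (b t l)) * (cmod (d t k) * cmod (d t (k - l)))"
      by (simp add: norm_mult)
     also have "\<dots> \<le> (mode_norm l * m l) * (((cmod (d t k))\<^sup>2 + (cmod (d t (k - l)))\<^sup>2) / 2)"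
     proof (intro mult_mono abs_drift_le_mode_norm[OF \<nu>] bm t)
      show "cmod (d t k) * cmod (d t (k - l)) \<le> ((cmod (d t k))\<^sup>2 + (cmod (d t (k - l)))\<^sup>2) / 2"
       using sum_squares_bound[of "cmod (d t k)" "cmod (d t (k - l))"] by simp
     qed (use m in auto)
     finally show "cmod (cnj (d t k) * (\<i> * of_real (drift \<nu> (k - l) l) * d t (k - l) * b t l)) \<le>
       (mode_norm l * m l) * (((cmod (d t k))\<^sup>2 + (cmod (d t (k - l)))\<^sup>2) / 2)" .
    qed
    also have "\<dots> = (mode_norm l * m l) * ((D t + (\<Sum>k\<in>S. (cmod (d t (k - l)))\<^sup>2)) / 2)"
     by (simp add: D_def sum_distrib_left[symmetric] sum_divide_distrib[symmetric] sum.distrib)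
    also have "\<dots> \<le> (mode_norm l * m l) * D t"
     using shift[of l] m(1) by (intro mult_left_mono) auto
    finally show "cmod (\<Sum>k\<in>S. cnj (d t k) * (\<i> * of_real (drift \<nu> (k - l) l) * d t (k - l) * b t l)) \<le> mode_norm l * m l * D t" .
   qed
   also have "\<dots> \<le> A * D t" unfolding sum_distrib_right[symmetric]
    by (rule mult_right_mono[OF A]) (simp add: D_def sum_nonneg)
   finally show ?thesis .
  qed
  have rest: "cmod (\<Sum>k\<in>S. cnj (d t k) * r t k) \<le> B * A * \<delta>"
  proof -
   have "cmod (\<Sum>k\<in>S. cnj (d t k) * r t k) \<le> (\<Sum>k\<in>S. if k \<in> M then 0 else m k * (B * A))"
   proof (rule sum_norm_le)
    fix k assume k: "k \<in> S"
    show "cmod (cnj (d t k) * r t k) \<le> (if k \<in> M then 0 else m k * (B * A))"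
    proof (cases "k \<in> M")
     case False
     have "cmod (advection \<nu> S (b t) (b t) k) \<le> (\<Sum>l\<in>S. B * (mode_norm l * m l))"
      unfolding advection_def
     proof (rule sum_norm_le)
      fix l
      have "cmod (\<i> * of_real (drift \<nu> (k - l) l) * b t (k - l) * b t l) = cmod (b t (k - l)) * (\<bar>drift \<nu> (k - l) l\<bar> * cmod (b t l))"
       by (simp add: norm_mult)
      also have "\<dots> \<le> B * (mode_norm l * m l)"
       using order_trans[OF bm[OF t] m(2)] by (intro mult_mono abs_drift_le_mode_norm[OF \<nu>] bm t B) auto
      finally show "cmod (\<i> * of_real (drift \<nu> (k - l) l) * b t (k - l) * b t l) \<le> B * (mode_norm l * m l)" .
     qed
     also have "\<dots> \<le> B * A" unfolding sum_distrib_left[symmetric] by (rule mult_left_mono[OF A B])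
     finally have "cmod (r t k) \<le> B * A" using False by (simp add: r_def)
     moreover have "cmod (d t k) \<le> m k" using am[OF t, of k] b'(1)[OF t(1) False] by (simp add: d_def)
     ultimately show ?thesis using False m(1)[of k] by (auto simp: norm_mult intro: mult_mono)
    qed (simp add: r_def)
   qed
   also have "\<dots> = (\<Sum>k\<in>S - M. m k) * (B * A)"
    unfolding sum_distrib_right
    by (rule sum.mono_neutral_cong_right) (use S in auto)
   also have "\<dots> \<le> \<delta> * (B * A)" by (rule mult_right_mono[OF \<delta>]) (use A0 B in simp)
   finally show ?thesis by (simp add: mult_ac)
  qed
  have "- Re (\<Sum>k\<in>S. cnj (d t k) * advection \<nu> S (d t) (b t) k) \<le> A * D t"
   using order_trans[OF abs_Re_le_cmod stretching] by linarith
  moreover have "- Re (\<Sum>k\<in>S. cnj (d t k) * r t k) \<le> B * A * \<delta>"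
   using order_trans[OF abs_Re_le_cmod rest] by linarith
  ultimately show ?thesis unfolding e n by linarith
 qed
 define E where "E = (\<lambda>t. exp (- (2 * A) * t) * D t - 2 * B * A * \<delta> * t)"
 have "E t \<le> E 0"
 proof (rule nonpos_derivative_imp_le[OF t(1)])
  fix u assume u: "0 \<le> u" "u \<le> t"
  show "(E has_real_derivative exp (- (2 * A) * u) * (D' u - 2 * A * D u) - 2 * B * A * \<delta>) (at u within {0..t})"
   unfolding E_def
   by (rule derivative_eq_intros DERIV_subset[OF D'[OF u(1)]] refl | simp)+ (simp add: algebra_simps)
  have "exp (- (2 * A) * u) * (D' u - 2 * A * D u) \<le> 1 * (2 * B * A * \<delta>)"
  proof (rule order_trans[OF mult_left_mono])
   show "D' u - 2 * A * D u \<le> 2 * B * A * \<delta>" using le[OF u(1)] u t by simp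
   show "exp (- (2 * A) * u) * (2 * B * A * \<delta>) \<le> 1 * (2 * B * A * \<delta>)"
    using A0 B \<delta>0 u by (intro mult_right_mono) auto
  qed simp
  then show "exp (- (2 * A) * u) * (D' u - 2 * A * D u) - 2 * B * A * \<delta> \<le> 0" by simp
 qed
 moreover have "D 0 \<le> B * \<delta>"
 proof -
  have "D 0 \<le> (\<Sum>k\<in>S. if k \<in> M then 0 else B * m k)"
   unfolding D_def
  proof (rule sum_mono)
   fix k assume "k \<in> S"
   show "(cmod (d 0 k))\<^sup>2 \<le> (if k \<in> M then 0 else B * m k)"
   proof (cases "k \<in> M")
    case True
    then show ?thesis using a b init[OF True] by (simp add: d_def galerkin_solution_def)
   next
    case False
    have "cmod (a 0 k) \<le> m k" using am[of 0 k] t by simp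
    then have "cmod (a 0 k) * cmod (a 0 k) \<le> B * m k" using m[of k] B by (intro mult_mono) auto
    then show ?thesis using False b'(1)[OF order_refl False] by (simp add: d_def power2_eq_square)
   qed
  qed
  also have "\<dots> = B * (\<Sum>k\<in>S - M. m k)"
   unfolding sum_distrib_left by (rule sum.mono_neutral_cong_right) (use S in auto)
  also have "\<dots> \<le> B * \<delta>" by (rule mult_left_mono[OF \<delta> B])
  finally show ?thesis .
 qed
 ultimately have "exp (- (2 * A) * t) * D t \<le> B * \<delta> + 2 * B * A * \<delta> * t" by (simp add: E_def)
 also have "\<dots> \<le> B * \<delta> + 2 * B * A * \<delta> * T"
  using t A0 B \<delta>0 by (intro add_left_mono mult_left_mono) auto
 finally have fin: "exp (2 * A * t) * (exp (- (2 * A) * t) * D t) \<le> exp (2 * A * t) * ((B + 2 * B * A * T) * \<delta>)"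
  by (intro mult_left_mono) (simp_all add: algebra_simps)
 have eq: "exp (2 * A * t) * (exp (- (2 * A) * t) * D t) = D t"
  by (simp only: mult.assoc[symmetric] exp_add[symmetric]) simp
 have "D t \<le> exp (2 * A * t) * ((B + 2 * B * A * T) * \<delta>)" using fin unfolding eq .
 also have "\<dots> \<le> exp (2 * A * T) * ((B + 2 * B * A * T) * \<delta>)"
  using t A0 B \<delta>0 by (intro mult_right_mono) (auto simp: mult_left_mono)
 finally show ?thesis by (simp add: D_def d_def mult.assoc)
qed

definition mode_box :: "nat \<Rightarrow> (int \<times> int) set" where
 "mode_box N = {k. k \<noteq> 0 \<and> \<bar>fst k\<bar> \<le> int N \<and> \<bar>snd k\<bar> \<le> int N}"

definition restrict_modes :: "(int \<times> int) set \<Rightarrow> (int \<times> int \<Rightarrow> complex) \<Rightarrow> int \<times> int \<Rightarrow> complex" where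
 "restrict_modes S a k = (if k \<in> S then a k else 0)"

lemma finite_mode_box: "finite (mode_box N)"
proof (rule finite_subset)
 show "mode_box N \<subseteq> {- int N..int N} \<times> {- int N..int N}" by (force simp: mode_box_def)
qed simp

lemma mode_box_minus: "k \<in> mode_box N \<Longrightarrow> - k \<in> mode_box N" by (auto simp: mode_box_def)

lemma mode_box_mono: "M \<le> N \<Longrightarrow> mode_box M \<subseteq> mode_box N" by (auto simp: mode_box_def)

lemma zero_notin_mode_box: "0 \<notin> mode_box N" by (simp add: mode_box_def)

lemma eventually_mode_box:
 assumes "k \<noteq> 0"
 shows "\<exists>N0. \<forall>N\<ge>N0. k \<in> mode_box N"
proof -
 define N0 where "N0 = nat (max \<bar>fst k\<bar> \<bar>snd k\<bar>)"
 have "k \<in> mode_box N" if "N0 \<le> N" for N using assms that by (auto simp: mode_box_def N0_def)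
 then show ?thesis by blast
qed

lemma infsum_real_tendsto_zero:
 fixes f :: "nat \<Rightarrow> 'k \<Rightarrow> real"
 assumes "\<And>k. (\<lambda>N. f N k) \<longlonglongrightarrow> 0" "\<And>N k. 0 \<le> f N k" "\<And>N k. f N k \<le> M k" "M summable_on UNIV"
 shows "(\<lambda>N. \<Sum>\<^sub>\<infinity>k. f N k) \<longlonglongrightarrow> 0" "f N summable_on UNIV"
proof -
 have s: "f N summable_on UNIV" for N
  by (rule Infinite_Sum.summable_on_comparison_test[OF assms(4)]) (use assms in auto)
 then show "f N summable_on UNIV" .
 have "(\<lambda>N. \<Sum>\<^sub>\<infinity>k. complex_of_real (f N k)) \<longlonglongrightarrow> (\<Sum>\<^sub>\<infinity>k :: 'k. complex_of_real 0)"
  by (rule infsum_tendsto_dominated[OF _ _ assms(4)]) (use assms in \<open>auto simp: tendsto_of_real_iff simp del: of_real_0\<close>)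
 moreover have "(\<Sum>\<^sub>\<infinity>k. complex_of_real (f N k)) = of_real (\<Sum>\<^sub>\<infinity>k. f N k)" for N
  by (rule infsumI) (intro has_sum_of_real has_sum_infsum s)
 ultimately have "(\<lambda>N. complex_of_real (\<Sum>\<^sub>\<infinity>k. f N k)) \<longlonglongrightarrow> complex_of_real 0" by simp
 then show "(\<lambda>N. \<Sum>\<^sub>\<infinity>k. f N k) \<longlonglongrightarrow> 0" by (simp only: tendsto_of_real_iff)
qed

lemma transport_coeff_finite:
 assumes "finite S" "\<And>l. l \<notin> S \<Longrightarrow> c l = 0"
 shows "transport_coeff \<nu> c k = advection \<nu> S c c k"
proof -
 have "transport_coeff \<nu> c k = (\<Sum>\<^sub>\<infinity>l\<in>S. \<i> * of_real (drift \<nu> (k - l) l) * c (k - l) * c l)"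
  unfolding transport_coeff_def by (rule infsum_cong_neutral) (use assms in auto)
 then show ?thesis by (simp add: advection_def assms(1))
qed

text \<open>The mean is conserved because the velocity is divergence free.\<close>

lemma transport_coeff_zero: "transport_coeff \<nu> c 0 = 0"
proof -
 have "drift \<nu> (0 - l) l = 0" for l
  using drift_shift[of \<nu> 0 l] by (simp add: drift_def)
 then show ?thesis by (simp add: transport_coeff_def)
qed

text \<open>The uniform decay makes the approximations a Cauchy sequence on every bounded time interval. The
 equation passes to the limit in its integrated form by dominated convergence. The approximations
 are kept in the conclusion because the sharp radius is proved for them first.\<close>

theorem galerkin_limit:
 assumes \<nu>: "0 < \<nu>" and \<sigma>: "0 < \<sigma>" "\<sigma> \<le> 1" and \<tau>0: "0 < \<tau>0" and herm: "hermitian a0" and a00: "a0 0 = 0"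
  and G: "0 < G" and GF: "\<And>F. finite F \<Longrightarrow> L2_set (\<lambda>k. exp (\<tau>0 * mode_norm k powr \<sigma>) * cmod (a0 k)) F \<le> G"
 shows "\<exists>A a. (\<forall>N. galerkin_solution \<nu> (mode_box N) (restrict_modes (mode_box N) a0) (A N)) \<and>
  a 0 = a0 \<and> (\<forall>t\<ge>0. hermitian (a t) \<and> a t 0 = 0) \<and>
  (\<forall>T>0. \<exists>\<tau>>0. \<forall>t\<in>{0..T}. \<forall>k. cmod (a t k) \<le> G * exp (- \<tau> * mode_norm k powr \<sigma>) \<and>
   (\<forall>N. cmod (A N t k) \<le> G * exp (- \<tau> * mode_norm k powr \<sigma>))) \<and>
  (\<forall>T>0. \<exists>\<eta>. \<eta> \<longlonglongrightarrow> 0 \<and> (\<forall>N. \<forall>t\<in>{0..T}. \<forall>k. cmod (A N t k - a t k) \<le> \<eta> N)) \<and>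
  (\<forall>t\<ge>0. \<forall>k. ((\<lambda>t. a t k) has_vector_derivative - transport_coeff \<nu> (a t) k) (at t within {0..}))"
proof -
 have "\<exists>a. galerkin_solution \<nu> (mode_box N) (restrict_modes (mode_box N) a0) a" for N
 proof (rule galerkin_solution_exists[OF finite_mode_box mode_box_minus])
  show "hermitian (restrict_modes (mode_box N) a0)"
   unfolding hermitian_def
  proof
   fix k
   show "restrict_modes (mode_box N) a0 (- k) = cnj (restrict_modes (mode_box N) a0 k)"
    using mode_box_minus[of k N] mode_box_minus[of "- k" N] herm[unfolded hermitian_def, THEN spec, of k]
    by (auto simp: restrict_modes_def)
  qed
 qed (simp_all add: restrict_modes_def)
 then obtain A where A: "\<And>N. galerkin_solution \<nu> (mode_box N) (restrict_modes (mode_box N) a0) (A N)" by metis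
 have supp: "A N t k = 0" if "0 \<le> t" "k \<notin> mode_box N" for N t k by (rule galerkin_solution_support[OF A that])
 have A_init: "A N 0 k = (if k \<in> mode_box N then a0 k else 0)" for N k
  using A[of N] by (simp add: galerkin_solution_def restrict_modes_def)
 have A_herm: "A N t (- k) = cnj (A N t k)" if "0 \<le> t" for N t k
  using A[of N, unfolded galerkin_solution_def, THEN conjunct2, THEN spec, THEN mp, OF that] by (simp only: hermitian_def)
 have A_ode: "((\<lambda>t. A N t k) has_vector_derivative - transport_coeff \<nu> (A N t) k) (at t within {0..})"
  if "0 \<le> t" "k \<in> mode_box N" for N t k
  using A[of N, unfolded galerkin_solution_def, THEN conjunct2, THEN spec, THEN mp, OF that(1)] that
  by (simp only: transport_coeff_finite[OF finite_mode_box supp])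
 have decay: "\<exists>\<tau>>0. \<forall>N t k. 0 \<le> t \<longrightarrow> t \<le> T \<longrightarrow> cmod (A N t k) \<le> G * exp (- \<tau> * mode_norm k powr \<sigma>)"
  if T: "0 < T" for T
 proof -
  have "L2_set (\<lambda>k. exp (\<tau>0 * mode_norm k powr \<sigma>) * cmod (restrict_modes (mode_box N) a0 k)) (mode_box N)
    = L2_set (\<lambda>k. exp (\<tau>0 * mode_norm k powr \<sigma>) * cmod (a0 k)) (mode_box N)" for N
   by (rule L2_set_cong) (simp_all add: restrict_modes_def)
  then have L: "L2_set (\<lambda>k. exp (\<tau>0 * mode_norm k powr \<sigma>) * cmod (restrict_modes (mode_box N) a0 k)) (mode_box N) \<le> G" for N
   using GF[OF finite_mode_box] by (simp only:)
  obtain \<tau> where \<tau>: "0 < \<tau>" and H: "\<forall>S a0 a t k. finite S \<longrightarrow> 0 \<notin> S \<longrightarrow> galerkin_solution \<nu> S a0 a \<longrightarrow>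
    L2_set (\<lambda>k. exp (\<tau>0 * mode_norm k powr \<sigma>) * cmod (a0 k)) S \<le> G \<longrightarrow> 0 \<le> t \<longrightarrow> t \<le> T \<longrightarrow>
    cmod (a t k) \<le> G * exp (- \<tau> * mode_norm k powr \<sigma>)"
   using galerkin_uniform_decay[OF \<nu> \<sigma> \<tau>0 T G] by (elim exE conjE)
  show ?thesis
   by (intro exI[of _ \<tau>] conjI \<tau> allI impI) (rule H[rule_format, OF finite_mode_box zero_notin_mode_box A L])
 qed
 have majorant: "\<exists>M. M summable_on UNIV \<and> (\<lambda>k. mode_norm k * M k) summable_on UNIV \<and> (\<forall>k. 0 \<le> M k) \<and> (\<forall>k. M k \<le> G) \<and>
   (\<forall>N t k. 0 \<le> t \<longrightarrow> t \<le> T \<longrightarrow> cmod (A N t k) \<le> M k)" if T: "0 < T" for T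
 proof -
  obtain \<tau> where \<tau>: "0 < \<tau>" "\<And>N t k. 0 \<le> t \<Longrightarrow> t \<le> T \<Longrightarrow> cmod (A N t k) \<le> G * exp (- \<tau> * mode_norm k powr \<sigma>)"
   using decay[OF T] by blast
  have "(\<lambda>k. mode_norm k ^ n * (G * exp (- \<tau> * mode_norm k powr \<sigma>))) summable_on UNIV" for n
   using summable_on_cmult_right[OF gevrey_weight_summable[OF \<tau>(1) \<sigma>(1), of n], of G] by (simp add: mult.left_commute)
  from this[of 0] this[of 1] show ?thesis using \<tau> G
   by (intro exI[of _ "\<lambda>k. G * exp (- \<tau> * mode_norm k powr \<sigma>)"]) (auto simp: mult_le_cancel_left1)
 qed
 have cauchy: "\<exists>\<eta>. \<eta> \<longlonglongrightarrow> 0 \<and> (\<forall>M N t k. M \<le> N \<longrightarrow> 0 \<le> t \<longrightarrow> t \<le> T \<longrightarrow> cmod (A N t k - A M t k) \<le> \<eta> M)" if T: "0 < T" for T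
 proof -
  obtain m where m: "m summable_on UNIV" "(\<lambda>k. mode_norm k * m k) summable_on UNIV" "\<And>k. 0 \<le> m k" "\<And>k. m k \<le> G"
   "\<And>N t k. 0 \<le> t \<Longrightarrow> t \<le> T \<Longrightarrow> cmod (A N t k) \<le> m k"
   using majorant[OF T] by blast
  define A1 where "A1 = (\<Sum>\<^sub>\<infinity>l. mode_norm l * m l)"
  define f where "f = (\<lambda>M k. if k \<in> mode_box M \<or> k = 0 then 0 else m k)"
  define \<delta> where "\<delta> = (\<lambda>M. \<Sum>\<^sub>\<infinity>k. f M k)"
  have f0: "(\<lambda>M. f M k) \<longlonglongrightarrow> 0" for k
  proof (cases "k = 0")
   case False
   then obtain N0 where "\<And>N. N0 \<le> N \<Longrightarrow> k \<in> mode_box N" using eventually_mode_box by blast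
   then have "eventually (\<lambda>M. k \<in> mode_box M) sequentially" by (rule eventually_sequentiallyI[of N0])
   then have "eventually (\<lambda>M. f M k = 0) sequentially" by (rule eventually_mono) (simp add: f_def)
   then show ?thesis by (rule tendsto_eventually)
  qed (simp add: f_def)
  have f1: "0 \<le> f M k" "f M k \<le> m k" for M k using m(3) by (simp_all add: f_def)
  have \<delta>: "\<delta> \<longlonglongrightarrow> 0" and fs: "f M summable_on UNIV" for M
   unfolding \<delta>_def by (rule infsum_real_tendsto_zero[OF f0 f1 m(1)])+
  define K where "K = exp (2 * A1 * T) * (G + 2 * G * A1 * T)"
  have le: "cmod (A N t k - A M t k) \<le> sqrt (K * \<delta> M)" if MN: "M \<le> N" and t: "0 \<le> t" "t \<le> T" for M N t k
  proof (cases "k \<in> mode_box N")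
   case True
   have "(\<Sum>k\<in>mode_box N. (cmod (A N t k - A M t k))\<^sup>2) \<le> exp (2 * A1 * T) * (G + 2 * G * A1 * T) * \<delta> M"
   proof (rule galerkin_difference_bound[OF _ finite_mode_box mode_box_mono[OF MN] A A _ m(3,4) _ _ m(5) m(5) t])
    show "(\<Sum>l\<in>mode_box N. mode_norm l * m l) \<le> A1"
     unfolding A1_def by (rule finite_sum_le_infsum[OF m(2) finite_mode_box]) (use m(3) in auto)
    have "(\<Sum>k\<in>mode_box N - mode_box M. m k) = (\<Sum>k\<in>mode_box N - mode_box M. f M k)"
     by (rule sum.cong) (use zero_notin_mode_box in \<open>auto simp: f_def\<close>)
    also have "\<dots> \<le> \<delta> M"
     unfolding \<delta>_def by (rule finite_sum_le_infsum[OF fs]) (use f1 finite_mode_box in auto)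
    finally show "(\<Sum>k\<in>mode_box N - mode_box M. m k) \<le> \<delta> M" .
   qed (use \<nu> mode_box_mono[OF MN] in \<open>auto simp: restrict_modes_def\<close>)
   moreover have "(cmod (A N t k - A M t k))\<^sup>2 \<le> (\<Sum>k\<in>mode_box N. (cmod (A N t k - A M t k))\<^sup>2)"
    by (rule member_le_sum[OF True _ finite_mode_box]) simp
   ultimately have "(cmod (A N t k - A M t k))\<^sup>2 \<le> K * \<delta> M" by (simp add: K_def)
   then show ?thesis by (rule real_le_rsqrt)
  next
   case False
   then have "k \<notin> mode_box M" using mode_box_mono[OF MN] by blast
   have "A N t k = 0" "A M t k = 0" by (rule supp[OF t(1) False], rule supp[OF t(1) \<open>k \<notin> mode_box M\<close>])
   moreover have "0 \<le> K * \<delta> M" using G T f1 m(3)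
    by (auto simp: K_def \<delta>_def A1_def intro!: mult_nonneg_nonneg add_nonneg_nonneg infsum_nonneg)
   ultimately show ?thesis by simp
  qed
  have "(\<lambda>M. sqrt (K * \<delta> M)) \<longlonglongrightarrow> sqrt (K * 0)" by (intro tendsto_intros \<delta>)
  then show ?thesis using le by (intro exI[of _ "\<lambda>M. sqrt (K * \<delta> M)"]) auto
 qed
 define a where "a = (\<lambda>t k. lim (\<lambda>N. A N t k))"
 have lim: "(\<lambda>N. A N t k) \<longlonglongrightarrow> a t k" if t: "0 \<le> t" for t k
 proof -
  obtain \<eta> where \<eta>: "\<eta> \<longlonglongrightarrow> 0" "\<And>M N k. M \<le> N \<Longrightarrow> cmod (A N t k - A M t k) \<le> \<eta> M"
   using cauchy[of "t + 1"] t by force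
  have "Cauchy (\<lambda>N. A N t k)"
   unfolding Cauchy_altdef2
  proof (intro allI impI)
   fix e :: real assume "0 < e"
   then obtain M where "\<eta> M < e" using order_tendstoD(2)[OF \<eta>(1)] eventually_sequentially by (metis order_refl)
   then show "\<exists>M. \<forall>N\<ge>M. dist (A N t k) (A M t k) < e"
    using \<eta>(2)[of M _ k] by (auto simp: dist_norm intro!: exI[of _ M] intro: le_less_trans)
  qed
  then show ?thesis unfolding a_def by (simp add: Cauchy_convergent_iff convergent_LIMSEQ_iff)
 qed
 have conv: "\<exists>\<eta>. \<eta> \<longlonglongrightarrow> 0 \<and> (\<forall>N. \<forall>t\<in>{0..T}. \<forall>k. cmod (A N t k - a t k) \<le> \<eta> N)" if T: "0 < T" for T
 proof -
  obtain \<eta> where \<eta>: "\<eta> \<longlonglongrightarrow> 0" "\<And>M N t k. M \<le> N \<Longrightarrow> 0 \<le> t \<Longrightarrow> t \<le> T \<Longrightarrow> cmod (A N t k - A M t k) \<le> \<eta> M"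
   using cauchy[OF T] by blast
  have "cmod (A M t k - a t k) \<le> \<eta> M" if t: "t \<in> {0..T}" for M t k
  proof (rule tendsto_upperbound)
   show "(\<lambda>N. cmod (A M t k - A N t k)) \<longlonglongrightarrow> cmod (A M t k - a t k)" using t by (intro tendsto_intros lim) auto
   show "\<forall>\<^sub>F N in sequentially. cmod (A M t k - A N t k) \<le> \<eta> M"
    using \<eta>(2)[of M _ t k] t by (auto intro!: eventually_sequentiallyI[of M] simp: norm_minus_commute)
  qed simp
  then show ?thesis using \<eta>(1) by blast
 qed
 have init: "a 0 k = a0 k" for k
 proof (cases "k = 0")
  case True
  then show ?thesis using lim[of 0 0] by (simp add: A_init zero_notin_mode_box a00 LIMSEQ_const_iff)
 next
  case False
  then obtain N0 where "\<And>N. N0 \<le> N \<Longrightarrow> k \<in> mode_box N" using eventually_mode_box by blast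
  then have "(\<lambda>N. A N 0 k) \<longlonglongrightarrow> a0 k"
   by (intro tendsto_eventually eventually_sequentiallyI[of N0]) (simp add: A_init)
  then show ?thesis using LIMSEQ_unique lim by blast
 qed
 have a_herm: "hermitian (a t)" if t: "0 \<le> t" for t
  unfolding hermitian_def
 proof
  fix k
  have "(\<lambda>N. A N t (- k)) \<longlonglongrightarrow> cnj (a t k)" unfolding A_herm[OF t] by (intro tendsto_intros lim t)
  then show "a t (- k) = cnj (a t k)" by (rule LIMSEQ_unique[OF lim[OF t]])
 qed
 have a_zero: "a t 0 = 0" if t: "0 \<le> t" for t
  using lim[OF t, of 0] by (simp add: supp[OF t zero_notin_mode_box] LIMSEQ_const_iff)
 have a_le: "cmod (a t k) \<le> B" if t: "0 \<le> t" and "\<And>N. cmod (A N t k) \<le> B" for t k B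
  by (rule tendsto_upperbound[OF tendsto_norm[OF lim[OF t]]]) (use that in auto)
 have a_decay: "\<exists>\<tau>>0. \<forall>t\<in>{0..T}. \<forall>k. cmod (a t k) \<le> G * exp (- \<tau> * mode_norm k powr \<sigma>) \<and>
   (\<forall>N. cmod (A N t k) \<le> G * exp (- \<tau> * mode_norm k powr \<sigma>))" if T: "0 < T" for T
 proof -
  obtain \<tau> where \<tau>: "0 < \<tau>" "\<And>N t k. 0 \<le> t \<Longrightarrow> t \<le> T \<Longrightarrow> cmod (A N t k) \<le> G * exp (- \<tau> * mode_norm k powr \<sigma>)"
   using decay[OF T] by blast
  show ?thesis
  proof (intro exI[of _ \<tau>] conjI ballI allI \<tau>(1))
   fix t k assume t: "t \<in> {0..T}"
   show "cmod (a t k) \<le> G * exp (- \<tau> * mode_norm k powr \<sigma>)" by (rule a_le) (use \<tau>(2) t in auto)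
   fix N show "cmod (A N t k) \<le> G * exp (- \<tau> * mode_norm k powr \<sigma>)" using \<tau>(2) t by auto
  qed
 qed
 have ode: "((\<lambda>t. a t k) has_vector_derivative - transport_coeff \<nu> (a t) k) (at t within {0..})" if t: "0 \<le> t" for t k
 proof (cases "k = 0")
  case True
  have "((\<lambda>t. a t 0) has_vector_derivative 0) (at t within {0..})"
   by (rule has_vector_derivative_transform[where f = "\<lambda>_. 0"]) (use t a_zero in auto)
  then show ?thesis using True by (simp add: transport_coeff_zero)
 next
  case False
  define T where "T = t + 1"
  have T: "0 < T" "t < T" using t by (simp_all add: T_def)
  obtain m where m: "m summable_on UNIV" "(\<lambda>k. mode_norm k * m k) summable_on UNIV" "\<And>k. 0 \<le> m k"
   "\<And>N t k. 0 \<le> t \<Longrightarrow> t \<le> T \<Longrightarrow> cmod (A N t k) \<le> m k"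
   using majorant[OF T(1)] by blast
  have am: "cmod (a s k) \<le> m k" if "0 \<le> s" "s \<le> T" for s k by (rule a_le) (use m(4) that in auto)
  note B = transport_coeff_summable_bound[OF less_imp_le[OF \<nu>] m(1-3)]
  have Duhamel: "(\<lambda>s. transport_coeff \<nu> (a s) k) integrable_on {0..r} \<and>
    a r k = a0 k - integral {0..r} (\<lambda>s. transport_coeff \<nu> (a s) k)" if r: "0 \<le> r" "r \<le> T" and k: "k \<noteq> 0" for r k
  proof -
   obtain N0 where N0: "\<And>N. N0 \<le> N \<Longrightarrow> k \<in> mode_box N" using eventually_mode_box[OF k] by blast
   have I: "((\<lambda>s. transport_coeff \<nu> (A (n + N0) s) k) has_integral a0 k - A (n + N0) r k) {0..r}" for n
   proof -
    have "((\<lambda>s. - transport_coeff \<nu> (A (n + N0) s) k) has_integral A (n + N0) r k - A (n + N0) 0 k) {0..r}"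
    proof (rule fundamental_theorem_of_calculus[OF r(1)])
     fix s assume "s \<in> {0..r}"
     then show "((\<lambda>s. A (n + N0) s k) has_vector_derivative - transport_coeff \<nu> (A (n + N0) s) k) (at s within {0..r})"
      by (intro has_vector_derivative_within_subset[OF A_ode]) (auto intro: N0)
    qed
    from has_integral_neg[OF this] show ?thesis using N0[of "n + N0"] by (simp add: A_init)
   qed
   have int: "(\<lambda>s. transport_coeff \<nu> (A (n + N0) s) k) integrable_on {0..r}" for n
    using I by (rule has_integral_integrable)
   have const: "(\<lambda>_ :: real. \<Sum>\<^sub>\<infinity>l. m (k - l) * (mode_norm l * m l)) integrable_on {0..r}"
    by (intro integrable_continuous_real continuous_intros)
   have le: "norm (transport_coeff \<nu> (A (n + N0) s) k) \<le> (\<Sum>\<^sub>\<infinity>l. m (k - l) * (mode_norm l * m l))" if s: "s \<in> {0..r}" for n s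
    by (rule B(4)) (use s r m(4) in auto)
   have pointwise: "(\<lambda>n. transport_coeff \<nu> (A (n + N0) s) k) \<longlonglongrightarrow> transport_coeff \<nu> (a s) k" if s: "s \<in> {0..r}" for s
   proof -
    have "(\<lambda>N. transport_coeff \<nu> (A N s) k) \<longlonglongrightarrow> transport_coeff \<nu> (a s) k"
     unfolding transport_coeff_def
    proof (rule infsum_tendsto_dominated[OF _ _ B(1)])
     fix l show "(\<lambda>N. \<i> * of_real (drift \<nu> (k - l) l) * A N s (k - l) * A N s l) \<longlonglongrightarrow>
       \<i> * of_real (drift \<nu> (k - l) l) * a s (k - l) * a s l"
      using s by (intro tendsto_intros lim) auto
     fix N show "cmod (\<i> * of_real (drift \<nu> (k - l) l) * A N s (k - l) * A N s l) \<le> m (k - l) * (mode_norm l * m l)"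
      by (rule B(3)) (use s r m(4) in auto)
    qed
    then show ?thesis by (rule LIMSEQ_ignore_initial_segment)
   qed
   note dc = dominated_convergence[of "\<lambda>n s. transport_coeff \<nu> (A (n + N0) s) k" "{0..r}", OF int const le pointwise]
   have "(\<lambda>n. a0 k - A (n + N0) r k) \<longlonglongrightarrow> a0 k - a r k"
    by (intro tendsto_intros LIMSEQ_ignore_initial_segment lim r)
   then have "integral {0..r} (\<lambda>s. transport_coeff \<nu> (a s) k) = a0 k - a r k"
    using dc(2) LIMSEQ_unique by (simp add: integral_unique[OF I])
   then show ?thesis using dc(1) by simp
  qed
  have cont: "continuous_on {0..T} (\<lambda>s. a s k)" for k
  proof (cases "k = 0")
   case True
   show ?thesis by (rule continuous_on_eq[OF continuous_on_const[of _ 0]]) (use a_zero True in auto)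
  next
   case False
   have "continuous_on {0..T} (\<lambda>r. a0 k - integral {0..r} (\<lambda>s. transport_coeff \<nu> (a s) k))"
    by (intro continuous_intros indefinite_integral_continuous_1) (use Duhamel[of T, OF _ _ False] T in auto)
   then show ?thesis by (rule continuous_on_eq) (use Duhamel[OF _ _ False] in auto)
  qed
  have ct: "continuous_on {0..T} (\<lambda>s. transport_coeff \<nu> (a s) k)"
   unfolding transport_coeff_def
  proof (rule continuous_on_infsum[OF _ _ B(1)])
   fix l show "continuous_on {0..T} (\<lambda>s. \<i> * of_real (drift \<nu> (k - l) l) * a s (k - l) * a s l)"
    by (intro continuous_intros cont)
   fix s assume "s \<in> {0..T}"
   then show "cmod (\<i> * of_real (drift \<nu> (k - l) l) * a s (k - l) * a s l) \<le> m (k - l) * (mode_norm l * m l)"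
    by (intro B(3)) (use am in auto)
  qed
  have tT: "t \<in> {0..T}" using t T by simp
  have "((\<lambda>r. a r k) has_vector_derivative 0 - transport_coeff \<nu> (a t) k) (at t within {0..T})"
  proof (rule has_vector_derivative_transform[OF tT])
   show "((\<lambda>r. a0 k - integral {0..r} (\<lambda>s. transport_coeff \<nu> (a s) k)) has_vector_derivative 0 - transport_coeff \<nu> (a t) k) (at t within {0..T})"
    by (rule has_vector_derivative_diff[OF has_vector_derivative_const integral_has_vector_derivative[OF ct tT]])
   fix r assume "r \<in> {0..T}"
   then have "0 \<le> r" "r \<le> T" by simp_all
   from Duhamel[OF this False] show "a r k = a0 k - integral {0..r} (\<lambda>s. transport_coeff \<nu> (a s) k)" by (rule conjunct2)
  qed
  then have "((\<lambda>r. a r k) has_vector_derivative - transport_coeff \<nu> (a t) k) (at t within {0..T})" by (simp only: diff_0)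
  then show ?thesis by (simp only: at_within_atLeastAtMost_eq[OF t T(2)])
 qed
 show ?thesis
 proof (rule exI[of _ A], rule exI[of _ a], intro conjI allI impI)
  show "a 0 = a0" using init by (rule ext)
 qed (rule A a_decay conv ode a_herm a_zero; assumption)+
qed

section \<open>Gevrey norms and classical solutions\<close>

lemma gevrey_term_eq:
 assumes "k \<noteq> 0"
 shows "gevrey_term 0 s \<tau> f k = (exp (\<tau> * mode_norm k powr (1 / s)) * cmod (fourier_coeff f k))\<^sup>2"
 using assms by (simp add: gevrey_term_def power_mult_distrib exp_double[symmetric] mult.assoc)

lemma lattice_star_iff: "k \<in> lattice_star \<longleftrightarrow> k \<noteq> 0"
 by (auto simp: lattice_star_def zero_prod_def)

lemma gevrey_term_nonneg: "0 \<le> gevrey_term r s \<tau> f k"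
 by (simp add: gevrey_term_def)

lemma L2_set_le_gevrey_norm:
 assumes "gevrey_domain 0 s \<tau> f" "fourier_coeff f 0 = 0" "finite F"
 shows "L2_set (\<lambda>k. exp (\<tau> * mode_norm k powr (1 / s)) * cmod (fourier_coeff f k)) F \<le> gevrey_norm 0 s \<tau> f"
proof -
 have "(\<Sum>k\<in>F. (exp (\<tau> * mode_norm k powr (1 / s)) * cmod (fourier_coeff f k))\<^sup>2) =
   (\<Sum>k\<in>F - {0}. (exp (\<tau> * mode_norm k powr (1 / s)) * cmod (fourier_coeff f k))\<^sup>2)"
  by (rule sum.mono_neutral_right) (use assms in auto)
 also have "\<dots> = (\<Sum>k\<in>F - {0}. gevrey_term 0 s \<tau> f k)"
  by (rule sum.cong) (simp_all add: gevrey_term_eq)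
 also have "\<dots> \<le> (\<Sum>\<^sub>\<infinity>k\<in>lattice_star. gevrey_term 0 s \<tau> f k)"
  by (rule finite_sum_le_infsum) (use assms gevrey_term_nonneg in \<open>auto simp: gevrey_domain_def lattice_star_iff\<close>)
 finally show ?thesis by (simp add: L2_set_def gevrey_norm_def)
qed

lemma gevrey_domain_if_bounded:
 assumes "\<And>F. finite F \<Longrightarrow> L2_set (\<lambda>k. exp (\<tau> * mode_norm k powr (1 / s)) * cmod (fourier_coeff f k)) F \<le> G"
 shows "gevrey_domain 0 s \<tau> f"
 unfolding gevrey_domain_def
proof (rule nonneg_bdd_above_summable_on)
 show "bdd_above (sum (gevrey_term 0 s \<tau> f) ` {F. F \<subseteq> lattice_star \<and> finite F})"
 proof (rule bdd_aboveI2)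
  fix F :: "(int \<times> int) set" assume F: "F \<in> {F. F \<subseteq> lattice_star \<and> finite F}"
  have "sum (gevrey_term 0 s \<tau> f) F = (\<Sum>k\<in>F. (exp (\<tau> * mode_norm k powr (1 / s)) * cmod (fourier_coeff f k))\<^sup>2)"
   by (rule sum.cong) (use F in \<open>auto simp: gevrey_term_eq lattice_star_iff\<close>)
  also have "\<dots> = (L2_set (\<lambda>k. exp (\<tau> * mode_norm k powr (1 / s)) * cmod (fourier_coeff f k)) F)\<^sup>2"
   by (rule L2_set_sq[symmetric])
  also have "\<dots> \<le> G\<^sup>2" by (rule power_mono[OF assms L2_set_nonneg]) (use F in auto)
  finally show "sum (gevrey_term 0 s \<tau> f) F \<le> G\<^sup>2" .
 qed
qed (rule gevrey_term_nonneg)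

text \<open>Half of the exponential decay pays for square summability.\<close>

lemma gevrey_radius_if_decay:
 assumes \<tau>: "0 < \<tau>" and s: "0 < s" and dec: "\<And>k. cmod (fourier_coeff f k) \<le> G * exp (- \<tau> * mode_norm k powr (1 / s))"
 shows "has_gevrey_radius s (\<tau> / 2) f"
proof -
 define W where "W = (\<Sum>\<^sub>\<infinity>k. exp (- \<tau> * mode_norm k powr (1 / s)))"
 have sW: "(\<lambda>k. exp (- \<tau> * mode_norm k powr (1 / s))) summable_on UNIV"
  using gevrey_weight_summable[OF \<tau>, of "1 / s" 0] s by simp
 have "gevrey_domain 0 s (\<tau> / 2) f"
 proof (rule gevrey_domain_if_bounded)
  fix F :: "(int \<times> int) set" assume F: "finite F"
  have "(\<Sum>k\<in>F. (exp (\<tau> / 2 * mode_norm k powr (1 / s)) * cmod (fourier_coeff f k))\<^sup>2) \<le>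
    (\<Sum>k\<in>F. G\<^sup>2 * exp (- \<tau> * mode_norm k powr (1 / s)))"
  proof (rule sum_mono)
   fix k
   define y where "y = mode_norm k powr (1 / s)"
   have "exp (\<tau> / 2 * y) * cmod (fourier_coeff f k) \<le> exp (\<tau> / 2 * y) * (G * exp (- \<tau> * y))"
    using dec[of k] by (intro mult_left_mono) (simp_all add: y_def)
   also have "\<dots> = G * exp (- \<tau> / 2 * y)" by (simp add: exp_add[symmetric] mult.left_commute field_simps)
   finally have "(exp (\<tau> / 2 * y) * cmod (fourier_coeff f k))\<^sup>2 \<le> (G * exp (- \<tau> / 2 * y))\<^sup>2"
    by (rule power_mono) simp
   also have "\<dots> = G\<^sup>2 * exp (- \<tau> * y)" by (simp add: power_mult_distrib exp_double[symmetric])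
   finally show "(exp (\<tau> / 2 * mode_norm k powr (1 / s)) * cmod (fourier_coeff f k))\<^sup>2 \<le> G\<^sup>2 * exp (- \<tau> * mode_norm k powr (1 / s))"
    by (simp add: y_def)
  qed
  also have "\<dots> \<le> G\<^sup>2 * W"
   unfolding sum_distrib_left[symmetric] W_def
   by (intro mult_left_mono finite_sum_le_infsum sW F) auto
  finally show "L2_set (\<lambda>k. exp (\<tau> / 2 * mode_norm k powr (1 / s)) * cmod (fourier_coeff f k)) F \<le> sqrt (G\<^sup>2 * W)"
   by (simp add: L2_set_def)
 qed
 then show ?thesis using \<tau> by (simp add: has_gevrey_radius_def)
qed

lemma gevrey_velocity_regular:
 assumes "0 \<le> \<nu>" "1 \<le> s" "gevrey_class s f"
 shows "torus_fun (ipmb_velocity1 \<nu> f)" "torus_fun (ipmb_velocity2 \<nu> f)"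
  and "\<exists>u1x. continuous_on UNIV u1x \<and> (\<forall>x y. ((\<lambda>x. ipmb_velocity1 \<nu> f (x, y)) has_real_derivative u1x (x, y)) (at x)) \<and>
   (\<forall>x y. ((\<lambda>y. ipmb_velocity2 \<nu> f (x, y)) has_real_derivative - u1x (x, y)) (at y))"
proof -
 have v: "ipmb_velocity1 \<nu> f = (\<lambda>x. Re (fseries (\<lambda>k. of_real (ipmb_symbol1 \<nu> k) * fourier_coeff f k) x))"
  "ipmb_velocity2 \<nu> f = (\<lambda>x. Re (fseries (\<lambda>k. of_real (ipmb_symbol2 \<nu> k) * fourier_coeff f k) x))"
  using ipmb_velocity_eq_fseries[OF refl] by blast+
 have s: "(\<lambda>k. cmod (fourier_coeff f k)) summable_on UNIV" "(\<lambda>k. mode_norm k * cmod (fourier_coeff f k)) summable_on UNIV"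
  using gevrey_class_moments[OF assms(3,2), of 0] gevrey_class_moments[OF assms(3,2), of 1] by simp_all
 show "torus_fun (ipmb_velocity1 \<nu> f)" "torus_fun (ipmb_velocity2 \<nu> f)"
  "\<exists>u1x. continuous_on UNIV u1x \<and> (\<forall>x y. ((\<lambda>x. ipmb_velocity1 \<nu> f (x, y)) has_real_derivative u1x (x, y)) (at x)) \<and>
   (\<forall>x y. ((\<lambda>y. ipmb_velocity2 \<nu> f (x, y)) has_real_derivative - u1x (x, y)) (at y))"
  unfolding v by (rule velocity_divergence_free[OF assms(1) s])+
qed

lemma continuous_on_time_slice:
 assumes "continuous_on ({0..} \<times> UNIV) (\<lambda>(t, z). f t z)" "0 \<le> (t :: real)"
 shows "continuous_on UNIV (f t)"
proof -
 have "continuous_on UNIV (\<lambda>z. case (t, z) of (t, z) \<Rightarrow> f t z)"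
  by (rule continuous_on_compose2[OF assms(1)]) (use assms(2) in \<open>auto intro!: continuous_intros\<close>)
 then show ?thesis by simp
qed

text \<open>Being transported by a divergence-free field, the solution stays between the extreme values of
 its initial datum.\<close>

lemma gevrey_solution_sup_bound:
 assumes \<nu>: "0 \<le> \<nu>" and s: "1 \<le> s" and sol: "gevrey_ipmb_solution s \<nu> \<theta>0 \<theta>" and S: "\<And>z. \<bar>\<theta>0 z\<bar> \<le> S" and t: "0 \<le> t"
 shows "\<bar>\<theta> t z\<bar> \<le> S"
proof -
 have ip: "ipmb_solution \<nu> \<theta>0 \<theta>" and gc: "\<And>t. 0 \<le> t \<Longrightarrow> gevrey_class s (\<theta> t)"
  using sol by (auto simp: gevrey_ipmb_solution_def)
 have init: "\<theta> 0 = \<theta>0" and tor: "\<And>t. 0 \<le> t \<Longrightarrow> torus_fun (\<theta> t)"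
  using ip by (auto simp: ipmb_solution_def)
 obtain \<theta>t \<theta>x \<theta>y where c: "continuous_on ({0..} \<times> UNIV) (\<lambda>(t, z). \<theta>t t z)"
   "continuous_on ({0..} \<times> UNIV) (\<lambda>(t, z). \<theta>x t z)" "continuous_on ({0..} \<times> UNIV) (\<lambda>(t, z). \<theta>y t z)"
  and d: "\<forall>t\<ge>0. \<forall>x y.
      ((\<lambda>t'. \<theta> t' (x, y)) has_real_derivative \<theta>t t (x, y)) (at t within {0..}) \<and>
      ((\<lambda>x'. \<theta> t (x', y)) has_real_derivative \<theta>x t (x, y)) (at x) \<and>
      ((\<lambda>y'. \<theta> t (x, y')) has_real_derivative \<theta>y t (x, y)) (at y) \<and>
      \<theta>t t (x, y) + (ipmb_velocity1 \<nu> (\<theta> t) (x, y) * \<theta>x t (x, y)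
            + ipmb_velocity2 \<nu> (\<theta> t) (x, y) * \<theta>y t (x, y)) = 0"
  using ip unfolding ipmb_solution_def by (elim conjE exE)
 have dt: "((\<lambda>t. \<theta> t z) has_real_derivative \<theta>t t z) (at t within {0..})" if "0 \<le> t" for t z
  using d that by (cases z) simp
 have dx: "((\<lambda>x. \<theta> t (x, y)) has_real_derivative \<theta>x t (x, y)) (at x)" if "0 \<le> t" for t x y using d that by simp
 have dy: "((\<lambda>y. \<theta> t (x, y)) has_real_derivative \<theta>y t (x, y)) (at y)" if "0 \<le> t" for t x y using d that by simp
 have pde: "\<theta>t t z = - (ipmb_velocity1 \<nu> (\<theta> t) z * \<theta>x t z + ipmb_velocity2 \<nu> (\<theta> t) z * \<theta>y t z)" if "0 \<le> t" for t z
 proof -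
  have "\<theta>t t (fst z, snd z) + (ipmb_velocity1 \<nu> (\<theta> t) (fst z, snd z) * \<theta>x t (fst z, snd z)
    + ipmb_velocity2 \<nu> (\<theta> t) (fst z, snd z) * \<theta>y t (fst z, snd z)) = 0" using d that by blast
  then show ?thesis unfolding prod.collapse by linarith
 qed
 have "\<theta> t z \<le> S"
  by (rule transport_le_initial[where \<phi> = \<theta> and \<phi>t = \<theta>t and \<phi>x = \<theta>x and \<phi>y = \<theta>y,
     OF c(1) continuous_on_time_slice[OF c(2)] continuous_on_time_slice[OF c(3)] tor dt dx dy
     gevrey_velocity_regular[OF \<nu> s gc] pde _ t])
   (use S abs_le_D1 in \<open>auto simp: init\<close>)
 moreover have "- \<theta> t z \<le> S"
 proof (rule transport_le_initial[where \<phi> = "\<lambda>t z. - \<theta> t z" and \<phi>t = "\<lambda>t z. - \<theta>t t z" and \<phi>x = "\<lambda>t z. - \<theta>x t z" and \<phi>y = "\<lambda>t z. - \<theta>y t z",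
     OF _ _ _ _ _ _ _ gevrey_velocity_regular[OF \<nu> s gc] _ _ t])
  show "continuous_on ({0..} \<times> UNIV) (\<lambda>(t, z). - \<theta>t t z)"
   using continuous_on_minus[OF c(1)] by (simp add: case_prod_unfold)
  show "- \<theta>t t z = - (ipmb_velocity1 \<nu> (\<theta> t) z * - \<theta>x t z + ipmb_velocity2 \<nu> (\<theta> t) z * - \<theta>y t z)" if "0 \<le> t" for t z
   using pde[OF that, of z] by simp
  show "- \<theta> 0 z \<le> S" for z using S[of z] by (simp add: init abs_le_iff)
  show "torus_fun (\<lambda>z. - \<theta> t z)" if "0 \<le> t" for t
   using tor[OF that] by (auto simp: torus_fun_def intro!: continuous_intros)
 qed (use continuous_on_time_slice[OF c(2)] continuous_on_time_slice[OF c(3)] dt dx dy in \<open>auto intro!: continuous_on_minus DERIV_minus\<close>)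
 ultimately show ?thesis by linarith
qed

section \<open>The radius of analyticity\<close>

text \<open>Once the solution is known to be bounded, its strain is bounded by the supremum of the initial
 datum, uniformly in time, so the Galerkin estimate may be run again with a fixed decay rate.\<close>

lemma galerkin_limit_gevrey_bound:
 assumes \<nu>: "0 < \<nu>" and \<sigma>: "0 < \<sigma>" "\<sigma> \<le> 1" and \<tau>0: "0 < \<tau>0" and G: "0 < G"
  and GF: "\<And>F. finite F \<Longrightarrow> L2_set (\<lambda>k. exp (\<tau>0 * mode_norm k powr \<sigma>) * cmod (a0 k)) F \<le> G"
  and A: "\<And>N. galerkin_solution \<nu> (mode_box N) (restrict_modes (mode_box N) a0) (A N)"
  and T: "0 < T" and m: "m summable_on UNIV" "\<And>t k. t \<in> {0..T} \<Longrightarrow> cmod (a t k) \<le> m k" "\<And>N t k. t \<in> {0..T} \<Longrightarrow> cmod (A N t k) \<le> m k"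
  and conv: "\<eta> \<longlonglongrightarrow> 0" "\<And>N t k. t \<in> {0..T} \<Longrightarrow> cmod (A N t k - a t k) \<le> \<eta> N"
  and S: "\<And>t x. t \<in> {0..T} \<Longrightarrow> cmod (fseries (a t) x) \<le> S"
  and R: "4 * (768 * strip_const / \<nu> * S + 1 / \<nu> * G) + trilinear_const \<sigma> / \<nu> * (2 * G) \<le> R"
  and t: "t \<in> {0..T}" and F: "finite F"
 shows "L2_set (\<lambda>k. exp (\<tau>0 * exp (- R * t) * mode_norm k powr \<sigma>) * cmod (a t k)) F \<le> G"
proof -
 have m0: "0 \<le> m k" for k using order_trans[OF norm_ge_zero m(2)[OF t]] .
 \<comment> \<open>Summable in \<open>k\<close> by the first entry, small for large \<open>N\<close> by the second.\<close>
 define f where "f = (\<lambda>N k. min (2 * m k) \<bar>\<eta> N\<bar>)"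
 have f: "(\<lambda>N. f N k) \<longlonglongrightarrow> 0" "0 \<le> f N k" "f N k \<le> 2 * m k" for N k
 proof -
  have "(\<lambda>N. min (2 * m k) \<bar>\<eta> N\<bar>) \<longlonglongrightarrow> min (2 * m k) \<bar>0\<bar>" by (intro tendsto_intros conv)
  then show "(\<lambda>N. f N k) \<longlonglongrightarrow> 0" using m0[of k] by (simp add: f_def)
 qed (use m0[of k] in \<open>simp_all add: f_def\<close>)
 have fs: "(\<lambda>N. \<Sum>\<^sub>\<infinity>k. f N k) \<longlonglongrightarrow> 0" "\<And>N. f N summable_on UNIV"
  by (rule infsum_real_tendsto_zero[OF f summable_on_cmult_right[OF m(1)]])+
 have "eventually (\<lambda>N. (\<Sum>\<^sub>\<infinity>k. f N k) < G) sequentially" by (rule order_tendstoD(2)[OF fs(1) G])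
 then obtain N0 where N0: "\<And>N. N0 \<le> N \<Longrightarrow> (\<Sum>\<^sub>\<infinity>k. f N k) < G" unfolding eventually_sequentially by blast
 have diff: "cmod (A N u k - a u k) \<le> f N k" if u: "u \<in> {0..T}" for N u k
 proof -
  have "cmod (A N u k - a u k) \<le> cmod (A N u k) + cmod (a u k)" by (rule norm_triangle_ineq4)
  then have "cmod (A N u k - a u k) \<le> 2 * m k" using m(2)[OF u, of k] m(3)[OF u, of N k] by linarith
  moreover have "cmod (A N u k - a u k) \<le> \<bar>\<eta> N\<bar>" using conv(2)[OF u, of N k] by linarith
  ultimately show ?thesis by (simp add: f_def)
 qed
 have mode_le: "x / mode_norm j \<le> x" if "0 \<le> x" for x j
 proof (cases "j = 0")
  case False
  have "x / mode_norm j \<le> x / 1" by (rule divide_left_mono) (use mode_norm_ge_1[OF False] that in auto)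
  then show ?thesis by simp
 qed (use that in simp)
 have strain_le: "cmod (strain \<nu> i n b j) \<le> 1 / \<nu> * cmod (b j)" for i n b j
 proof -
  have "1 / \<nu> * (cmod (b j) / mode_norm j) \<le> 1 / \<nu> * cmod (b j)"
   by (rule mult_left_mono[OF mode_le]) (use \<nu> in auto)
  then show ?thesis using cmod_strain_le[OF \<nu>, of i n b j] by linarith
 qed
 have bound: "L2_set (\<lambda>k. exp (\<tau>0 * exp (- R * t) * mode_norm k powr \<sigma>) * cmod (A N t k)) (mode_box N) \<le> G" if N: "N0 \<le> N" for N
 proof (rule galerkin_gevrey_bound[OF \<nu> \<sigma> \<tau>0 finite_mode_box zero_notin_mode_box A G, where T = T])
  have "L2_set (\<lambda>k. exp (\<tau>0 * mode_norm k powr \<sigma>) * cmod (restrict_modes (mode_box N) a0 k)) (mode_box N)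
    = L2_set (\<lambda>k. exp (\<tau>0 * mode_norm k powr \<sigma>) * cmod (a0 k)) (mode_box N)"
   by (rule L2_set_cong) (simp_all add: restrict_modes_def)
  then show "L2_set (\<lambda>k. exp (\<tau>0 * mode_norm k powr \<sigma>) * cmod (restrict_modes (mode_box N) a0 k)) (mode_box N) \<le> G"
   using GF[OF finite_mode_box] by (simp only:)
  show "4 * (768 * strip_const / \<nu> * S + 1 / \<nu> * G) + trilinear_const \<sigma> / \<nu> * (2 * G) \<le> R" by (rule R)
  fix u i n assume "0 \<le> u" "u \<le> T"
  then have u: "u \<in> {0..T}" by simp
  have as: "(\<lambda>k. cmod (a u k)) summable_on UNIV" by (rule abs_summable_le[OF m(1) m(2)[OF u]])
  have "form_bound (mode_box N) (strain \<nu> i n (a u)) (768 * strip_const / \<nu> * S)"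
  proof (rule form_bound_sup[OF finite_mode_box])
   show "(\<lambda>k. cmod (strain \<nu> i n (a u) k)) summable_on UNIV"
    by (rule abs_summable_le[OF summable_on_cmult_right[OF as, of "1 / \<nu>"] strain_le[of i n "a u"]])
   show "cmod (fseries (strain \<nu> i n (a u)) x) \<le> 768 * strip_const / \<nu> * S" for x
    by (rule fseries_strain_le[OF \<nu> as S[OF u]])
  qed
  moreover have "form_bound (mode_box N) (strain \<nu> i n (\<lambda>k. A N u k - a u k)) (1 / \<nu> * G)"
  proof (rule sum_cmod_form_bound[OF finite_mode_box])
   fix X :: "(int \<times> int) set" assume X: "finite X"
   have "(\<Sum>j\<in>X. cmod (strain \<nu> i n (\<lambda>k. A N u k - a u k) j)) \<le> (\<Sum>j\<in>X. 1 / \<nu> * f N j)"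
   proof (rule sum_mono)
    fix j
    have "1 / \<nu> * cmod (A N u j - a u j) \<le> 1 / \<nu> * f N j" using \<nu> by (intro mult_left_mono diff[OF u]) auto
    then show "cmod (strain \<nu> i n (\<lambda>k. A N u k - a u k) j) \<le> 1 / \<nu> * f N j"
     using strain_le[of i n "\<lambda>k. A N u k - a u k" j] by linarith
   qed
   also have "\<dots> = 1 / \<nu> * (\<Sum>j\<in>X. f N j)" by (rule sum_distrib_left[symmetric])
   also have "\<dots> \<le> 1 / \<nu> * G"
   proof (rule mult_left_mono)
    have "(\<Sum>j\<in>X. f N j) \<le> (\<Sum>\<^sub>\<infinity>k. f N k)" by (rule finite_sum_le_infsum[OF fs(2) X]) (use f(2) in auto)
    then show "(\<Sum>j\<in>X. f N j) \<le> G" using N0[OF N] by linarith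
   qed (use \<nu> in simp)
   finally show "(\<Sum>j\<in>X. cmod (strain \<nu> i n (\<lambda>k. A N u k - a u k) j)) \<le> 1 / \<nu> * G" .
  qed
  ultimately have "form_bound (mode_box N) (\<lambda>j. strain \<nu> i n (a u) j + strain \<nu> i n (\<lambda>k. A N u k - a u k) j)
    (768 * strip_const / \<nu> * S + 1 / \<nu> * G)" by (rule form_bound_add)
  moreover have "(\<lambda>j. strain \<nu> i n (a u) j + strain \<nu> i n (\<lambda>k. A N u k - a u k) j) = strain \<nu> i n (A N u)"
   by (rule ext) (simp add: strain_def algebra_simps)
  ultimately show "form_bound (mode_box N) (strain \<nu> i n (A N u)) (768 * strip_const / \<nu> * S + 1 / \<nu> * G)" by (simp only:)
 qed (use t in auto)
 have "L2_set (\<lambda>k. exp (\<tau>0 * exp (- R * t) * mode_norm k powr \<sigma>) * cmod (A N t k)) F \<le> G" if N: "N0 \<le> N" for N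
 proof -
  have supp: "A N t k = 0" if "k \<notin> mode_box N" for k using galerkin_solution_support[OF A _ that] t by auto
  have "(\<Sum>k\<in>F. (exp (\<tau>0 * exp (- R * t) * mode_norm k powr \<sigma>) * cmod (A N t k))\<^sup>2) =
    (\<Sum>k\<in>F \<inter> mode_box N. (exp (\<tau>0 * exp (- R * t) * mode_norm k powr \<sigma>) * cmod (A N t k))\<^sup>2)"
   by (rule sum.mono_neutral_right) (use F in \<open>auto intro!: supp\<close>)
  also have "\<dots> \<le> (\<Sum>k\<in>mode_box N. (exp (\<tau>0 * exp (- R * t) * mode_norm k powr \<sigma>) * cmod (A N t k))\<^sup>2)"
   by (rule sum_mono2[OF finite_mode_box]) auto
  finally have "L2_set (\<lambda>k. exp (\<tau>0 * exp (- R * t) * mode_norm k powr \<sigma>) * cmod (A N t k)) F \<le>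
    L2_set (\<lambda>k. exp (\<tau>0 * exp (- R * t) * mode_norm k powr \<sigma>) * cmod (A N t k)) (mode_box N)"
   unfolding L2_set_def by (rule real_sqrt_le_mono)
  then show ?thesis using bound[OF N] by linarith
 qed
 then have ev: "eventually (\<lambda>N. L2_set (\<lambda>k. exp (\<tau>0 * exp (- R * t) * mode_norm k powr \<sigma>) * cmod (A N t k)) F \<le> G) sequentially"
  by (rule eventually_sequentiallyI)
 have lim: "(\<lambda>N. A N t k) \<longlonglongrightarrow> a t k" for k
 proof (rule LIM_zero_cancel, rule Lim_null_comparison[OF _ conv(1)])
  show "\<forall>\<^sub>F N in sequentially. norm (A N t k - a t k) \<le> \<eta> N" using conv(2)[OF t] by (intro always_eventually) auto
 qed
 have "(\<lambda>N. L2_set (\<lambda>k. exp (\<tau>0 * exp (- R * t) * mode_norm k powr \<sigma>) * cmod (A N t k)) F) \<longlonglongrightarrow>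
   L2_set (\<lambda>k. exp (\<tau>0 * exp (- R * t) * mode_norm k powr \<sigma>) * cmod (a t k)) F"
  unfolding L2_set_def by (intro tendsto_intros lim)
 from tendsto_upperbound[OF this ev] show ?thesis by simp
qed

text \<open>Cauchy-Schwarz against the weight. This is where the supremum of the initial datum is bounded by its
 Gevrey norm.\<close>

lemma coefficient_sum_le_gevrey_norm:
 assumes \<tau>: "0 < \<tau>" and \<sigma>: "0 < \<sigma>" and GF: "\<And>F. finite F \<Longrightarrow> L2_set (\<lambda>k. exp (\<tau> * mode_norm k powr \<sigma>) * cmod (c k)) F \<le> G"
 shows "(\<lambda>k. cmod (c k)) summable_on UNIV"
  and "(\<Sum>\<^sub>\<infinity>k. cmod (c k)) \<le> sqrt (\<Sum>\<^sub>\<infinity>k. exp (- (2 * \<tau>) * mode_norm k powr \<sigma>)) * G"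
proof -
 let ?W = "\<Sum>\<^sub>\<infinity>k. exp (- (2 * \<tau>) * mode_norm k powr \<sigma>)"
 have sW: "(\<lambda>k. exp (- (2 * \<tau>) * mode_norm k powr \<sigma>)) summable_on UNIV"
  using gevrey_weight_summable[of "2 * \<tau>" \<sigma> 0] \<tau> \<sigma> by simp
 have le: "(\<Sum>k\<in>F. cmod (c k)) \<le> sqrt ?W * G" if F: "finite F" for F
 proof -
  have "(\<Sum>k\<in>F. cmod (c k)) = (\<Sum>k\<in>F. \<bar>exp (- \<tau> * mode_norm k powr \<sigma>)\<bar> * \<bar>exp (\<tau> * mode_norm k powr \<sigma>) * cmod (c k)\<bar>)"
   by (rule sum.cong) (simp_all add: abs_mult mult.assoc[symmetric] exp_add[symmetric])
  also have "\<dots> \<le> L2_set (\<lambda>k. exp (- \<tau> * mode_norm k powr \<sigma>)) F * L2_set (\<lambda>k. exp (\<tau> * mode_norm k powr \<sigma>) * cmod (c k)) F"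
   by (rule L2_set_mult_ineq)
  also have "\<dots> \<le> sqrt ?W * G"
  proof (rule mult_mono[OF _ GF[OF F]])
   have "(\<Sum>k\<in>F. (exp (- \<tau> * mode_norm k powr \<sigma>))\<^sup>2) = (\<Sum>k\<in>F. exp (- (2 * \<tau>) * mode_norm k powr \<sigma>))"
    by (rule sum.cong) (simp_all add: exp_double[symmetric] mult.assoc)
   also have "\<dots> \<le> ?W" by (rule finite_sum_le_infsum[OF sW F]) auto
   finally show "L2_set (\<lambda>k. exp (- \<tau> * mode_norm k powr \<sigma>)) F \<le> sqrt ?W" by (simp add: L2_set_def)
  qed (auto intro: infsum_nonneg)
  finally show ?thesis .
 qed
 show "(\<lambda>k. cmod (c k)) summable_on UNIV" "(\<Sum>\<^sub>\<infinity>k. cmod (c k)) \<le> sqrt ?W * G"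
  by (rule bounded_sums_summable_on[OF norm_ge_zero le]; assumption)+
qed

section \<open>Uniqueness\<close>

lemma symbol_square_summable:
 assumes \<nu>: "0 < \<nu>"
 shows "(\<lambda>k. (ipmb_symbol1 \<nu> k)\<^sup>2 + (ipmb_symbol2 \<nu> k)\<^sup>2) summable_on UNIV"
proof (rule Infinite_Sum.summable_on_comparison_test)
 show "(\<lambda>k. (1 / \<nu>\<^sup>2) * mode_norm k powr (- 2 - 2)) summable_on UNIV"
  by (intro summable_on_cmult_right mode_norm_powr_summable) simp
 fix k
 show "(ipmb_symbol1 \<nu> k)\<^sup>2 + (ipmb_symbol2 \<nu> k)\<^sup>2 \<le> (1 / \<nu>\<^sup>2) * mode_norm k powr (- 2 - 2)"
 proof (cases "k = 0")
  case False
  have r: "0 < mode_norm k" by (rule mode_norm_pos[OF False])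
  have "1 / (1 + \<nu> * (mode_norm k)\<^sup>2) \<le> 1 / (\<nu> * (mode_norm k)\<^sup>2)"
   by (rule frac_le) (use \<nu> False in auto)
  then have "(1 / (1 + \<nu> * (mode_norm k)\<^sup>2))\<^sup>2 \<le> (1 / (\<nu> * (mode_norm k)\<^sup>2))\<^sup>2"
   by (rule power_mono) (use \<nu> in simp)
  also have "\<dots> = (1 / \<nu>\<^sup>2) * (1 / mode_norm k ^ 4)"
   by (simp add: power_divide power_mult_distrib)
  also have "1 / mode_norm k ^ 4 = mode_norm k powr (- 2 - 2)"
   using r powr_realpow[of "mode_norm k" 4] by (simp add: powr_minus field_simps)
  finally show ?thesis using symbol_sq_sum_le[of \<nu> k] \<nu> by linarith
 qed simp
qed simp

text \<open>The velocity gains two derivatives, which in two dimensions suffices to bound it pointwise by the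
 mean square of the scalar.\<close>

lemma velocity_le_L2:
 assumes \<nu>: "0 < \<nu>"
 shows "\<exists>C\<ge>0. \<forall>f g x. torus_fun f \<longrightarrow> torus_fun g \<longrightarrow>
  (\<lambda>k. cmod (fourier_coeff f k)) summable_on UNIV \<longrightarrow> (\<lambda>k. cmod (fourier_coeff g k)) summable_on UNIV \<longrightarrow>
  \<bar>ipmb_velocity1 \<nu> f x - ipmb_velocity1 \<nu> g x\<bar> \<le> C * sqrt (integral torus_cell (\<lambda>x. (f x - g x)\<^sup>2)) \<and>
  \<bar>ipmb_velocity2 \<nu> f x - ipmb_velocity2 \<nu> g x\<bar> \<le> C * sqrt (integral torus_cell (\<lambda>x. (f x - g x)\<^sup>2))"
proof -
 define V where "V = (\<Sum>\<^sub>\<infinity>k. (ipmb_symbol1 \<nu> k)\<^sup>2 + (ipmb_symbol2 \<nu> k)\<^sup>2)"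
 define C where "C = sqrt V * sqrt (1 / (2 * pi)\<^sup>2)"
 have V0: "0 \<le> V" unfolding V_def by (intro infsum_nonneg) simp
 have main: "\<bar>Re (fseries (\<lambda>k. of_real (s k) * fourier_coeff f k) x) - Re (fseries (\<lambda>k. of_real (s k) * fourier_coeff g k) x)\<bar>
   \<le> C * sqrt (integral torus_cell (\<lambda>x. (f x - g x)\<^sup>2))"
  if f: "torus_fun f" "(\<lambda>k. cmod (fourier_coeff f k)) summable_on UNIV" and g: "torus_fun g" "(\<lambda>k. cmod (fourier_coeff g k)) summable_on UNIV"
   and s: "\<And>k. (s k)\<^sup>2 \<le> (ipmb_symbol1 \<nu> k)\<^sup>2 + (ipmb_symbol2 \<nu> k)\<^sup>2" "\<And>k z. cmod (of_real (s k) * z) \<le> cmod z" for f g x s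
 proof -
  define h where "h = (\<lambda>x. f x - g x)"
  define I where "I = integral torus_cell (\<lambda>x. (h x)\<^sup>2)"
  have tor: "torus_fun h" using f(1) g(1) by (auto simp: h_def torus_fun_def intro!: continuous_intros)
  have coeff: "fourier_coeff h k = fourier_coeff f k - fourier_coeff g k" for k
   unfolding h_def by (rule fourier_coeff_diff[OF f(1) g(1)])
  have I0: "0 \<le> I" unfolding I_def by (rule Henstock_Kurzweil_Integration.integral_nonneg)
    (auto simp: torus_cell_eq_cbox intro!: integrable_continuous continuous_intros torus_fun_continuous[OF tor])
  have Bessel: "(\<Sum>k\<in>F. (cmod (fourier_coeff h k))\<^sup>2) \<le> I / (2 * pi)\<^sup>2" if F: "finite F" for F
  proof -
   have c: "continuous_on torus_cell (\<lambda>x. complex_of_real (h x))"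
    by (intro continuous_intros torus_fun_continuous[OF tor])
   have "bounded ((\<lambda>x. complex_of_real (h x)) ` torus_cell)"
    by (intro compact_imp_bounded compact_continuous_image c compact_torus_cell)
   then obtain B where B: "\<And>x. x \<in> torus_cell \<Longrightarrow> cmod (complex_of_real (h x)) \<le> B" by (auto simp: bounded_iff)
   have "(\<Sum>k\<in>F. (cmod (fourier_coeff h k))\<^sup>2) \<le> (LINT x|cell_measure. (cmod (complex_of_real (h x)))\<^sup>2) / (2 * pi)\<^sup>2"
    unfolding fourier_coeff_eq_cell_coeff by (rule Bessel_inequality[OF borel_measurable_cell_continuous[OF c] B F])
   also have "(LINT x|cell_measure. (cmod (complex_of_real (h x)))\<^sup>2) = I"
    unfolding I_def norm_of_real power2_abs
    by (rule integral_cell_eq) (intro continuous_intros torus_fun_continuous[OF tor])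
   finally show ?thesis .
  qed
  have le: "(\<Sum>k\<in>F. cmod (of_real (s k) * fourier_coeff h k)) \<le> C * sqrt I" if F: "finite F" for F
  proof -
   have "(\<Sum>k\<in>F. cmod (of_real (s k) * fourier_coeff h k)) = (\<Sum>k\<in>F. \<bar>s k\<bar> * \<bar>cmod (fourier_coeff h k)\<bar>)"
    by (simp add: norm_mult)
   also have "\<dots> \<le> L2_set s F * L2_set (\<lambda>k. cmod (fourier_coeff h k)) F" by (rule L2_set_mult_ineq)
   also have "\<dots> \<le> sqrt V * sqrt (I / (2 * pi)\<^sup>2)"
   proof (rule mult_mono)
    have "(\<Sum>k\<in>F. (s k)\<^sup>2) \<le> (\<Sum>k\<in>F. (ipmb_symbol1 \<nu> k)\<^sup>2 + (ipmb_symbol2 \<nu> k)\<^sup>2)" by (intro sum_mono s)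
    also have "\<dots> \<le> V" unfolding V_def by (rule finite_sum_le_infsum[OF symbol_square_summable[OF \<nu>] F]) auto
    finally show "L2_set s F \<le> sqrt V" by (simp add: L2_set_def)
    show "L2_set (\<lambda>k. cmod (fourier_coeff h k)) F \<le> sqrt (I / (2 * pi)\<^sup>2)"
     unfolding L2_set_def by (rule real_sqrt_le_mono[OF Bessel[OF F]])
   qed (use V0 in \<open>auto simp: L2_set_nonneg\<close>)
   also have "\<dots> = C * sqrt I" by (simp add: C_def real_sqrt_divide)
   finally show ?thesis .
  qed
  note S = bounded_sums_summable_on[OF norm_ge_zero le]
  have sf: "(\<lambda>k. cmod (of_real (s k) * fourier_coeff f k)) summable_on UNIV" by (rule abs_summable_le[OF f(2) s(2)])
  have sg: "(\<lambda>k. cmod (of_real (s k) * fourier_coeff g k)) summable_on UNIV" by (rule abs_summable_le[OF g(2) s(2)])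
  have "fseries (\<lambda>k. of_real (s k) * fourier_coeff f k) x - fseries (\<lambda>k. of_real (s k) * fourier_coeff g k) x
    = fseries (\<lambda>k. of_real (s k) * fourier_coeff h k) x"
  proof -
   have "((\<lambda>k. of_real (s k) * fourier_coeff f k * mode k x + (- 1) * (of_real (s k) * fourier_coeff g k * mode k x)) has_sum
     fseries (\<lambda>k. of_real (s k) * fourier_coeff f k) x + (- 1) * fseries (\<lambda>k. of_real (s k) * fourier_coeff g k) x) UNIV"
    unfolding fseries_def by (intro has_sum_add has_sum_cmult_right has_sum_infsum fseries_summable(2) sf sg)
   from infsumI[OF this] show ?thesis by (simp add: fseries_def coeff algebra_simps)
  qed
  then have "\<bar>Re (fseries (\<lambda>k. of_real (s k) * fourier_coeff f k) x) - Re (fseries (\<lambda>k. of_real (s k) * fourier_coeff g k) x)\<bar>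
    \<le> cmod (fseries (\<lambda>k. of_real (s k) * fourier_coeff h k) x)"
   using abs_Re_le_cmod by (metis minus_complex.sel(1))
  also have "\<dots> \<le> C * sqrt I" by (rule order_trans[OF cmod_fseries_le[OF S(1)] S(2)])
  finally show ?thesis by (simp only: I_def h_def)
 qed
 show ?thesis
 proof (intro exI[of _ C] conjI allI impI)
  show "0 \<le> C" using V0 by (simp add: C_def)
  fix f g x
  assume A: "torus_fun f" "torus_fun g" "(\<lambda>k. cmod (fourier_coeff f k)) summable_on UNIV" "(\<lambda>k. cmod (fourier_coeff g k)) summable_on UNIV"
  show "\<bar>ipmb_velocity1 \<nu> f x - ipmb_velocity1 \<nu> g x\<bar> \<le> C * sqrt (integral torus_cell (\<lambda>x. (f x - g x)\<^sup>2))"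
   unfolding ipmb_velocity_eq_fseries(1)[OF refl]
   by (rule main[OF A(1,3,2,4)]) (use symbol_times_le(1) \<nu> in auto)
  show "\<bar>ipmb_velocity2 \<nu> f x - ipmb_velocity2 \<nu> g x\<bar> \<le> C * sqrt (integral torus_cell (\<lambda>x. (f x - g x)\<^sup>2))"
   unfolding ipmb_velocity_eq_fseries(2)[OF refl]
   by (rule main[OF A(1,3,2,4)]) (use symbol_times_le(2) \<nu> in auto)
 qed
qed

text \<open>The difference of two solutions is transported by the second velocity, with a source formed from the
 difference of the velocities and the gradient of the first solution. The source is bounded by the
 mean square of the difference, and Gronwall's inequality applies.\<close>

theorem gevrey_solution_unique:
 assumes \<nu>: "0 < \<nu>" and s: "1 \<le> s"
  and sol: "gevrey_ipmb_solution s \<nu> \<theta>0 \<theta>" and sol': "gevrey_ipmb_solution s \<nu> \<theta>0 \<theta>'" and t: "0 \<le> t"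
 shows "\<theta>' t = \<theta> t"
proof -
 have ip: "ipmb_solution \<nu> \<theta>0 \<theta>" and gc: "\<And>t. 0 \<le> t \<Longrightarrow> gevrey_class s (\<theta> t)"
  using sol by (auto simp: gevrey_ipmb_solution_def)
 have ip': "ipmb_solution \<nu> \<theta>0 \<theta>'" and gc': "\<And>t. 0 \<le> t \<Longrightarrow> gevrey_class s (\<theta>' t)"
  using sol' by (auto simp: gevrey_ipmb_solution_def)
 have init: "\<theta> 0 = \<theta>0" "\<theta>' 0 = \<theta>0" and tor: "\<And>t. 0 \<le> t \<Longrightarrow> torus_fun (\<theta> t)" "\<And>t. 0 \<le> t \<Longrightarrow> torus_fun (\<theta>' t)"
  using ip ip' by (auto simp: ipmb_solution_def)
 obtain \<theta>t \<theta>x \<theta>y where c: "continuous_on ({0..} \<times> UNIV) (\<lambda>(t, z). \<theta>t t z)"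
   "continuous_on ({0..} \<times> UNIV) (\<lambda>(t, z). \<theta>x t z)" "continuous_on ({0..} \<times> UNIV) (\<lambda>(t, z). \<theta>y t z)"
  and d: "\<forall>t\<ge>0. \<forall>x y.
      ((\<lambda>t'. \<theta> t' (x, y)) has_real_derivative \<theta>t t (x, y)) (at t within {0..}) \<and>
      ((\<lambda>x'. \<theta> t (x', y)) has_real_derivative \<theta>x t (x, y)) (at x) \<and>
      ((\<lambda>y'. \<theta> t (x, y')) has_real_derivative \<theta>y t (x, y)) (at y) \<and>
      \<theta>t t (x, y) + (ipmb_velocity1 \<nu> (\<theta> t) (x, y) * \<theta>x t (x, y)
            + ipmb_velocity2 \<nu> (\<theta> t) (x, y) * \<theta>y t (x, y)) = 0"
  using ip unfolding ipmb_solution_def by (elim conjE exE)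
 obtain \<theta>t' \<theta>x' \<theta>y' where c': "continuous_on ({0..} \<times> UNIV) (\<lambda>(t, z). \<theta>t' t z)"
   "continuous_on ({0..} \<times> UNIV) (\<lambda>(t, z). \<theta>x' t z)" "continuous_on ({0..} \<times> UNIV) (\<lambda>(t, z). \<theta>y' t z)"
  and d': "\<forall>t\<ge>0. \<forall>x y.
      ((\<lambda>t'. \<theta>' t' (x, y)) has_real_derivative \<theta>t' t (x, y)) (at t within {0..}) \<and>
      ((\<lambda>x'. \<theta>' t (x', y)) has_real_derivative \<theta>x' t (x, y)) (at x) \<and>
      ((\<lambda>y'. \<theta>' t (x, y')) has_real_derivative \<theta>y' t (x, y)) (at y) \<and>
      \<theta>t' t (x, y) + (ipmb_velocity1 \<nu> (\<theta>' t) (x, y) * \<theta>x' t (x, y)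
            + ipmb_velocity2 \<nu> (\<theta>' t) (x, y) * \<theta>y' t (x, y)) = 0"
  using ip' unfolding ipmb_solution_def by (elim conjE exE)
 have dt: "((\<lambda>t. \<theta>' t z - \<theta> t z) has_real_derivative \<theta>t' t z - \<theta>t t z) (at t within {0..})" if "0 \<le> t" for t z
  using d d' that by (cases z) (auto intro!: DERIV_diff)
 have dx: "((\<lambda>x. \<theta>' t (x, y) - \<theta> t (x, y)) has_real_derivative \<theta>x' t (x, y) - \<theta>x t (x, y)) (at x)" if "0 \<le> t" for t x y
  using d d' that by (auto intro!: DERIV_diff)
 have dy: "((\<lambda>y. \<theta>' t (x, y) - \<theta> t (x, y)) has_real_derivative \<theta>y' t (x, y) - \<theta>y t (x, y)) (at y)" if "0 \<le> t" for t x y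
  using d d' that by (auto intro!: DERIV_diff)
 define v1 v2 where "v1 = (\<lambda>t z. ipmb_velocity1 \<nu> (\<theta>' t) z - ipmb_velocity1 \<nu> (\<theta> t) z)"
  and "v2 = (\<lambda>t z. ipmb_velocity2 \<nu> (\<theta>' t) z - ipmb_velocity2 \<nu> (\<theta> t) z)"
 define src where "src = (\<lambda>t z. - (v1 t z * \<theta>x t z + v2 t z * \<theta>y t z))"
 have pde: "\<theta>t' t z - \<theta>t t z = src t z - (ipmb_velocity1 \<nu> (\<theta>' t) z * (\<theta>x' t z - \<theta>x t z) + ipmb_velocity2 \<nu> (\<theta>' t) z * (\<theta>y' t z - \<theta>y t z))"
  if "0 \<le> t" for t z
 proof -
  obtain x y where z: "z = (x, y)" by (cases z)
  have "\<theta>t t z + (ipmb_velocity1 \<nu> (\<theta> t) z * \<theta>x t z + ipmb_velocity2 \<nu> (\<theta> t) z * \<theta>y t z) = 0"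
   "\<theta>t' t z + (ipmb_velocity1 \<nu> (\<theta>' t) z * \<theta>x' t z + ipmb_velocity2 \<nu> (\<theta>' t) z * \<theta>y' t z) = 0"
   using d d' that unfolding z by blast+
  then have "\<theta>t t z = - (ipmb_velocity1 \<nu> (\<theta> t) z * \<theta>x t z + ipmb_velocity2 \<nu> (\<theta> t) z * \<theta>y t z)"
   "\<theta>t' t z = - (ipmb_velocity1 \<nu> (\<theta>' t) z * \<theta>x' t z + ipmb_velocity2 \<nu> (\<theta>' t) z * \<theta>y' t z)"
   by linarith+
  then show ?thesis by (simp add: src_def v1_def v2_def algebra_simps)
 qed
 define E where "E = (\<lambda>t. integral torus_cell (\<lambda>z. (\<theta>' t z - \<theta> t z)\<^sup>2))"
 have tor_diff: "torus_fun (\<lambda>z. \<theta>' t z - \<theta> t z)" if "0 \<le> t" for t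
  using tor[OF that] by (auto simp: torus_fun_def intro!: continuous_intros)
 have ct_diff: "continuous_on ({0..} \<times> UNIV) (\<lambda>(t, z). \<theta>t' t z - \<theta>t t z)"
  using continuous_on_diff[OF c'(1) c(1)] by (simp add: case_prod_unfold)
 have slice: "continuous_on UNIV (\<theta>x t)" "continuous_on UNIV (\<theta>y t)" "continuous_on UNIV (\<theta>x' t)" "continuous_on UNIV (\<theta>y' t)"
  if "0 \<le> t" for t
  by (rule continuous_on_time_slice[OF c(2) that] continuous_on_time_slice[OF c(3) that]
    continuous_on_time_slice[OF c'(2) that] continuous_on_time_slice[OF c'(3) that])+
 have dE: "(E has_real_derivative integral torus_cell (\<lambda>z. 2 * (\<theta>' t z - \<theta> t z) * src t z)) (at t within {0..})" if t: "0 \<le> t" for t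
 proof -
  obtain u1x where u: "continuous_on UNIV u1x" "\<And>x y. ((\<lambda>x. ipmb_velocity1 \<nu> (\<theta>' t) (x, y)) has_real_derivative u1x (x, y)) (at x)"
   "\<And>x y. ((\<lambda>y. ipmb_velocity2 \<nu> (\<theta>' t) (x, y)) has_real_derivative - u1x (x, y)) (at y)"
   using gevrey_velocity_regular(3)[OF less_imp_le[OF \<nu>] s gc'[OF t]] by blast
  show ?thesis
   unfolding E_def
   by (rule transport_integral_derivative[where \<phi> = "\<lambda>t z. \<theta>' t z - \<theta> t z" and \<phi>t = "\<lambda>t z. \<theta>t' t z - \<theta>t t z"
      and \<phi>x = "\<lambda>t z. \<theta>x' t z - \<theta>x t z" and \<phi>y = "\<lambda>t z. \<theta>y' t z - \<theta>y t z"
      and \<beta> = "\<lambda>r. r\<^sup>2" and \<beta>' = "\<lambda>r. 2 * r" and s = "src t" and t = t,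
      OF ct_diff continuous_on_diff[OF slice(3)[OF t] slice(1)[OF t]] continuous_on_diff[OF slice(4)[OF t] slice(2)[OF t]]
      tor_diff dt dx[OF t] dy[OF t] _ _ gevrey_velocity_regular(1,2)[OF less_imp_le[OF \<nu>] s gc'[OF t]] u t pde[OF t]])
    (auto intro!: derivative_eq_intros continuous_intros)
 qed
 obtain C where C: "0 \<le> C" and vC: "\<And>t z. 0 \<le> t \<Longrightarrow> \<bar>v1 t z\<bar> \<le> C * sqrt (E t)" "\<And>t z. 0 \<le> t \<Longrightarrow> \<bar>v2 t z\<bar> \<le> C * sqrt (E t)"
 proof -
  obtain C where C: "0 \<le> C" and H: "\<forall>f g x. torus_fun f \<longrightarrow> torus_fun g \<longrightarrow>
   (\<lambda>k. cmod (fourier_coeff f k)) summable_on UNIV \<longrightarrow> (\<lambda>k. cmod (fourier_coeff g k)) summable_on UNIV \<longrightarrow>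
   \<bar>ipmb_velocity1 \<nu> f x - ipmb_velocity1 \<nu> g x\<bar> \<le> C * sqrt (integral torus_cell (\<lambda>x. (f x - g x)\<^sup>2)) \<and>
   \<bar>ipmb_velocity2 \<nu> f x - ipmb_velocity2 \<nu> g x\<bar> \<le> C * sqrt (integral torus_cell (\<lambda>x. (f x - g x)\<^sup>2))"
   using velocity_le_L2[OF \<nu>] by (elim exE conjE)
  have m: "(\<lambda>k. cmod (fourier_coeff (\<theta> t) k)) summable_on UNIV" "(\<lambda>k. cmod (fourier_coeff (\<theta>' t) k)) summable_on UNIV" if "0 \<le> t" for t
   using gevrey_class_moments[OF gc[OF that] s, of 0] gevrey_class_moments[OF gc'[OF that] s, of 0] by simp_all
  show thesis
  proof (rule that[OF C])
   fix t z assume t: "0 \<le> (t :: real)"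
   note h = H[THEN spec, THEN spec, THEN spec, THEN mp, OF tor(2)[OF t], THEN mp, OF tor(1)[OF t], THEN mp, OF m(2)[OF t], THEN mp, OF m(1)[OF t], of z]
   show "\<bar>v1 t z\<bar> \<le> C * sqrt (E t)" "\<bar>v2 t z\<bar> \<le> C * sqrt (E t)"
    using h by (simp_all only: v1_def v2_def E_def)
  qed
 qed
 obtain B where B: "0 \<le> B" "\<And>u z. u \<in> {0..t} \<Longrightarrow> z \<in> torus_cell \<Longrightarrow> \<bar>\<theta>x u z\<bar> \<le> B \<and> \<bar>\<theta>y u z\<bar> \<le> B"
 proof -
  have "compact ({0..t} \<times> torus_cell)" by (intro compact_Times compact_torus_cell compact_Icc)
  moreover have "continuous_on ({0..t} \<times> torus_cell) (\<lambda>(t, z). \<theta>x t z)" "continuous_on ({0..t} \<times> torus_cell) (\<lambda>(t, z). \<theta>y t z)"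
   by (rule continuous_on_subset[OF c(2)], force, rule continuous_on_subset[OF c(3)], force)
  ultimately have b: "bounded ((\<lambda>(t, z). \<theta>x t z) ` ({0..t} \<times> torus_cell))" "bounded ((\<lambda>(t, z). \<theta>y t z) ` ({0..t} \<times> torus_cell))"
   by (auto intro!: compact_imp_bounded compact_continuous_image)
  obtain B1 where B1: "\<And>p. p \<in> {0..t} \<times> torus_cell \<Longrightarrow> norm (case p of (t, z) \<Rightarrow> \<theta>x t z) \<le> B1"
   using b(1) unfolding bounded_iff by blast
  obtain B2 where B2: "\<And>p. p \<in> {0..t} \<times> torus_cell \<Longrightarrow> norm (case p of (t, z) \<Rightarrow> \<theta>y t z) \<le> B2"
   using b(2) unfolding bounded_iff by blast
  show thesis
  proof (rule that[of "max 0 (max B1 B2)"])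
   fix u z assume "u \<in> {0..t}" "z \<in> torus_cell"
   then show "\<bar>\<theta>x u z\<bar> \<le> max 0 (max B1 B2) \<and> \<bar>\<theta>y u z\<bar> \<le> max 0 (max B1 B2)"
    using B1[of "(u, z)"] B2[of "(u, z)"] by auto
  qed simp
 qed
 have cont: "continuous_on torus_cell (\<lambda>z. \<theta>' u z - \<theta> u z)" if "0 \<le> u" for u by (rule torus_fun_continuous[OF tor_diff[OF that]])
 have E0: "0 \<le> E u" if "0 \<le> u" for u
  unfolding E_def by (rule Henstock_Kurzweil_Integration.integral_nonneg)
   (use cont[OF that] in \<open>auto simp: torus_cell_eq_cbox intro!: integrable_continuous continuous_intros\<close>)
 \<comment> \<open>The \<open>1\<close> comes from splitting the product of difference and source, \<open>(2 * pi)\<^sup>2\<close> is the area of the cell.\<close>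
 define K where "K = 1 + (2 * pi)\<^sup>2 * (2 * C * B)\<^sup>2"
 have le: "integral torus_cell (\<lambda>z. 2 * (\<theta>' u z - \<theta> u z) * src u z) \<le> K * E u" if u: "u \<in> {0..t}" for u
 proof -
  have u0: "0 \<le> u" using u by simp
  have sb: "\<bar>src u z\<bar> \<le> 2 * C * B * sqrt (E u)" if z: "z \<in> torus_cell" for z
  proof -
   have CE: "0 \<le> C * sqrt (E u)" using C E0[OF u0] by simp
   have "\<bar>v1 u z * \<theta>x u z\<bar> \<le> (C * sqrt (E u)) * B" "\<bar>v2 u z * \<theta>y u z\<bar> \<le> (C * sqrt (E u)) * B"
    unfolding abs_mult
    by (rule mult_mono[OF vC(1)[OF u0] B(2)[OF u z, THEN conjunct1] CE abs_ge_zero],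
      rule mult_mono[OF vC(2)[OF u0] B(2)[OF u z, THEN conjunct2] CE abs_ge_zero])
   then show ?thesis by (simp add: src_def abs_le_iff algebra_simps)
  qed
  have cs: "continuous_on torus_cell (src u)"
   unfolding src_def v1_def v2_def
   by (intro continuous_intros torus_fun_continuous[OF gevrey_velocity_regular(1)[OF less_imp_le[OF \<nu>] s]]
     torus_fun_continuous[OF gevrey_velocity_regular(2)[OF less_imp_le[OF \<nu>] s]] gc gc' u0
     continuous_on_subset[OF slice(1)] continuous_on_subset[OF slice(2)] subset_UNIV)
  have int: "f integrable_on torus_cell" if "continuous_on torus_cell f" for f :: "real \<times> real \<Rightarrow> real"
   using that unfolding torus_cell_eq_cbox by (rule integrable_continuous)
  have "integral torus_cell (\<lambda>z. 2 * (\<theta>' u z - \<theta> u z) * src u z) \<le>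
    integral torus_cell (\<lambda>z. (\<theta>' u z - \<theta> u z)\<^sup>2 + (2 * C * B)\<^sup>2 * E u)"
  proof (rule integral_le)
   fix z assume z: "z \<in> torus_cell"
   have "2 * (\<theta>' u z - \<theta> u z) * src u z \<le> (\<theta>' u z - \<theta> u z)\<^sup>2 + (src u z)\<^sup>2" by (rule sum_squares_bound)
   moreover have "(src u z)\<^sup>2 \<le> (2 * C * B * sqrt (E u))\<^sup>2" using power_mono[OF sb[OF z], of 2] by simp
   moreover have "(2 * C * B * sqrt (E u))\<^sup>2 = (2 * C * B)\<^sup>2 * E u" using E0[OF u0] by (simp add: power_mult_distrib)
   ultimately show "2 * (\<theta>' u z - \<theta> u z) * src u z \<le> (\<theta>' u z - \<theta> u z)\<^sup>2 + (2 * C * B)\<^sup>2 * E u" by linarith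
  qed (intro int continuous_intros cont u0 cs)+
  also have "\<dots> = E u + integral torus_cell (\<lambda>z. (2 * C * B)\<^sup>2 * E u)"
   unfolding E_def by (intro Henstock_Kurzweil_Integration.integral_add int continuous_intros cont u0)
  also have "integral torus_cell (\<lambda>z. (2 * C * B)\<^sup>2 * E u) = (2 * pi)\<^sup>2 * ((2 * C * B)\<^sup>2 * E u)"
   by (simp add: torus_cell_eq_cbox content_Pair power2_eq_square)
  finally show ?thesis by (simp add: K_def algebra_simps)
 qed
 define H where "H = (\<lambda>u. exp (- K * u) * E u)"
 have "H t \<le> H 0"
 proof (rule nonpos_derivative_imp_le[OF t])
  fix u assume u: "0 \<le> u" "u \<le> t"
  let ?D = "integral torus_cell (\<lambda>z. 2 * (\<theta>' u z - \<theta> u z) * src u z)"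
  show "(H has_real_derivative exp (- K * u) * (?D - K * E u)) (at u within {0..t})"
   unfolding H_def
   by (rule derivative_eq_intros DERIV_subset[OF dE[OF u(1)]] refl | simp)+ (simp add: algebra_simps)
  show "exp (- K * u) * (?D - K * E u) \<le> 0" using le[of u] u by (intro mult_nonneg_nonpos) auto
 qed
 moreover have "H 0 = 0" by (simp add: H_def E_def init)
 ultimately have "E t \<le> 0" by (simp add: H_def mult_le_0_iff)
 then have "E t = 0" using E0[OF t] by simp
 then have "\<theta>' t z - \<theta> t z = 0" for z
  by (intro torus_fun_zero_if_L2_zero[OF tor_diff[OF t], of z]) (simp only: E_def)
 then show ?thesis by (intro ext) simp
qed

section \<open>Existence with the stated radius\<close>

lemma fourier_coeff_mean_zero: "mean_zero f \<Longrightarrow> fourier_coeff f 0 = 0"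
proof -
 assume "mean_zero f"
 then have "(LINT x:torus_cell|lborel. complex_of_real (f x)) = 0"
  by (simp only: mean_zero_def set_lebesgue_integral_cell integral_complex_of_real of_real_0)
 then show ?thesis by (simp add: fourier_coeff_def mode_phase_def)
qed

text \<open>The square root bounds the supremum of the datum in terms of its Gevrey norm, so the first summand is
 the cost of the strain; the last is the cost of the second-order remainder.\<close>

definition radius_rate :: "real \<Rightarrow> real \<Rightarrow> real \<Rightarrow> real" where
 "radius_rate s \<nu> \<tau>0 = max 1 (4 * (768 * strip_const / \<nu> * sqrt (\<Sum>\<^sub>\<infinity>k. exp (- (2 * \<tau>0) * mode_norm k powr (1 / s))) + 1 / \<nu>)
   + trilinear_const (1 / s) / \<nu> * 2)"

theorem gevrey_solution_exists:
 assumes s: "1 \<le> s" and \<nu>: "0 < \<nu>" and \<tau>0: "0 < \<tau>0"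
  and tor: "torus_fun \<theta>0" and mz: "mean_zero \<theta>0" and rad: "has_gevrey_radius s \<tau>0 \<theta>0"
 shows "\<exists>\<theta>. gevrey_ipmb_solution s \<nu> \<theta>0 \<theta> \<and>
  (\<forall>t\<ge>0. has_gevrey_radius s (\<tau>0 * exp (- radius_rate s \<nu> \<tau>0 * t * gevrey_norm 0 s \<tau>0 \<theta>0)) (\<theta> t))"
proof -
 define \<sigma> where "\<sigma> = 1 / s"
 have \<sigma>: "0 < \<sigma>" "\<sigma> \<le> 1" using s by (simp_all add: \<sigma>_def)
 define a0 where "a0 = fourier_coeff \<theta>0"
 define n where "n = gevrey_norm 0 s \<tau>0 \<theta>0"
 define W where "W = sqrt (\<Sum>\<^sub>\<infinity>k. exp (- (2 * \<tau>0) * mode_norm k powr \<sigma>))"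
 have a00: "a0 0 = 0" unfolding a0_def by (rule fourier_coeff_mean_zero[OF mz])
 have a0_herm: "hermitian a0" unfolding a0_def by (rule hermitian_fourier_coeff[OF tor])
 have n_bound: "L2_set (\<lambda>k. exp (\<tau>0 * mode_norm k powr \<sigma>) * cmod (a0 k)) F \<le> n" if "finite F" for F
  unfolding a0_def n_def \<sigma>_def
  by (rule L2_set_le_gevrey_norm) (use rad a00 that in \<open>auto simp: has_gevrey_radius_def a0_def\<close>)
 have n0: "0 \<le> n" using order_trans[OF L2_set_nonneg n_bound[of "{}"]] by simp
 note sum0 = coefficient_sum_le_gevrey_norm[OF \<tau>0 \<sigma>(1) n_bound]
 have sup0: "\<bar>\<theta>0 z\<bar> \<le> W * n" for z
 proof -
  have "\<theta>0 z = Re (fseries a0 z)" unfolding a0_def by (rule fourier_inversion[OF tor sum0(1)[unfolded a0_def]])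
  then have "\<bar>\<theta>0 z\<bar> \<le> cmod (fseries a0 z)" using abs_Re_le_cmod[of "fseries a0 z"] by simp
  also have "\<dots> \<le> (\<Sum>\<^sub>\<infinity>k. cmod (a0 k))" by (rule cmod_fseries_le[OF sum0(1)])
  also have "\<dots> \<le> W * n" unfolding W_def by (rule sum0(2))
  finally show ?thesis .
 qed
 \<comment> \<open>A vanishing norm means vanishing data; the approximation then runs with any positive bound.\<close>
 define G where "G = (if n = 0 then 1 else n)"
 have G: "0 < G" "n \<le> G" using n0 by (auto simp: G_def)
 have GF: "L2_set (\<lambda>k. exp (\<tau>0 * mode_norm k powr \<sigma>) * cmod (a0 k)) F \<le> G" if "finite F" for F
  using n_bound[OF that] G(2) by linarith
 obtain A a where A: "\<forall>N. galerkin_solution \<nu> (mode_box N) (restrict_modes (mode_box N) a0) (A N)"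
  and init: "a 0 = a0" and sym: "\<forall>t\<ge>0. hermitian (a t) \<and> a t 0 = 0"
  and dec: "\<forall>T>0. \<exists>\<tau>>0. \<forall>t\<in>{0..T}. \<forall>k. cmod (a t k) \<le> G * exp (- \<tau> * mode_norm k powr \<sigma>) \<and>
   (\<forall>N. cmod (A N t k) \<le> G * exp (- \<tau> * mode_norm k powr \<sigma>))"
  and conv: "\<forall>T>0. \<exists>\<eta>. \<eta> \<longlonglongrightarrow> 0 \<and> (\<forall>N. \<forall>t\<in>{0..T}. \<forall>k. cmod (A N t k - a t k) \<le> \<eta> N)"
  and ode: "\<forall>t\<ge>0. \<forall>k. ((\<lambda>t. a t k) has_vector_derivative - transport_coeff \<nu> (a t) k) (at t within {0..})"
  by (rule exE[OF galerkin_limit[OF \<nu> \<sigma> \<tau>0 a0_herm a00 G(1)]], erule GF) (elim exE conjE, rule that; assumption)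
 have dec': "\<exists>\<tau>>0. \<forall>t\<in>{0..T}. \<forall>k. cmod (a t k) \<le> G * exp (- \<tau> * mode_norm k powr \<sigma>) \<and>
   (\<forall>N. cmod (A N t k) \<le> G * exp (- \<tau> * mode_norm k powr \<sigma>))" if "0 < T" for T
  using dec[THEN spec, THEN mp, OF that] .
 have weight: "(\<lambda>k. G * exp (- \<tau> * mode_norm k powr \<sigma>)) summable_on UNIV" if "0 < \<tau>" for \<tau>
  using summable_on_cmult_right[OF gevrey_weight_summable[OF that \<sigma>(1), of 0], of G] by simp
 define \<theta> where "\<theta> = (\<lambda>t x. Re (fseries (a t) x))"
 have herm: "hermitian (a t)" "a t 0 = 0" if "0 \<le> t" for t using sym that by blast+
 have ip: "ipmb_solution \<nu> \<theta>0 \<theta>"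
  unfolding \<theta>_def
 proof (rule coefficients_ipmb_solution[where a = a, OF less_imp_le[OF \<nu>] \<sigma>(1) tor init[unfolded a0_def] herm])
  fix T :: real assume "0 \<le> T"
  then have "0 < T + 1" by simp
  then obtain \<tau> where \<tau>: "0 < \<tau>" and H: "\<forall>t\<in>{0..T + 1}. \<forall>k. cmod (a t k) \<le> G * exp (- \<tau> * mode_norm k powr \<sigma>) \<and>
    (\<forall>N. cmod (A N t k) \<le> G * exp (- \<tau> * mode_norm k powr \<sigma>))"
   using dec' by blast
  show "\<exists>\<tau>>0. \<exists>G. \<forall>t\<in>{0..T}. \<forall>k. cmod (a t k) \<le> G * exp (- \<tau> * mode_norm k powr \<sigma>)"
  proof (rule exI[of _ \<tau>], rule conjI[OF \<tau>], rule exI[of _ G], intro ballI allI)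
   fix t k assume "t \<in> {0..T}"
   then have "t \<in> {0..T + 1}" by simp
   from H[THEN bspec, OF this, THEN spec, of k] show "cmod (a t k) \<le> G * exp (- \<tau> * mode_norm k powr \<sigma>)" by (rule conjunct1)
  qed
 qed (use ode in blast)+
 have decay: "\<exists>\<tau>>0. \<forall>k. cmod (a t k) \<le> G * exp (- \<tau> * mode_norm k powr \<sigma>)" if t: "0 \<le> t" for t
 proof -
  have "0 < t + 1" "t \<in> {0..t + 1}" using t by simp_all
  then show ?thesis using dec'[of "t + 1"] by blast
 qed
 have abs: "(\<lambda>k. cmod (a t k)) summable_on UNIV" if t: "0 \<le> t" for t
 proof -
  obtain \<tau> where \<tau>: "0 < \<tau>" "\<forall>k. cmod (a t k) \<le> G * exp (- \<tau> * mode_norm k powr \<sigma>)" using decay[OF t] by blast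
  show ?thesis by (rule abs_summable_le[OF weight[OF \<tau>(1)] \<tau>(2)[THEN spec]])
 qed
 have coeff: "fourier_coeff (\<theta> t) k = a t k" if t: "0 \<le> t" for t k
  unfolding \<theta>_def by (rule fourier_coeff_fseries[OF abs[OF t] herm(1)[OF t]])
 have "gevrey_class s (\<theta> t)" if t: "0 \<le> t" for t
 proof -
  obtain \<tau> where \<tau>: "0 < \<tau>" "\<forall>k. cmod (a t k) \<le> G * exp (- \<tau> * mode_norm k powr \<sigma>)" using decay[OF t] by blast
  have "has_gevrey_radius s (\<tau> / 2) (\<theta> t)"
   by (rule gevrey_radius_if_decay[OF \<tau>(1)]) (use s \<tau>(2)[THEN spec] in \<open>simp_all add: coeff[OF t] \<sigma>_def\<close>)
  then show ?thesis unfolding gevrey_class_def by blast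
 qed
 then have sol: "gevrey_ipmb_solution s \<nu> \<theta>0 \<theta>" using ip by (simp add: gevrey_ipmb_solution_def)
 have sup: "\<bar>\<theta> t z\<bar> \<le> W * n" if "0 \<le> t" for t z
  by (rule gevrey_solution_sup_bound[OF less_imp_le[OF \<nu>] s sol sup0 that])
 have bound: "L2_set (\<lambda>k. exp (\<tau>0 * exp (- radius_rate s \<nu> \<tau>0 * t * n) * mode_norm k powr (1 / s)) * cmod (fourier_coeff (\<theta> t) k)) F \<le> n"
  if t: "0 \<le> t" and F: "finite F" for t F
 proof (cases "n = 0")
  case True
  then have "\<theta> t = (\<lambda>_. 0)" using sup[OF t] by (intro ext) simp
  then have "fourier_coeff (\<theta> t) k = 0" for k by (simp add: fourier_coeff_def)
  then show ?thesis by (simp add: True L2_set_def)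
 next
  case False
  then have Gn: "G = n" by (simp add: G_def)
  define T where "T = t + 1"
  have T: "0 < T" "t \<in> {0..T}" using t by (simp_all add: T_def)
  obtain \<tau> where \<tau>: "0 < \<tau>" and H: "\<forall>t\<in>{0..T}. \<forall>k. cmod (a t k) \<le> G * exp (- \<tau> * mode_norm k powr \<sigma>) \<and>
    (\<forall>N. cmod (A N t k) \<le> G * exp (- \<tau> * mode_norm k powr \<sigma>))"
   using dec'[OF T(1)] by blast
  obtain \<eta> where \<eta>: "\<eta> \<longlonglongrightarrow> 0" and E: "\<forall>N. \<forall>t\<in>{0..T}. \<forall>k. cmod (A N t k - a t k) \<le> \<eta> N"
   using conv[THEN spec, THEN mp, OF T(1)] by blast
  have "L2_set (\<lambda>k. exp (\<tau>0 * exp (- (radius_rate s \<nu> \<tau>0 * n) * t) * mode_norm k powr \<sigma>) * cmod (a t k)) F \<le> G"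
  proof (rule galerkin_limit_gevrey_bound[OF \<nu> \<sigma> \<tau>0 G(1) GF A[THEN spec] T(1) weight[OF \<tau>] _ _ \<eta> _ _ _ T(2) F, where S = "W * n"])
   fix t k assume t: "t \<in> {0..T}"
   show "cmod (a t k) \<le> G * exp (- \<tau> * mode_norm k powr \<sigma>)"
    by (rule H[THEN bspec, OF t, THEN spec, THEN conjunct1])
   show "cmod (A N t k) \<le> G * exp (- \<tau> * mode_norm k powr \<sigma>)" for N
    by (rule H[THEN bspec, OF t, THEN spec, THEN conjunct2, THEN spec])
   show "cmod (A N t k - a t k) \<le> \<eta> N" for N by (rule E[THEN spec, THEN bspec, OF t, THEN spec])
  next
   fix t x assume "t \<in> {0..T}"
   then have t: "0 \<le> t" by simp
   have "cmod (fseries (a t) x) = \<bar>\<theta> t x\<bar>"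
    using arg_cong[OF fseries_hermitian_real(2)[OF herm(1)[OF t], of x], of cmod] by (simp add: \<theta>_def)
   then show "cmod (fseries (a t) x) \<le> W * n" using sup[OF t, of x] by simp
  next
   have "4 * (768 * strip_const / \<nu> * (W * n) + 1 / \<nu> * G) + trilinear_const \<sigma> / \<nu> * (2 * G)
     = (4 * (768 * strip_const / \<nu> * W + 1 / \<nu>) + trilinear_const \<sigma> / \<nu> * 2) * n"
    unfolding Gn by (simp add: algebra_simps)
   also have "\<dots> \<le> radius_rate s \<nu> \<tau>0 * n"
    by (rule mult_right_mono[OF _ n0]) (simp add: radius_rate_def W_def \<sigma>_def)
   finally show "4 * (768 * strip_const / \<nu> * (W * n) + 1 / \<nu> * G) + trilinear_const \<sigma> / \<nu> * (2 * G) \<le> radius_rate s \<nu> \<tau>0 * n" .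
  qed (rule GF; assumption)?
  then show ?thesis by (simp add: coeff[OF t] Gn \<sigma>_def mult_ac)
 qed
 have "has_gevrey_radius s (\<tau>0 * exp (- radius_rate s \<nu> \<tau>0 * t * n)) (\<theta> t)" if t: "0 \<le> t" for t
  unfolding has_gevrey_radius_def using \<tau>0 by (intro conjI gevrey_domain_if_bounded[OF bound[OF t]]) auto
 then show ?thesis using sol unfolding n_def by blast
qed

theorem theorem6p9:
 fixes s \<nu> \<tau>0 :: real
 assumes "1 \<le> s" and "0 < \<nu>" and "0 < \<tau>0"
 shows "\<exists>C>0. \<forall>\<theta>0 :: real \<times> real \<Rightarrow> real.
      torus_fun \<theta>0 \<longrightarrow> mean_zero \<theta>0 \<longrightarrow> has_gevrey_radius s \<tau>0 \<theta>0 \<longrightarrow>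
      (\<exists>\<theta>. gevrey_ipmb_solution s \<nu> \<theta>0 \<theta> \<and>
        (\<forall>\<theta>'. gevrey_ipmb_solution s \<nu> \<theta>0 \<theta>' \<longrightarrow> (\<forall>t\<ge>0. \<theta>' t = \<theta> t)) \<and>
        (\<exists>\<tau> :: real \<Rightarrow> real. antimono_on {0..} \<tau> \<and>
          (\<forall>t\<ge>0. has_gevrey_radius s (\<tau> t) (\<theta> t) \<and>
           \<tau>0 * exp (- C * t * gevrey_norm 0 s \<tau>0 \<theta>0) \<le> \<tau> t)))"
proof (intro exI[of _ "radius_rate s \<nu> \<tau>0"] conjI allI impI)
 show C: "0 < radius_rate s \<nu> \<tau>0" by (simp add: radius_rate_def)
 fix \<theta>0 :: "real \<times> real \<Rightarrow> real"
 assume \<theta>0: "torus_fun \<theta>0" "mean_zero \<theta>0" "has_gevrey_radius s \<tau>0 \<theta>0"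
 obtain \<theta> where \<theta>: "gevrey_ipmb_solution s \<nu> \<theta>0 \<theta>"
  "\<And>t. 0 \<le> t \<Longrightarrow> has_gevrey_radius s (\<tau>0 * exp (- radius_rate s \<nu> \<tau>0 * t * gevrey_norm 0 s \<tau>0 \<theta>0)) (\<theta> t)"
  using gevrey_solution_exists[OF assms \<theta>0] by blast
 let ?\<tau> = "\<lambda>t. \<tau>0 * exp (- radius_rate s \<nu> \<tau>0 * t * gevrey_norm 0 s \<tau>0 \<theta>0)"
 have "0 \<le> gevrey_norm 0 s \<tau>0 \<theta>0"
  unfolding gevrey_norm_def by (intro real_sqrt_ge_zero infsum_nonneg gevrey_term_nonneg)
 then have mono: "antimono_on {0..} ?\<tau>"
  using C assms(3) by (auto intro!: monotone_onI mult_right_mono mult_left_mono)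
 show "\<exists>\<theta>. gevrey_ipmb_solution s \<nu> \<theta>0 \<theta> \<and>
   (\<forall>\<theta>'. gevrey_ipmb_solution s \<nu> \<theta>0 \<theta>' \<longrightarrow> (\<forall>t\<ge>0. \<theta>' t = \<theta> t)) \<and>
   (\<exists>\<tau> :: real \<Rightarrow> real. antimono_on {0..} \<tau> \<and>
     (\<forall>t\<ge>0. has_gevrey_radius s (\<tau> t) (\<theta> t) \<and>
      \<tau>0 * exp (- radius_rate s \<nu> \<tau>0 * t * gevrey_norm 0 s \<tau>0 \<theta>0) \<le> \<tau> t))"
 proof (rule exI[of _ \<theta>], intro conjI allI impI)
  show "\<theta>' t = \<theta> t" if "gevrey_ipmb_solution s \<nu> \<theta>0 \<theta>'" "0 \<le> t" for \<theta>' t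
   by (rule gevrey_solution_unique[OF assms(2,1) \<theta>(1) that])
  show "\<exists>\<tau> :: real \<Rightarrow> real. antimono_on {0..} \<tau> \<and>
     (\<forall>t\<ge>0. has_gevrey_radius s (\<tau> t) (\<theta> t) \<and>
      \<tau>0 * exp (- radius_rate s \<nu> \<tau>0 * t * gevrey_norm 0 s \<tau>0 \<theta>0) \<le> \<tau> t)"
   by (rule exI[of _ ?\<tau>]) (use mono \<theta>(2) in auto)
 qed (rule \<theta>(1))
qed

end
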